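(* Assume Hypotheses (A) of the context. Then there exist $D_1>0$ depending only on $c_1,n,p,q,D_0,T$, and $\epsilon_1>0$ depending only on $c_1,n,p,q,D_0,T,c_0,\beta,W$, such that if $\varepsilon<\epsilon_1$ then $$\sup_{t\in[0,T]}D(t)\le D_1 .$$
   Context: Let $n\ge2$, and let $\Omega$ be $\mathbb T^n$ (the unit flat torus; functions regarded as $\mathbb Z^n$-periodic on $\mathbb R^n$) or $\mathbb R^n$. $W:\mathbb R\to[0,\infty)$ is $C^3$ with $W(\pm1)=W'(\pm1)=0$; for some $\gamma\in(-1,1)$, $W'<0$ on $(\gamma,1)$ and $W'>0$ on $(-1,\gamma)$; for some $\alpha\in(0,1)$ and $\kappa>0$, $W''(x)\ge\kappa$ whenever $\alpha\le|x|\le1$. $\omega_{n-1}$ is the volume of the unit ball in $\mathbb R^{n-1}$. For a function $\varphi(x,t)$ and $0<\varepsilon<1$, $\mu^\varepsilon_t$ is the Radon measure $\mu^\varepsilon_t(\phi)=\int_\Omega\phi\big(\frac{\varepsilon|\nabla\varphi(x,t)|^2}2+\frac{W(\varphi(x,t))}\varepsilon\big)dx$, and $D(t):=\max\{1,\mu_t^\varepsilon(\Omega),\sup_{B_r(x)\subset\Omega}\frac{\mu^\varepsilon_t(B_r(x))}{\omega_{n-1}r^{n-1}}\}$. Hypotheses (A): $2<q<\infty$, $\frac{nq}{2(q-1)}<p<\infty$ and $p\ge\frac43$ if $n=2$; $0<\beta<\frac12$; $0<\varepsilon<1$; $T>0$; $c_0,c_1,D_0>0$; $u\in C_c^\infty(\Omega\times[0,T];\mathbb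 R^n)$; $\varphi$ is such that $\nabla^j\varphi$ ($j=0,1,2,3$) and $\partial_t\nabla^k\varphi$ ($k=0,1$) are continuous on $\Omega\times[0,T]$ and $\partial_t\varphi+u\cdot\nabla\varphi=\Delta\varphi-\frac{W'(\varphi)}{\varepsilon^2}$ on $\Omega\times[0,T]$, $\varphi(\cdot,0)=\varphi_0$; moreover $\sup_{\Omega\times[0,T]}|\varphi|\le1$; $\sup_\Omega\varepsilon^i|\nabla^i\varphi_0|\le c_0$ for $i=1,2,3$; if $\Omega=\mathbb R^n$, $\lim_{R\to\infty}R^k\|\varphi+1\|_{C^2((\mathbb R^n\setminus B_R)\times[0,T])}=0$ for every $k\in\mathbb N$; $\sup_\Omega\big(\frac{\varepsilon|\nabla\varphi_0|^2}2-\frac{W(\varphi_0)}\varepsilon\big)\le\varepsilon^{-\beta}$; $\sup_{\Omega\times[0,T]}|u|\le\varepsilon^{-\beta}$ and $\sup_{\Omega\times[0,T]}|\nabla u|\le\varepsilon^{-(\beta+1)}$; $\|u\|_{L^q([0,T];(W^{1,p}(\Omega))^n)}\le c_1$; and $D(0)\le D_0$. *)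

theory Defs
  imports "HOL-Analysis.Analysis"
begin

fun Ck :: "nat \<Rightarrow> 'a::euclidean_space set \<Rightarrow> ('a \<Rightarrow> 'b::real_normed_vector) \<Rightarrow> bool" where
  "Ck 0 S f = continuous_on S f"
| "Ck (Suc k) S f =
     (continuous_on S f \<and>
      (\<exists>g. (\<forall>x\<in>S. (f has_derivative (\<lambda>h. \<Sum>b\<in>Basis. (h \<bullet> b) *\<^sub>R g b x)) (at x within S))
          \<and> (\<forall>b\<in>Basis. Ck k S (g b))))"

definition smooth_on :: "'a::euclidean_space set \<Rightarrow> ('a \<Rightarrow> 'b::real_normed_vector) \<Rightarrow> bool" where
  "smooth_on S f = (\<forall>k. Ck k S f)"

definition lattice_vec :: "real^'n \<Rightarrow> bool" where
  "lattice_vec k = (\<forall>i. k $ i \<in> \<int>)"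

text \<open>The domain Omega: if tor then the flat torus, represented by the fundamental
  cell [0,1)^n (functions being Z^n-periodic), otherwise all of R^n.\<close>
definition Omega :: "bool \<Rightarrow> (real^'n) set" where
  "Omega tor = (if tor then {x. \<forall>i. 0 \<le> x $ i \<and> x $ i < 1} else UNIV)"

text \<open>The (open) ball B_r(x) in Omega; on the torus it is the metric ball of the flat torus,
  represented inside the fundamental cell.\<close>
definition Oball :: "bool \<Rightarrow> real^'n \<Rightarrow> real \<Rightarrow> (real^'n) set" where
  "Oball tor x r = (if tor then {y \<in> Omega True. \<exists>k. lattice_vec k \<and> dist y (x + k) < r}
                    else ball x r)"

text \<open>mu^eps_t(A) for the profile f = phi(.,t) with gradient gf = grad phi(.,t).\<close>
definition mu_eps :: "bool \<Rightarrow> real \<Rightarrow> (real \<Rightarrow> real) \<Rightarrow> (real^'n \<Rightarrow> real) \<Rightarrow> (real^'n \<Rightarrow> real^'n)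
                      \<Rightarrow> (real^'n) set \<Rightarrow> ennreal" where
  "mu_eps tor eps W f gf A =
     (\<integral>\<^sup>+ x. ennreal (eps * (norm (gf x))\<^sup>2 / 2 + W (f x) / eps) * indicator (A \<inter> Omega tor) x \<partial>lborel)"

definition Dfun :: "bool \<Rightarrow> real \<Rightarrow> (real \<Rightarrow> real) \<Rightarrow> (real^'n \<Rightarrow> real) \<Rightarrow> (real^'n \<Rightarrow> real^'n) \<Rightarrow> ennreal" where
  "Dfun tor eps W f gf =
     max 1 (max (mu_eps tor eps W f gf (Omega tor))
       (SUP xr \<in> (UNIV :: (real^'n) set) \<times> {0<..}.
          mu_eps tor eps W f gf (Oball tor (fst xr) (snd xr)) /
          ennreal (unit_ball_vol (real (CARD('n) - 1)) * (snd xr) ^ (CARD('n) - 1))))"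

definition Lp_norm :: "bool \<Rightarrow> real \<Rightarrow> (real^'n \<Rightarrow> 'b::real_normed_vector) \<Rightarrow> real" where
  "Lp_norm tor p v = (LINT x : Omega tor | lborel. norm (v x) powr p) powr (1 / p)"

end

theory Submission
  imports Defs "HOL-Real_Asymp.Real_Asymp"
begin

text \<open>Testing the energy against a backward heat kernel centred at \<open>(y, s)\<close>, cut off near \<open>y\<close>, gives an
  almost monotone quantity whose error has two sources. The positive part of the discrepancy is controlled by a
  maximum principle: the barrier \<open>hump \<gamma> \<phi>\<close> plus an exponentially decaying initial layer dominates it, and it is
  integrable against the kernel up to a factor that vanishes with \<open>\<epsilon>\<close>. The drift contributes the integral of
  \<open>|u|\<^sup>2\<close> against the energy, which a Meyers--Ziemer type trace inequality bounds by the density ratio times a power of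
  the \<open>W\<^bsup>1,p\<^esup>\<close> norm; Hoelder in time makes it integrable exactly when \<open>p > nq/(2(q-1))\<close>. On a time
  step of length \<open>h\<close> independent of \<open>\<epsilon>\<close> the errors absorb at most half of the current density bound,
  so the density grows by a fixed factor per step, and \<open>[0,T]\<close> is covered by finitely many steps.\<close>

text \<open>The difficulty is uniformity in epsilon. The initial discrepancy may be as large as
  epsilon^(-\<beta>), while \<open>hump\<close> vanishes at the wells, so no multiple of
  \<open>hump\<close> dominates it; this forces the additive layer, whose decay rate of order
  epsilon^(-2) makes its time integral small. Against the kernel, the part of the discrepancy
  proportional to the energy costs a factor 1/(s - t), which is not integrable up to the pole s. But
  for radii of order epsilon the density bound is trivial, so poles lie at least a multiple of
  epsilon^2 in the future, the singular integral is O(log(1/epsilon)), and epsilon^\<delta> with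
  \<delta> = (1 - 2 \<beta>)/2 > 0 beats it. Every error is proportional to the density bound M
  assumed on the step, so a step improves M to C M0 + M/2. Iterated from any finite bound, even one
  blowing up as epsilon tends to 0, this reaches the fixed point 2 C M0 and takes the place of a
  continuity argument in time. The torus is treated through periodic lifts to R^n, where balls of
  radius at most 1/2 embed.\<close>

abbreviation (input) nn_lborel :: "('a::euclidean_space \<Rightarrow> ennreal) \<Rightarrow> ennreal" (binder "\<integral>" 10)
  where "nn_lborel f \<equiv> nn_integral lborel f"

text \<open>Integrate a in r, differentiate F(r,s) - F(r1,s) = integral of a under the integral sign
  in s, and read off that b(r,s0) is a primitive of c. No differentiability of b is presupposed;
  this fits \<open>\<phi>t\<close>, whose spatial derivative has to be identified with the time
  derivative \<open>gt\<close> of the gradient.\<close>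

lemma mixed_partial_derivative:
  fixes F a b c :: "real \<Rightarrow> real \<Rightarrow> real"
  assumes ab: "r0 \<in> {r1..r2}" and S: "s0 \<in> {s1..s2}"
    and Fr: "\<And>r s. r \<in> {r1..r2} \<Longrightarrow> s \<in> {s1..s2} \<Longrightarrow> ((\<lambda>r. F r s) has_real_derivative a r s) (at r within {r1..r2})"
    and as: "\<And>r s. r \<in> {r1..r2} \<Longrightarrow> s \<in> {s1..s2} \<Longrightarrow> ((\<lambda>s. a r s) has_real_derivative c r s) (at s within {s1..s2})"
    and Fs: "\<And>r s. r \<in> {r1..r2} \<Longrightarrow> s \<in> {s1..s2} \<Longrightarrow> ((\<lambda>s. F r s) has_real_derivative b r s) (at s within {s1..s2})"
    and ca: "\<And>s. s \<in> {s1..s2} \<Longrightarrow> continuous_on {r1..r2} (\<lambda>r. a r s)"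
    and cc: "continuous_on ({r1..r2} \<times> {s1..s2}) (\<lambda>(r,s). c r s)"
    and ne: "s1 < s2"
  shows "((\<lambda>r. b r s0) has_real_derivative c r0 s0) (at r0 within {r1..r2})"
proof -
  have id: "b r s0 = b r1 s0 + integral {r1..r} (\<lambda>x. c x s0)" if r: "r \<in> {r1..r2}" for r
  proof -
    have sub: "{r1..r} \<subseteq> {r1..r2}" using r by auto
    have cc': "continuous_on ({s1..s2} \<times> cbox r1 r) (\<lambda>(s, x). c x s)"
    proof -
      have "continuous_on ({s1..s2} \<times> cbox r1 r) (\<lambda>z. (\<lambda>(r,s). c r s) (snd z, fst z))"
        by (rule continuous_on_compose2[OF cc]) (use r in \<open>auto intro!: continuous_intros\<close>)
      then show ?thesis by (simp add: case_prod_beta)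
    qed
    have L: "((\<lambda>s. integral (cbox r1 r) (\<lambda>x. a x s)) has_real_derivative integral (cbox r1 r) (\<lambda>x. c x s0)) (at s0 within {s1..s2})"
    proof (rule leibniz_rule_field_derivative[where fx="\<lambda>s x. c x s" and f="\<lambda>s x. a x s"])
      show "((\<lambda>x. a t x) has_real_derivative c t x) (at x within {s1..s2})" if "x \<in> {s1..s2}" "t \<in> cbox r1 r" for x t
        using as that sub by auto
      show "(\<lambda>x. a x s) integrable_on cbox r1 r" if "s \<in> {s1..s2}" for s
        using continuous_on_subset[OF ca[OF that] sub] by (intro integrable_continuous) auto
    qed (use S cc' in auto)
    have I: "integral (cbox r1 r) (\<lambda>x. a x s) = F r s - F r1 s" if "s \<in> {s1..s2}" for s
    proof -
      have "((\<lambda>x. a x s) has_integral (F r s - F r1 s)) {r1..r}"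
        by (rule fundamental_theorem_of_calculus)
          (use r that in \<open>auto intro!: has_vector_derivative_within_subset[OF Fr[unfolded has_real_derivative_iff_has_vector_derivative] sub]\<close>)
      then show ?thesis by (simp add: integral_unique)
    qed
    have 1: "((\<lambda>s. F r s - F r1 s) has_real_derivative integral (cbox r1 r) (\<lambda>x. c x s0)) (at s0 within {s1..s2})"
      by (rule has_field_derivative_transform_within[OF L zero_less_one S]) (rule I)
    have 2: "((\<lambda>s. F r s - F r1 s) has_real_derivative b r s0 - b r1 s0) (at s0 within {s1..s2})"
      using Fs S r ab by (intro derivative_intros) auto
    have "at s0 within {s1..s2} \<noteq> bot"
      using S ne by (simp add: at_within_Icc_at trivial_limit_within islimpt_Icc)
    then have "integral (cbox r1 r) (\<lambda>x. c x s0) = b r s0 - b r1 s0"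
      using 1 2 by (metis has_field_derivative_def vector_derivative_unique_within
          has_real_derivative_iff_has_vector_derivative)
    then show ?thesis by simp
  qed
  have cx: "continuous_on {r1..r2} (\<lambda>x. c x s0)"
  proof -
    have "continuous_on {r1..r2} (\<lambda>z. (\<lambda>(r,s). c r s) (z, s0))"
      by (rule continuous_on_compose2[OF cc]) (use S in \<open>auto intro!: continuous_intros\<close>)
    then show ?thesis by simp
  qed
  have "((\<lambda>r. b r1 s0 + integral {r1..r} (\<lambda>x. c x s0)) has_real_derivative 0 + c r0 s0) (at r0 within {r1..r2})"
    by (intro derivative_intros integral_has_real_derivative cx ab)
  then have "((\<lambda>r. b r1 s0 + integral {r1..r} (\<lambda>x. c x s0)) has_real_derivative c r0 s0) (at r0 within {r1..r2})"
    by simp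
  then show ?thesis
    by (rule has_field_derivative_transform_within[OF _ zero_less_one ab]) (rule id[symmetric])
qed

text \<open>The divergence theorem, one direction at a time: by translation invariance of Lebesgue
  measure the integral of F(x + s b) is constant in s, and differentiating under the integral sign
  at s = 0 gives the claim.\<close>

lemma integral_directional_derivative_eq_0:
  fixes F F' :: "'a::euclidean_space \<Rightarrow> real"
  assumes d: "\<And>x. ((\<lambda>s. F (x + s *\<^sub>R b)) has_real_derivative F' x) (at 0)"
    and cF: "continuous_on UNIV F" and cF': "continuous_on UNIV F'"
    and supp: "\<And>x. norm x \<ge> K \<Longrightarrow> F x = 0" and K: "K > 0"
    and box: "ball 0 (K + norm b) \<subseteq> cbox l u"
  shows "integral (cbox l u) F' = 0"
proof -
  have d': "((\<lambda>s. F (x + s *\<^sub>R b)) has_real_derivative F' (x + s *\<^sub>R b)) (at s)" for x s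
  proof -
    have "((\<lambda>r. F ((x + s *\<^sub>R b) + r *\<^sub>R b)) has_real_derivative F' (x + s *\<^sub>R b)) (at 0)" by (rule d)
    then have "((\<lambda>r. F (x + (s + r) *\<^sub>R b)) has_real_derivative F' (x + s *\<^sub>R b)) (at 0)"
      by (simp add: algebra_simps)
    then show ?thesis using DERIV_shift[of "\<lambda>r. F (x + r *\<^sub>R b)" _ 0 s] by (simp add: add.commute)
  qed
  have 1: "((\<lambda>s. integral (cbox l u) (\<lambda>x. F (x + s *\<^sub>R b))) has_real_derivative
        integral (cbox l u) (\<lambda>x. F' (x + 0 *\<^sub>R b))) (at 0 within {-1<..<1})"
  proof (rule leibniz_rule_field_derivative[where fx="\<lambda>s x. F' (x + s *\<^sub>R b)"])
    show "(\<lambda>x. F (x + s *\<^sub>R b)) integrable_on cbox l u" for s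
      by (intro integrable_continuous continuous_on_compose2[OF cF]) (auto intro!: continuous_intros)
    show "continuous_on ({-1<..<1} \<times> cbox l u) (\<lambda>(s, x). F' (x + s *\<^sub>R b))"
      unfolding case_prod_beta
      by (intro continuous_on_compose2[OF cF']) (auto intro!: continuous_intros)
  qed (auto intro!: has_field_derivative_at_within d')
  \<comment> \<open>The margin \<open>norm b\<close> in \<open>box\<close> keeps the shifted support
    inside the box for |s| \<le> 1, so the box integrals equal integrals over the whole space, where
    translation costs nothing.\<close>
  have inv: "integral (cbox l u) (\<lambda>x. F (x + s *\<^sub>R b)) = integral (cbox l u) F" if s: "s \<in> {-1<..<1}" for s
  proof -
    have out: "F (x + r *\<^sub>R b) = 0" if "x \<notin> cbox l u" "\<bar>r\<bar> \<le> 1" for x r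
    proof -
      have "K + norm b \<le> norm x" using that box by (meson in_mono linorder_not_le mem_ball_0)
      moreover have "norm (r *\<^sub>R b) \<le> norm b" using that by (simp add: mult_left_le_one_le)
      ultimately have "K \<le> norm (x + r *\<^sub>R b)" using norm_diff_ineq[of x "r *\<^sub>R b"] by linarith
      then show ?thesis by (rule supp)
    qed
    have c: "(\<lambda>x. F (x + r *\<^sub>R b)) integrable_on cbox l u" for r
      by (intro integrable_continuous continuous_on_compose2[OF cF]) (auto intro!: continuous_intros)
    have e: "integral (cbox l u) (\<lambda>x. F (x + r *\<^sub>R b)) = integral UNIV (\<lambda>x. F (x + r *\<^sub>R b))
        \<and> (\<lambda>x. F (x + r *\<^sub>R b)) integrable_on UNIV" if "\<bar>r\<bar> \<le> 1" for r
    proof -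
      have "((\<lambda>x. F (x + r *\<^sub>R b)) has_integral integral (cbox l u) (\<lambda>x. F (x + r *\<^sub>R b))) UNIV"
        by (rule has_integral_on_superset[OF integrable_integral[OF c[of r]]]) (use out that in auto)
      then show ?thesis by (auto simp: integral_unique has_integral_integrable)
    qed
    have il: "integrable lborel F"
    proof -
      have "integrable lborel (\<lambda>x. indicator (cbox l u) x *\<^sub>R F x)"
        by (rule borel_integrable_compact) (auto intro: continuous_on_subset[OF cF])
      also have "(\<lambda>x. indicator (cbox l u) x *\<^sub>R F x) = F"
        using out[of _ 0] by (auto simp: indicator_def fun_eq_iff)
      finally show ?thesis .
    qed
    have dist: "distr lborel borel (\<lambda>x::'a. x + s *\<^sub>R b) = lborel"
      using lborel_affine[of 1 "s *\<^sub>R b"] by (simp add: density_1 add.commute)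
    have il': "integrable lborel (\<lambda>x. F (x + s *\<^sub>R b))"
      using il by (subst (asm) dist[symmetric], subst (asm) integrable_distr_eq) auto
    have "(LINT x|lborel. F (x + s *\<^sub>R b)) = (LINT x|lborel. F x)"
      using il by (subst (2) dist[symmetric], subst integral_distr) auto
    then have "integral UNIV (\<lambda>x. F (x + s *\<^sub>R b)) = integral UNIV F"
      using il il' by (simp add: integral_lborel)
    then show ?thesis using e[of s] e[of 0] s by auto
  qed
  have "((\<lambda>s. integral (cbox l u) F) has_real_derivative integral (cbox l u) F') (at 0 within {-1<..<1})"
    using 1 by (intro has_field_derivative_transform_within[where d=1 and g="\<lambda>s. integral (cbox l u) F", OF 1[simplified]]) (simp_all add: inv)
  then have "((\<lambda>s. integral (cbox l u) F) has_real_derivative integral (cbox l u) F') (at 0)"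
    by (simp add: at_within_open[of 0 "{-1<..<1::real}"])
  then show ?thesis using DERIV_unique DERIV_const by blast
qed

text \<open>Made for touching points of a maximum principle: the second derivative is required at 0
  only. Were it positive, f' would be positive just to the right of 0 and the mean value theorem
  would push f above f 0.\<close>

lemma second_derivative_local_max:
  fixes f f' :: "real \<Rightarrow> real"
  assumes e: "e > 0" and f: "\<And>s. \<bar>s\<bar> < e \<Longrightarrow> (f has_real_derivative f' s) (at s)"
    and f': "(f' has_real_derivative l) (at 0)"
    and mx: "\<And>s. \<bar>s\<bar> < e \<Longrightarrow> f s \<le> f 0"
  shows "f' 0 = 0 \<and> l \<le> 0"
proof -
  have 0: "f' 0 = 0"
    using DERIV_local_max[OF f[of 0] e] mx e by auto
  have "l \<le> 0"
  proof (rule ccontr)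
    assume "\<not> l \<le> 0"
    then obtain d where d: "d > 0" "\<And>h. h > 0 \<Longrightarrow> h < d \<Longrightarrow> f' 0 < f' (0 + h)"
      using DERIV_pos_inc_right[OF f'] by (metis linorder_not_le)
    define h where "h = min d e / 2"
    have h: "h > 0" "h < d" "h < e" using d e by (auto simp: h_def min_def)
    obtain z where "z > 0" "z < h" "f h - f 0 = (h - 0) * f' z"
      using MVT2[of 0 h f f'] h f by (smt (verit, best))
    moreover have "f' z > 0" using d(2)[of z] 0 h calculation by simp
    ultimately have "f h > f 0" using h by (smt (verit) mult_pos_pos)
    then show False using mx[of h] h by auto
  qed
  with 0 show ?thesis by simp
qed

lemma norm_matrix_vector_mult_le:
  fixes A :: "real^'n^'m"
  shows "norm (A *v x) \<le> norm A * norm x"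
proof -
  have "norm (A *v x) = L2_set (\<lambda>i. A $ i \<bullet> x) UNIV"
    by (simp add: norm_vec_def matrix_vector_mul_component L2_set_def)
  also have "\<dots> \<le> L2_set (\<lambda>i. norm (A $ i) * norm x) UNIV"
    by (rule order_trans[OF _ L2_set_mono[of UNIV "\<lambda>i. \<bar>A $ i \<bullet> x\<bar>"]]) (auto simp: L2_set_def Cauchy_Schwarz_ineq2)
  also have "\<dots> = norm A * norm x"
    by (simp add: L2_set_left_distrib[symmetric] norm_vec_def)
  finally show ?thesis .
qed

lemma nn_integral_affine:
  fixes f :: "'a::euclidean_space \<Rightarrow> ennreal"
  assumes [measurable]: "f \<in> borel_measurable borel" and c: "c > 0"
  shows "(\<integral>x. f (t + c *\<^sub>R x)) = ennreal (1 / c ^ DIM('a)) * (\<integral>x. f x)"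
proof -
  have "(\<integral>x. f x) = ennreal (c ^ DIM('a)) * (\<integral>x. f (t + c *\<^sub>R x))"
    using c by (subst lborel_affine[of c t]) (simp_all add: nn_integral_density nn_integral_distr nn_integral_cmult)
  then show ?thesis using c
    by (simp add: mult.assoc[symmetric] ennreal_mult[symmetric])
qed

lemma nn_integral_translate:
  fixes f :: "'a::euclidean_space \<Rightarrow> ennreal"
  assumes "f \<in> borel_measurable borel"
  shows "(\<integral>x. f (t + x)) = (\<integral>x. f x)"
  using nn_integral_affine[OF assms, of 1 t] by simp

section \<open>Weighted energy inequality for the transported Allen--Cahn equation\<close>

text \<open>Truncated powers of exponent at least 2 are continuously differentiable, so the cube of
  a truncated affine function has two continuous derivatives. This lets polynomial cutoffs stand in
  for smooth bumps.\<close>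

lemma DERIV_max_0_power:
  "((\<lambda>x::real. max 0 x ^ Suc (Suc k)) has_real_derivative real (k + 2) * max 0 x ^ Suc k) (at x)"
proof -
  consider "x > 0" | "x < 0" | "x = 0" by linarith
  then show ?thesis
  proof cases
    case 1
    have "((\<lambda>x::real. x ^ Suc (Suc k)) has_real_derivative real (k + 2) * max 0 x ^ Suc k) (at x)"
      using 1 by (auto intro!: derivative_eq_intros simp: algebra_simps simp del: power_Suc)
    then show ?thesis
      by (rule has_field_derivative_transform_within_open[where S="{0<..}"]) (use 1 in auto)
  next
    case 2
    have "((\<lambda>x::real. 0) has_real_derivative real (k + 2) * max 0 x ^ Suc k) (at x)"
      using 2 by (auto simp: max_def)
    then show ?thesis
      by (rule has_field_derivative_transform_within_open[where S="{..<0}"]) (use 2 in auto)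
  next
    case 3
    have "((\<lambda>h::real. max 0 h ^ Suc (Suc k) / h) \<longlongrightarrow> 0) (at 0)"
    proof (rule Lim_null_comparison)
      show "\<forall>\<^sub>F h in at 0. norm (max 0 h ^ Suc (Suc k) / h) \<le> \<bar>h::real\<bar> ^ Suc k"
      proof (rule always_eventually, rule allI)
        fix h :: real
        show "norm (max 0 h ^ Suc (Suc k) / h) \<le> \<bar>h\<bar> ^ Suc k"
        proof (cases "h > 0")
          case False
          then have "max 0 h = 0" by simp
          then have "max 0 h ^ Suc (Suc k) / h = 0" by simp
          then show ?thesis by (metis abs_ge_zero norm_zero zero_le_power)
        qed (simp add: max_def)
      qed
      show "((\<lambda>h::real. \<bar>h\<bar> ^ Suc k) \<longlongrightarrow> 0) (at 0)"
        by (auto intro!: tendsto_eq_intros)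
    qed
    then show ?thesis using 3 by (simp add: DERIV_def)
  qed
qed

lemma has_vector_derivative_along_line:
  fixes f :: "'a::real_normed_vector \<Rightarrow> 'b::real_normed_vector"
  assumes "(f has_derivative f') (at (x + s *\<^sub>R b))"
  shows "((\<lambda>s. f (x + s *\<^sub>R b)) has_vector_derivative f' b) (at s)"
proof -
  have 1: "((\<lambda>s. x + s *\<^sub>R b) has_vector_derivative b) (at s)"
    by (auto intro!: derivative_eq_intros)
  have "((f \<circ> (\<lambda>s. x + s *\<^sub>R b)) has_derivative (f' \<circ> (\<lambda>h. h *\<^sub>R b))) (at s)"
    by (rule diff_chain_at) (use 1 assms in \<open>auto simp: has_vector_derivative_def\<close>)
  moreover have "f' (h *\<^sub>R b) = h *\<^sub>R f' b" for h
    using assms by (simp add: linear_cmul has_derivative_linear)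
  ultimately show ?thesis by (simp add: has_vector_derivative_def o_def)
qed

lemma has_real_derivative_vec_nth:
  "(f has_vector_derivative f') F \<Longrightarrow> ((\<lambda>s. f s $ i) has_real_derivative f' $ i) F"
  unfolding has_real_derivative_iff_has_vector_derivative
  by (rule bounded_linear.has_vector_derivative[OF bounded_linear_vec_nth])

text \<open>In the application w is the cutoff, k the Gaussian factor, q = |x - x0|^2 for the centre
  x0, f = \<Delta>\<phi> - W'/\<epsilon>^2, v = u . grad \<phi>, G = |grad \<phi>|^2, and
  \<open>y\<close> = (x - x0) . grad \<phi>. The quadratic terms in f, v and y complete to one
  negative square; left over are v^2/4, a term 12 \<iota>^2 w y^2 from the cutoff, and the
  discrepancy \<epsilon> G - E with weight 2 \<mu>. The cube of w makes p1^2/p0 a polynomial in w,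
  so the square closes up to the edge of the support.\<close>

lemma localized_dissipation_algebra:
  fixes k w q R \<epsilon> \<mu> G y E v U f n :: real
  assumes k: "k \<ge> 0" and w: "0 \<le> w" "w \<le> 1" and q: "q \<ge> 0" "q * \<iota> \<le> 1" and \<iota>: "\<iota> \<ge> 0"
    and \<epsilon>: "\<epsilon> > 0" and \<mu>: "\<mu> \<ge> 0" and y: "y\<^sup>2 \<le> q * G" and EG: "\<epsilon> * G \<le> 2 * E" and v: "v\<^sup>2 \<le> U * G"
    and G: "G \<ge> 0" and U: "U \<ge> 0" and n: "n \<ge> 0"
  defines "p0 \<equiv> w ^ 3" and "p1 \<equiv> - 3 * \<iota> * w\<^sup>2 - \<mu> * w ^ 3"
    and "p2 \<equiv> 6 * \<iota>\<^sup>2 * w + 6 * \<mu> * \<iota> * w\<^sup>2 + \<mu>\<^sup>2 * w ^ 3"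
  shows "k * ((2 * (n - 1) * \<mu> - 4 * \<mu>\<^sup>2 * q) * p0 * E - \<epsilon> * p0 * (f - v) * f - 2 * \<epsilon> * p1 * y * f
      - 2 * \<epsilon> * p1 * y * (f - v) - 4 * \<epsilon> * p2 * y\<^sup>2 - 2 * \<epsilon> * p1 * G + 4 * E * p2 * q + 2 * n * E * p1)
    \<le> k * (2 * \<mu> * w ^ 3 * (\<epsilon> * G - E) + w * E * (60 + 24 * \<mu> * q) * \<iota> + w ^ 3 * U * E / 2)"
proof -
  define S where "S = w * f - 2 * (3 * \<iota> + \<mu> * w) * y"
  have E: "E \<ge> 0" using EG \<epsilon> G by (smt (verit) mult_nonneg_nonneg)
  have id: "(2 * (n - 1) * \<mu> - 4 * \<mu>\<^sup>2 * q) * p0 * E - \<epsilon> * p0 * (f - v) * f - 2 * \<epsilon> * p1 * y * f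
      - 2 * \<epsilon> * p1 * y * (f - v) - 4 * \<epsilon> * p2 * y\<^sup>2 - 2 * \<epsilon> * p1 * G + 4 * E * p2 * q + 2 * n * E * p1
    = - \<epsilon> * w * (S - w * v / 2)\<^sup>2 + \<epsilon> * w ^ 3 * v\<^sup>2 / 4 + 12 * \<epsilon> * \<iota>\<^sup>2 * w * y\<^sup>2
      + E * (- 2 * \<mu> * w ^ 3 + 24 * q * w * \<iota>\<^sup>2 + 24 * \<mu> * q * w\<^sup>2 * \<iota> - 6 * n * w\<^sup>2 * \<iota>)
      + 2 * \<epsilon> * G * (3 * w\<^sup>2 * \<iota> + \<mu> * w ^ 3)"
    unfolding p0_def p1_def p2_def S_def by (simp add: power2_eq_square power3_eq_cube field_simps)
  have w2: "w\<^sup>2 \<le> w" using w by (simp add: power2_eq_square mult_left_le)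
  have s1: "- \<epsilon> * w * (S - w * v / 2)\<^sup>2 \<le> 0" using \<epsilon> w by simp
  have s2: "\<epsilon> * w ^ 3 * v\<^sup>2 / 4 \<le> w ^ 3 * U * E / 2"
  proof -
    have "\<epsilon> * v\<^sup>2 \<le> U * (\<epsilon> * G)" using v \<epsilon> by (simp add: mult.left_commute)
    also have "\<dots> \<le> U * (2 * E)" using EG U by (rule mult_left_mono)
    finally have "w ^ 3 * (\<epsilon> * v\<^sup>2) \<le> w ^ 3 * (U * (2 * E))" using w by (intro mult_left_mono) auto
    then show ?thesis by (simp add: algebra_simps)
  qed
  have s3: "12 * \<epsilon> * \<iota>\<^sup>2 * w * y\<^sup>2 \<le> 24 * w * E * \<iota>"
  proof -
    have "\<epsilon> * y\<^sup>2 \<le> q * (\<epsilon> * G)" using y \<epsilon> by (simp add: mult.left_commute)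
    also have "\<dots> \<le> q * (2 * E)" using EG q by (intro mult_left_mono) auto
    finally have "\<epsilon> * y\<^sup>2 \<le> 2 * q * E" by simp
    then have "(12 * \<iota>\<^sup>2 * w) * (\<epsilon> * y\<^sup>2) \<le> (12 * \<iota>\<^sup>2 * w) * (2 * q * E)" using w by (intro mult_left_mono) auto
    also have "\<dots> = 24 * w * E * \<iota> * (q * \<iota>)" by (simp add: power2_eq_square)
    also have "\<dots> \<le> 24 * w * E * \<iota>" using q w E \<iota> by (intro mult_left_le) auto
    finally show ?thesis by (simp add: algebra_simps)
  qed
  have s4: "E * (- 2 * \<mu> * w ^ 3 + 24 * q * w * \<iota>\<^sup>2 + 24 * \<mu> * q * w\<^sup>2 * \<iota> - 6 * n * w\<^sup>2 * \<iota>)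
     \<le> E * (- 2 * \<mu> * w ^ 3 + 24 * w * \<iota> + 24 * \<mu> * q * w * \<iota>)"
  proof -
    have "24 * q * w * \<iota>\<^sup>2 = 24 * w * \<iota> * (q * \<iota>)" by (simp add: power2_eq_square)
    also have "\<dots> \<le> 24 * w * \<iota>" using q w \<iota> by (intro mult_left_le) auto
    finally have a: "24 * q * w * \<iota>\<^sup>2 \<le> 24 * w * \<iota>" .
    have b: "24 * \<mu> * q * w\<^sup>2 * \<iota> \<le> 24 * \<mu> * q * w * \<iota>"
      using w2 \<mu> q \<iota> by (intro mult_right_mono mult_left_mono) auto
    have "6 * n * w\<^sup>2 * \<iota> \<ge> 0" using n \<iota> by simp
    then have "- 2 * \<mu> * w ^ 3 + 24 * q * w * \<iota>\<^sup>2 + 24 * \<mu> * q * w\<^sup>2 * \<iota> - 6 * n * w\<^sup>2 * \<iota>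
      \<le> - 2 * \<mu> * w ^ 3 + 24 * w * \<iota> + 24 * \<mu> * q * w * \<iota>" using a b by linarith
    then show ?thesis using E by (intro mult_left_mono) auto
  qed
  have s5: "2 * \<epsilon> * G * (3 * w\<^sup>2 * \<iota> + \<mu> * w ^ 3) \<le> 12 * w * E * \<iota> + 2 * \<mu> * w ^ 3 * (\<epsilon> * G)"
  proof -
    have "(\<epsilon> * G) * (6 * w\<^sup>2 * \<iota>) \<le> (2 * E) * (6 * w * \<iota>)"
      using w2 w \<iota> E G \<epsilon> by (intro mult_mono[OF EG]) (auto intro!: mult_right_mono)
    then show ?thesis by (simp add: algebra_simps)
  qed
  \<comment> \<open>The 60 is 24 + 24 + 12, collected from \<open>s3\<close>, \<open>s4\<close> and
    \<open>s5\<close>; the term 24 \<mu> q comes from \<open>s4\<close>.\<close>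
  show ?thesis
    unfolding id using s1 s2 s3 s4 s5 by (intro mult_left_mono[OF _ k]) (simp add: algebra_simps)
qed


text \<open>The argument q is a squared distance and \<iota> the inverse square of the cutoff
  radius: \<iota> = 16 gives radius 1/4, and letting \<iota> tend to 0 removes the cutoff.\<close>

definition cut :: "real \<Rightarrow> real \<Rightarrow> real" where "cut \<iota> q = max 0 (1 - q * \<iota>)"

text \<open>A Gaussian with cutoff, as a function of the squared distance q; \<open>kern1\<close>
  and \<open>kern2\<close> are its first two q-derivatives, so its spatial gradient is 2
  \<open>kern1\<close> (x - y). The cutoff is cubed to leave two continuous derivatives.\<close>

definition kern0 :: "real \<Rightarrow> real \<Rightarrow> real \<Rightarrow> real \<Rightarrow> real" where
  "kern0 a \<mu> \<iota> q = a * exp (- \<mu> * q) * cut \<iota> q ^ 3"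
definition kern1 :: "real \<Rightarrow> real \<Rightarrow> real \<Rightarrow> real \<Rightarrow> real" where
  "kern1 a \<mu> \<iota> q = a * exp (- \<mu> * q) * (- 3 * \<iota> * (cut \<iota> q)\<^sup>2 - \<mu> * cut \<iota> q ^ 3)"
definition kern2 :: "real \<Rightarrow> real \<Rightarrow> real \<Rightarrow> real \<Rightarrow> real" where
  "kern2 a \<mu> \<iota> q = a * exp (- \<mu> * q) *
     (6 * \<iota>\<^sup>2 * cut \<iota> q + 6 * \<mu> * \<iota> * (cut \<iota> q)\<^sup>2 + \<mu>\<^sup>2 * cut \<iota> q ^ 3)"

lemma DERIV_cut_power:
  "((\<lambda>q. cut \<iota> q ^ 3) has_real_derivative - 3 * \<iota> * (cut \<iota> q)\<^sup>2) (at q)"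
  "((\<lambda>q. (cut \<iota> q)\<^sup>2) has_real_derivative - 2 * \<iota> * cut \<iota> q) (at q)"
proof -
  have d: "((\<lambda>q. 1 - q * \<iota>) has_real_derivative - \<iota>) (at q)" by (auto intro!: derivative_eq_intros)
  show "((\<lambda>q. cut \<iota> q ^ 3) has_real_derivative - 3 * \<iota> * (cut \<iota> q)\<^sup>2) (at q)"
    using DERIV_chain2[OF DERIV_max_0_power[of 1] d]
    by (simp add: cut_def numeral_3_eq_3 numeral_2_eq_2 algebra_simps)
  show "((\<lambda>q. (cut \<iota> q)\<^sup>2) has_real_derivative - 2 * \<iota> * cut \<iota> q) (at q)"
    using DERIV_chain2[OF DERIV_max_0_power[of 0] d]
    by (simp add: cut_def numeral_2_eq_2 algebra_simps)
qed

lemma DERIV_kern0: "(kern0 a \<mu> \<iota> has_real_derivative kern1 a \<mu> \<iota> q) (at q)"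
proof -
  have e: "((\<lambda>q. a * exp (- \<mu> * q)) has_real_derivative - \<mu> * (a * exp (- \<mu> * q))) (at q)"
    by (auto intro!: derivative_eq_intros)
  have eq: "kern1 a \<mu> \<iota> q = - \<mu> * (a * exp (- \<mu> * q)) * cut \<iota> q ^ 3
    + - 3 * \<iota> * (cut \<iota> q)\<^sup>2 * (a * exp (- \<mu> * q))"
    unfolding kern1_def by (simp add: algebra_simps)
  show ?thesis
    using DERIV_mult[OF e DERIV_cut_power(1)] by (simp only: kern0_def[abs_def] eq)
qed

lemma DERIV_kern1: "(kern1 a \<mu> \<iota> has_real_derivative kern2 a \<mu> \<iota> q) (at q)"
proof -
  have e: "((\<lambda>q. a * exp (- \<mu> * q)) has_real_derivative - \<mu> * (a * exp (- \<mu> * q))) (at q)"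
    by (auto intro!: derivative_eq_intros)
  have f: "((\<lambda>q. - 3 * \<iota> * (cut \<iota> q)\<^sup>2 - \<mu> * cut \<iota> q ^ 3) has_real_derivative
      - 3 * \<iota> * (- 2 * \<iota> * cut \<iota> q) - \<mu> * (- 3 * \<iota> * (cut \<iota> q)\<^sup>2)) (at q)"
    by (intro DERIV_diff DERIV_cmult DERIV_cut_power)
  have "kern2 a \<mu> \<iota> q = - \<mu> * (a * exp (- \<mu> * q)) * (- 3 * \<iota> * (cut \<iota> q)\<^sup>2 - \<mu> * cut \<iota> q ^ 3)
    + (- 3 * \<iota> * (- 2 * \<iota> * cut \<iota> q) - \<mu> * (- 3 * \<iota> * (cut \<iota> q)\<^sup>2)) * (a * exp (- \<mu> * q))"
    unfolding kern2_def by (simp add: algebra_simps power2_eq_square power3_eq_cube)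
  then show ?thesis
    using DERIV_mult[OF e f] by (simp only: kern1_def[abs_def])
qed

lemma continuous_on_cut [continuous_intros]:
  "continuous_on S f \<Longrightarrow> continuous_on S (\<lambda>x. cut \<iota> (f x))"
  unfolding cut_def by (intro continuous_intros)

lemma continuous_on_kern [continuous_intros]:
  assumes "continuous_on S a" "continuous_on S m" "continuous_on S f"
  shows "continuous_on S (\<lambda>x. kern0 (a x) (m x) \<iota> (f x))"
    "continuous_on S (\<lambda>x. kern1 (a x) (m x) \<iota> (f x))"
    "continuous_on S (\<lambda>x. kern2 (a x) (m x) \<iota> (f x))"
  unfolding kern0_def kern1_def kern2_def by (intro continuous_intros assms)+

lemma cut_bounds: "0 \<le> cut \<iota> q" "q \<ge> 0 \<Longrightarrow> \<iota> \<ge> 0 \<Longrightarrow> cut \<iota> q \<le> 1" "q * \<iota> \<ge> 1 \<Longrightarrow> cut \<iota> q = 0"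
  by (auto simp: cut_def)

lemma kern_vanish: "q * \<iota> \<ge> 1 \<Longrightarrow> kern0 a \<mu> \<iota> q = 0" "q * \<iota> \<ge> 1 \<Longrightarrow> kern1 a \<mu> \<iota> q = 0"
  by (auto simp: kern0_def kern1_def cut_bounds)

lemma continuous_on_vec_nth:
  fixes f :: "'c::topological_space \<Rightarrow> ('b::real_normed_vector)^'n"
  shows "continuous_on S f \<Longrightarrow> continuous_on S (\<lambda>x. f x $ i)"
  using bounded_linear.continuous_on[OF bounded_linear_vec_nth] by blast

lemma continuous_on_swap:
  assumes "continuous_on (UNIV \<times> A) (\<lambda>(x, t). f x t)" "B \<subseteq> A"
  shows "continuous_on (B \<times> S) (\<lambda>z. f (snd z) (fst z))"
proof -
  have "continuous_on (B \<times> S) (\<lambda>z. (\<lambda>(x, t). f x t) (snd z, fst z))"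
    by (rule continuous_on_compose2[OF assms(1)]) (use assms in \<open>auto intro!: continuous_intros\<close>)
  then show ?thesis by simp
qed

lemma continuous_on_slice:
  assumes "continuous_on (UNIV \<times> A) (\<lambda>(x, t). f x t)" "t \<in> A"
  shows "continuous_on S (\<lambda>x. f x t)"
proof -
  have "continuous_on S (\<lambda>x. (\<lambda>(x, t). f x t) (x, t))"
    by (rule continuous_on_compose2[OF assms(1)]) (use assms in \<open>auto intro!: continuous_intros\<close>)
  then show ?thesis by simp
qed

text \<open>All functions live on R^n; the torus enters through periodic instances. Derivatives are
  supplied as data: \<open>T3\<close> x t $ i $ j $ k is the derivative of the Hessian entry (i,j)
  in direction k, and \<open>gt\<close> is the time derivative of the gradient.\<close>

locale allen_cahn_transport =
  fixes T \<epsilon> :: real and W W1 W2 :: "real \<Rightarrow> real"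
    and u :: "real^'n \<Rightarrow> real \<Rightarrow> real^'n" and Du :: "real^'n \<Rightarrow> real \<Rightarrow> real^'n^'n"
    and \<phi> :: "real^'n \<Rightarrow> real \<Rightarrow> real" and g :: "real^'n \<Rightarrow> real \<Rightarrow> real^'n"
    and H :: "real^'n \<Rightarrow> real \<Rightarrow> real^'n^'n" and T3 :: "real^'n \<Rightarrow> real \<Rightarrow> real^'n^'n^'n"
    and \<phi>t :: "real^'n \<Rightarrow> real \<Rightarrow> real" and gt :: "real^'n \<Rightarrow> real \<Rightarrow> real^'n"
  assumes T_pos: "T > 0" and eps_pos: "\<epsilon> > 0" and eps_less_1: "\<epsilon> < 1"
    and W_nonneg: "\<And>x. W x \<ge> 0"
    and W_deriv: "\<And>x. (W has_real_derivative W1 x) (at x)"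
    and W1_deriv: "\<And>x. (W1 has_real_derivative W2 x) (at x)"
    and u_cont: "continuous_on (UNIV \<times> {0..T}) (\<lambda>(x,t). u x t)"
    and u_deriv: "\<And>x t. t \<in> {0..T} \<Longrightarrow> ((\<lambda>y. u y t) has_derivative (\<lambda>h. Du x t *v h)) (at x)"
    and \<phi>_deriv: "\<And>x t. t \<in> {0..T} \<Longrightarrow> ((\<lambda>y. \<phi> y t) has_derivative (\<lambda>h. g x t \<bullet> h)) (at x)"
    and g_deriv: "\<And>x t. t \<in> {0..T} \<Longrightarrow> ((\<lambda>y. g y t) has_derivative (\<lambda>h. H x t *v h)) (at x)"
    and H_deriv: "\<And>x t. t \<in> {0..T} \<Longrightarrow> ((\<lambda>y. H y t) has_derivative
            (\<lambda>h. \<chi> i j. \<Sum>k\<in>UNIV. T3 x t $ i $ j $ k * h $ k)) (at x)"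
    and \<phi>_time: "\<And>x t. t \<in> {0..T} \<Longrightarrow> ((\<lambda>s. \<phi> x s) has_real_derivative \<phi>t x t) (at t within {0..T})"
    and g_time: "\<And>x t. t \<in> {0..T} \<Longrightarrow> ((\<lambda>s. g x s) has_vector_derivative gt x t) (at t within {0..T})"
    and \<phi>_cont: "continuous_on (UNIV \<times> {0..T}) (\<lambda>(x,t). \<phi> x t)"
    and g_cont: "continuous_on (UNIV \<times> {0..T}) (\<lambda>(x,t). g x t)"
    and H_cont: "continuous_on (UNIV \<times> {0..T}) (\<lambda>(x,t). H x t)"
    and T3_cont: "continuous_on (UNIV \<times> {0..T}) (\<lambda>(x,t). T3 x t)"
    and \<phi>t_cont: "continuous_on (UNIV \<times> {0..T}) (\<lambda>(x,t). \<phi>t x t)"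
    and gt_cont: "continuous_on (UNIV \<times> {0..T}) (\<lambda>(x,t). gt x t)"
    and pde: "\<And>x t. t \<in> {0..T} \<Longrightarrow> \<phi>t x t + u x t \<bullet> g x t =
            (\<Sum>i\<in>UNIV. H x t $ i $ i) - W1 (\<phi> x t) / \<epsilon>\<^sup>2"
    and \<phi>_bound: "\<And>x t. t \<in> {0..T} \<Longrightarrow> \<bar>\<phi> x t\<bar> \<le> 1"
begin

definition E :: "real^'n \<Rightarrow> real \<Rightarrow> real" where
  "E x t = \<epsilon> * (norm (g x t))\<^sup>2 / 2 + W (\<phi> x t) / \<epsilon>"

lemma E_alt: "E x t = \<epsilon> * (\<Sum>i\<in>UNIV. (g x t $ i)\<^sup>2) / 2 + W (\<phi> x t) / \<epsilon>"
  unfolding E_def power2_norm_eq_inner inner_vec_def by (simp add: power2_eq_square)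

lemma E_nonneg: "E x t \<ge> 0"
  unfolding E_def using eps_pos W_nonneg by simp

lemma \<phi>_line:
  assumes "t \<in> {0..T}"
  shows "((\<lambda>s. \<phi> (x + s *\<^sub>R axis j 1) t) has_real_derivative g (x + s *\<^sub>R axis j 1) t $ j) (at s)"
  using has_vector_derivative_along_line[OF \<phi>_deriv[OF assms], where x=x and s=s and b="axis j 1"]
  by (simp add: has_real_derivative_iff_has_vector_derivative cart_eq_inner_axis)

lemma g_line:
  assumes "t \<in> {0..T}"
  shows "((\<lambda>s. g (x + s *\<^sub>R axis j 1) t $ i) has_real_derivative H (x + s *\<^sub>R axis j 1) t $ i $ j) (at s)"
  using has_real_derivative_vec_nth[OF has_vector_derivative_along_line[OF g_deriv[OF assms], where x=x and s=s and b="axis j 1"], of i]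
  by (simp add: matrix_vector_mult_basis column_def)

lemma H_line:
  assumes "t \<in> {0..T}"
  shows "((\<lambda>s. H (x + s *\<^sub>R axis j 1) t $ i $ k) has_real_derivative T3 (x + s *\<^sub>R axis j 1) t $ i $ k $ j) (at s)"
proof -
  have "((\<lambda>s. H (x + s *\<^sub>R axis j 1) t $ i) has_vector_derivative
      (\<chi> i k. \<Sum>l\<in>UNIV. T3 (x + s *\<^sub>R axis j 1) t $ i $ k $ l * (axis j 1 :: real^'n) $ l) $ i) (at s)"
    using bounded_linear.has_vector_derivative[OF bounded_linear_vec_nth
        has_vector_derivative_along_line[OF H_deriv[OF assms], where x=x and s=s and b="axis j 1"], of i] by simp
  from has_real_derivative_vec_nth[OF this, of k] show ?thesis
    by (simp add: axis_def if_distrib if_distribR cong: if_cong)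
qed

lemma W_nonneg_cont: "continuous_on S W" "continuous_on S W1"
  using W_deriv W1_deriv by (auto intro!: continuous_at_imp_continuous_on DERIV_isCont)

lemma cont_plane:
  assumes "continuous_on (UNIV \<times> {0..T}) (\<lambda>(x,t). f x t :: real)" "t \<in> {0..T}"
  shows "continuous_on ({-1..1} \<times> {-1..1}) (\<lambda>(r, s). f (x + r *\<^sub>R axis i 1 + s *\<^sub>R axis j 1 :: real^'n) t)"
  unfolding case_prod_beta
  by (intro continuous_on_compose2[OF continuous_on_slice[OF assms(1,2), of UNIV]] continuous_intros) auto

end

context allen_cahn_transport
begin

lemma H_sym:
  assumes t: "t \<in> {0..T}"
  shows "H x t $ i $ j = H x t $ j $ i"
proof -
  let ?p = "\<lambda>r s. x + r *\<^sub>R axis i 1 + s *\<^sub>R axis j 1"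
  have p: "?p r s = x + s *\<^sub>R axis j 1 + r *\<^sub>R axis i 1" for r s by simp
  have Hc: "continuous_on (UNIV \<times> {0..T}) (\<lambda>(x,t). H x t $ i $ j)"
    using H_cont unfolding case_prod_beta by (intro continuous_on_vec_nth)
  have gc: "continuous_on S (\<lambda>x. g x t)" for S by (rule continuous_on_slice[OF g_cont t])
  have "((\<lambda>r. g (?p r 0) t $ j) has_real_derivative H (?p 0 0) t $ i $ j) (at 0 within {-1..1})"
  proof (rule mixed_partial_derivative[where F="\<lambda>r s. \<phi> (?p r s) t" and a="\<lambda>r s. g (?p r s) t $ i"
        and b="\<lambda>r s. g (?p r s) t $ j" and c="\<lambda>r s. H (?p r s) t $ i $ j"
        and ?r0.0=0 and ?s0.0=0 and ?r1.0="-1" and ?r2.0=1 and ?s1.0="-1" and ?s2.0=1])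
    show "((\<lambda>r. \<phi> (?p r s) t) has_real_derivative g (?p r s) t $ i) (at r within {- 1..1})" for r s
      unfolding p by (rule has_field_derivative_at_within[OF \<phi>_line[OF t]])
    show "((\<lambda>s. g (?p r s) t $ i) has_real_derivative H (?p r s) t $ i $ j) (at s within {- 1..1})" for r s
      by (rule has_field_derivative_at_within[OF g_line[OF t]])
    show "((\<lambda>s. \<phi> (?p r s) t) has_real_derivative g (?p r s) t $ j) (at s within {- 1..1})" for r s
      by (rule has_field_derivative_at_within[OF \<phi>_line[OF t]])
    show "continuous_on {- 1..1} (\<lambda>r. g (?p r s) t $ i)" for s
      by (intro continuous_intros continuous_on_compose2[OF gc[of UNIV]]) auto
    show "continuous_on ({- 1..1} \<times> {- 1..1}) (\<lambda>(r, s). H (?p r s) t $ i $ j)"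
      by (rule cont_plane[OF Hc t])
  qed auto
  then have 1: "((\<lambda>r. g (x + r *\<^sub>R axis i 1) t $ j) has_real_derivative H x t $ i $ j) (at 0)"
    by (simp add: at_within_Icc_at)
  show ?thesis using DERIV_unique[OF 1 g_line[OF t, of x i j 0, simplified]] by simp
qed

lemma T3_sym1:
  assumes t: "t \<in> {0..T}"
  shows "T3 x t $ i $ j $ k = T3 x t $ j $ i $ k"
proof -
  have eq: "(\<lambda>s. H (x + s *\<^sub>R axis k 1) t $ i $ j) = (\<lambda>s. H (x + s *\<^sub>R axis k 1) t $ j $ i)"
    by (rule ext) (rule H_sym[OF t])
  have "((\<lambda>s. H (x + s *\<^sub>R axis k 1) t $ j $ i) has_real_derivative T3 (x + 0 *\<^sub>R axis k 1) t $ i $ j $ k) (at 0)"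
    unfolding eq[symmetric] by (rule H_line[OF t])
  moreover have "((\<lambda>s. H (x + s *\<^sub>R axis k 1) t $ j $ i) has_real_derivative T3 (x + 0 *\<^sub>R axis k 1) t $ j $ i $ k) (at 0)"
    by (rule H_line[OF t])
  ultimately show ?thesis using DERIV_unique by fastforce
qed

lemma T3_sym2:
  assumes t: "t \<in> {0..T}"
  shows "T3 x t $ l $ i $ j = T3 x t $ l $ j $ i"
proof -
  let ?p = "\<lambda>r s. x + r *\<^sub>R axis i 1 + s *\<^sub>R axis j 1"
  have p: "?p r s = x + s *\<^sub>R axis j 1 + r *\<^sub>R axis i 1" for r s by simp
  have Tc: "continuous_on (UNIV \<times> {0..T}) (\<lambda>(x,t). T3 x t $ l $ i $ j)"
    using T3_cont unfolding case_prod_beta by (intro continuous_on_vec_nth)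
  have Hc: "continuous_on S (\<lambda>x. H x t)" for S by (rule continuous_on_slice[OF H_cont t])
  have "((\<lambda>r. H (?p r 0) t $ l $ j) has_real_derivative T3 (?p 0 0) t $ l $ i $ j) (at 0 within {-1..1})"
  proof (rule mixed_partial_derivative[where F="\<lambda>r s. g (?p r s) t $ l" and a="\<lambda>r s. H (?p r s) t $ l $ i"
        and b="\<lambda>r s. H (?p r s) t $ l $ j" and c="\<lambda>r s. T3 (?p r s) t $ l $ i $ j"
        and ?r0.0=0 and ?s0.0=0 and ?r1.0="-1" and ?r2.0=1 and ?s1.0="-1" and ?s2.0=1])
    show "((\<lambda>r. g (?p r s) t $ l) has_real_derivative H (?p r s) t $ l $ i) (at r within {- 1..1})" for r s
      unfolding p by (rule has_field_derivative_at_within[OF g_line[OF t]])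
    show "((\<lambda>s. H (?p r s) t $ l $ i) has_real_derivative T3 (?p r s) t $ l $ i $ j) (at s within {- 1..1})" for r s
      by (rule has_field_derivative_at_within[OF H_line[OF t]])
    show "((\<lambda>s. g (?p r s) t $ l) has_real_derivative H (?p r s) t $ l $ j) (at s within {- 1..1})" for r s
      by (rule has_field_derivative_at_within[OF g_line[OF t]])
    show "continuous_on {- 1..1} (\<lambda>r. H (?p r s) t $ l $ i)" for s
      by (intro continuous_intros continuous_on_compose2[OF Hc[of UNIV]]) auto
    show "continuous_on ({- 1..1} \<times> {- 1..1}) (\<lambda>(r, s). T3 (?p r s) t $ l $ i $ j)"
      by (rule cont_plane[OF Tc t])
  qed auto
  then have 1: "((\<lambda>r. H (x + r *\<^sub>R axis i 1) t $ l $ j) has_real_derivative T3 x t $ l $ i $ j) (at 0)"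
    by (simp add: at_within_Icc_at)
  show ?thesis using DERIV_unique[OF 1 H_line[OF t, of x i l j 0, simplified]] by simp
qed

lemma g_time_nth:
  assumes "t \<in> {0..T}"
  shows "((\<lambda>s. g x s $ i) has_real_derivative gt x t $ i) (at t within {0..T})"
  by (rule has_real_derivative_vec_nth[OF g_time[OF assms]])

text \<open>Exchanging the order of differentiation turns \<open>gt\<close>, the time derivative of
  the gradient, into the gradient of \<open>\<phi>t\<close>. Both the divergence identity and the
  differentiated equation rest on this.\<close>

lemma \<phi>t_line:
  assumes t: "t \<in> {0..T}"
  shows "((\<lambda>s. \<phi>t (x + s *\<^sub>R axis j 1) t) has_real_derivative gt x t $ j) (at 0)"
proof -
  have "((\<lambda>r. \<phi>t (x + r *\<^sub>R axis j 1) t) has_real_derivative gt (x + 0 *\<^sub>R axis j 1) t $ j) (at 0 within {-1..1})"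
  proof (rule mixed_partial_derivative[where F="\<lambda>r s. \<phi> (x + r *\<^sub>R axis j 1) s"
        and a="\<lambda>r s. g (x + r *\<^sub>R axis j 1) s $ j" and c = "\<lambda>r s. gt (x + r *\<^sub>R axis j 1) s $ j"
        and b="\<lambda>r s. \<phi>t (x + r *\<^sub>R axis j 1) s"
        and ?r0.0=0 and ?s0.0=t and ?r1.0="-1" and ?r2.0=1 and ?s1.0=0 and ?s2.0=T])
    show "continuous_on {- 1..1} (\<lambda>r. g (x + r *\<^sub>R axis j 1) s $ j)" if "s \<in> {0..T}" for s
      by (intro continuous_intros continuous_on_compose2[OF continuous_on_slice[OF g_cont that, of UNIV]]) auto
    show "continuous_on ({- 1..1} \<times> {0..T}) (\<lambda>(r, s). gt (x + r *\<^sub>R axis j 1) s $ j)"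
    proof -
      have "continuous_on ({- 1..1} \<times> {0..T}) (\<lambda>z. (\<lambda>(x,t). gt x t) (x + fst z *\<^sub>R axis j 1, snd z))"
        by (rule continuous_on_compose2[OF gt_cont]) (auto intro!: continuous_intros)
      then show ?thesis unfolding case_prod_beta by (intro continuous_intros) simp
    qed
    show "((\<lambda>r. \<phi> (x + r *\<^sub>R axis j 1) s) has_real_derivative g (x + r *\<^sub>R axis j 1) s $ j) (at r within {- 1..1})"
      if "s \<in> {0..T}" for r s
      by (rule has_field_derivative_at_within[OF \<phi>_line[OF that]])
  qed (use t T_pos in \<open>auto intro!: g_time_nth \<phi>_time\<close>)
  then show ?thesis by (simp add: at_within_Icc_at)
qed

end

section \<open>The weighted energy identity in divergence form\<close>

context allen_cahn_transport
begin

lemma norm_sq_line: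
  fixes x y :: "real^'n"
  shows "((\<lambda>s. (norm (x + s *\<^sub>R axis j 1 - y))\<^sup>2) has_real_derivative 2 * (x - y) $ j) (at 0)"
proof -
  have "(norm (x + s *\<^sub>R axis j 1 - y))\<^sup>2 = (norm (x - y))\<^sup>2 + 2 * s * (x - y) $ j + s\<^sup>2" for s
  proof -
    have "x + s *\<^sub>R axis j 1 - y = (x - y) + s *\<^sub>R axis j 1" by simp
    then show ?thesis
      by (simp only: power2_norm_eq_inner)
        (simp add: inner_add_left inner_add_right inner_axis inner_axis' inner_axis_axis power2_eq_square algebra_simps)
  qed
  then show ?thesis by (auto intro!: derivative_eq_intros)
qed

lemma E_line:
  assumes t: "t \<in> {0..T}"
  shows "((\<lambda>s. E (x + s *\<^sub>R axis j 1) t) has_real_derivative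
     \<epsilon> * (\<Sum>i\<in>UNIV. g x t $ i * H x t $ i $ j) + W1 (\<phi> x t) * g x t $ j / \<epsilon>) (at 0)"
proof -
  have 1: "((\<lambda>s. (g (x + s *\<^sub>R axis j 1) t $ i)\<^sup>2) has_real_derivative 2 * (g x t $ i * H x t $ i $ j)) (at 0)" for i
    using DERIV_power[OF g_line[OF t, of x j i 0], of 2] by (simp add: mult_ac)
  have 2: "((\<lambda>s. W (\<phi> (x + s *\<^sub>R axis j 1) t)) has_real_derivative W1 (\<phi> x t) * g x t $ j) (at 0)"
    using DERIV_chain2[OF W_deriv \<phi>_line[OF t, of x j 0]] by simp
  have "((\<lambda>s. \<epsilon> * (\<Sum>i\<in>UNIV. (g (x + s *\<^sub>R axis j 1) t $ i)\<^sup>2) / 2 + W (\<phi> (x + s *\<^sub>R axis j 1) t) / \<epsilon>)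
    has_real_derivative \<epsilon> * (\<Sum>i\<in>UNIV. 2 * (g x t $ i * H x t $ i $ j)) / 2 + W1 (\<phi> x t) * g x t $ j / \<epsilon>) (at 0)"
    by (intro DERIV_add DERIV_cdivide DERIV_cmult DERIV_sum 1 2)
  then show ?thesis by (simp add: E_alt sum_distrib_left[symmetric])
qed

lemma E_time:
  assumes t: "t \<in> {0..T}"
  shows "((\<lambda>s. E x s) has_real_derivative \<epsilon> * (g x t \<bullet> gt x t) + W1 (\<phi> x t) * \<phi>t x t / \<epsilon>) (at t within {0..T})"
proof -
  have 1: "((\<lambda>s. (g x s $ i)\<^sup>2) has_real_derivative 2 * (g x t $ i * gt x t $ i)) (at t within {0..T})" for i
    using DERIV_power[OF g_time_nth[OF t, of x i], of 2] by (simp add: mult_ac)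
  have 2: "((\<lambda>s. W (\<phi> x s)) has_real_derivative W1 (\<phi> x t) * \<phi>t x t) (at t within {0..T})"
    by (rule DERIV_chain2[OF W_deriv \<phi>_time[OF t]])
  have "((\<lambda>s. \<epsilon> * (\<Sum>i\<in>UNIV. (g x s $ i)\<^sup>2) / 2 + W (\<phi> x s) / \<epsilon>)
    has_real_derivative \<epsilon> * (\<Sum>i\<in>UNIV. 2 * (g x t $ i * gt x t $ i)) / 2 + W1 (\<phi> x t) * \<phi>t x t / \<epsilon>) (at t within {0..T})"
    by (intro DERIV_add DERIV_cdivide DERIV_cmult DERIV_sum 1 2)
  then show ?thesis by (simp add: E_alt sum_distrib_left[symmetric] inner_vec_def)
qed

text \<open>With k the kernel, this is the j-th component of \<epsilon> k \<open>\<phi>t\<close>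
  grad \<phi> plus the stress tensor, \<epsilon> times grad \<phi> tensor grad \<phi> minus E times
  the identity, applied to grad k. Subtracting its divergence from the time derivative of k E
  cancels \<open>gt\<close> and every second derivative except the Laplacian.\<close>

definition flux :: "real \<Rightarrow> real^'n \<Rightarrow> real \<Rightarrow> real \<Rightarrow> real \<Rightarrow> 'n \<Rightarrow> real^'n \<Rightarrow> real" where
  "flux t y a m \<iota> j x =
    \<epsilon> * g x t $ j * (kern0 a m \<iota> ((norm (x - y))\<^sup>2) * \<phi>t x t + 2 * kern1 a m \<iota> ((norm (x - y))\<^sup>2) * ((x - y) \<bullet> g x t))
    - 2 * E x t * kern1 a m \<iota> ((norm (x - y))\<^sup>2) * (x - y) $ j"

definition dflux :: "real \<Rightarrow> real^'n \<Rightarrow> real \<Rightarrow> real \<Rightarrow> real \<Rightarrow> 'n \<Rightarrow> real^'n \<Rightarrow> real" where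
  "dflux t y a m \<iota> j x = (let q = (norm (x - y))\<^sup>2; z = x - y; p0 = kern0 a m \<iota> q; p1 = kern1 a m \<iota> q; p2 = kern2 a m \<iota> q in
    \<epsilon> * H x t $ j $ j * (p0 * \<phi>t x t + 2 * p1 * (z \<bullet> g x t))
    + \<epsilon> * g x t $ j * (2 * p1 * z $ j * \<phi>t x t + p0 * gt x t $ j + 4 * p2 * z $ j * (z \<bullet> g x t)
         + 2 * p1 * (g x t $ j + (\<Sum>i\<in>UNIV. z $ i * H x t $ i $ j)))
    - 2 * (\<epsilon> * (\<Sum>i\<in>UNIV. g x t $ i * H x t $ i $ j) + W1 (\<phi> x t) * g x t $ j / \<epsilon>) * p1 * z $ j
    - 2 * E x t * (2 * p2 * (z $ j)\<^sup>2 + p1))"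

lemma flux_line:
  assumes t: "t \<in> {0..T}"
  shows "((\<lambda>s. flux t y a m \<iota> j (x + s *\<^sub>R axis j 1)) has_real_derivative dflux t y a m \<iota> j x) (at 0)"
proof -
  let ?e = "\<lambda>s. x + s *\<^sub>R axis j 1"
  let ?q = "(norm (x - y))\<^sup>2" and ?z = "x - y"
  have k0: "((\<lambda>s. kern0 a m \<iota> ((norm (?e s - y))\<^sup>2)) has_real_derivative kern1 a m \<iota> ?q * (2 * ?z $ j)) (at 0)"
    using DERIV_chain2[OF DERIV_kern0 norm_sq_line[of x j y]] by simp
  have k1: "((\<lambda>s. kern1 a m \<iota> ((norm (?e s - y))\<^sup>2)) has_real_derivative kern2 a m \<iota> ?q * (2 * ?z $ j)) (at 0)"
    using DERIV_chain2[OF DERIV_kern1 norm_sq_line[of x j y]] by simp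
  have zi: "((\<lambda>s. (?e s - y) $ i) has_real_derivative (if i = j then 1 else 0)) (at 0)" for i
    by (auto intro!: derivative_eq_intros simp: axis_def)
  have gi: "((\<lambda>s. g (?e s) t $ i) has_real_derivative H x t $ i $ j) (at 0)" for i
    using g_line[OF t, of x j i 0] by simp
  have zg: "((\<lambda>s. (?e s - y) \<bullet> g (?e s) t) has_real_derivative g x t $ j + (\<Sum>i\<in>UNIV. ?z $ i * H x t $ i $ j)) (at 0)"
  proof -
    have "((\<lambda>s. \<Sum>i\<in>UNIV. (?e s - y) $ i * g (?e s) t $ i) has_real_derivative
      (\<Sum>i\<in>UNIV. (if i = j then 1 else 0) * g (?e 0) t $ i + H x t $ i $ j * (?e 0 - y) $ i)) (at 0)"
      by (intro DERIV_sum DERIV_mult zi gi)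
    moreover have "(\<Sum>i\<in>UNIV. (if i = j then 1 else 0) * g (?e 0) t $ i + H x t $ i $ j * (?e 0 - y) $ i)
        = g x t $ j + (\<Sum>i\<in>UNIV. ?z $ i * H x t $ i $ j)"
      unfolding sum.distrib by (simp add: if_distrib if_distribR mult.commute cong: if_cong)
    ultimately show ?thesis by (simp only: inner_vec_def inner_real_def)
  qed
  have pt: "((\<lambda>s. \<phi>t (?e s) t) has_real_derivative gt x t $ j) (at 0)" by (rule \<phi>t_line[OF t])
  have Ee: "((\<lambda>s. E (?e s) t) has_real_derivative
     \<epsilon> * (\<Sum>i\<in>UNIV. g x t $ i * H x t $ i $ j) + W1 (\<phi> x t) * g x t $ j / \<epsilon>) (at 0)" by (rule E_line[OF t])
  have A: "((\<lambda>s. kern0 a m \<iota> ((norm (?e s - y))\<^sup>2) * \<phi>t (?e s) t + 2 * (kern1 a m \<iota> ((norm (?e s - y))\<^sup>2) * ((?e s - y) \<bullet> g (?e s) t)))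
     has_real_derivative (kern1 a m \<iota> ?q * (2 * ?z $ j)) * \<phi>t (?e 0) t + gt x t $ j * kern0 a m \<iota> ((norm (?e 0 - y))\<^sup>2)
      + 2 * (kern2 a m \<iota> ?q * (2 * ?z $ j) * ((?e 0 - y) \<bullet> g (?e 0) t)
            + (g x t $ j + (\<Sum>i\<in>UNIV. ?z $ i * H x t $ i $ j)) * kern1 a m \<iota> ((norm (?e 0 - y))\<^sup>2))) (at 0)"
    by (intro DERIV_add DERIV_mult DERIV_cmult k0 k1 zg pt)
  have B: "((\<lambda>s. (\<epsilon> * g (?e s) t $ j) * (kern0 a m \<iota> ((norm (?e s - y))\<^sup>2) * \<phi>t (?e s) t + 2 * (kern1 a m \<iota> ((norm (?e s - y))\<^sup>2) * ((?e s - y) \<bullet> g (?e s) t)))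
      - 2 * ((E (?e s) t * kern1 a m \<iota> ((norm (?e s - y))\<^sup>2)) * (?e s - y) $ j)) has_real_derivative
      ((\<epsilon> * H x t $ j $ j) * (kern0 a m \<iota> ((norm (?e 0 - y))\<^sup>2) * \<phi>t (?e 0) t + 2 * (kern1 a m \<iota> ((norm (?e 0 - y))\<^sup>2) * ((?e 0 - y) \<bullet> g (?e 0) t)))
       + ((kern1 a m \<iota> ?q * (2 * ?z $ j)) * \<phi>t (?e 0) t + gt x t $ j * kern0 a m \<iota> ((norm (?e 0 - y))\<^sup>2)
      + 2 * (kern2 a m \<iota> ?q * (2 * ?z $ j) * ((?e 0 - y) \<bullet> g (?e 0) t)
            + (g x t $ j + (\<Sum>i\<in>UNIV. ?z $ i * H x t $ i $ j)) * kern1 a m \<iota> ((norm (?e 0 - y))\<^sup>2))) * (\<epsilon> * g (?e 0) t $ j))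
      - 2 * (((\<epsilon> * (\<Sum>i\<in>UNIV. g x t $ i * H x t $ i $ j) + W1 (\<phi> x t) * g x t $ j / \<epsilon>) * kern1 a m \<iota> ((norm (?e 0 - y))\<^sup>2)
           + (kern2 a m \<iota> ?q * (2 * ?z $ j)) * E (?e 0) t) * (?e 0 - y) $ j
          + (if j = j then 1 else 0) * (E (?e 0) t * kern1 a m \<iota> ((norm (?e 0 - y))\<^sup>2)))) (at 0)"
    by (intro DERIV_diff DERIV_cmult DERIV_mult[OF _ A] DERIV_mult[OF _ zi] DERIV_mult[OF Ee k1] gi)
  show ?thesis
    unfolding flux_def dflux_def Let_def
    using B by (auto elim!: DERIV_cong simp: algebra_simps power2_eq_square)
qed

lemma sum_dflux:
  assumes t: "t \<in> {0..T}"
  defines "f x \<equiv> (\<Sum>i\<in>UNIV. H x t $ i $ i)"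
  shows "(\<Sum>j\<in>UNIV. dflux t y a m \<iota> j x) = (let q = (norm (x - y))\<^sup>2; z = (x - y) \<bullet> g x t;
      p0 = kern0 a m \<iota> q; p1 = kern1 a m \<iota> q; p2 = kern2 a m \<iota> q in
     \<epsilon> * f x * (p0 * \<phi>t x t + 2 * p1 * z) + 2 * \<epsilon> * p1 * z * \<phi>t x t + \<epsilon> * p0 * (g x t \<bullet> gt x t)
     + 4 * \<epsilon> * p2 * z\<^sup>2 + 2 * \<epsilon> * p1 * (norm (g x t))\<^sup>2 - 2 * p1 * W1 (\<phi> x t) * z / \<epsilon>
     - 4 * E x t * p2 * q - 2 * real CARD('n) * E x t * p1)"
proof -
  define z where "z = x - y"
  define q where "q = (norm z)\<^sup>2"
  define p0 where "p0 = kern0 a m \<iota> q"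
  define p1 where "p1 = kern1 a m \<iota> q"
  define p2 where "p2 = kern2 a m \<iota> q"
  define zg where "zg = z \<bullet> g x t"
  define c where "c = 2 * W1 (\<phi> x t) / \<epsilon> * p1"
  have zg': "zg = (\<Sum>j\<in>UNIV. g x t $ j * z $ j)" by (simp add: zg_def inner_vec_def mult.commute)
  \<comment> \<open>The symmetry of the Hessian enters here: the second derivatives coming from grad
    E cancel those coming from (x - y) . grad \<phi>.\<close>
  have sw: "(\<Sum>j\<in>UNIV. g x t $ j * (\<Sum>i\<in>UNIV. z $ i * H x t $ i $ j))
      = (\<Sum>j\<in>UNIV. z $ j * (\<Sum>i\<in>UNIV. g x t $ i * H x t $ i $ j))"
  proof -
    have "(\<Sum>j\<in>UNIV. g x t $ j * (\<Sum>i\<in>UNIV. z $ i * H x t $ i $ j)) = (\<Sum>j\<in>UNIV. \<Sum>i\<in>UNIV. g x t $ j * z $ i * H x t $ i $ j)"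
      by (simp add: sum_distrib_left mult_ac)
    also have "\<dots> = (\<Sum>i\<in>UNIV. \<Sum>j\<in>UNIV. g x t $ j * z $ i * H x t $ i $ j)" by (rule sum.swap)
    also have "\<dots> = (\<Sum>i\<in>UNIV. \<Sum>j\<in>UNIV. g x t $ j * z $ i * H x t $ j $ i)" by (simp only: H_sym[OF t, of x])
    also have "\<dots> = (\<Sum>j\<in>UNIV. z $ j * (\<Sum>i\<in>UNIV. g x t $ i * H x t $ i $ j))"
      by (simp add: sum_distrib_left mult_ac)
    finally show ?thesis .
  qed
  have "(\<Sum>j\<in>UNIV. dflux t y a m \<iota> j x) = (\<Sum>j\<in>UNIV. H x t $ j $ j * (\<epsilon> * (p0 * \<phi>t x t + 2 * p1 * zg))
      + (g x t $ j * z $ j) * (2 * \<epsilon> * p1 * \<phi>t x t) + (g x t $ j * gt x t $ j) * (\<epsilon> * p0)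
      + (g x t $ j * z $ j) * (4 * \<epsilon> * p2 * zg) + (g x t $ j * g x t $ j) * (2 * \<epsilon> * p1)
      + g x t $ j * (\<Sum>i\<in>UNIV. z $ i * H x t $ i $ j) * (2 * \<epsilon> * p1)
      - z $ j * (\<Sum>i\<in>UNIV. g x t $ i * H x t $ i $ j) * (2 * \<epsilon> * p1)
      - (g x t $ j * z $ j) * c - (z $ j * z $ j) * (4 * E x t * p2) - 2 * E x t * p1)"
    unfolding dflux_def Let_def z_def[symmetric] q_def[symmetric] p0_def[symmetric] p1_def[symmetric] p2_def[symmetric] zg_def[symmetric]
    by (rule sum.cong) (simp_all add: c_def algebra_simps power2_eq_square add_divide_distrib)
  also have "\<dots> = f x * (\<epsilon> * (p0 * \<phi>t x t + 2 * p1 * zg))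
      + zg * (2 * \<epsilon> * p1 * \<phi>t x t) + (g x t \<bullet> gt x t) * (\<epsilon> * p0)
      + zg * (4 * \<epsilon> * p2 * zg) + (norm (g x t))\<^sup>2 * (2 * \<epsilon> * p1)
      - zg * c - q * (4 * E x t * p2) - real CARD('n) * (2 * E x t * p1)"
    by (simp add: sum.distrib sum_subtractf sum_distrib_right[symmetric] sw zg'[symmetric] f_def
        power2_norm_eq_inner inner_vec_def q_def z_def[symmetric])
  finally show ?thesis
    unfolding Let_def z_def[symmetric] q_def[symmetric] p0_def[symmetric] p1_def[symmetric] p2_def[symmetric] zg_def[symmetric]
    by (simp add: c_def algebra_simps power2_eq_square)
qed

lemma v_bound: "(u x t \<bullet> g x t)\<^sup>2 \<le> (norm (u x t))\<^sup>2 * (norm (g x t))\<^sup>2"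
  using Cauchy_Schwarz_ineq[of "u x t" "g x t"] by (simp add: power2_norm_eq_inner)

lemma eps_grad_le: "\<epsilon> * (norm (g x t))\<^sup>2 \<le> 2 * E x t"
  using W_nonneg[of "\<phi> x t"] eps_pos by (simp add: E_def)

text \<open>The left side is the time derivative of kernel times E, when a' = 2 (n - 1) m a and m' =
  4 m^2, minus the divergence of \<open>flux\<close>. Inside the cutoff it is
  \<open>localized_dissipation_algebra\<close>, with the equation used to eliminate the Laplacian;
  outside, both sides vanish.\<close>

lemma dissipation_pointwise:
  fixes y :: "real^'n"
  assumes t: "t \<in> {0..T}" and a: "a \<ge> 0" and m: "m \<ge> 0" and i: "\<iota> \<ge> 0"
  defines "q x \<equiv> (norm (x - y))\<^sup>2"
  shows "(2 * (real CARD('n) - 1) * m - 4 * m\<^sup>2 * q x) * kern0 a m \<iota> (q x) * E x t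
      + kern0 a m \<iota> (q x) * (\<epsilon> * (g x t \<bullet> gt x t) + W1 (\<phi> x t) * \<phi>t x t / \<epsilon>)
      - (\<Sum>j\<in>UNIV. dflux t y a m \<iota> j x)
    \<le> a * exp (- m * q x) * (2 * m * cut \<iota> (q x) ^ 3 * (\<epsilon> * (norm (g x t))\<^sup>2 - E x t)
       + cut \<iota> (q x) * E x t * (60 + 24 * m * q x) * \<iota> + cut \<iota> (q x) ^ 3 * (norm (u x t))\<^sup>2 * E x t / 2)"
proof (cases "q x * \<iota> \<le> 1")
  case True
  define k where "k = a * exp (- m * q x)"
  define w where "w = cut \<iota> (q x)"
  define z where "z = (x - y) \<bullet> g x t"
  define f where "f = (\<Sum>i\<in>UNIV. H x t $ i $ i) - W1 (\<phi> x t) / \<epsilon>\<^sup>2"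
  define v where "v = u x t \<bullet> g x t"
  define p0 where "p0 = w ^ 3"
  define p1 where "p1 = - 3 * \<iota> * w\<^sup>2 - m * w ^ 3"
  define p2 where "p2 = 6 * \<iota>\<^sup>2 * w + 6 * m * \<iota> * w\<^sup>2 + m\<^sup>2 * w ^ 3"
  have kern: "kern0 a m \<iota> (q x) = k * p0" "kern1 a m \<iota> (q x) = k * p1" "kern2 a m \<iota> (q x) = k * p2"
    by (simp_all add: kern0_def kern1_def kern2_def k_def p0_def p1_def p2_def w_def)
  have pt: "\<phi>t x t = f - v" using pde[OF t, of x] by (simp add: f_def v_def)
  have lap: "(\<Sum>i\<in>UNIV. H x t $ i $ i) = f + W1 (\<phi> x t) / \<epsilon>\<^sup>2" by (simp add: f_def)
  have alg: "k * ((2 * (real CARD('n) - 1) * m - 4 * m\<^sup>2 * q x) * p0 * E x t - \<epsilon> * p0 * (f - v) * f - 2 * \<epsilon> * p1 * z * f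
      - 2 * \<epsilon> * p1 * z * (f - v) - 4 * \<epsilon> * p2 * z\<^sup>2 - 2 * \<epsilon> * p1 * (norm (g x t))\<^sup>2 + 4 * E x t * p2 * q x
      + 2 * real CARD('n) * E x t * p1)
    \<le> k * (2 * m * w ^ 3 * (\<epsilon> * (norm (g x t))\<^sup>2 - E x t) + w * E x t * (60 + 24 * m * q x) * \<iota> + w ^ 3 * (norm (u x t))\<^sup>2 * E x t / 2)"
    unfolding p0_def p1_def p2_def
  proof (rule localized_dissipation_algebra)
    show "z\<^sup>2 \<le> q x * (norm (g x t))\<^sup>2"
      using Cauchy_Schwarz_ineq[of "x - y" "g x t"] by (simp add: power2_norm_eq_inner q_def z_def)
  qed (use a m i True eps_pos cut_bounds v_bound eps_grad_le in \<open>auto simp: k_def q_def w_def v_def\<close>)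
  have id: "(2 * (real CARD('n) - 1) * m - 4 * m\<^sup>2 * q x) * (k * p0) * E x t
      + (k * p0) * (\<epsilon> * (g x t \<bullet> gt x t) + W1 (\<phi> x t) * (f - v) / \<epsilon>)
      - (\<epsilon> * (f + W1 (\<phi> x t) / \<epsilon>\<^sup>2) * (k * p0 * (f - v) + 2 * (k * p1) * z) + 2 * \<epsilon> * (k * p1) * z * (f - v) + \<epsilon> * (k * p0) * (g x t \<bullet> gt x t)
     + 4 * \<epsilon> * (k * p2) * z\<^sup>2 + 2 * \<epsilon> * (k * p1) * (norm (g x t))\<^sup>2 - 2 * (k * p1) * W1 (\<phi> x t) * z / \<epsilon>
     - 4 * E x t * (k * p2) * q x - 2 * real CARD('n) * E x t * (k * p1))
    = k * ((2 * (real CARD('n) - 1) * m - 4 * m\<^sup>2 * q x) * p0 * E x t - \<epsilon> * p0 * (f - v) * f - 2 * \<epsilon> * p1 * z * f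
      - 2 * \<epsilon> * p1 * z * (f - v) - 4 * \<epsilon> * p2 * z\<^sup>2 - 2 * \<epsilon> * p1 * (norm (g x t))\<^sup>2 + 4 * E x t * p2 * q x
      + 2 * real CARD('n) * E x t * p1)"
    using eps_pos by (simp add: field_simps power2_eq_square)
  show ?thesis
    unfolding sum_dflux[OF t] Let_def q_def[symmetric] z_def[symmetric] kern lap pt id
    using alg by (simp only: k_def w_def)
next
  case False
  then have "kern0 a m \<iota> (q x) = 0" "kern1 a m \<iota> (q x) = 0" "kern2 a m \<iota> (q x) = 0" "cut \<iota> (q x) = 0"
    by (auto simp: kern_vanish kern2_def cut_bounds)
  then show ?thesis
    unfolding sum_dflux[OF t] Let_def q_def[symmetric] by simp
qed

lemma E_cont: "continuous_on (UNIV \<times> {0..T}) (\<lambda>(x,t). E x t)"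
  using g_cont \<phi>_cont unfolding E_def case_prod_beta
  by (intro continuous_intros continuous_on_compose2[OF W_nonneg_cont(1)[of UNIV]]) (auto simp: eps_pos less_imp_neq[symmetric])

lemma cont_slices:
  assumes "t \<in> {0..T}"
  shows "continuous_on S (\<lambda>x. \<phi> x t)" "continuous_on S (\<lambda>x. g x t)" "continuous_on S (\<lambda>x. H x t)"
    "continuous_on S (\<lambda>x. \<phi>t x t)" "continuous_on S (\<lambda>x. gt x t)" "continuous_on S (\<lambda>x. u x t)" "continuous_on S (\<lambda>x. E x t)"
  using continuous_on_slice[OF \<phi>_cont assms] continuous_on_slice[OF g_cont assms] continuous_on_slice[OF H_cont assms]
    continuous_on_slice[OF \<phi>t_cont assms] continuous_on_slice[OF gt_cont assms] continuous_on_slice[OF u_cont assms]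
    continuous_on_slice[OF E_cont assms] by auto

lemma integral_dflux_eq_0:
  assumes t: "t \<in> {0..T}" and K: "K > 0" and out: "\<And>x. norm x \<ge> K \<Longrightarrow> (norm (x - y))\<^sup>2 * \<iota> \<ge> 1"
    and box: "ball 0 (K + 1) \<subseteq> cbox l r"
  shows "dflux t y a m \<iota> j integrable_on cbox l r" "integral (cbox l r) (dflux t y a m \<iota> j) = 0"
proof -
  have W1c: "continuous_on UNIV (\<lambda>x. W1 (\<phi> x t))"
    by (intro continuous_on_compose2[OF W_nonneg_cont(2)[of UNIV]] cont_slices t) auto
  have c: "continuous_on UNIV (dflux t y a m \<iota> j)"
    unfolding dflux_def Let_def
    by (intro continuous_intros cont_slices t W1c) (use eps_pos in auto)
  have c0: "continuous_on UNIV (flux t y a m \<iota> j)"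
    unfolding flux_def by (intro continuous_intros cont_slices t)
  show "dflux t y a m \<iota> j integrable_on cbox l r"
    by (intro integrable_continuous continuous_on_subset[OF c]) auto
  have flux0: "flux t y a m \<iota> j x = 0" if "norm x \<ge> K" for x
    using kern_vanish[OF out[OF that]] by (simp add: flux_def)
  show "integral (cbox l r) (dflux t y a m \<iota> j) = 0"
    by (rule integral_directional_derivative_eq_0[where b="axis j 1" and F="flux t y a m \<iota> j" and K=K])
      (use K box in \<open>simp_all add: flux_line[OF t] c c0 flux0\<close>)
qed

text \<open>The pointwise inequality is integrated; the flux has compact support and drops out. The
  equations for a and m are solved by m = 1/(4 (s - t)), a = (s - t)^(-(n-1)/2), a backward heat
  kernel normalized for dimension n - 1, and also by a = 1, m = 0, which gives a plain mass balance.
  Both choices occur below.\<close>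

lemma weighted_energy_inequality:
  fixes a m :: "real \<Rightarrow> real"
  assumes sub: "0 \<le> t0" "t1 \<le> T"
    and a: "\<And>t. t \<in> {t0..t1} \<Longrightarrow> (a has_real_derivative 2 * (real CARD('n) - 1) * m t * a t) (at t within {t0..t1})"
    and m: "\<And>t. t \<in> {t0..t1} \<Longrightarrow> (m has_real_derivative 4 * (m t)\<^sup>2) (at t within {t0..t1})"
    and a0: "\<And>t. t \<in> {t0..t1} \<Longrightarrow> a t \<ge> 0" and m0: "\<And>t. t \<in> {t0..t1} \<Longrightarrow> m t \<ge> 0" and i: "\<iota> \<ge> 0"
    and K: "K > 0" and out: "\<And>x. norm x \<ge> K \<Longrightarrow> (norm (x - y))\<^sup>2 * \<iota> \<ge> 1"
    and box: "ball 0 (K + 1) \<subseteq> cbox l r"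
  obtains Y' where
    "\<And>t. t \<in> {t0..t1} \<Longrightarrow>
      ((\<lambda>t. integral (cbox l r) (\<lambda>x. kern0 (a t) (m t) \<iota> ((norm (x - y))\<^sup>2) * E x t)) has_real_derivative Y' t) (at t within {t0..t1})"
    "\<And>t. t \<in> {t0..t1} \<Longrightarrow> Y' t \<le> integral (cbox l r) (\<lambda>x. a t * exp (- m t * (norm (x - y))\<^sup>2) *
       (2 * m t * cut \<iota> ((norm (x - y))\<^sup>2) ^ 3 * (\<epsilon> * (norm (g x t))\<^sup>2 - E x t)
       + cut \<iota> ((norm (x - y))\<^sup>2) * E x t * (60 + 24 * m t * (norm (x - y))\<^sup>2) * \<iota>
       + cut \<iota> ((norm (x - y))\<^sup>2) ^ 3 * (norm (u x t))\<^sup>2 * E x t / 2))"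
proof -
  define q where "q x = (norm (x - y))\<^sup>2" for x
  define D where "D t x = (2 * (real CARD('n) - 1) * m t - 4 * (m t)\<^sup>2 * q x) * kern0 (a t) (m t) \<iota> (q x) * E x t
      + kern0 (a t) (m t) \<iota> (q x) * (\<epsilon> * (g x t \<bullet> gt x t) + W1 (\<phi> x t) * \<phi>t x t / \<epsilon>)" for t x
  have sub': "{t0..t1} \<subseteq> {0..T}" using sub by auto
  have ac: "continuous_on {t0..t1} a" and mc: "continuous_on {t0..t1} m"
    by (rule DERIV_continuous_on, erule a, rule DERIV_continuous_on, erule m)
  have D_deriv: "((\<lambda>t. kern0 (a t) (m t) \<iota> (q x) * E x t) has_real_derivative D t x) (at t within {t0..t1})"
    if t: "t \<in> {t0..t1}" for t x
  proof -
    have 1: "((\<lambda>t. exp (- m t * q x)) has_real_derivative exp (- m t * q x) * (- (4 * (m t)\<^sup>2) * q x)) (at t within {t0..t1})"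
      by (intro DERIV_chain2[OF DERIV_exp] DERIV_cmult_right DERIV_minus m[OF t])
    have k: "((\<lambda>t. a t * exp (- m t * q x) * cut \<iota> (q x) ^ 3) has_real_derivative
        (2 * (real CARD('n) - 1) * m t * a t * exp (- m t * q x) + exp (- m t * q x) * (- (4 * (m t)\<^sup>2) * q x) * a t) * cut \<iota> (q x) ^ 3) (at t within {t0..t1})"
      by (intro DERIV_cmult_right DERIV_mult a[OF t] 1)
    have e: "((\<lambda>s. E x s) has_real_derivative \<epsilon> * (g x t \<bullet> gt x t) + W1 (\<phi> x t) * \<phi>t x t / \<epsilon>) (at t within {t0..t1})"
      using E_time[of t x] t sub' by (meson has_field_derivative_subset subsetD)
    show ?thesis
      using DERIV_mult[OF k e] unfolding kern0_def D_def
      by (elim DERIV_cong) (simp add: algebra_simps)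
  qed
  have D_cont: "continuous_on ({t0..t1} \<times> cbox l r) (\<lambda>(t, x). D t x)"
  proof -
    have f: "continuous_on ({t0..t1} \<times> cbox l r) (\<lambda>z. a (fst z))" "continuous_on ({t0..t1} \<times> cbox l r) (\<lambda>z. m (fst z))"
      by (auto intro!: continuous_on_compose2[OF ac] continuous_on_compose2[OF mc] continuous_intros)
    note cs = continuous_on_swap[OF \<phi>_cont sub'] continuous_on_swap[OF g_cont sub'] continuous_on_swap[OF gt_cont sub']
      continuous_on_swap[OF \<phi>t_cont sub'] continuous_on_swap[OF E_cont sub']
    have W1c: "continuous_on ({t0..t1} \<times> cbox l r) (\<lambda>z. W1 (\<phi> (snd z) (fst z)))"
      by (intro continuous_on_compose2[OF W_nonneg_cont(2)[of UNIV]] cs) auto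
    show ?thesis
      unfolding D_def q_def case_prod_beta
      by (intro continuous_intros f cs W1c) (use eps_pos in auto)
  qed
  show thesis
  proof (rule that[of "\<lambda>t. integral (cbox l r) (D t)"])
    fix t assume t: "t \<in> {t0..t1}"
    then have tT: "t \<in> {0..T}" using sub' by auto
    show "((\<lambda>t. integral (cbox l r) (\<lambda>x. kern0 (a t) (m t) \<iota> ((norm (x - y))\<^sup>2) * E x t)) has_real_derivative
      integral (cbox l r) (D t)) (at t within {t0..t1})"
      unfolding q_def[symmetric]
    proof (rule leibniz_rule_field_derivative[where fx=D])
      show "(\<lambda>x. kern0 (a s) (m s) \<iota> (q x) * E x s) integrable_on cbox l r" if "s \<in> {t0..t1}" for s
        unfolding q_def using that sub' by (intro integrable_continuous continuous_intros cont_slices) auto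
    qed (use t D_deriv D_cont in auto)
    have Dc: "continuous_on (cbox l r) (D t)"
    proof -
      have "continuous_on (cbox l r) (\<lambda>x. (\<lambda>(t, x). D t x) (t, x))"
        by (rule continuous_on_compose2[OF D_cont]) (use t in \<open>auto intro!: continuous_intros\<close>)
      then show ?thesis by simp
    qed
    have "integral (cbox l r) (D t) = integral (cbox l r) (\<lambda>x. D t x - (\<Sum>j\<in>UNIV. dflux t y (a t) (m t) \<iota> j x))"
    proof -
      have "(\<lambda>x. \<Sum>j\<in>UNIV. dflux t y (a t) (m t) \<iota> j x) integrable_on cbox l r"
        by (intro integrable_sum integral_dflux_eq_0[OF tT K out box]) auto
      moreover have "integral (cbox l r) (\<lambda>x. \<Sum>j\<in>UNIV. dflux t y (a t) (m t) \<iota> j x) = 0"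
        using integral_dflux_eq_0[OF tT K out box]
        by (subst integral_sum) auto
      ultimately show ?thesis
        using integral_diff[OF integrable_continuous[OF Dc]] by simp
    qed
    also have "\<dots> \<le> integral (cbox l r) (\<lambda>x. a t * exp (- m t * q x) *
       (2 * m t * cut \<iota> (q x) ^ 3 * (\<epsilon> * (norm (g x t))\<^sup>2 - E x t)
       + cut \<iota> (q x) * E x t * (60 + 24 * m t * q x) * \<iota>
       + cut \<iota> (q x) ^ 3 * (norm (u x t))\<^sup>2 * E x t / 2))"
    proof (rule integral_le)
      show "(\<lambda>x. D t x - (\<Sum>j\<in>UNIV. dflux t y (a t) (m t) \<iota> j x)) integrable_on cbox l r"
        by (intro integrable_diff integrable_continuous[OF Dc] integrable_sum integral_dflux_eq_0[OF tT K out box]) auto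
      show "(\<lambda>x. a t * exp (- m t * q x) *
       (2 * m t * cut \<iota> (q x) ^ 3 * (\<epsilon> * (norm (g x t))\<^sup>2 - E x t)
       + cut \<iota> (q x) * E x t * (60 + 24 * m t * q x) * \<iota>
       + cut \<iota> (q x) ^ 3 * (norm (u x t))\<^sup>2 * E x t / 2)) integrable_on cbox l r"
        unfolding q_def using tT by (intro integrable_continuous continuous_intros cont_slices) auto
      show "D t x - (\<Sum>j\<in>UNIV. dflux t y (a t) (m t) \<iota> j x) \<le> a t * exp (- m t * q x) *
       (2 * m t * cut \<iota> (q x) ^ 3 * (\<epsilon> * (norm (g x t))\<^sup>2 - E x t)
       + cut \<iota> (q x) * E x t * (60 + 24 * m t * q x) * \<iota>
       + cut \<iota> (q x) ^ 3 * (norm (u x t))\<^sup>2 * E x t / 2)" for x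
        unfolding D_def q_def by (rule dissipation_pointwise[OF tT a0[OF t] m0[OF t] i])
    qed
    finally show "integral (cbox l r) (D t) \<le> integral (cbox l r) (\<lambda>x. a t * exp (- m t * (norm (x - y))\<^sup>2) *
       (2 * m t * cut \<iota> ((norm (x - y))\<^sup>2) ^ 3 * (\<epsilon> * (norm (g x t))\<^sup>2 - E x t)
       + cut \<iota> ((norm (x - y))\<^sup>2) * E x t * (60 + 24 * m t * (norm (x - y))\<^sup>2) * \<iota>
       + cut \<iota> ((norm (x - y))\<^sup>2) ^ 3 * (norm (u x t))\<^sup>2 * E x t / 2))"
      unfolding q_def .
  qed
qed

end

section \<open>The discrepancy barrier\<close>

text \<open>Two half parabolas glued at their common vertex: value 1 at the maximum point \<gamma>
  of the potential, 0 at both wells. The second derivative may jump at \<gamma>. Vanishing at the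
  wells is what allows its square to be bounded by a multiple of W.\<close>

definition hump :: "real \<Rightarrow> real \<Rightarrow> real" where
  "hump \<gamma> x = 1 - (if x \<ge> \<gamma> then 1 / (1 - \<gamma>)\<^sup>2 else 1 / (1 + \<gamma>)\<^sup>2) * (x - \<gamma>)\<^sup>2"

text \<open>The maximum principle needs a twice differentiable comparison function touching
  \<open>hump\<close> from above; at \<gamma> the flatter of the two parabolas serves. The bound 1/4
  holds because 1 - \<gamma> and 1 + \<gamma> are at most 2.\<close>

lemma hump_touching_parabola:
  assumes \<gamma>: "-1 < \<gamma>" "\<gamma> < 1"
  obtains C where "C \<ge> 1 / 4" "hump \<gamma> x = 1 - C * (x - \<gamma>)\<^sup>2"
    "\<forall>\<^sub>F y in nhds x. hump \<gamma> y \<le> 1 - C * (y - \<gamma>)\<^sup>2"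
proof -
  define A where "A = 1 / (1 - \<gamma>)\<^sup>2"
  define B where "B = 1 / (1 + \<gamma>)\<^sup>2"
  have "(1 - \<gamma>)\<^sup>2 \<le> 2\<^sup>2" "(1 + \<gamma>)\<^sup>2 \<le> 2\<^sup>2" using \<gamma> by (intro power_mono; simp)+
  then have A: "A \<ge> 1 / 4" and B: "B \<ge> 1 / 4" using \<gamma> by (auto simp: A_def B_def field_simps)
  have h: "hump \<gamma> y = 1 - (if y \<ge> \<gamma> then A else B) * (y - \<gamma>)\<^sup>2" for y
    by (simp add: hump_def A_def B_def)
  consider "x > \<gamma>" | "x < \<gamma>" | "x = \<gamma>" by linarith
  then show ?thesis
  proof cases
    case 1
    have "\<forall>\<^sub>F y in nhds x. y \<in> {\<gamma><..}" using 1 by (intro eventually_nhds_in_open) auto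
    then have "\<forall>\<^sub>F y in nhds x. hump \<gamma> y \<le> 1 - A * (y - \<gamma>)\<^sup>2" by eventually_elim (simp add: h)
    then show ?thesis using 1 A by (intro that[of A]) (simp_all add: h)
  next
    case 2
    have "\<forall>\<^sub>F y in nhds x. y \<in> {..<\<gamma>}" using 2 by (intro eventually_nhds_in_open) auto
    then have "\<forall>\<^sub>F y in nhds x. hump \<gamma> y \<le> 1 - B * (y - \<gamma>)\<^sup>2" by eventually_elim (simp add: h)
    then show ?thesis using 2 B by (intro that[of B]) (simp_all add: h)
  next
    case 3
    have "hump \<gamma> y \<le> 1 - min A B * (y - \<gamma>)\<^sup>2" for y
      unfolding h by (auto intro!: mult_right_mono)
    then show ?thesis using 3 A B by (intro that[of "min A B"]) (simp_all add: h)
  qed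
qed

lemma hump_bounds:
  assumes \<gamma>: "-1 < \<gamma>" "\<gamma> < 1" and x: "\<bar>x\<bar> \<le> 1"
  shows "0 \<le> hump \<gamma> x" "hump \<gamma> x \<le> 1"
proof -
  show "hump \<gamma> x \<le> 1" by (simp add: hump_def)
  show "0 \<le> hump \<gamma> x"
  proof (cases "x \<ge> \<gamma>")
    case True
    then have "(x - \<gamma>)\<^sup>2 \<le> (1 - \<gamma>)\<^sup>2" using x by (intro power_mono) auto
    then show ?thesis using True \<gamma> by (simp add: hump_def divide_le_eq)
  next
    case False
    then have "(\<gamma> - x)\<^sup>2 \<le> (1 + \<gamma>)\<^sup>2" using x by (intro power_mono) auto
    then show ?thesis using False \<gamma> by (simp add: hump_def divide_le_eq power2_commute)
  qed
qed

lemma continuous_on_hump: 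
  assumes "-1 < \<gamma>" "\<gamma> < 1"
  shows "continuous_on S (hump \<gamma>)"
proof -
  have "hump \<gamma> = (\<lambda>x. 1 - (max 0 (x - \<gamma>) / (1 - \<gamma>))\<^sup>2 - (max 0 (\<gamma> - x) / (1 + \<gamma>))\<^sup>2)"
    by (auto simp: hump_def fun_eq_iff power_divide max_def power2_commute)
  then show ?thesis using assms by (auto intro!: continuous_intros)
qed

text \<open>P is the derivative in a of W + d (1 - C (a - \<gamma>)^2), and -P^2 + P W1 splits into
  two dissipative terms, one with (\<gamma> - a) W1 and one with d^2 (1 - h). The first pays, with
  W0, for the decay of d through \<open>bw\<close>. The condition d \<ge> 4 \<omega> pays for the
  gradient of the drift and d^2 \<ge> 2 e for the decay of the layer e.\<close>

lemma barrier_algebra: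
  fixes d e h C a \<gamma> W0 W1 \<omega> \<mu> Q :: real
  assumes C: "C \<ge> 1/4" and h: "h = 1 - C * (a - \<gamma>)\<^sup>2" "0 \<le> h" and Q: "Q = W0 + d * h + e"
    and d: "d \<ge> 4 * \<omega>" "d > 0" "d\<^sup>2 \<ge> 2 * e" and \<omega>: "\<omega> > 0" and e: "e > 0" and W0: "W0 \<ge> 0"
    and sgn: "(\<gamma> - a) * W1 \<ge> 0" and bw: "\<mu> * h \<le> (\<gamma> - a) * W1 / 2 + W0 / 2" and \<mu>: "0 < \<mu>" "\<mu> \<le> 1/4"
    and P: "P = W1 - 2 * d * C * (a - \<gamma>)"
  shows "- P\<^sup>2 + P * W1 - 4 * d * C * Q + 2 * \<omega> * Q + \<mu> * d * h + 2 * \<mu> * e < 0"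
proof -
  have Q0: "Q > 0" using Q d e W0 h by (simp add: add_nonneg_pos)
  have 1: "- 4 * d * C * Q + 2 * \<omega> * Q \<le> - (d * Q / 2)"
  proof -
    have "d * 1 \<le> d * (4 * C)" using C d by (intro mult_left_mono) auto
    then have "d \<le> 4 * d * C" by (simp add: mult_ac)
    then have "d / 2 \<le> 4 * d * C - 2 * \<omega>" using d by linarith
    then have "d / 2 * Q \<le> (4 * d * C - 2 * \<omega>) * Q" using Q0 by (intro mult_right_mono) auto
    then show ?thesis by (simp add: algebra_simps)
  qed
  have 2: "- P\<^sup>2 + P * W1 = - d * (2 * C * ((\<gamma> - a) * W1)) - d\<^sup>2 * (4 * C * (1 - h))"
    unfolding P h by (simp add: algebra_simps power2_eq_square)
  have 3: "2 * C * ((\<gamma> - a) * W1) \<ge> (\<gamma> - a) * W1 / 2"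
    using mult_right_mono[OF C sgn] by simp
  have h1: "h \<le> 1" using h C by simp
  have 4: "4 * C * (1 - h) \<ge> 1 - h" using mult_right_mono[of 1 "4 * C" "1 - h"] C h1 by simp
  have 5: "d * (2 * C * ((\<gamma> - a) * W1)) \<ge> d * ((\<gamma> - a) * W1 / 2)" using 3 d by (intro mult_left_mono) auto
  have 6: "d\<^sup>2 * (4 * C * (1 - h)) \<ge> d\<^sup>2 * (1 - h)" using 4 by (intro mult_left_mono) auto
  have "d * (\<mu> * h) \<le> d * ((\<gamma> - a) * W1 / 2 + W0 / 2)" using bw d by (intro mult_left_mono) auto
  then have 7: "\<mu> * d * h \<le> d * ((\<gamma> - a) * W1 / 2) + d * W0 / 2" by (simp add: algebra_simps)
  have 8: "2 * \<mu> * e \<le> d\<^sup>2 / 4"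
    using mult_mono[of \<mu> "1/4" "2 * e" "d\<^sup>2"] d \<mu> e by simp
  have 9: "d * Q / 2 = d * W0 / 2 + d\<^sup>2 * h / 2 + d * e / 2" unfolding Q by (simp add: algebra_simps power2_eq_square)
  \<comment> \<open>The weight 1 - h degenerates at \<gamma> and the weight h at the wells; together
    they never fall below d^2/2.\<close>
  have 10: "d\<^sup>2 * (1 - h) + d\<^sup>2 * h / 2 \<ge> d\<^sup>2 / 2"
    using mult_left_mono[OF h1, of "d\<^sup>2"] by (simp add: algebra_simps)
  have 11: "d\<^sup>2 > 0" "d * e > 0" using d e by auto
  show ?thesis using 1 2 5 6 7 8 9 10 11 by linarith
qed

section \<open>The maximum principle for the discrepancy\<close>

context allen_cahn_transport
begin

lemma u_line:
  assumes "t \<in> {0..T}"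
  shows "((\<lambda>s. u (x + s *\<^sub>R axis j 1) t $ i) has_real_derivative Du (x + s *\<^sub>R axis j 1) t $ i $ j) (at s)"
  using has_real_derivative_vec_nth[OF has_vector_derivative_along_line[OF u_deriv[OF assms], where x=x and s=s and b="axis j 1"], of i]
  by (simp add: matrix_vector_mult_basis column_def)

text \<open>The equation differentiated in direction i. The symmetries of \<open>T3\<close> turn the
  gradient of the Laplacian into the Laplacian of the gradient.\<close>

lemma gt_eq:
  assumes t: "t \<in> {0..T}"
  shows "gt x t $ i = (\<Sum>j\<in>UNIV. T3 x t $ i $ j $ j) - W2 (\<phi> x t) * g x t $ i / \<epsilon>\<^sup>2
     - (\<Sum>k\<in>UNIV. Du x t $ k $ i * g x t $ k + u x t $ k * H x t $ k $ i)"
proof -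
  let ?e = "\<lambda>s. x + s *\<^sub>R axis i 1"
  have 1: "\<phi>t z t = (\<Sum>j\<in>UNIV. H z t $ j $ j) - W1 (\<phi> z t) / \<epsilon>\<^sup>2 - (\<Sum>k\<in>UNIV. u z t $ k * g z t $ k)" for z
    using pde[OF t, of z] by (simp add: inner_vec_def)
  have "((\<lambda>s. (\<Sum>j\<in>UNIV. H (?e s) t $ j $ j) - W1 (\<phi> (?e s) t) / \<epsilon>\<^sup>2 - (\<Sum>k\<in>UNIV. u (?e s) t $ k * g (?e s) t $ k))
     has_real_derivative (\<Sum>j\<in>UNIV. T3 (?e 0) t $ j $ j $ i) - W2 (\<phi> (?e 0) t) * g (?e 0) t $ i / \<epsilon>\<^sup>2
       - (\<Sum>k\<in>UNIV. Du (?e 0) t $ k $ i * g (?e 0) t $ k + H (?e 0) t $ k $ i * u (?e 0) t $ k)) (at 0)"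
    by (intro DERIV_diff DERIV_sum DERIV_mult DERIV_cdivide H_line[OF t] u_line[OF t] g_line[OF t]
        DERIV_chain2[OF W1_deriv] \<phi>_line[OF t])
  then have "((\<lambda>s. \<phi>t (?e s) t) has_real_derivative (\<Sum>j\<in>UNIV. T3 x t $ j $ j $ i) - W2 (\<phi> x t) * g x t $ i / \<epsilon>\<^sup>2
       - (\<Sum>k\<in>UNIV. Du x t $ k $ i * g x t $ k + H x t $ k $ i * u x t $ k)) (at 0)"
    by (simp add: 1)
  from DERIV_unique[OF \<phi>t_line[OF t] this]
  have "gt x t $ i = (\<Sum>j\<in>UNIV. T3 x t $ j $ j $ i) - W2 (\<phi> x t) * g x t $ i / \<epsilon>\<^sup>2
       - (\<Sum>k\<in>UNIV. Du x t $ k $ i * g x t $ k + H x t $ k $ i * u x t $ k)" .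
  moreover have "T3 x t $ j $ j $ i = T3 x t $ i $ j $ j" for j
    using T3_sym2[OF t, of x j j i] T3_sym1[OF t, of x j i j] by simp
  ultimately show ?thesis by (simp add: mult.commute)
qed

text \<open>At a first touching point of discrepancy and barrier, the equation contradicts
  \<open>barrier_algebra\<close>. The layer starts at 2 \<omega>, above the initial discrepancy
  \<omega>; the amplitude 2 sqrt \<omega> exp(-\<mu> t/\<epsilon>^2) in d is exactly what d^2 \<ge>
  2 e requires, and the 4 \<omega> absorbs the Jacobian of u. Hypothesis \<open>cpt\<close> ensures
  that the extremum is attained: outside K, up to repetition of values, the gradient is too small
  for touching.\<close>

lemma discrepancy_barrier:
  fixes \<gamma> \<mu> \<omega> :: real
  assumes \<gamma>: "-1 < \<gamma>" "\<gamma> < 1" and \<mu>: "0 < \<mu>" "\<mu> \<le> 1/4" and \<omega>: "\<omega> > 0"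
    and sgn: "\<And>x. \<bar>x\<bar> \<le> 1 \<Longrightarrow> (\<gamma> - x) * W1 x \<ge> 0"
    and bw: "\<And>x. \<bar>x\<bar> \<le> 1 \<Longrightarrow> \<mu> * hump \<gamma> x \<le> (\<gamma> - x) * W1 x / 2 + W x / 2"
    and init: "\<And>x. \<epsilon>\<^sup>2 * (norm (g x 0))\<^sup>2 / 2 - W (\<phi> x 0) \<le> \<omega>"
    and Du: "\<And>x t. t \<in> {0..T} \<Longrightarrow> \<epsilon>\<^sup>2 * norm (Du x t) \<le> \<omega>"
    and cpt: "\<And>\<delta>. \<delta> > 0 \<Longrightarrow> \<exists>K. compact K \<and> (\<forall>x. \<forall>t\<in>{0..T}.
        (\<exists>x'\<in>K. \<phi> x' t = \<phi> x t \<and> g x' t = g x t) \<or> \<epsilon>\<^sup>2 * (norm (g x t))\<^sup>2 / 2 < \<delta>)"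
    and t: "t \<in> {0..T}"
  shows "\<epsilon>\<^sup>2 * (norm (g x t))\<^sup>2 / 2 - W (\<phi> x t)
    \<le> (4 * \<omega> + 2 * sqrt \<omega> * exp (- \<mu> * t / \<epsilon>\<^sup>2)) * hump \<gamma> (\<phi> x t) + 2 * \<omega> * exp (- 2 * \<mu> * t / \<epsilon>\<^sup>2)"
proof -
  define d where "d t = 4 * \<omega> + 2 * sqrt \<omega> * exp (- \<mu> * t / \<epsilon>\<^sup>2)" for t
  define e where "e t = 2 * \<omega> * exp (- 2 * \<mu> * t / \<epsilon>\<^sup>2)" for t
  define F where "F x t = \<epsilon>\<^sup>2 * (norm (g x t))\<^sup>2 / 2 - W (\<phi> x t) - d t * hump \<gamma> (\<phi> x t) - e t" for x t
  have d_pos: "d t > 0" "d t \<ge> 4 * \<omega>" and e_pos: "e t > 0" for t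
    using \<omega> by (auto simp: d_def e_def intro!: add_pos_nonneg)
  have de: "(d t)\<^sup>2 \<ge> 2 * e t" for t
  proof -
    have "(2 * sqrt \<omega> * exp (- \<mu> * t / \<epsilon>\<^sup>2))\<^sup>2 \<le> (d t)\<^sup>2"
      using \<omega> by (intro power_mono) (auto simp: d_def)
    moreover have "(2 * sqrt \<omega> * exp (- \<mu> * t / \<epsilon>\<^sup>2))\<^sup>2 = 2 * e t"
      using \<omega> by (simp add: e_def power_mult_distrib exp_double[symmetric])
    ultimately show ?thesis by simp
  qed
  have "F x t < 0" if t: "t \<in> {0..T}" for x t
  proof (rule ccontr)
    assume "\<not> F x t < 0"
    then have Fx: "F x t \<ge> 0" by simp
    \<comment> \<open>The layer decreases in time, so e T is a positive threshold valid at all times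
      and selects one compact set K.\<close>
    have eT: "e t \<ge> e T" if "t \<in> {0..T}" for t
      using that \<omega> \<mu> eps_pos by (auto simp: e_def intro!: mult_left_mono divide_right_mono)
    obtain K where K: "compact K" and Kx: "\<And>x t. t \<in> {0..T} \<Longrightarrow>
        (\<exists>x'\<in>K. \<phi> x' t = \<phi> x t \<and> g x' t = g x t) \<or> \<epsilon>\<^sup>2 * (norm (g x t))\<^sup>2 / 2 < e T"
      using cpt[OF e_pos[of T]] by blast
    have red: "\<exists>x'\<in>K. F x' t = F x t" if Fp: "F x t \<ge> 0" and tp: "t \<in> {0..T}" for x t
    proof -
      have "\<epsilon>\<^sup>2 * (norm (g x t))\<^sup>2 / 2 \<ge> e t"
        using Fp W_nonneg[of "\<phi> x t"] mult_nonneg_nonneg[OF less_imp_le[OF d_pos(1)[of t]] hump_bounds(1)[OF \<gamma> \<phi>_bound[OF tp, of x]]]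
        unfolding F_def by linarith
      then obtain x' where "x' \<in> K" "\<phi> x' t = \<phi> x t" "g x' t = g x t"
        using Kx[OF tp, of x] eT[OF tp] by auto
      then show ?thesis by (intro bexI[of _ x']) (simp_all add: F_def)
    qed
    have dc: "continuous_on S d" "continuous_on S e" for S
      unfolding d_def e_def by (auto intro!: continuous_intros simp: eps_pos less_imp_neq[symmetric])
    have F_cont: "continuous_on (UNIV \<times> {0..T}) (\<lambda>(x, t). F x t)"
      using g_cont \<phi>_cont unfolding F_def case_prod_beta
      by (intro continuous_intros continuous_on_compose2[OF W_nonneg_cont(1)[of UNIV]]
          continuous_on_compose2[OF continuous_on_hump[OF \<gamma>, of UNIV]] continuous_on_compose2[OF dc(1)[of UNIV]] continuous_on_compose2[OF dc(2)[of UNIV]])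
        auto
    define Z where "Z = {z \<in> K \<times> {0..T}. (\<lambda>(x, t). F x t) z \<ge> 0}"
    have "compact Z"
    proof -
      have "Z = (K \<times> {0..T}) \<inter> (\<lambda>(x, t). F x t) -` {0..}" by (auto simp: Z_def)
      moreover have "closed ((K \<times> {0..T}) \<inter> (\<lambda>(x, t). F x t) -` {0..})"
        by (rule continuous_closed_preimage[OF continuous_on_subset[OF F_cont]])
          (use K compact_Times[OF K compact_Icc] in \<open>auto intro: compact_imp_closed\<close>)
      ultimately show ?thesis using compact_Int_closed[OF compact_Times[OF K compact_Icc[of 0 T]]]
        by (metis inf.left_idem)
    qed
    moreover have "Z \<noteq> {}" using red[OF Fx t] Fx t unfolding Z_def by fastforce
    \<comment> \<open>z has the smallest time among all points of K where the strict barrier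
      fails.\<close>
    ultimately obtain z where z: "z \<in> Z" and zmin: "\<And>w. w \<in> Z \<Longrightarrow> snd z \<le> snd w"
      using continuous_attains_inf[of Z snd] continuous_on_snd[OF continuous_on_id] by blast
    obtain x0 s where zz: "z = (x0, s)" by (cases z)
    have s: "s \<in> {0..T}" and F0: "F x0 s \<ge> 0" using z by (auto simp: Z_def zz)
    have before: "F y r < 0" if rT: "r \<in> {0..T}" and rs: "r < s" for y r
    proof (rule ccontr)
      assume "\<not> F y r < 0"
      then have Fy: "F y r \<ge> 0" by simp
      then obtain y' where "y' \<in> K" "F y' r = F y r" using red[OF Fy rT] by blast
      with Fy have "y' \<in> K" "F y' r \<ge> 0" by auto
      then have "(y', r) \<in> Z" using rT by (simp add: Z_def)
      then show False using zmin[of "(y', r)"] rs zz by simp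
    qed
    have s0: "s > 0"
    proof (rule ccontr)
      assume "\<not> s > 0"
      then have [simp]: "s = 0" using s by simp
      have "d 0 * hump \<gamma> (\<phi> x0 0) \<ge> 0"
        using d_pos[of 0] hump_bounds(1)[OF \<gamma> \<phi>_bound[OF s, of x0]] by simp
      then have "F x0 0 \<le> \<omega> - e 0" using init[of x0] by (simp add: F_def)
      then show False using F0 \<omega> by (simp add: e_def)
    qed
    have F_le: "F y s \<le> 0" for y
    proof (rule ccontr)
      assume "\<not> F y s \<le> 0"
      then have p: "F y s > 0" by simp
      have c: "continuous_on {0..T} (\<lambda>r. F y r)"
      proof -
        have "continuous_on {0..T} (\<lambda>r. (\<lambda>(x, t). F x t) (y, r))"
          by (rule continuous_on_compose2[OF F_cont]) (auto intro!: continuous_intros)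
        then show ?thesis by simp
      qed
      have "\<forall>\<^sub>F r in at s within {0..T}. F y r > 0"
        using c s p by (auto simp: continuous_on_def intro: order_tendstoD)
      then obtain \<eta> where \<eta>: "\<eta> > 0" "\<And>r. r \<in> {0..T} \<Longrightarrow> r \<noteq> s \<Longrightarrow> dist r s < \<eta> \<Longrightarrow> F y r > 0"
        by (auto simp: eventually_at)
      define r where "r = max 0 (s - \<eta> / 2)"
      have "r \<in> {0..T}" "r < s" "dist r s < \<eta>" using s s0 \<eta> by (auto simp: r_def dist_real_def max_def)
      then show False using \<eta>(2)[of r] before[of r y] by simp
    qed
    have Fz: "F x0 s = 0" using F_le[of x0] F0 by simp
    obtain C where C: "C \<ge> 1 / 4" "hump \<gamma> (\<phi> x0 s) = 1 - C * (\<phi> x0 s - \<gamma>)\<^sup>2"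
      and Cev: "\<forall>\<^sub>F y in nhds (\<phi> x0 s). hump \<gamma> y \<le> 1 - C * (y - \<gamma>)\<^sup>2"
      using hump_touching_parabola[OF \<gamma>] by blast
    define P where "P v = W1 v - 2 * d s * C * (v - \<gamma>)" for v
    \<comment> \<open>F with \<open>hump\<close> replaced by the touching parabola. Near the
      touching point Ft \<le> F, with equality there, so Ft is differentiable as often as needed and
      inherits both the spatial maximum and the sign before time s.\<close>
    define Ft where "Ft x t = \<epsilon>\<^sup>2 * (\<Sum>i\<in>UNIV. (g x t $ i)\<^sup>2) / 2 - W (\<phi> x t) - d t * (1 - C * (\<phi> x t - \<gamma>)\<^sup>2) - e t" for x t
    have Ft_F: "Ft x t \<le> F x t" if "hump \<gamma> (\<phi> x t) \<le> 1 - C * (\<phi> x t - \<gamma>)\<^sup>2" for x t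
    proof -
      have "d t * hump \<gamma> (\<phi> x t) \<le> d t * (1 - C * (\<phi> x t - \<gamma>)\<^sup>2)"
        using that d_pos(1)[of t] by (intro mult_left_mono) auto
      then show ?thesis by (simp add: Ft_def F_def power2_norm_eq_inner inner_vec_def power2_eq_square[of "_ $ _"])
    qed
    have Ft0: "Ft x0 s = 0"
      using Fz by (simp add: Ft_def F_def C power2_norm_eq_inner inner_vec_def power2_eq_square[of "_ $ _"])
    define G where "G = (norm (g x0 s))\<^sup>2"
    have Gsum: "G = (\<Sum>i\<in>UNIV. g x0 s $ i * g x0 s $ i)" by (simp add: G_def power2_norm_eq_inner inner_vec_def)
    define h where "h = hump \<gamma> (\<phi> x0 s)"
    define Q where "Q = W (\<phi> x0 s) + d s * h + e s"
    have h01: "0 \<le> h" using hump_bounds[OF \<gamma> \<phi>_bound[OF s]] by (simp add: h_def)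
    have Q0: "Q > 0" using W_nonneg[of "\<phi> x0 s"] d_pos(1)[of s] e_pos[of s] h01 by (simp add: Q_def add_nonneg_pos)
    have GQ: "\<epsilon>\<^sup>2 * G = 2 * Q" using Fz by (simp add: F_def G_def Q_def h_def)
    have G0: "G > 0" using GQ Q0 eps_pos by (smt (verit) mult_nonneg_nonpos zero_le_power2)
    let ?p = "P (\<phi> x0 s)"
    \<comment> \<open>Coordinate lines suffice: the first-order conditions say that \<epsilon>^2
      times the Hessian maps grad \<phi> to P grad \<phi>, and the second-order ones, summed over j,
      give the Laplacian inequality \<open>ii\<close>.\<close>
    have sp: "\<epsilon>\<^sup>2 * (\<Sum>i\<in>UNIV. g x0 s $ i * H x0 s $ i $ j) - ?p * g x0 s $ j = 0 \<and>
      \<epsilon>\<^sup>2 * (\<Sum>i\<in>UNIV. (H x0 s $ i $ j)\<^sup>2 + g x0 s $ i * T3 x0 s $ i $ j $ j)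
        - ((W2 (\<phi> x0 s) - 2 * d s * C) * (g x0 s $ j)\<^sup>2 + ?p * H x0 s $ j $ j) \<le> 0" for j
    proof -
      let ?e = "\<lambda>r. x0 + r *\<^sub>R axis j 1"
      let ?f' = "\<lambda>r. \<epsilon>\<^sup>2 * (\<Sum>i\<in>UNIV. g (?e r) s $ i * H (?e r) s $ i $ j) - P (\<phi> (?e r) s) * g (?e r) s $ j"
      have pc: "isCont (\<lambda>r. \<phi> (?e r) s) 0" using \<phi>_line[OF s, of x0 j 0] by (rule DERIV_isCont)
      have "\<forall>\<^sub>F r in nhds 0. hump \<gamma> (\<phi> (?e r) s) \<le> 1 - C * (\<phi> (?e r) s - \<gamma>)\<^sup>2"
      proof -
        have "((\<lambda>r. \<phi> (?e r) s) \<longlongrightarrow> \<phi> x0 s) (nhds 0)"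
          using pc by (simp add: continuous_at isCont_def tendsto_nhds_iff)
        from eventually_compose_filterlim[OF Cev this] show ?thesis .
      qed
      then obtain \<eta> where \<eta>: "\<eta> > 0" "\<And>r. dist r 0 < \<eta> \<Longrightarrow> hump \<gamma> (\<phi> (?e r) s) \<le> 1 - C * (\<phi> (?e r) s - \<gamma>)\<^sup>2"
        by (auto simp: eventually_nhds_metric)
      have P_deriv: "((\<lambda>r. P (\<phi> (?e r) s)) has_real_derivative (W2 (\<phi> x0 s) - 2 * d s * C) * g x0 s $ j) (at 0)"
      proof -
        have "(P has_real_derivative W2 v - 2 * d s * C * (1 - 0)) (at v)" for v
          unfolding P_def by (intro DERIV_diff DERIV_cmult W1_deriv DERIV_ident DERIV_const)
        from DERIV_chain2[OF this[of "\<phi> (?e 0) s"] \<phi>_line[OF s, of x0 j 0]] show ?thesis by simp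
      qed
      have "?f' 0 = 0 \<and> \<epsilon>\<^sup>2 * (\<Sum>i\<in>UNIV. (H x0 s $ i $ j)\<^sup>2 + g x0 s $ i * T3 x0 s $ i $ j $ j)
        - ((W2 (\<phi> x0 s) - 2 * d s * C) * (g x0 s $ j)\<^sup>2 + ?p * H x0 s $ j $ j) \<le> 0"
      proof (rule second_derivative_local_max[OF \<eta>(1), of "\<lambda>r. Ft (?e r) s"])
        show "((\<lambda>r. Ft (?e r) s) has_real_derivative ?f' r) (at r)" for r
        proof -
          have 1: "((\<lambda>r. (g (?e r) s $ i)\<^sup>2) has_real_derivative 2 * (g (?e r) s $ i * H (?e r) s $ i $ j)) (at r)" for i
            using DERIV_power[OF g_line[OF s, of x0 j i r], of 2] by (simp add: mult_ac)
          have 2: "((\<lambda>r. (\<phi> (?e r) s - \<gamma>)\<^sup>2) has_real_derivative 2 * ((\<phi> (?e r) s - \<gamma>) * g (?e r) s $ j)) (at r)"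
            using DERIV_power[OF DERIV_diff[OF \<phi>_line[OF s, of x0 j r] DERIV_const[of \<gamma>]], of 2] by (simp add: mult_ac)
          have "((\<lambda>r. Ft (?e r) s) has_real_derivative
            \<epsilon>\<^sup>2 * (\<Sum>i\<in>UNIV. 2 * (g (?e r) s $ i * H (?e r) s $ i $ j)) / 2 - W1 (\<phi> (?e r) s) * g (?e r) s $ j
             - d s * (0 - C * (2 * ((\<phi> (?e r) s - \<gamma>) * g (?e r) s $ j))) - 0) (at r)"
            unfolding Ft_def
            by (intro DERIV_diff DERIV_cdivide DERIV_cmult DERIV_sum 1 2 DERIV_const DERIV_chain2[OF W_deriv] \<phi>_line s)
          then show ?thesis by (simp add: P_def sum_distrib_left[symmetric] algebra_simps)
        qed
        show "(?f' has_real_derivative \<epsilon>\<^sup>2 * (\<Sum>i\<in>UNIV. (H x0 s $ i $ j)\<^sup>2 + g x0 s $ i * T3 x0 s $ i $ j $ j)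
          - ((W2 (\<phi> x0 s) - 2 * d s * C) * (g x0 s $ j)\<^sup>2 + ?p * H x0 s $ j $ j)) (at 0)"
        proof -
          have "(?f' has_real_derivative \<epsilon>\<^sup>2 * (\<Sum>i\<in>UNIV. H (?e 0) s $ i $ j * H (?e 0) s $ i $ j + T3 (?e 0) s $ i $ j $ j * g (?e 0) s $ i)
            - ((W2 (\<phi> x0 s) - 2 * d s * C) * g x0 s $ j * g (?e 0) s $ j + H (?e 0) s $ j $ j * P (\<phi> (?e 0) s))) (at 0)"
            by (intro DERIV_diff DERIV_cmult DERIV_sum DERIV_mult g_line H_line P_deriv s)
          then show ?thesis by (simp add: power2_eq_square mult_ac)
        qed
        show "Ft (?e r) s \<le> Ft (?e 0) s" if "\<bar>r\<bar> < \<eta>" for r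
          using Ft_F[OF \<eta>(2)[of r]] F_le[of "?e r"] that Ft0 by simp
      qed
      then show ?thesis by simp
    qed
    define d' where "d' = - 2 * \<mu> * sqrt \<omega> * exp (- \<mu> * s / \<epsilon>\<^sup>2) / \<epsilon>\<^sup>2"
    define e' where "e' = - 2 * \<mu> * e s / \<epsilon>\<^sup>2"
    \<comment> \<open>Since Ft \<le> F < 0 just before s and Ft = 0 at s, the left derivative cannot
      be negative.\<close>
    have time: "\<epsilon>\<^sup>2 * (\<Sum>i\<in>UNIV. g x0 s $ i * gt x0 s $ i) - ?p * \<phi>t x0 s - d' * h - e' \<ge> 0"
    proof (rule ccontr)
      assume neg: "\<not> ?thesis"
      have 1: "((\<lambda>r. (g x0 r $ i)\<^sup>2) has_real_derivative 2 * (g x0 s $ i * gt x0 s $ i)) (at s within {0..T})" for i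
        using DERIV_power[OF g_time_nth[OF s, of x0 i], of 2] by (simp add: mult_ac)
      have 2: "((\<lambda>r. (\<phi> x0 r - \<gamma>)\<^sup>2) has_real_derivative 2 * ((\<phi> x0 s - \<gamma>) * \<phi>t x0 s)) (at s within {0..T})"
        using DERIV_power[OF DERIV_diff[OF \<phi>_time[OF s, of x0] DERIV_const[of \<gamma>]], of 2] by (simp add: mult_ac)
      have ex: "((\<lambda>t. exp (c * t / \<epsilon>\<^sup>2)) has_real_derivative exp (c * s / \<epsilon>\<^sup>2) * (c / \<epsilon>\<^sup>2)) (at s within {0..T})" for c
        by (intro DERIV_chain2[OF DERIV_exp] DERIV_cdivide DERIV_cmult_Id)
      have "(d has_real_derivative 0 + 2 * sqrt \<omega> * (exp (- \<mu> * s / \<epsilon>\<^sup>2) * (- \<mu> / \<epsilon>\<^sup>2))) (at s within {0..T})"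
        unfolding d_def by (intro DERIV_add DERIV_const DERIV_cmult ex)
      then have dd: "(d has_real_derivative d') (at s within {0..T})" by (simp add: d'_def mult_ac)
      have "(e has_real_derivative 2 * \<omega> * (exp (- 2 * \<mu> * s / \<epsilon>\<^sup>2) * (- 2 * \<mu> / \<epsilon>\<^sup>2))) (at s within {0..T})"
        unfolding e_def by (intro DERIV_cmult ex)
      then have ed: "(e has_real_derivative e') (at s within {0..T})" by (simp add: e'_def e_def mult_ac)
      have "((\<lambda>r. Ft x0 r) has_real_derivative
          \<epsilon>\<^sup>2 * (\<Sum>i\<in>UNIV. 2 * (g x0 s $ i * gt x0 s $ i)) / 2 - W1 (\<phi> x0 s) * \<phi>t x0 s
           - (d' * (1 - C * (\<phi> x0 s - \<gamma>)\<^sup>2) + (0 - C * (2 * ((\<phi> x0 s - \<gamma>) * \<phi>t x0 s))) * d s) - e') (at s within {0..T})"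
        unfolding Ft_def
        by (intro DERIV_diff DERIV_cdivide DERIV_cmult DERIV_sum DERIV_mult[OF dd] ed 1 2 DERIV_const DERIV_chain2[OF W_deriv] \<phi>_time s)
      then have der: "((\<lambda>r. Ft x0 r) has_real_derivative
         \<epsilon>\<^sup>2 * (\<Sum>i\<in>UNIV. g x0 s $ i * gt x0 s $ i) - ?p * \<phi>t x0 s - d' * h - e') (at s within {0..T})"
        by (simp add: P_def h_def C(2) sum_distrib_left[symmetric] algebra_simps)
      obtain \<eta> where \<eta>: "\<eta> > 0" "\<And>k. k > 0 \<Longrightarrow> s - k \<in> {0..T} \<Longrightarrow> k < \<eta> \<Longrightarrow> Ft x0 s < Ft x0 (s - k)"
        using has_real_derivative_neg_dec_left[OF der] neg by (auto simp: not_le)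
      have "((\<lambda>r. \<phi> x0 r) \<longlongrightarrow> \<phi> x0 s) (at s within {0..T})"
        using DERIV_continuous[OF \<phi>_time[OF s, of x0]] by (simp add: continuous_within)
      from eventually_compose_filterlim[OF Cev this]
      have "\<forall>\<^sub>F r in at s within {0..T}. hump \<gamma> (\<phi> x0 r) \<le> 1 - C * (\<phi> x0 r - \<gamma>)\<^sup>2" .
      then obtain \<eta>2 where \<eta>2: "\<eta>2 > 0" "\<And>r. r \<in> {0..T} \<Longrightarrow> r \<noteq> s \<Longrightarrow> dist r s < \<eta>2 \<Longrightarrow> hump \<gamma> (\<phi> x0 r) \<le> 1 - C * (\<phi> x0 r - \<gamma>)\<^sup>2"
        by (auto simp: eventually_at)
      define k where "k = min s (min \<eta> \<eta>2) / 2"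
      have k: "k > 0" "k < \<eta>" "k < \<eta>2" "k \<le> s" using s0 \<eta>(1) \<eta>2(1) by (auto simp: k_def min_def)
      have kr: "s - k \<in> {0..T}" using k s by auto
      have "0 < Ft x0 (s - k)" using \<eta>(2)[OF k(1) kr k(2)] Ft0 by simp
      also have "\<dots> \<le> F x0 (s - k)" using k kr by (intro Ft_F \<eta>2(2)) (auto simp: dist_real_def)
      finally show False using before[OF kr, of x0] k by simp
    qed
    define v where "v = (\<Sum>k\<in>UNIV. u x0 s $ k * g x0 s $ k)"
    define L where "L = (\<Sum>j\<in>UNIV. H x0 s $ j $ j)"
    define B3 where "B3 = (\<Sum>i\<in>UNIV. \<Sum>j\<in>UNIV. g x0 s $ i * T3 x0 s $ i $ j $ j)"
    define HH where "HH = (\<Sum>j\<in>UNIV. \<Sum>i\<in>UNIV. (H x0 s $ i $ j)\<^sup>2)"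
    define DD where "DD = (\<Sum>i\<in>UNIV. \<Sum>k\<in>UNIV. Du x0 s $ k $ i * g x0 s $ k * g x0 s $ i)"
    let ?w = "W2 (\<phi> x0 s)" and ?w1 = "W1 (\<phi> x0 s)"
    have gH: "\<epsilon>\<^sup>2 * (\<Sum>i\<in>UNIV. g x0 s $ i * H x0 s $ i $ j) = ?p * g x0 s $ j" for j using sp[of j] by simp
    have ii: "\<epsilon>\<^sup>2 * (HH + B3) - (?w - 2 * d s * C) * G - ?p * L \<le> 0"
    proof -
      have "(\<Sum>j\<in>UNIV. \<epsilon>\<^sup>2 * (\<Sum>i\<in>UNIV. (H x0 s $ i $ j)\<^sup>2 + g x0 s $ i * T3 x0 s $ i $ j $ j)
        - ((?w - 2 * d s * C) * (g x0 s $ j)\<^sup>2 + ?p * H x0 s $ j $ j)) \<le> 0"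
        using sp by (intro sum_nonpos) auto
      moreover have "B3 = (\<Sum>j\<in>UNIV. \<Sum>i\<in>UNIV. g x0 s $ i * T3 x0 s $ i $ j $ j)"
        unfolding B3_def by (rule sum.swap)
      ultimately show ?thesis
        by (simp add: sum_subtractf sum.distrib sum_distrib_left[symmetric] HH_def Gsum L_def power2_eq_square[of "g _ _ $ _"])
    qed
    have ggt: "\<epsilon>\<^sup>2 * (\<Sum>i\<in>UNIV. g x0 s $ i * gt x0 s $ i) = \<epsilon>\<^sup>2 * B3 - ?w * G - \<epsilon>\<^sup>2 * DD - ?p * v"
    proof -
      have a: "(\<Sum>i\<in>UNIV. g x0 s $ i * gt x0 s $ i) = B3 - ?w * G / \<epsilon>\<^sup>2 - DD - (\<Sum>i\<in>UNIV. \<Sum>k\<in>UNIV. g x0 s $ i * (u x0 s $ k * H x0 s $ k $ i))"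
        unfolding gt_eq[OF s] B3_def DD_def Gsum
        by (simp add: algebra_simps sum.distrib sum_subtractf sum_distrib_left sum_divide_distrib)
      have "(\<Sum>i\<in>UNIV. \<Sum>k\<in>UNIV. g x0 s $ i * (u x0 s $ k * H x0 s $ k $ i)) = (\<Sum>k\<in>UNIV. \<Sum>i\<in>UNIV. g x0 s $ i * (u x0 s $ k * H x0 s $ k $ i))"
        by (rule sum.swap)
      also have "\<dots> = (\<Sum>k\<in>UNIV. u x0 s $ k * (\<Sum>i\<in>UNIV. g x0 s $ i * H x0 s $ i $ k))"
        by (subst H_sym[OF s]) (simp add: sum_distrib_left mult_ac)
      finally have "\<epsilon>\<^sup>2 * (\<Sum>i\<in>UNIV. \<Sum>k\<in>UNIV. g x0 s $ i * (u x0 s $ k * H x0 s $ k $ i)) = (\<Sum>k\<in>UNIV. u x0 s $ k * (\<epsilon>\<^sup>2 * (\<Sum>i\<in>UNIV. g x0 s $ i * H x0 s $ i $ k)))"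
        by (simp add: sum_distrib_left mult_ac)
      also have "\<dots> = ?p * v" unfolding gH v_def by (simp add: sum_distrib_left mult_ac)
      finally show ?thesis unfolding a using eps_pos by (simp add: right_diff_distrib)
    qed
    have pt: "\<phi>t x0 s = L - ?w1 / \<epsilon>\<^sup>2 - v" using pde[OF s, of x0] by (simp add: L_def v_def inner_vec_def)
    have DDb: "- DD \<le> norm (Du x0 s) * G"
    proof -
      have "DD = g x0 s \<bullet> (Du x0 s *v g x0 s)"
      proof -
        have "DD = (\<Sum>k\<in>UNIV. \<Sum>i\<in>UNIV. Du x0 s $ k $ i * g x0 s $ k * g x0 s $ i)"
          unfolding DD_def by (rule sum.swap)
        then show ?thesis by (simp add: inner_vec_def matrix_vector_mult_def sum_distrib_left mult_ac)
      qed
      then have "\<bar>DD\<bar> \<le> norm (g x0 s) * norm (Du x0 s *v g x0 s)" by (simp add: Cauchy_Schwarz_ineq2)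
      also have "\<dots> \<le> norm (g x0 s) * (norm (Du x0 s) * norm (g x0 s))"
        by (intro mult_left_mono norm_matrix_vector_mult_le) auto
      finally have "\<bar>DD\<bar> \<le> norm (g x0 s) * (norm (Du x0 s) * norm (g x0 s))" .
      then show ?thesis by (simp add: G_def power2_eq_square mult_ac)
    qed
    \<comment> \<open>The critical point equation and Cauchy-Schwarz bound the Hessian from below by
      P. This produces the term -P^2 that drives \<open>barrier_algebra\<close>.\<close>
    have HHb: "\<epsilon>\<^sup>2 * \<epsilon>\<^sup>2 * HH \<ge> ?p\<^sup>2"
    proof -
      have cs: "(\<Sum>i\<in>UNIV. g x0 s $ i * H x0 s $ i $ j)\<^sup>2 \<le> G * (\<Sum>i\<in>UNIV. (H x0 s $ i $ j)\<^sup>2)" for j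
        using Cauchy_Schwarz_ineq[of "g x0 s" "\<chi> i. H x0 s $ i $ j"]
        by (simp add: inner_vec_def Gsum power2_eq_square)
      have "?p\<^sup>2 * G = (\<Sum>j\<in>UNIV. (?p * g x0 s $ j)\<^sup>2)"
        by (simp add: Gsum sum_distrib_left power2_eq_square mult_ac)
      also have "\<dots> = (\<Sum>j\<in>UNIV. \<epsilon>\<^sup>2 * \<epsilon>\<^sup>2 * (\<Sum>i\<in>UNIV. g x0 s $ i * H x0 s $ i $ j)\<^sup>2)"
        by (simp only: gH[symmetric]) (simp add: power2_eq_square mult_ac)
      also have "\<dots> \<le> (\<Sum>j\<in>UNIV. \<epsilon>\<^sup>2 * \<epsilon>\<^sup>2 * (G * (\<Sum>i\<in>UNIV. (H x0 s $ i $ j)\<^sup>2)))"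
        by (intro sum_mono mult_left_mono cs) auto
      also have "\<dots> = \<epsilon>\<^sup>2 * \<epsilon>\<^sup>2 * HH * G" by (simp add: HH_def sum_distrib_left mult_ac)
      finally show ?thesis using G0 by simp
    qed
    have ed': "- (\<epsilon>\<^sup>2 * d' * h) \<le> \<mu> * d s * h"
    proof -
      have "- (\<epsilon>\<^sup>2 * d') \<le> \<mu> * d s" using \<omega> \<mu> eps_pos by (simp add: d'_def d_def algebra_simps)
      from mult_right_mono[OF this h01] show ?thesis by simp
    qed
    have ee': "- (\<epsilon>\<^sup>2 * e') = 2 * \<mu> * e s" using eps_pos by (simp add: e'_def)
    \<comment> \<open>The time condition times \<epsilon>^2, with \<open>gt\<close> and
      \<open>\<phi>t\<close> eliminated through the equation. It is regrouped so that
      \<open>ii\<close> disposes of all third derivatives and of the Laplacian.\<close>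
    have "0 \<le> \<epsilon>\<^sup>2 * (\<epsilon>\<^sup>2 * B3 - ?w * G - \<epsilon>\<^sup>2 * DD - ?p * v - ?p * (L - ?w1 / \<epsilon>\<^sup>2 - v) - d' * h - e')"
      using time unfolding ggt pt by (intro mult_nonneg_nonneg) auto
    also have "\<dots> = \<epsilon>\<^sup>2 * (\<epsilon>\<^sup>2 * (HH + B3) - (?w - 2 * d s * C) * G - ?p * L) - \<epsilon>\<^sup>2 * \<epsilon>\<^sup>2 * HH
      - 2 * d s * C * (\<epsilon>\<^sup>2 * G) - \<epsilon>\<^sup>2 * \<epsilon>\<^sup>2 * DD + ?p * ?w1 - \<epsilon>\<^sup>2 * d' * h - \<epsilon>\<^sup>2 * e'"
      using eps_pos by (simp add: field_simps)
    also have "\<dots> \<le> - ?p\<^sup>2 + ?p * ?w1 - 4 * d s * C * Q + 2 * \<omega> * Q + \<mu> * d s * h + 2 * \<mu> * e s"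
    proof -
      have "\<epsilon>\<^sup>2 * (\<epsilon>\<^sup>2 * (HH + B3) - (?w - 2 * d s * C) * G - ?p * L) \<le> 0" using ii by (simp add: mult_le_0_iff)
      moreover have "\<epsilon>\<^sup>2 * \<epsilon>\<^sup>2 * - DD \<le> 2 * \<omega> * Q"
      proof -
        have "\<epsilon>\<^sup>2 * \<epsilon>\<^sup>2 * - DD \<le> \<epsilon>\<^sup>2 * \<epsilon>\<^sup>2 * (norm (Du x0 s) * G)" using DDb by (intro mult_left_mono) auto
        also have "\<dots> = (\<epsilon>\<^sup>2 * norm (Du x0 s)) * (\<epsilon>\<^sup>2 * G)" by simp
        also have "\<dots> \<le> \<omega> * (\<epsilon>\<^sup>2 * G)" using G0 by (intro mult_right_mono Du s) auto
        finally show ?thesis by (simp add: GQ)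
      qed
      moreover have "2 * d s * C * (\<epsilon>\<^sup>2 * G) = 4 * d s * C * Q" by (simp add: GQ)
      ultimately show ?thesis using HHb ed' ee' by linarith
    qed
    also have "\<dots> < 0"
    proof -
      have hC: "h = 1 - C * (\<phi> x0 s - \<gamma>)\<^sup>2" using C(2) by (simp add: h_def)
      have bw0: "\<mu> * h \<le> (\<gamma> - \<phi> x0 s) * W1 (\<phi> x0 s) / 2 + W (\<phi> x0 s) / 2"
        using bw[OF \<phi>_bound[OF s]] by (simp add: h_def)
      show ?thesis
      by (rule barrier_algebra[where ?W0.0="W (\<phi> x0 s)" and a="\<phi> x0 s" and \<gamma>=\<gamma>])
        (fact C(1) hC h01 d_pos de e_pos \<omega> \<mu> W_nonneg sgn[OF \<phi>_bound[OF s]] bw0 | simp only: Q_def P_def)+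
    qed
    finally show False by simp
  qed
  from this[OF t, of x] show ?thesis unfolding F_def d_def e_def by linarith
qed

end

lemma nn_integral_ball_affine:
  fixes f :: "real^'n \<Rightarrow> ennreal"
  assumes [measurable]: "f \<in> borel_measurable borel" and r: "r > 0"
  shows "(\<integral>z. (if dist 0 z < 1 then f (x + r *\<^sub>R z) else 0))
    = ennreal (1 / r ^ CARD('n)) * (\<integral>y. (if dist x y < r then f y else 0))"
proof -
  have "(\<integral>z. (if dist 0 z < 1 then f (x + r *\<^sub>R z) else 0))
     = (\<integral>z. (\<lambda>y. if dist x y < r then f y else 0) (x + r *\<^sub>R z))"
    using r by (intro nn_integral_cong) (simp add: dist_norm)
  also have "\<dots> = ennreal (1 / r ^ CARD('n)) * (\<integral>y. (if dist x y < r then f y else 0))"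
    by (subst nn_integral_affine[OF _ r]) simp_all
  finally show ?thesis .
qed

lemma emeasure_unit_ball_cart:
  "(\<integral>\<^sup>+z. (if dist 0 z < 1 then c else 0) \<partial>(lborel :: (real^'n) measure)) = c * ennreal (unit_ball_vol (real CARD('n)))"
proof -
  have "(\<integral>\<^sup>+z. (if dist 0 z < 1 then c else 0) \<partial>(lborel :: (real^'n) measure)) = (\<integral>\<^sup>+z. c * indicator (ball 0 1) z \<partial>(lborel :: (real^'n) measure))"
    by (intro nn_integral_cong) (simp add: indicator_def)
  also have "\<dots> = c * emeasure lborel (ball (0::real^'n) 1)" by (subst nn_integral_cmult_indicator) simp_all
  finally show ?thesis by (simp add: emeasure_ball)
qed

section \<open>The trace inequality\<close>

text \<open>The fundamental theorem of calculus from x to x + R z, averaged over z in the unit ball.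
  Substituting y = x + r z turns the average at radius r into r^(-n) times an integral over the ball
  of radius r: a Riesz potential already decomposed by scales, as a threshold depending on the scale
  requires.\<close>

lemma radial_representation:
  fixes w G :: "real^'n \<Rightarrow> real"
  assumes w: "\<And>x. (w has_derivative w' x) (at x)" and w': "\<And>x h. \<bar>w' x h\<bar> \<le> G x * norm h"
    and G: "continuous_on UNIV G" and R: "R > 0"
  shows "ennreal (unit_ball_vol (real CARD('n)) * \<bar>w x\<bar>) \<le>
     ennreal (1 / R ^ CARD('n)) * (\<integral>y. (if dist x y < R then ennreal \<bar>w y\<bar> else 0))
    + (\<integral>r. (if 0 < r \<and> r \<le> R then ennreal (1 / r ^ CARD('n)) * (\<integral>y. (if dist x y < r then ennreal (G y) else 0)) else 0))"
proof -
  have wc: "continuous_on UNIV w"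
    by (intro continuous_at_imp_continuous_on ballI has_derivative_continuous[OF w])
  have [measurable]: "w \<in> borel_measurable borel" "G \<in> borel_measurable borel"
    using wc G by (auto intro: borel_measurable_continuous_onI)
  have G0: "G y \<ge> 0" for y using order_trans[OF abs_ge_zero w'[of y "SOME b. b \<in> Basis"]] by simp
  have pt: "ennreal \<bar>w x\<bar> \<le> ennreal \<bar>w (x + R *\<^sub>R z)\<bar> + (\<integral>r. (if 0 < r \<and> r \<le> R then ennreal (G (x + r *\<^sub>R z)) else 0))"
    if z: "dist 0 z < 1" for z
  proof -
    have Gc: "continuous_on {0..R} (\<lambda>r. G (x + r *\<^sub>R z))"
      by (intro continuous_on_compose2[OF G] continuous_intros) auto
    have "((\<lambda>r. w' (x + r *\<^sub>R z) z) has_integral w (x + R *\<^sub>R z) - w (x + 0 *\<^sub>R z)) {0..R}"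
    proof (rule fundamental_theorem_of_calculus)
      show "((\<lambda>r. w (x + r *\<^sub>R z)) has_vector_derivative w' (x + r *\<^sub>R z) z) (at r within {0..R})" for r
        by (rule has_vector_derivative_at_within[OF has_vector_derivative_along_line[OF w]])
    qed (use R in simp)
    then have hi: "((\<lambda>r. w' (x + r *\<^sub>R z) z) has_integral w (x + R *\<^sub>R z) - w x) {0..R}" by simp
    have "norm (integral {0..R} (\<lambda>r. w' (x + r *\<^sub>R z) z)) \<le> integral {0..R} (\<lambda>r. G (x + r *\<^sub>R z))"
    proof (rule integral_norm_bound_integral)
      show "(\<lambda>r. G (x + r *\<^sub>R z)) integrable_on {0..R}" by (rule integrable_continuous_interval[OF Gc])
      show "norm (w' (x + r *\<^sub>R z) z) \<le> G (x + r *\<^sub>R z)" for r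
        using w'[of "x + r *\<^sub>R z" z] G0[of "x + r *\<^sub>R z"] z mult_left_mono[of "norm z" 1 "G (x + r *\<^sub>R z)"]
        by (simp add: dist_norm)
    qed (use hi in auto)
    then have "\<bar>w x\<bar> \<le> \<bar>w (x + R *\<^sub>R z)\<bar> + integral {0..R} (\<lambda>r. G (x + r *\<^sub>R z))"
      using integral_unique[OF hi] by simp
    moreover have "ennreal (integral {0..R} (\<lambda>r. G (x + r *\<^sub>R z))) = (\<integral>r. (if 0 < r \<and> r \<le> R then ennreal (G (x + r *\<^sub>R z)) else 0))"
    proof -
      have "((\<lambda>r. G (x + r *\<^sub>R z)) has_integral integral {0..R} (\<lambda>r. G (x + r *\<^sub>R z))) {0..R}"
        by (rule integrable_integral[OF integrable_continuous_interval[OF Gc]])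
      then have "((\<lambda>r. if 0 < r \<and> r \<le> R then G (x + r *\<^sub>R z) else 0) has_integral integral {0..R} (\<lambda>r. G (x + r *\<^sub>R z))) {0..R}"
        by (rule has_integral_spike[of "{0}", rotated 2]) auto
      then have "((\<lambda>r. if 0 < r \<and> r \<le> R then G (x + r *\<^sub>R z) else 0) has_integral integral {0..R} (\<lambda>r. G (x + r *\<^sub>R z))) UNIV"
        by (rule has_integral_on_superset) auto
      then have "(\<integral>r. ennreal (if 0 < r \<and> r \<le> R then G (x + r *\<^sub>R z) else 0)) = ennreal (integral {0..R} (\<lambda>r. G (x + r *\<^sub>R z)))"
        by (intro nn_integral_has_integral_lborel) (auto simp: G0)
      then show ?thesis by (simp add: if_distrib[of ennreal] cong: if_cong)
    qed
    moreover have "integral {0..R} (\<lambda>r. G (x + r *\<^sub>R z)) \<ge> 0"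
      by (rule integral_nonneg[OF integrable_continuous_interval[OF Gc]]) (rule G0)
    ultimately show ?thesis
      using ennreal_leI[of "\<bar>w x\<bar>" "\<bar>w (x + R *\<^sub>R z)\<bar> + integral {0..R} (\<lambda>r. G (x + r *\<^sub>R z))"] by simp
  qed
  have "ennreal (unit_ball_vol (real CARD('n)) * \<bar>w x\<bar>) = (\<integral>\<^sup>+z. (if dist 0 z < 1 then ennreal \<bar>w x\<bar> else 0) \<partial>(lborel :: (real^'n) measure))"
    unfolding emeasure_unit_ball_cart by (simp add: ennreal_mult'' mult.commute)
  also have "\<dots> \<le> (\<integral>\<^sup>+z. (if dist 0 z < 1 then ennreal \<bar>w (x + R *\<^sub>R z)\<bar> else 0)
     + (if dist 0 z < 1 then (\<integral>r. (if 0 < r \<and> r \<le> R then ennreal (G (x + r *\<^sub>R z)) else 0)) else 0) \<partial>(lborel :: (real^'n) measure))"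
    using pt by (intro nn_integral_mono) auto
  also have "\<dots> = (\<integral>\<^sup>+z. (if dist 0 z < 1 then ennreal \<bar>w (x + R *\<^sub>R z)\<bar> else 0) \<partial>(lborel :: (real^'n) measure))
     + (\<integral>\<^sup>+z. (if dist 0 z < 1 then (\<integral>r. (if 0 < r \<and> r \<le> R then ennreal (G (x + r *\<^sub>R z)) else 0)) else 0) \<partial>(lborel :: (real^'n) measure))"
    by (rule nn_integral_add) measurable
  also have "(\<integral>\<^sup>+z. (if dist 0 z < 1 then ennreal \<bar>w (x + R *\<^sub>R z)\<bar> else 0) \<partial>(lborel :: (real^'n) measure))
      = ennreal (1 / R ^ CARD('n)) * (\<integral>y. (if dist x y < R then ennreal \<bar>w y\<bar> else 0))"
    by (rule nn_integral_ball_affine[where f="\<lambda>y. ennreal \<bar>w y\<bar>"]) (use R in simp_all)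
  also have "(\<integral>\<^sup>+z. (if dist 0 z < 1 then (\<integral>r. (if 0 < r \<and> r \<le> R then ennreal (G (x + r *\<^sub>R z)) else 0)) else 0) \<partial>(lborel :: (real^'n) measure))
    = (\<integral>\<^sup>+z. (\<integral>r. (if dist 0 z < 1 \<and> 0 < r \<and> r \<le> R then ennreal (G (x + r *\<^sub>R z)) else 0)) \<partial>(lborel :: (real^'n) measure))"
    by (intro nn_integral_cong) auto
  also have "\<dots> = (\<integral>r. (\<integral>\<^sup>+z. (if dist 0 z < 1 \<and> 0 < r \<and> r \<le> R then ennreal (G (x + r *\<^sub>R z)) else 0) \<partial>(lborel :: (real^'n) measure)))"
    by (rule lborel_pair.Fubini') measurable
  also have "\<dots> = (\<integral>r. (if 0 < r \<and> r \<le> R then ennreal (1 / r ^ CARD('n)) * (\<integral>y. (if dist x y < r then ennreal (G y) else 0)) else 0))"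
  proof (rule nn_integral_cong)
    fix r :: real
    show "(\<integral>\<^sup>+z. (if dist 0 z < 1 \<and> 0 < r \<and> r \<le> R then ennreal (G (x + r *\<^sub>R z)) else 0) \<partial>(lborel :: (real^'n) measure))
      = (if 0 < r \<and> r \<le> R then ennreal (1 / r ^ CARD('n)) * (\<integral>y. (if dist x y < r then ennreal (G y) else 0)) else 0)"
      using nn_integral_ball_affine[of "\<lambda>y. ennreal (G y)" r x] by auto
  qed
  finally show ?thesis .
qed

lemma ball_average_Fubini:
  fixes f g :: "real^'n \<Rightarrow> ennreal"
  assumes [measurable]: "f \<in> borel_measurable borel" "g \<in> borel_measurable borel"
  shows "(\<integral>x. f x * (\<integral>y. (if dist x y < r then g y else 0)))
      = (\<integral>y. g y * (\<integral>x. (if dist x y < r then f x else 0)))"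
proof -
  have "(\<integral>x. f x * (\<integral>y. (if dist x y < r then g y else 0)))
     = (\<integral>x. (\<integral>y. (if dist x y < r then f x * g y else 0)))"
    by (subst nn_integral_cmult[symmetric]) (auto intro!: nn_integral_cong)
  also have "\<dots> = (\<integral>y. (\<integral>x. (if dist x y < r then f x * g y else 0)))"
    by (rule lborel_pair.Fubini') measurable
  also have "\<dots> = (\<integral>y. g y * (\<integral>x. (if dist x y < r then f x else 0)))"
    by (subst nn_integral_cmult[symmetric]) (auto intro!: nn_integral_cong simp: mult.commute)
  finally show ?thesis .
qed

lemma nn_integral_ball_const:
  fixes f :: "real^'n \<Rightarrow> ennreal"
  assumes [measurable]: "f \<in> borel_measurable borel" and r: "r > 0"
  shows "(\<integral>y. (\<integral>x. (if dist x y < r then f x else 0)))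
      = ennreal (unit_ball_vol (real CARD('n)) * r ^ CARD('n)) * (\<integral>x. f x)"
proof -
  have "(\<integral>y. (if dist x y < r then 1 else 0)) = ennreal (unit_ball_vol (real CARD('n)) * r ^ CARD('n))" for x :: "real^'n"
  proof -
    have "(\<integral>y. (if dist x y < r then 1 else 0)) = (\<integral>y. indicator (ball x r) y)"
      by (intro nn_integral_cong) (simp add: indicator_def)
    then show ?thesis using r by (simp add: emeasure_ball)
  qed
  then show ?thesis
    using ball_average_Fubini[OF assms(1), of "\<lambda>_. 1" r] by (simp add: nn_integral_multc mult.commute)
qed

lemma powr_antimono_base:
  fixes a b s :: real
  assumes "0 < a" "a \<le> b" "s \<le> 0"
  shows "b powr s \<le> a powr s"
  using assms by (intro powr_mono2') auto

text \<open>Where g \<le> a, the constant a is used and the ball masses of f integrate to m times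
  the volume of a ball; where g > a, g \<le> g^p a^(1-p) and the ball masses are at most U. The set
  S localizes the p-integral near the support of f.\<close>

lemma ball_average_Young:
  fixes f :: "real^'n \<Rightarrow> ennreal" and g :: "real^'n \<Rightarrow> real"
  assumes [measurable]: "f \<in> borel_measurable borel" "g \<in> borel_measurable borel" "S \<in> sets borel"
    and g0: "\<And>y. g y \<ge> 0" and p: "p > 1" and r: "r > 0" and a: "a > 0"
    and fm: "(\<integral>x. f x) = ennreal m" "m \<ge> 0"
    and U: "\<And>y. (\<integral>x. (if dist x y < r then f x else 0)) \<le> ennreal U" "U \<ge> 0"
    and S: "\<And>x y. f x \<noteq> 0 \<Longrightarrow> dist x y < r \<Longrightarrow> y \<in> S"
    and Gp: "(\<integral>y. ennreal (g y powr p) * indicator S y) \<le> ennreal Gp" "Gp \<ge> 0"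
  shows "(\<integral>y. ennreal (g y) * (\<integral>x. (if dist x y < r then f x else 0)))
    \<le> ennreal (a * m * (unit_ball_vol (real CARD('n)) * r ^ CARD('n)) + a powr (1 - p) * U * Gp)"
proof -
  define X where "X y = (\<integral>x. (if dist x y < r then f x else 0))" for y
  have [measurable]: "X \<in> borel_measurable borel" unfolding X_def by measurable
  have pt: "ennreal (g y) * X y \<le> ennreal a * X y + ennreal (a powr (1 - p) * U) * (ennreal (g y powr p) * indicator S y)" for y
  proof (cases "X y = 0")
    case False
    have "y \<in> S"
    proof (rule ccontr)
      assume "y \<notin> S"
      then have "X y = (\<integral>\<^sup>+x. 0 \<partial>(lborel :: (real^'n) measure))"
        unfolding X_def using S by (intro nn_integral_cong) auto
      then show False using False by simp
    qed
    show ?thesis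
    proof (cases "g y \<le> a")
      case True
      then have "ennreal (g y) * X y \<le> ennreal a * X y" by (intro mult_right_mono ennreal_leI) auto
      then show ?thesis by (rule order_trans) simp
    next
      case False
      then have ga: "a < g y" by simp
      have "g y = g y powr p * g y powr (1 - p)" using ga a by (simp add: powr_add[symmetric])
      also have "\<dots> \<le> g y powr p * a powr (1 - p)"
        using ga a p by (intro mult_left_mono powr_antimono_base) auto
      finally have "ennreal (g y) * X y \<le> ennreal (g y powr p * a powr (1 - p)) * ennreal U"
        using U(1)[of y] by (intro mult_mono ennreal_leI) (auto simp: X_def)
      also have "\<dots> = ennreal (a powr (1 - p) * U) * (ennreal (g y powr p) * indicator S y)"
        using \<open>y \<in> S\<close> U(2) by (simp add: ennreal_mult'[symmetric] ennreal_mult''[symmetric] mult_ac)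
      finally show ?thesis by (rule order_trans) simp
    qed
  qed simp
  have "(\<integral>y. ennreal (g y) * X y)
    \<le> (\<integral>y. ennreal a * X y + ennreal (a powr (1 - p) * U) * (ennreal (g y powr p) * indicator S y))"
    by (intro nn_integral_mono pt)
  also have "\<dots> = ennreal a * (\<integral>y. X y) + ennreal (a powr (1 - p) * U) * (\<integral>y. ennreal (g y powr p) * indicator S y)"
    by (simp add: nn_integral_add nn_integral_cmult)
  also have "\<dots> \<le> ennreal a * (ennreal (unit_ball_vol (real CARD('n)) * r ^ CARD('n)) * ennreal m) + ennreal (a powr (1 - p) * U) * ennreal Gp"
    unfolding X_def nn_integral_ball_const[OF assms(1) r] fm by (intro add_mono mult_left_mono Gp) auto
  also have "\<dots> = ennreal (a * m * (unit_ball_vol (real CARD('n)) * r ^ CARD('n)) + a powr (1 - p) * U * Gp)"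
    using a r fm U Gp by (simp add: ennreal_mult''[symmetric] ennreal_plus[symmetric] mult_ac del: ennreal_plus)
  finally show ?thesis unfolding X_def .
qed

text \<open>A capacity-type estimate. As f lives where |w| \<ge> 1, integrating the radial
  representation against f gives at least b m, with b the volume of the unit ball. With threshold A
  r at scale r, and 1/4 at the outermost scale, the truncated parts cost b m/4 each and are
  absorbed; what remains is Gp times a scale integral in which w no longer occurs.\<close>

lemma weak_trace_inequality:
  fixes f :: "real^'n \<Rightarrow> ennreal" and g w G :: "real^'n \<Rightarrow> real" and A :: "real \<Rightarrow> real"
  assumes [measurable]: "f \<in> borel_measurable borel" "g \<in> borel_measurable borel" "S \<in> sets borel" "A \<in> borel_measurable borel"
    and p: "p > 1" and R: "R > 0"
    and fm: "(\<integral>x. f x) = ennreal m" "m \<ge> 0"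
    and ball: "\<And>y r. 0 < r \<Longrightarrow> r \<le> R \<Longrightarrow> (\<integral>x. (if dist x y < r then f x else 0)) \<le> ennreal (\<Lambda> * r ^ (CARD('n) - 1))"
    and \<Lambda>: "\<Lambda> > 0"
    and S: "\<And>x y. f x \<noteq> 0 \<Longrightarrow> dist x y < R \<Longrightarrow> y \<in> S"
    and w: "\<And>x. (w has_derivative w' x) (at x)" "\<And>x h. \<bar>w' x h\<bar> \<le> G x * norm h" and G: "continuous_on UNIV G"
    and wg: "\<And>x. \<bar>w x\<bar> \<le> g x" and Gg: "\<And>x. G x \<le> g x" and w1: "\<And>x. f x \<noteq> 0 \<Longrightarrow> \<bar>w x\<bar> \<ge> 1"
    and Gp: "(\<integral>y. ennreal (g y powr p) * indicator S y) \<le> ennreal Gp" "Gp \<ge> 0"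
    and A: "\<And>r. 0 < r \<Longrightarrow> r \<le> R \<Longrightarrow> A r > 0" "(\<integral>r. (if 0 < r \<and> r \<le> R then ennreal (A r) else 0)) \<le> ennreal (1/4)"
    and J: "(\<integral>r. (if 0 < r \<and> r \<le> R then ennreal (A r powr (1 - p) * min (\<Lambda> * r ^ (CARD('n) - 1)) m / r ^ CARD('n)) else 0)) \<le> ennreal J" "J \<ge> 0"
  shows "unit_ball_vol (real CARD('n)) * m / 2 \<le> Gp * ((1/4) powr (1 - p) * min (\<Lambda> * R ^ (CARD('n) - 1)) m / R ^ CARD('n) + J)"
proof -
  define b where "b = unit_ball_vol (real CARD('n))"
  have b: "b > 0" by (simp add: b_def)
  define U where "U r = min (\<Lambda> * r ^ (CARD('n) - 1)) m" for r
  have U0: "U r \<ge> 0" if "r > 0" for r using that \<Lambda> fm by (simp add: U_def)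
  have Xm: "(\<integral>x. (if dist x y < r then f x else 0)) \<le> ennreal m" for y r
    unfolding fm(1)[symmetric] by (intro nn_integral_mono) auto
  have XU: "(\<integral>x. (if dist x y < r then f x else 0)) \<le> ennreal (U r)" if "0 < r" "r \<le> R" for y r
    using ball[OF that, of y] Xm[of y r] by (simp add: U_def min_def)
  have g0: "g y \<ge> 0" for y using wg[of y] by linarith
  have wc: "continuous_on UNIV w"
    by (intro continuous_at_imp_continuous_on ballI has_derivative_continuous[OF w(1)])
  have [measurable]: "w \<in> borel_measurable borel" "G \<in> borel_measurable borel"
    using wc G by (auto intro: borel_measurable_continuous_onI)
  have key: "(\<integral>x. f x * (\<integral>y. (if dist x y < r then ennreal (k y) else 0)))
      \<le> ennreal (a * m * (b * r ^ CARD('n)) + a powr (1 - p) * U r * Gp)"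
    if r: "0 < r" "r \<le> R" and a: "a > 0" and [measurable]: "k \<in> borel_measurable borel" and kg: "\<And>y. k y \<le> g y" for k a r
  proof -
    have "(\<integral>x. f x * (\<integral>y. (if dist x y < r then ennreal (k y) else 0)))
      = (\<integral>y. ennreal (k y) * (\<integral>x. (if dist x y < r then f x else 0)))"
      by (rule ball_average_Fubini) measurable
    also have "\<dots> \<le> (\<integral>y. ennreal (g y) * (\<integral>x. (if dist x y < r then f x else 0)))"
      by (intro nn_integral_mono mult_right_mono ennreal_leI kg) simp
    also have "\<dots> \<le> ennreal (a * m * (b * r ^ CARD('n)) + a powr (1 - p) * U r * Gp)"
      unfolding b_def
      by (rule ball_average_Young[where S=S]) (use r a p g0 fm XU U0 Gp S in auto)
    finally show ?thesis .
  qed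
  have "ennreal (b * m) = (\<integral>x. f x * ennreal b)"
    using b fm by (subst nn_integral_multc) (auto simp: ennreal_mult' mult.commute)
  also have "\<dots> \<le> (\<integral>x. f x * (ennreal (1 / R ^ CARD('n)) * (\<integral>y. (if dist x y < R then ennreal \<bar>w y\<bar> else 0))
    + (\<integral>r. (if 0 < r \<and> r \<le> R then ennreal (1 / r ^ CARD('n)) * (\<integral>y. (if dist x y < r then ennreal (G y) else 0)) else 0))))"
  proof (rule nn_integral_mono)
    fix x
    show "f x * ennreal b \<le> f x * (ennreal (1 / R ^ CARD('n)) * (\<integral>y. (if dist x y < R then ennreal \<bar>w y\<bar> else 0))
    + (\<integral>r. (if 0 < r \<and> r \<le> R then ennreal (1 / r ^ CARD('n)) * (\<integral>y. (if dist x y < r then ennreal (G y) else 0)) else 0)))"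
    proof (cases "f x = 0")
      case False
      have "ennreal b \<le> ennreal (b * \<bar>w x\<bar>)" using w1[OF False] b by (intro ennreal_leI) simp
      also note radial_representation[OF w G R, of x, folded b_def]
      finally show ?thesis by (intro mult_left_mono) auto
    qed simp
  qed
  also have "\<dots> = ennreal (1 / R ^ CARD('n)) * (\<integral>x. f x * (\<integral>y. (if dist x y < R then ennreal \<bar>w y\<bar> else 0)))
    + (\<integral>x. (\<integral>r. (if 0 < r \<and> r \<le> R then ennreal (1 / r ^ CARD('n)) * (f x * (\<integral>y. (if dist x y < r then ennreal (G y) else 0))) else 0)))"
    unfolding distrib_left
    by (subst nn_integral_add) (auto simp: nn_integral_cmult[symmetric] mult_ac intro!: arg_cong2[where f="(+)"] nn_integral_cong)
  also have "(\<integral>x. (\<integral>r. (if 0 < r \<and> r \<le> R then ennreal (1 / r ^ CARD('n)) * (f x * (\<integral>y. (if dist x y < r then ennreal (G y) else 0))) else 0)))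
     = (\<integral>r. (\<integral>x. (if 0 < r \<and> r \<le> R then ennreal (1 / r ^ CARD('n)) * (f x * (\<integral>y. (if dist x y < r then ennreal (G y) else 0))) else 0)))"
    by (rule lborel_pair.Fubini') measurable
  finally have main: "ennreal (b * m) \<le> ennreal (1 / R ^ CARD('n)) * (\<integral>x. f x * (\<integral>y. (if dist x y < R then ennreal \<bar>w y\<bar> else 0)))
    + (\<integral>r. (\<integral>x. (if 0 < r \<and> r \<le> R then ennreal (1 / r ^ CARD('n)) * (f x * (\<integral>y. (if dist x y < r then ennreal (G y) else 0))) else 0)))" .
  have "ennreal (1 / R ^ CARD('n)) * (\<integral>x. f x * (\<integral>y. (if dist x y < R then ennreal \<bar>w y\<bar> else 0)))
    \<le> ennreal (1 / R ^ CARD('n)) * ennreal (1/4 * m * (b * R ^ CARD('n)) + (1/4) powr (1 - p) * U R * Gp)"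
    by (intro mult_left_mono key) (use R wg in auto)
  also have "\<dots> = ennreal (b * m / 4 + Gp * ((1/4) powr (1 - p) * U R / R ^ CARD('n)))"
    using R by (subst ennreal_mult'[symmetric]) (auto simp: field_simps)
  finally have h1: "ennreal (1 / R ^ CARD('n)) * (\<integral>x. f x * (\<integral>y. (if dist x y < R then ennreal \<bar>w y\<bar> else 0)))
    \<le> ennreal (b * m / 4 + Gp * ((1/4) powr (1 - p) * U R / R ^ CARD('n)))" .
  have "(\<integral>r. (\<integral>x. (if 0 < r \<and> r \<le> R then ennreal (1 / r ^ CARD('n)) * (f x * (\<integral>y. (if dist x y < r then ennreal (G y) else 0))) else 0)))
    \<le> (\<integral>r. ennreal (b * m) * (if 0 < r \<and> r \<le> R then ennreal (A r) else 0)
          + ennreal Gp * (if 0 < r \<and> r \<le> R then ennreal (A r powr (1 - p) * U r / r ^ CARD('n)) else 0))"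
  proof (rule nn_integral_mono)
    fix r
    show "(\<integral>x. (if 0 < r \<and> r \<le> R then ennreal (1 / r ^ CARD('n)) * (f x * (\<integral>y. (if dist x y < r then ennreal (G y) else 0))) else 0))
      \<le> ennreal (b * m) * (if 0 < r \<and> r \<le> R then ennreal (A r) else 0)
          + ennreal Gp * (if 0 < r \<and> r \<le> R then ennreal (A r powr (1 - p) * U r / r ^ CARD('n)) else 0)"
    proof (cases "0 < r \<and> r \<le> R")
      case True
      have "(\<integral>x. ennreal (1 / r ^ CARD('n)) * (f x * (\<integral>y. (if dist x y < r then ennreal (G y) else 0))))
        = ennreal (1 / r ^ CARD('n)) * (\<integral>x. f x * (\<integral>y. (if dist x y < r then ennreal (G y) else 0)))"
        by (rule nn_integral_cmult) measurable
      also have "\<dots> \<le> ennreal (1 / r ^ CARD('n)) * ennreal (A r * m * (b * r ^ CARD('n)) + A r powr (1 - p) * U r * Gp)"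
        by (intro mult_left_mono key) (use True A Gg in auto)
      also have "\<dots> = ennreal (b * m * A r + Gp * (A r powr (1 - p) * U r / r ^ CARD('n)))"
        using True by (subst ennreal_mult'[symmetric]) (auto simp: field_simps)
      also have "\<dots> = ennreal (b * m) * ennreal (A r) + ennreal Gp * ennreal (A r powr (1 - p) * U r / r ^ CARD('n))"
        using True A(1)[of r] b fm Gp U0[of r]
        by (simp add: ennreal_mult''[symmetric] ennreal_mult'[symmetric] ennreal_plus[symmetric] del: ennreal_plus)
      finally show ?thesis using True by simp
    next
      case False
      then have F: "(0 < r \<and> r \<le> R) = False" by simp
      show ?thesis unfolding F by simp
    qed
  qed
  also have "\<dots> = ennreal (b * m) * (\<integral>r. (if 0 < r \<and> r \<le> R then ennreal (A r) else 0))
     + ennreal Gp * (\<integral>r. (if 0 < r \<and> r \<le> R then ennreal (A r powr (1 - p) * U r / r ^ CARD('n)) else 0))"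
    unfolding U_def by (subst nn_integral_add) (simp_all add: nn_integral_cmult)
  also have "\<dots> \<le> ennreal (b * m) * ennreal (1/4) + ennreal Gp * ennreal J"
    using A(2) J(1) unfolding U_def by (intro add_mono mult_left_mono) auto
  finally have h2: "(\<integral>r. (\<integral>x. (if 0 < r \<and> r \<le> R then ennreal (1 / r ^ CARD('n)) * (f x * (\<integral>y. (if dist x y < r then ennreal (G y) else 0))) else 0)))
    \<le> ennreal (b * m) * ennreal (1/4) + ennreal Gp * ennreal J" .
  note order_trans[OF main add_mono[OF h1 h2]]
  also have "ennreal (b * m / 4 + Gp * ((1/4) powr (1 - p) * U R / R ^ CARD('n))) + (ennreal (b * m) * ennreal (1/4) + ennreal Gp * ennreal J)
    = ennreal (b * m / 4 + Gp * ((1/4) powr (1 - p) * U R / R ^ CARD('n)) + (b * m / 4 + Gp * J))"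
    using b fm Gp J U0[OF R] R
    by (simp add: ennreal_mult''[symmetric] ennreal_mult'[symmetric] ennreal_plus[symmetric] del: ennreal_plus)
  finally have "b * m \<le> b * m / 4 + Gp * ((1/4) powr (1 - p) * U R / R ^ CARD('n)) + (b * m / 4 + Gp * J)"
    using b fm Gp J U0[OF R] R by (subst (asm) ennreal_le_iff) auto
  then have "b * m / 2 \<le> Gp * ((1/4) powr (1 - p) * U R / R ^ CARD('n)) + Gp * J" by linarith
  then show ?thesis unfolding b_def[symmetric] U_def[symmetric] by (simp only: distrib_left)
qed

text \<open>The function A replaces an application of Hoelder's inequality on each ball: it is the threshold
  at which the gradient is truncated at scale r.\<close>

definition admissible_exponents :: "nat \<Rightarrow> real \<Rightarrow> real \<Rightarrow> bool" where
  "admissible_exponents n p \<beta> \<longleftrightarrow> (\<exists>K>0. \<forall>\<Lambda>>0. \<forall>m>0. \<exists>A \<in> borel_measurable borel.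
     (\<forall>r. 0 < r \<and> r \<le> 1/4 \<longrightarrow> A r > 0) \<and>
     (\<integral>r. (if 0 < r \<and> r \<le> 1/4 then ennreal (A r) else 0)) \<le> ennreal (1/4) \<and>
     (\<integral>r. (if 0 < r \<and> r \<le> 1/4 then ennreal (A r powr (1 - p) * min (\<Lambda> * r ^ (n - 1)) m / r ^ n) else 0))
       \<le> ennreal (K * \<Lambda> powr \<beta> * m powr (1 - \<beta>)))"

lemma ennreal_mult_add_mult:
  assumes "a \<ge> 0" "b \<ge> 0" "c \<ge> 0" "d \<ge> 0"
  shows "ennreal a * ennreal b + ennreal c * ennreal d = ennreal (a * b + c * d)"
  using assms by (simp only: ennreal_mult[symmetric] ennreal_plus[symmetric] mult_nonneg_nonneg)

lemma min_le_weighted_product: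
  fixes a b \<beta> :: real
  assumes "a > 0" "b > 0" "0 \<le> \<beta>" "\<beta> \<le> 1"
  shows "min a b \<le> a powr \<beta> * b powr (1 - \<beta>)"
proof -
  have m: "min a b > 0" using assms by simp
  have "min a b = min a b powr \<beta> * min a b powr (1 - \<beta>)" using m by (simp add: powr_add[symmetric])
  also have "\<dots> \<le> a powr \<beta> * b powr (1 - \<beta>)"
    using m assms by (intro mult_mono powr_mono2) auto
  finally show ?thesis .
qed

lemma nn_integral_powr_initial:
  fixes s R :: real
  assumes s: "s > -1" and R: "R > 0"
  shows "(\<integral>r. (if 0 < r \<and> r \<le> R then ennreal (r powr s) else 0)) = ennreal (R powr (s + 1) / (s + 1))"
proof -
  have "((\<lambda>r. r powr s) has_integral R powr (s + 1) / (s + 1)) {0..R}"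
    using has_integral_powr_from_0[OF s, of R] R by simp
  then have "((\<lambda>r. if 0 < r \<and> r \<le> R then r powr s else 0) has_integral R powr (s + 1) / (s + 1)) {0..R}"
    by (rule has_integral_spike[of "{0}", rotated 2]) auto
  then have "((\<lambda>r. if 0 < r \<and> r \<le> R then r powr s else 0) has_integral R powr (s + 1) / (s + 1)) UNIV"
    by (rule has_integral_on_superset) auto
  then have "(\<integral>r. ennreal (if 0 < r \<and> r \<le> R then r powr s else 0)) = ennreal (R powr (s + 1) / (s + 1))"
    by (intro nn_integral_has_integral_lborel) auto
  then show ?thesis by (simp add: if_distrib[of ennreal] cong: if_cong)
qed

lemma nn_integral_powr_tail:
  fixes s R :: real
  assumes s: "s < -1" and R: "R > 0"
  shows "(\<integral>r. (if R < r then ennreal (r powr s) else 0)) \<le> ennreal (- (R powr (s + 1)) / (s + 1))"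
proof -
  have "((\<lambda>r. r powr s) has_integral - (R powr (s + 1)) / (s + 1)) {R..}"
    by (rule has_integral_powr_to_inf[OF s R])
  then have "((\<lambda>r. if R \<le> r then r powr s else 0) has_integral - (R powr (s + 1)) / (s + 1)) UNIV"
    by (subst (asm) has_integral_restrict_UNIV[symmetric]) (simp add: atLeast_def)
  then have "(\<integral>r. ennreal (if R \<le> r then r powr s else 0)) = ennreal (- (R powr (s + 1)) / (s + 1))"
    by (intro nn_integral_has_integral_lborel) auto
  moreover have "(\<integral>r. (if R < r then ennreal (r powr s) else 0)) \<le> (\<integral>r. ennreal (if R \<le> r then r powr s else 0))"
    by (intro nn_integral_mono) auto
  ultimately show ?thesis by simp
qed

text \<open>The surplus c = p + \<beta> (n - 1) - n > 0 is split in two: \<delta> (p - 1) = c/2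
  makes the threshold r^(\<delta> - 1) integrable at 0, and the other half leaves the exponent c/2 -
  1 > -1 in the second integral, after the minimum has been replaced by a geometric mean. A0
  normalizes the first integral to 1/4.\<close>

lemma admissible_exponents_subcritical:
  fixes p \<beta> :: real
  assumes n: "n \<ge> 1" and p: "p > 1" and \<beta>: "0 < \<beta>" "\<beta> \<le> 1" and sub: "\<beta> * (real n - 1) > real n - p"
  shows "admissible_exponents n p \<beta>"
proof -
  define c where "c = p + \<beta> * (real n - 1) - real n"
  have c: "c > 0" using sub by (simp add: c_def)
  define \<delta> where "\<delta> = c / (2 * (p - 1))"
  have \<delta>: "\<delta> > 0" using c p by (simp add: \<delta>_def)
  have \<delta>p: "\<delta> * (p - 1) = c / 2" using p by (simp add: \<delta>_def field_simps)
  define A0 where "A0 = \<delta> / (4 * (1/4) powr \<delta>)"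
  have A0: "A0 > 0" using \<delta> by (simp add: A0_def)
  define A where "A r = A0 * r powr (\<delta> - 1)" for r :: real
  define s where "s = (\<delta> - 1) * (1 - p) + (real n - 1) * \<beta> - real n"
  have s: "s = c / 2 - 1" using \<delta>p by (simp add: s_def c_def algebra_simps)
  have s1: "s > -1" using c s by simp
  define K where "K = A0 powr (1 - p) * ((1/4) powr (s + 1) / (s + 1))"
  have K: "K > 0" using A0 s1 by (simp add: K_def)
  have [measurable]: "A \<in> borel_measurable borel" unfolding A_def by measurable
  have "\<forall>\<Lambda>>0. \<forall>m>0. \<exists>A \<in> borel_measurable borel.
     (\<forall>r. 0 < r \<and> r \<le> 1/4 \<longrightarrow> A r > 0) \<and>
     (\<integral>r. (if 0 < r \<and> r \<le> 1/4 then ennreal (A r) else 0)) \<le> ennreal (1/4) \<and>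
     (\<integral>r. (if 0 < r \<and> r \<le> 1/4 then ennreal (A r powr (1 - p) * min (\<Lambda> * r ^ (n - 1)) m / r ^ n) else 0))
       \<le> ennreal (K * \<Lambda> powr \<beta> * m powr (1 - \<beta>))"
  proof (intro allI impI bexI[of _ A] conjI)
    fix \<Lambda> m :: real assume \<Lambda>: "\<Lambda> > 0" and m: "m > 0"
    show "A r > 0" if "0 < r \<and> r \<le> 1/4" for r using that A0 by (simp add: A_def)
    have "(\<integral>r. (if 0 < r \<and> r \<le> 1/4 then ennreal (A r) else 0))
      = (\<integral>r. ennreal A0 * (if 0 < r \<and> r \<le> 1/4 then ennreal (r powr (\<delta> - 1)) else 0))"
      using A0 by (intro nn_integral_cong) (simp add: A_def ennreal_mult')
    also have "\<dots> = ennreal A0 * ennreal ((1/4) powr \<delta> / \<delta>)"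
      using nn_integral_powr_initial[of "\<delta> - 1" "1/4"] \<delta> by (simp add: nn_integral_cmult)
    also have "\<dots> = ennreal (1/4)"
      using \<delta> A0 by (subst ennreal_mult'[symmetric]) (auto simp: A0_def)
    finally show "(\<integral>r. (if 0 < r \<and> r \<le> 1/4 then ennreal (A r) else 0)) \<le> ennreal (1/4)" by simp
    have pt: "A r powr (1 - p) * min (\<Lambda> * r ^ (n - 1)) m / r ^ n \<le> A0 powr (1 - p) * \<Lambda> powr \<beta> * m powr (1 - \<beta>) * r powr s"
      if r: "0 < r" for r
    proof -
      have "min (\<Lambda> * r ^ (n - 1)) m \<le> (\<Lambda> * r ^ (n - 1)) powr \<beta> * m powr (1 - \<beta>)"
        using r \<Lambda> m \<beta> by (intro min_le_weighted_product) auto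
      also have "(\<Lambda> * r ^ (n - 1)) powr \<beta> = \<Lambda> powr \<beta> * r powr ((real n - 1) * \<beta>)"
        using r \<Lambda> n by (simp add: powr_mult powr_realpow[symmetric] powr_powr of_nat_diff)
      finally have "A r powr (1 - p) * min (\<Lambda> * r ^ (n - 1)) m / r ^ n
         \<le> A r powr (1 - p) * (\<Lambda> powr \<beta> * r powr ((real n - 1) * \<beta>) * m powr (1 - \<beta>)) / r ^ n"
        using r by (intro divide_right_mono mult_left_mono) auto
      also have "A r powr (1 - p) * (\<Lambda> powr \<beta> * r powr ((real n - 1) * \<beta>) * m powr (1 - \<beta>)) / r ^ n = A0 powr (1 - p) * r powr ((\<delta> - 1) * (1 - p)) * (\<Lambda> powr \<beta> * r powr ((real n - 1) * \<beta>) * m powr (1 - \<beta>)) / r ^ n"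
        using A0 r by (simp add: A_def powr_mult powr_powr)
      also have "\<dots> = A0 powr (1 - p) * \<Lambda> powr \<beta> * m powr (1 - \<beta>) * (r powr ((\<delta> - 1) * (1 - p)) * r powr ((real n - 1) * \<beta>) / r powr real n)"
        using r by (simp add: powr_realpow)
      also have "r powr ((\<delta> - 1) * (1 - p)) * r powr ((real n - 1) * \<beta>) / r powr real n = r powr s"
        using r by (simp add: s_def powr_add powr_diff)
      finally show ?thesis .
    qed
    have "(\<integral>r. (if 0 < r \<and> r \<le> 1/4 then ennreal (A r powr (1 - p) * min (\<Lambda> * r ^ (n - 1)) m / r ^ n) else 0))
      \<le> (\<integral>r. ennreal (A0 powr (1 - p) * \<Lambda> powr \<beta> * m powr (1 - \<beta>)) * (if 0 < r \<and> r \<le> 1/4 then ennreal (r powr s) else 0))"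
      using pt by (intro nn_integral_mono) (auto simp: ennreal_mult'[symmetric] intro!: ennreal_leI)
    also have "\<dots> = ennreal (A0 powr (1 - p) * \<Lambda> powr \<beta> * m powr (1 - \<beta>)) * ennreal ((1/4) powr (s + 1) / (s + 1))"
      using nn_integral_powr_initial[OF s1, of "1/4"] by (simp add: nn_integral_cmult)
    also have "\<dots> = ennreal (K * \<Lambda> powr \<beta> * m powr (1 - \<beta>))"
      using s1 by (subst ennreal_mult'[symmetric]) (auto simp: K_def mult_ac)
    finally show "(\<integral>r. (if 0 < r \<and> r \<le> 1/4 then ennreal (A r powr (1 - p) * min (\<Lambda> * r ^ (n - 1)) m / r ^ n) else 0))
      \<le> ennreal (K * \<Lambda> powr \<beta> * m powr (1 - \<beta>))" .
  qed measurable
  then show ?thesis unfolding admissible_exponents_def using K by blast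
qed

text \<open>In the plane the exponent 4/3 is allowed, for which the trace exponent is exactly 2 and no room is left;
  the threshold then has to be adapted to the mass m of the level set.\<close>

lemma admissible_exponents_critical_plane: "admissible_exponents 2 (4/3) (2/3)"
proof -
  define A0 :: real where "A0 = 1/32"
  define K :: real where "K = A0 powr (-1/3) * 8"
  have K: "K > 0" by (simp add: K_def A0_def)
  have "\<forall>\<Lambda>>0. \<forall>m>0. \<exists>A \<in> borel_measurable borel.
     (\<forall>r. 0 < r \<and> r \<le> 1/4 \<longrightarrow> A r > 0) \<and>
     (\<integral>r. (if 0 < r \<and> r \<le> 1/4 then ennreal (A r) else 0)) \<le> ennreal (1/4) \<and>
     (\<integral>r. (if 0 < r \<and> r \<le> 1/4 then ennreal (A r powr (1 - 4/3) * min (\<Lambda> * r ^ (2 - 1)) m / r ^ 2) else 0))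
       \<le> ennreal (K * \<Lambda> powr (2/3) * m powr (1 - 2/3))"
  proof (intro allI impI)
    fix \<Lambda> m :: real assume \<Lambda>: "\<Lambda> > 0" and m: "m > 0"
    define R where "R = m / \<Lambda>"
    have R: "R > 0" using \<Lambda> m by (simp add: R_def)
    have mR: "m = \<Lambda> * R" using \<Lambda> by (simp add: R_def)
    \<comment> \<open>At r = R the two bounds \<Lambda> r and m cross. The exponents -3/4 and -5/4
      are integrable towards 0 and towards infinity; each side contributes 4 A0, so A0 = 1/32 gives
      1/4.\<close>
    define A where "A r = (if r \<le> R then A0 * R powr (-1/4) * r powr (-3/4) else A0 * R powr (1/4) * r powr (-5/4))" for r :: real
    have A0: "A0 > 0" by (simp add: A0_def)
    have [measurable]: "A \<in> borel_measurable borel" unfolding A_def by measurable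
    have Apos: "A r > 0" if "r > 0" for r using that A0 R by (simp add: A_def)
    have i1: "(\<integral>r. (if 0 < r \<and> r \<le> 1/4 then ennreal (A r) else 0)) \<le> ennreal (1/4)"
    proof -
      have "(\<integral>r. (if 0 < r \<and> r \<le> 1/4 then ennreal (A r) else 0))
        \<le> (\<integral>r. ennreal (A0 * R powr (-1/4)) * (if 0 < r \<and> r \<le> R then ennreal (r powr (-3/4)) else 0)
           + ennreal (A0 * R powr (1/4)) * (if R < r then ennreal (r powr (-5/4)) else 0))"
        using A0 by (intro nn_integral_mono) (auto simp: A_def ennreal_mult''[symmetric])
      also have "\<dots> = ennreal (A0 * R powr (-1/4)) * (\<integral>r. (if 0 < r \<and> r \<le> R then ennreal (r powr (-3/4)) else 0))
           + ennreal (A0 * R powr (1/4)) * (\<integral>r. (if R < r then ennreal (r powr (-5/4)) else 0))"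
        by (subst nn_integral_add) (simp_all add: nn_integral_cmult)
      also have "\<dots> \<le> ennreal (A0 * R powr (-1/4)) * ennreal (R powr (1/4) / (1/4)) + ennreal (A0 * R powr (1/4)) * ennreal (- (R powr (-1/4)) / (-1/4))"
        using nn_integral_powr_initial[of "-3/4" R] nn_integral_powr_tail[of "-5/4" R] R
        by (intro add_mono mult_left_mono) auto
      also have "\<dots> = ennreal (A0 * 8)"
        using A0 R by (simp add: ennreal_mult''[symmetric] ennreal_plus[symmetric] mult.assoc powr_add[symmetric] del: ennreal_plus)
      finally show ?thesis by (simp add: A0_def)
    qed
    have i2: "(\<integral>r. (if 0 < r \<and> r \<le> 1/4 then ennreal (A r powr (1 - 4/3) * min (\<Lambda> * r ^ (2 - 1)) m / r ^ 2) else 0))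
       \<le> ennreal (K * \<Lambda> powr (2/3) * m powr (1 - 2/3))"
    proof -
      have pt1: "A r powr (1 - 4/3) * min (\<Lambda> * r ^ (2 - 1)) m / r ^ 2 \<le> A0 powr (-1/3) * R powr (1/12) * \<Lambda> * r powr (-3/4)"
        if r: "0 < r" "r \<le> R" for r
      proof -
        have e1: "A r powr (1 - 4/3) = A0 powr (-1/3) * R powr (1/12) * r powr (1/4)"
          using r R A0 by (simp add: A_def powr_mult powr_powr)
        have e2: "min (\<Lambda> * r ^ (2 - 1)) m / r ^ 2 \<le> \<Lambda> * r powr (-1)"
        proof -
          have "min (\<Lambda> * r ^ (2 - 1)) m / r ^ 2 \<le> \<Lambda> * r / r ^ 2" using r by (intro divide_right_mono) auto
          also have "\<dots> = \<Lambda> * r powr (-1)" using r by (simp add: power2_eq_square powr_minus divide_inverse)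
          finally show ?thesis .
        qed
        have "A r powr (1 - 4/3) * (min (\<Lambda> * r ^ (2 - 1)) m / r ^ 2) \<le> (A0 powr (-1/3) * R powr (1/12) * r powr (1/4)) * (\<Lambda> * r powr (-1))"
          unfolding e1 by (rule mult_left_mono[OF e2]) simp
        also have "\<dots> = A0 powr (-1/3) * R powr (1/12) * \<Lambda> * (r powr (1/4) * r powr (-1))" by simp
        also have "r powr (1/4) * r powr (-1) = r powr (-3/4)" unfolding powr_add[symmetric] by simp
        finally show ?thesis by simp
      qed
      have pt2: "A r powr (1 - 4/3) * min (\<Lambda> * r ^ (2 - 1)) m / r ^ 2 \<le> A0 powr (-1/3) * R powr (-1/12) * (\<Lambda> * R) * r powr (-19/12)"
        if r: "R < r" for r
      proof -
        have r0: "r > 0" using r R by simp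
        have e1: "A r powr (1 - 4/3) = A0 powr (-1/3) * R powr (-1/12) * r powr (5/12)"
          using r R A0 by (simp add: A_def powr_mult powr_powr)
        have e2: "min (\<Lambda> * r ^ (2 - 1)) m / r ^ 2 \<le> (\<Lambda> * R) * r powr (-2)"
        proof -
          have "r powr (-2) = inverse (r ^ 2)" using r0 by (simp only: powr_minus powr_numeral)
          then show ?thesis using r0 by (simp add: mR divide_inverse mult_right_mono)
        qed
        have "A r powr (1 - 4/3) * (min (\<Lambda> * r ^ (2 - 1)) m / r ^ 2) \<le> (A0 powr (-1/3) * R powr (-1/12) * r powr (5/12)) * ((\<Lambda> * R) * r powr (-2))"
          unfolding e1 by (rule mult_left_mono[OF e2]) simp
        also have "\<dots> = A0 powr (-1/3) * R powr (-1/12) * (\<Lambda> * R) * (r powr (5/12) * r powr (-2))" by simp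
        also have "r powr (5/12) * r powr (-2) = r powr (-19/12)" unfolding powr_add[symmetric] by simp
        finally show ?thesis by simp
      qed
      have "(\<integral>r. (if 0 < r \<and> r \<le> 1/4 then ennreal (A r powr (1 - 4/3) * min (\<Lambda> * r ^ (2 - 1)) m / r ^ 2) else 0))
        \<le> (\<integral>r. ennreal (A0 powr (-1/3) * R powr (1/12) * \<Lambda>) * (if 0 < r \<and> r \<le> R then ennreal (r powr (-3/4)) else 0)
           + ennreal (A0 powr (-1/3) * R powr (-1/12) * (\<Lambda> * R)) * (if R < r then ennreal (r powr (-19/12)) else 0))"
      proof (rule nn_integral_mono)
        fix r :: real
        consider "r \<le> 0" | "0 < r" "r \<le> R" | "R < r" by linarith
        then show "(if 0 < r \<and> r \<le> 1/4 then ennreal (A r powr (1 - 4/3) * min (\<Lambda> * r ^ (2 - 1)) m / r ^ 2) else 0)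
          \<le> ennreal (A0 powr (-1/3) * R powr (1/12) * \<Lambda>) * (if 0 < r \<and> r \<le> R then ennreal (r powr (-3/4)) else 0)
           + ennreal (A0 powr (-1/3) * R powr (-1/12) * (\<Lambda> * R)) * (if R < r then ennreal (r powr (-19/12)) else 0)"
        proof cases
          case 2
          then have "ennreal (A r powr (1 - 4/3) * min (\<Lambda> * r ^ (2 - 1)) m / r ^ 2) \<le> ennreal (A0 powr (-1/3) * R powr (1/12) * \<Lambda>) * ennreal (r powr (-3/4))"
            using pt1[OF 2] by (subst ennreal_mult''[symmetric]) (auto intro!: ennreal_leI)
          then show ?thesis using 2 by auto
        next
          case 3
          then have "ennreal (A r powr (1 - 4/3) * min (\<Lambda> * r ^ (2 - 1)) m / r ^ 2) \<le> ennreal (A0 powr (-1/3) * R powr (-1/12) * (\<Lambda> * R)) * ennreal (r powr (-19/12))"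
            using pt2[OF 3] by (subst ennreal_mult''[symmetric]) (auto intro!: ennreal_leI)
          then show ?thesis using 3 by auto
        qed simp
      qed
      also have "\<dots> = ennreal (A0 powr (-1/3) * R powr (1/12) * \<Lambda>) * (\<integral>r. (if 0 < r \<and> r \<le> R then ennreal (r powr (-3/4)) else 0))
           + ennreal (A0 powr (-1/3) * R powr (-1/12) * (\<Lambda> * R)) * (\<integral>r. (if R < r then ennreal (r powr (-19/12)) else 0))"
        by (subst nn_integral_add) (simp_all add: nn_integral_cmult)
      also have "\<dots> \<le> ennreal (A0 powr (-1/3) * R powr (1/12) * \<Lambda>) * ennreal (R powr (1/4) / (1/4))
           + ennreal (A0 powr (-1/3) * R powr (-1/12) * (\<Lambda> * R)) * ennreal (- (R powr (-7/12)) / (-7/12))"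
        using nn_integral_powr_initial[of "-3/4" R] nn_integral_powr_tail[of "-19/12" R] R
        by (intro add_mono mult_left_mono) auto
      also have "\<dots> = ennreal (A0 powr (-1/3) * R powr (1/12) * \<Lambda> * (R powr (1/4) / (1/4)) + A0 powr (-1/3) * R powr (-1/12) * (\<Lambda> * R) * (- (R powr (-7/12)) / (-7/12)))"
        by (rule ennreal_mult_add_mult) (use R \<Lambda> in auto)
      also have "A0 powr (-1/3) * R powr (1/12) * \<Lambda> * (R powr (1/4) / (1/4)) + A0 powr (-1/3) * R powr (-1/12) * (\<Lambda> * R) * (- (R powr (-7/12)) / (-7/12))
         = A0 powr (-1/3) * \<Lambda> * (4 * (R powr (1/12) * R powr (1/4)) + 12/7 * (R powr (-1/12) * R powr 1 * R powr (-7/12)))"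
        using R by (simp add: algebra_simps)
      also have "R powr (1/12) * R powr (1/4) = R powr (1/3)" unfolding powr_add[symmetric] by simp
      also have "R powr (-1/12) * R powr 1 * R powr (-7/12) = R powr (1/3)"
        unfolding powr_add[symmetric] by simp
      also have "A0 powr (-1/3) * \<Lambda> * (4 * R powr (1/3) + 12/7 * R powr (1/3)) \<le> K * \<Lambda> * R powr (1/3)"
        unfolding K_def using \<Lambda> by (simp add: algebra_simps)
      also have "K * \<Lambda> * R powr (1/3) = K * \<Lambda> powr (2/3) * m powr (1 - 2/3)"
      proof -
        have "\<Lambda> powr (2/3) * m powr (1 - 2/3) = \<Lambda> powr (2/3) * \<Lambda> powr (1/3) * R powr (1/3)"
          using \<Lambda> R by (simp add: mR powr_mult)
        also have "\<Lambda> powr (2/3) * \<Lambda> powr (1/3) = \<Lambda>" using \<Lambda> by (simp add: powr_add[symmetric])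
        finally show ?thesis by simp
      qed
      finally show ?thesis by (simp add: ennreal_leI)
    qed
    show "\<exists>A \<in> borel_measurable borel.
     (\<forall>r. 0 < r \<and> r \<le> 1/4 \<longrightarrow> A r > 0) \<and>
     (\<integral>r. (if 0 < r \<and> r \<le> 1/4 then ennreal (A r) else 0)) \<le> ennreal (1/4) \<and>
     (\<integral>r. (if 0 < r \<and> r \<le> 1/4 then ennreal (A r powr (1 - 4/3) * min (\<Lambda> * r ^ (2 - 1)) m / r ^ 2) else 0))
       \<le> ennreal (K * \<Lambda> powr (2/3) * m powr (1 - 2/3))"
      using Apos i1 i2 by (intro bexI[of _ A]) auto
  qed
  then show ?thesis unfolding admissible_exponents_def using K by blast
qed

section \<open>Truncation to dyadic level sets\<close>

definition bump :: "real \<Rightarrow> real" where "bump y = (max 0 ((y - 1/2) * (4 - y)))\<^sup>2"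

definition bump' :: "real \<Rightarrow> real" where "bump' y = 2 * max 0 ((y - 1/2) * (4 - y)) * (9/2 - 2 * y)"

lemma DERIV_bump: "(bump has_real_derivative bump' y) (at y)"
proof -
  have d: "((\<lambda>y. (y - 1/2) * (4 - y)) has_real_derivative 9/2 - 2 * y) (at y)"
    by (auto intro!: derivative_eq_intros simp: algebra_simps)
  show ?thesis
    using DERIV_chain2[OF DERIV_max_0_power[of 0] d] by (simp add: bump_def[abs_def] bump'_def numeral_2_eq_2)
qed

lemma bump_facts:
  shows "0 \<le> bump y" "bump y \<le> 16" "\<bar>bump' y\<bar> \<le> 28" "1 \<le> y \<Longrightarrow> y \<le> 2 \<Longrightarrow> 1 \<le> bump y"
    "\<not> (1/2 < y \<and> y < 4) \<Longrightarrow> bump y = 0" "\<not> (1/2 < y \<and> y < 4) \<Longrightarrow> bump' y = 0"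
proof -
  define P where "P = (y - 1/2) * (4 - y)"
  have "P = 49/16 - (y - 9/4)\<^sup>2" by (simp add: P_def power2_eq_square algebra_simps)
  then have "P \<le> 4" using zero_le_power2[of "y - 9/4"] by linarith
  then have P4: "max 0 P \<le> 4" by simp
  have out: "max 0 P = 0" if "\<not> (1/2 < y \<and> y < 4)"
  proof -
    have "P \<le> 0" unfolding P_def
    proof (cases "y \<le> 1/2")
      case True
      then show "(y - 1/2) * (4 - y) \<le> 0" by (intro mult_nonpos_nonneg) auto
    next
      case False
      then show "(y - 1/2) * (4 - y) \<le> 0" using that by (intro mult_nonneg_nonpos) auto
    qed
    then show ?thesis by simp
  qed
  show "0 \<le> bump y" by (simp add: bump_def)
  have "(max 0 P)\<^sup>2 \<le> 4\<^sup>2" using P4 by (intro power_mono) auto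
  then show "bump y \<le> 16" by (simp add: bump_def P_def)
  show o1: "bump y = 0" if "\<not> (1/2 < y \<and> y < 4)" using out[OF that] by (simp add: bump_def P_def)
  show o2: "bump' y = 0" if "\<not> (1/2 < y \<and> y < 4)" using out[OF that] by (simp add: bump'_def P_def)
  show "\<bar>bump' y\<bar> \<le> 28"
  proof (cases "1/2 < y \<and> y < 4")
    case True
    then have "\<bar>9/2 - 2 * y\<bar> \<le> 7/2" by (intro abs_leI) auto
    then have "(2 * max 0 P) * \<bar>9/2 - 2 * y\<bar> \<le> 8 * (7/2)" using P4 by (intro mult_mono) auto
    then show ?thesis by (simp add: bump'_def P_def abs_mult)
  qed (simp add: o2)
  show "1 \<le> bump y" if "1 \<le> y" "y \<le> 2"
  proof -
    have "1/2 * 2 \<le> P" unfolding P_def using that by (intro mult_mono) auto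
    then show ?thesis using one_le_power[of "max 0 P" 2] by (simp add: bump_def P_def)
  qed
qed

lemma bump_comp_deriv:
  fixes v :: "real^'n \<Rightarrow> real^'m"
  assumes v: "\<And>x. (v has_derivative (\<lambda>h. Dv x *v h)) (at x)" and q: "q > 0"
  shows "((\<lambda>x. bump ((norm (v x))\<^sup>2 / q)) has_derivative (\<lambda>h. bump' ((norm (v x))\<^sup>2 / q) * (2 * (v x \<bullet> (Dv x *v h)) / q))) (at x)"
proof -
  have "((\<lambda>x. v x \<bullet> v x / q) has_derivative (\<lambda>h. (v x \<bullet> (Dv x *v h) + (Dv x *v h) \<bullet> v x) / q)) (at x)"
    using q by (auto intro!: derivative_eq_intros v simp: add_divide_distrib)
  then have 1: "((\<lambda>x. (norm (v x))\<^sup>2 / q) has_derivative (\<lambda>h. 2 * (v x \<bullet> (Dv x *v h)) / q)) (at x)"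
    by (simp add: power2_norm_eq_inner inner_commute)
  show ?thesis
    using has_derivative_compose[OF 1 DERIV_bump[of "(norm (v x))\<^sup>2 / q", unfolded has_field_derivative_def]] .
qed

text \<open>The weak inequality for w = \<open>bump\<close> (|v|^2/q), which is at least 1 on the
  shell q \<le> |v|^2 < 2 q and vanishes off q/2 < |v|^2 < 4 q. There |v| \<le> 2 sqrt q, so |grad
  w| \<le> 28 * 2 * 2 |Dv| / sqrt q, the origin of 112. The mass m stands on both sides; dividing by
  m^(1-\<beta>) leaves m^\<beta>.\<close>

lemma level_set_trace:
  fixes e :: "real^'n \<Rightarrow> ennreal" and v :: "real^'n \<Rightarrow> real^'m"
  assumes [measurable]: "e \<in> borel_measurable borel" "S \<in> sets borel"
    and p: "p > 1" and \<beta>: "0 < \<beta>" "\<beta> \<le> 1" and K: "K > 0"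
    and adm: "\<And>\<Lambda> m. \<Lambda> > 0 \<Longrightarrow> m > 0 \<Longrightarrow> \<exists>A \<in> borel_measurable borel.
     (\<forall>r. 0 < r \<and> r \<le> 1/4 \<longrightarrow> A r > 0) \<and>
     (\<integral>r. (if 0 < r \<and> r \<le> 1/4 then ennreal (A r) else 0)) \<le> ennreal (1/4) \<and>
     (\<integral>r. (if 0 < r \<and> r \<le> 1/4 then ennreal (A r powr (1 - p) * min (\<Lambda> * r ^ (CARD('n) - 1)) m / r ^ CARD('n)) else 0))
       \<le> ennreal (K * \<Lambda> powr \<beta> * m powr (1 - \<beta>))"
    and ball: "\<And>y r. 0 < r \<Longrightarrow> r \<le> 1/4 \<Longrightarrow> (\<integral>x. (if dist x y < r then e x else 0)) \<le> ennreal (\<Lambda> * r ^ (CARD('n) - 1))"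
    and \<Lambda>: "\<Lambda> > 0" and S: "\<And>x y. e x \<noteq> 0 \<Longrightarrow> dist x y < 1/4 \<Longrightarrow> y \<in> S"
    and v: "\<And>x. (v has_derivative (\<lambda>h. Dv x *v h)) (at x)" and Dv: "continuous_on UNIV Dv"
    and q: "q > 0"
    and m: "(\<integral>x. (if q \<le> (norm (v x))\<^sup>2 \<and> (norm (v x))\<^sup>2 < 2 * q then e x else 0)) = ennreal m" "m \<ge> 0"
    and a: "(\<integral>x. (if q / 2 < (norm (v x))\<^sup>2 \<and> (norm (v x))\<^sup>2 < 4 * q then ennreal ((norm (v x) + norm (Dv x)) powr p) * indicator S x else 0)) \<le> ennreal a" "a \<ge> 0"
  defines "c \<equiv> 2 * ((1/4) powr (1 - p) * ((1/4) ^ (CARD('n) - 1)) powr \<beta> / (1/4) ^ CARD('n) + K) / unit_ball_vol (real CARD('n)) * 112 powr p"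
  shows "m \<le> (c * q powr (- p / 2) * a) powr (1 / \<beta>) * \<Lambda>"
proof (cases "m = 0")
  case True
  then show ?thesis using \<Lambda> by simp
next
  case False
  then have m0: "m > 0" using m by simp
  define b where "b = unit_ball_vol (real CARD('n))"
  have b: "b > 0" by (simp add: b_def)
  obtain A where [measurable]: "A \<in> borel_measurable borel" and A: "\<And>r. 0 < r \<Longrightarrow> r \<le> 1/4 \<Longrightarrow> A r > 0"
     "(\<integral>r. (if 0 < r \<and> r \<le> 1/4 then ennreal (A r) else 0)) \<le> ennreal (1/4)"
     "(\<integral>r. (if 0 < r \<and> r \<le> 1/4 then ennreal (A r powr (1 - p) * min (\<Lambda> * r ^ (CARD('n) - 1)) m / r ^ CARD('n)) else 0))
       \<le> ennreal (K * \<Lambda> powr \<beta> * m powr (1 - \<beta>))"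
    using adm[OF \<Lambda> m0] by blast
  have vc: "continuous_on UNIV v"
    by (intro continuous_at_imp_continuous_on ballI has_derivative_continuous[OF v])
  have [measurable]: "v \<in> borel_measurable borel" "Dv \<in> borel_measurable borel"
    using vc Dv by (auto intro: borel_measurable_continuous_onI)
  define f where "f x = (if q \<le> (norm (v x))\<^sup>2 \<and> (norm (v x))\<^sup>2 < 2 * q then e x else 0)" for x
  define s where "s x = (norm (v x))\<^sup>2 / q" for x
  define g where "g x = (if q / 2 < (norm (v x))\<^sup>2 \<and> (norm (v x))\<^sup>2 < 4 * q then 112 * (norm (v x) + norm (Dv x)) / sqrt q else 0)" for x
  define G where "G x = \<bar>bump' (s x)\<bar> * (2 * (norm (v x) * norm (Dv x)) / q)" for x
  have [measurable]: "f \<in> borel_measurable borel" "g \<in> borel_measurable borel" unfolding f_def g_def by measurable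
  have shell: "(q / 2 < (norm (v x))\<^sup>2 \<and> (norm (v x))\<^sup>2 < 4 * q) \<longleftrightarrow> (1/2 < s x \<and> s x < 4)" for x
    using q by (auto simp: s_def field_simps)
  have ub: "norm (v x) \<le> 2 * sqrt q" if "(norm (v x))\<^sup>2 < 4 * q" for x
  proof -
    have "norm (v x) = sqrt ((norm (v x))\<^sup>2)" by simp
    also have "\<dots> \<le> sqrt (4 * q)" using that by (intro real_sqrt_le_mono) simp
    finally show ?thesis by (simp add: real_sqrt_mult)
  qed
  have lb: "sqrt q \<le> 2 * norm (v x)" if "q / 2 < (norm (v x))\<^sup>2" for x
  proof -
    have "sqrt q \<le> sqrt (4 * (norm (v x))\<^sup>2)" using that q by (intro real_sqrt_le_mono) auto
    then show ?thesis by (simp add: real_sqrt_mult)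
  qed
  have sq: "sqrt q > 0" "sqrt q * sqrt q = q" using q by auto
  have wk: "b * m / 2 \<le> (112 powr p * q powr (- p / 2) * a) *
      ((1/4) powr (1 - p) * min (\<Lambda> * (1/4) ^ (CARD('n) - 1)) m / (1/4) ^ CARD('n) + K * \<Lambda> powr \<beta> * m powr (1 - \<beta>))"
    unfolding b_def
  proof (rule weak_trace_inequality[where f=f and g=g and G=G and S=S and A=A and w="\<lambda>x. bump (s x)"
        and w'="\<lambda>x h. bump' (s x) * (2 * (v x \<bullet> (Dv x *v h)) / q)"])
    show "(\<integral>x. f x) = ennreal m" using m unfolding f_def by simp
    show "(\<integral>x. (if dist x y < r then f x else 0)) \<le> ennreal (\<Lambda> * r ^ (CARD('n) - 1))" if "0 < r" "r \<le> 1/4" for y r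
      by (rule order_trans[OF nn_integral_mono ball[OF that, of y]]) (auto simp: f_def)
    show "y \<in> S" if "f x \<noteq> 0" "dist x y < 1/4" for x y using that S[of x y] by (auto simp: f_def split: if_splits)
    show "((\<lambda>x. bump (s x)) has_derivative (\<lambda>h. bump' (s x) * (2 * (v x \<bullet> (Dv x *v h)) / q))) (at x)" for x
      unfolding s_def by (rule bump_comp_deriv[OF v q])
    show "\<bar>bump' (s x) * (2 * (v x \<bullet> (Dv x *v h)) / q)\<bar> \<le> G x * norm h" for x h
    proof -
      have "\<bar>v x \<bullet> (Dv x *v h)\<bar> \<le> norm (v x) * norm (Dv x *v h)" by (rule Cauchy_Schwarz_ineq2)
      also have "\<dots> \<le> norm (v x) * (norm (Dv x) * norm h)" by (intro mult_left_mono norm_matrix_vector_mult_le) auto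
      finally have "\<bar>bump' (s x)\<bar> * (2 * \<bar>v x \<bullet> (Dv x *v h)\<bar> / q) \<le> \<bar>bump' (s x)\<bar> * (2 * (norm (v x) * (norm (Dv x) * norm h)) / q)"
        using q by (intro mult_left_mono divide_right_mono) auto
      then show ?thesis using q by (simp add: G_def abs_mult mult_ac)
    qed
    show "continuous_on UNIV G"
      unfolding G_def s_def bump'_def using q by (intro continuous_intros vc Dv) auto
    show "\<bar>bump (s x)\<bar> \<le> g x" for x
    proof (cases "1/2 < s x \<and> s x < 4")
      case True
      then have "q / 2 < (norm (v x))\<^sup>2" using shell[of x] by blast
      note lb[OF this]
      also have "2 * norm (v x) \<le> 2 * (norm (v x) + norm (Dv x))" by simp
      finally have "sqrt q \<le> 2 * (norm (v x) + norm (Dv x))" .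
      then have "16 * sqrt q \<le> 16 * (2 * (norm (v x) + norm (Dv x)))" by (rule mult_left_mono) simp
      also have "16 * (2 * X) \<le> 112 * X" if "X \<ge> 0" for X :: real using that by simp
      then have "16 * (2 * (norm (v x) + norm (Dv x))) \<le> 112 * (norm (v x) + norm (Dv x))" by simp
      finally have "16 * sqrt q \<le> 112 * (norm (v x) + norm (Dv x))" .
      then have "16 \<le> 112 * (norm (v x) + norm (Dv x)) / sqrt q" using sq
        by (simp add: pos_le_divide_eq)
      then show ?thesis using bump_facts(1,2)[of "s x"] True shell[of x] by (simp add: g_def)
    next
      case False
      then show ?thesis using bump_facts(5)[OF False] sq by (auto simp: g_def)
    qed
    show "G x \<le> g x" for x
    proof (cases "1/2 < s x \<and> s x < 4")
      case True
      then have n: "norm (v x) \<le> 2 * sqrt q" using ub shell by blast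
      have "G x \<le> 28 * (2 * (norm (v x) * norm (Dv x)) / q)"
        unfolding G_def using bump_facts(3) q by (intro mult_right_mono) auto
      also have "\<dots> \<le> 28 * (2 * (2 * sqrt q * norm (Dv x)) / q)"
        using n q by (intro mult_left_mono divide_right_mono mult_right_mono) auto
      also have "\<dots> = 112 * norm (Dv x) / sqrt q"
        using sq q by (simp add: field_simps)
      also have "\<dots> \<le> 112 * (norm (v x) + norm (Dv x)) / sqrt q"
        using sq by (intro divide_right_mono) auto
      finally show ?thesis using True shell[of x] by (simp add: g_def)
    next
      case False
      then show ?thesis using bump_facts(6)[OF False] sq by (auto simp: g_def G_def)
    qed
    show "1 \<le> \<bar>bump (s x)\<bar>" if "f x \<noteq> 0" for x
    proof -
      have "1 \<le> s x" "s x \<le> 2" using that q by (auto simp: f_def s_def field_simps split: if_splits)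
      then show ?thesis using bump_facts(4)[of "s x"] by simp
    qed
    show "(\<integral>y. ennreal (g y powr p) * indicator S y) \<le> ennreal (112 powr p * q powr (- p / 2) * a)"
    proof -
      have "ennreal (g y powr p) * indicator S y = ennreal (112 powr p * q powr (- p / 2)) *
         (if q / 2 < (norm (v y))\<^sup>2 \<and> (norm (v y))\<^sup>2 < 4 * q then ennreal ((norm (v y) + norm (Dv y)) powr p) * indicator S y else 0)" for y
      proof (cases "q / 2 < (norm (v y))\<^sup>2 \<and> (norm (v y))\<^sup>2 < 4 * q")
        case True
        have gen: "(112 * X / sqrt q) powr p = 112 powr p * X powr p / (q powr (1/2)) powr p" if "X \<ge> 0" for X
          using sq q that by (simp add: powr_divide powr_mult powr_half_sqrt)
        have "(112 * (norm (v y) + norm (Dv y)) / sqrt q) powr p = 112 powr p * (norm (v y) + norm (Dv y)) powr p / (q powr (1/2)) powr p"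
          by (rule gen) (intro add_nonneg_nonneg norm_ge_zero)
        also have "\<dots> = (112 powr p * q powr (- p / 2)) * (norm (v y) + norm (Dv y)) powr p"
        proof -
          have "(q powr (1/2)) powr p = q powr (p / 2)" unfolding powr_powr by simp
          moreover have "q powr (- p / 2) = 1 / q powr (p / 2)" using powr_minus_divide[of q "p / 2"] by simp
          ultimately show ?thesis by (simp only: times_divide_eq_right times_divide_eq_left mult_1_right mult_1_left)
        qed
        finally show ?thesis using True unfolding g_def by (simp add: ennreal_mult' mult.assoc)
      next
        case False
        then have "g y = 0" by (auto simp: g_def)
        then show ?thesis using False p by auto
      qed
      then have "(\<integral>y. ennreal (g y powr p) * indicator S y) = ennreal (112 powr p * q powr (- p / 2)) *
         (\<integral>y. (if q / 2 < (norm (v y))\<^sup>2 \<and> (norm (v y))\<^sup>2 < 4 * q then ennreal ((norm (v y) + norm (Dv y)) powr p) * indicator S y else 0))"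
        by (simp add: nn_integral_cmult)
      also have "\<dots> \<le> ennreal (112 powr p * q powr (- p / 2)) * ennreal a" by (intro mult_left_mono a) auto
      finally show ?thesis using a by (simp add: ennreal_mult'')
    qed
  qed (use p m \<Lambda> A a K in auto)
  define K' where "K' = (1/4) powr (1 - p) * ((1/4) ^ (CARD('n) - 1)) powr \<beta> / (1/4) ^ CARD('n) + K"
  have K': "K' > 0" unfolding K'_def using K by (intro add_nonneg_pos) auto
  have "min (\<Lambda> * (1/4) ^ (CARD('n) - 1)) m \<le> (\<Lambda> * (1/4) ^ (CARD('n) - 1)) powr \<beta> * m powr (1 - \<beta>)"
    using \<Lambda> m0 \<beta> by (intro min_le_weighted_product) auto
  also have "\<dots> = ((1/4) ^ (CARD('n) - 1)) powr \<beta> * (\<Lambda> powr \<beta> * m powr (1 - \<beta>))"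
    using \<Lambda> by (simp add: powr_mult)
  finally have "(1/4) powr (1 - p) * min (\<Lambda> * (1/4) ^ (CARD('n) - 1)) m / (1/4) ^ CARD('n)
      \<le> (1/4) powr (1 - p) * (((1/4) ^ (CARD('n) - 1)) powr \<beta> * (\<Lambda> powr \<beta> * m powr (1 - \<beta>))) / (1/4) ^ CARD('n)"
    by (intro divide_right_mono mult_left_mono) auto
  then have "(1/4) powr (1 - p) * min (\<Lambda> * (1/4) ^ (CARD('n) - 1)) m / (1/4) ^ CARD('n) + K * \<Lambda> powr \<beta> * m powr (1 - \<beta>)
      \<le> K' * (\<Lambda> powr \<beta> * m powr (1 - \<beta>))"
    by (simp add: K'_def algebra_simps)
  from order_trans[OF wk mult_left_mono[OF this]]
  have "b * m / 2 \<le> (112 powr p * q powr (- p / 2) * a) * (K' * (\<Lambda> powr \<beta> * m powr (1 - \<beta>)))" using a by simp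
  moreover have mm: "m = m powr \<beta> * m powr (1 - \<beta>)" using m0 by (simp add: powr_add[symmetric])
  ultimately have "(b * m powr \<beta> / 2) * m powr (1 - \<beta>) \<le> ((112 powr p * q powr (- p / 2) * a) * K' * \<Lambda> powr \<beta>) * m powr (1 - \<beta>)"
    by (simp add: mult_ac)
  then have "b * m powr \<beta> / 2 \<le> (112 powr p * q powr (- p / 2) * a) * K' * \<Lambda> powr \<beta>" using m0 by simp
  then have "m powr \<beta> \<le> (c * q powr (- p / 2) * a) * \<Lambda> powr \<beta>"
    using b unfolding c_def K'_def[symmetric] b_def[symmetric] by (simp add: field_simps)
  then have "(m powr \<beta>) powr (1 / \<beta>) \<le> ((c * q powr (- p / 2) * a) * \<Lambda> powr \<beta>) powr (1 / \<beta>)"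
    using \<beta> by (intro powr_mono2) auto
  moreover have "c \<ge> 0" unfolding c_def K'_def[symmetric] using K' by simp
  ultimately show ?thesis using m0 \<beta> \<Lambda> a by (simp add: powr_powr powr_mult)
qed

lemma dyadic_level_exists:
  fixes y :: real
  assumes "y > 0"
  shows "\<exists>k::int. 2 powr of_int k \<le> y \<and> y < 2 * 2 powr of_int k"
proof (intro exI conjI)
  let ?k = "\<lfloor>log 2 y\<rfloor>"
  have "2 powr of_int ?k \<le> 2 powr log 2 y" by (intro powr_mono) auto
  then show "2 powr of_int ?k \<le> y" using assms by simp
  have "y = 2 powr log 2 y" using assms by simp
  also have "\<dots> < 2 powr (of_int ?k + 1)" by (intro powr_less_mono) linarith+
  finally show "y < 2 * 2 powr of_int ?k" by (simp add: powr_add)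
qed

lemma dyadic_shell_count:
  fixes y :: real
  shows "(\<integral>\<^sup>+k. (if 2 powr of_int k / 2 < y \<and> y < 4 * 2 powr of_int k then 1 else 0) \<partial>count_space (UNIV::int set)) \<le> 3"
proof (cases "y > 0")
  case True
  let ?k = "\<lfloor>log 2 y\<rfloor>"
  have sub: "k \<in> {?k - 1..?k + 1}" if "2 powr of_int k / 2 < y \<and> y < 4 * 2 powr of_int k" for k :: int
  proof -
    have "2 powr (of_int k - 1) < y" "y < 2 powr (of_int k + 2)" using that by (simp_all add: powr_diff powr_add)
    then have "of_int k - 1 < log 2 y" "log 2 y < of_int k + 2" using True by (simp_all add: less_log_iff log_less_iff)
    then show ?thesis by auto linarith+
  qed
  have "(\<integral>\<^sup>+k. (if 2 powr of_int k / 2 < y \<and> y < 4 * 2 powr of_int k then 1 else 0) \<partial>count_space (UNIV::int set))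
     \<le> (\<integral>\<^sup>+k. indicator {?k - 1..?k + 1} k \<partial>count_space (UNIV::int set))"
    using sub by (intro nn_integral_mono) (auto simp: indicator_def)
  also have "\<dots> = 3" by (subst nn_integral_indicator) (auto simp: emeasure_count_space)
  finally show ?thesis .
next
  case False
  then have F: "(2 powr of_int k / 2 < y \<and> y < 4 * 2 powr of_int k) = False" for k :: int
    using powr_gt_zero[of 2 "of_int k"] by (smt (verit) divide_pos_pos)
  show ?thesis unfolding F by simp
qed

text \<open>Truncation turns the weak estimate into a strong one. Each dyadic shell sees only its
  own p-energy \<open>al\<close> k; as 1/\<beta> \<ge> 1, the power 1/\<beta> of \<open>al\<close> k
  is at most \<open>al\<close> k times NN^(1/\<beta> - 1), and the widened shells overlap at most
  three times, so the sum is bounded. This gives the exponent \<sigma> = p/\<beta>. Since \<sigma>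
  \<ge> 2, splitting at height a descends to |v|^2; a stays free, to be balanced against the
  kernel.\<close>

lemma trace_inequality:
  fixes p \<beta> :: real
  assumes adm: "admissible_exponents CARD('n) p \<beta>" and p: "p > 1" and \<beta>: "0 < \<beta>" "\<beta> \<le> 1" and \<sigma>: "p / \<beta> \<ge> 2"
  shows "\<exists>C>0. \<forall>(e :: real^'n \<Rightarrow> ennreal) (v :: real^'n \<Rightarrow> real^'m) Dv S \<Lambda> NN V a.
     e \<in> borel_measurable borel \<longrightarrow> S \<in> sets borel \<longrightarrow> \<Lambda> > 0 \<longrightarrow>
     (\<forall>y r. 0 < r \<longrightarrow> r \<le> 1/4 \<longrightarrow> (\<integral>x. (if dist x y < r then e x else 0)) \<le> ennreal (\<Lambda> * r ^ (CARD('n) - 1))) \<longrightarrow>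
     (\<integral>x. e x) \<le> ennreal V \<longrightarrow> V \<ge> 0 \<longrightarrow>
     (\<forall>x y. e x \<noteq> 0 \<longrightarrow> dist x y < 1/4 \<longrightarrow> y \<in> S) \<longrightarrow>
     (\<forall>x. (v has_derivative (\<lambda>h. Dv x *v h)) (at x)) \<longrightarrow> continuous_on UNIV Dv \<longrightarrow>
     (\<integral>x. ennreal ((norm (v x) + norm (Dv x)) powr p) * indicator S x) \<le> ennreal NN \<longrightarrow> NN \<ge> 0 \<longrightarrow> a > 0 \<longrightarrow>
     (\<integral>x. e x * ennreal ((norm (v x))\<^sup>2)) \<le> ennreal (a\<^sup>2 * V + a powr (2 - p / \<beta>) * (C * \<Lambda> * NN powr (1 / \<beta>)))"
proof -
  obtain K where K: "K > 0" and HK: "\<And>\<Lambda> m. \<Lambda> > 0 \<Longrightarrow> m > 0 \<Longrightarrow> \<exists>A \<in> borel_measurable borel.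
     (\<forall>r. 0 < r \<and> r \<le> 1/4 \<longrightarrow> A r > 0) \<and>
     (\<integral>r. (if 0 < r \<and> r \<le> 1/4 then ennreal (A r) else 0)) \<le> ennreal (1/4) \<and>
     (\<integral>r. (if 0 < r \<and> r \<le> 1/4 then ennreal (A r powr (1 - p) * min (\<Lambda> * r ^ (CARD('n) - 1)) m / r ^ CARD('n)) else 0))
       \<le> ennreal (K * \<Lambda> powr \<beta> * m powr (1 - \<beta>))"
    using adm unfolding admissible_exponents_def by blast
  define c where "c = 2 * ((1/4) powr (1 - p) * ((1/4) ^ (CARD('n) - 1)) powr \<beta> / (1/4) ^ CARD('n) + K) / unit_ball_vol (real CARD('n)) * 112 powr p"
  have c: "c > 0" unfolding c_def using K by (intro mult_pos_pos divide_pos_pos add_nonneg_pos) auto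
  define \<sigma> where "\<sigma> = p / \<beta>"
  have \<sigma>2: "\<sigma> \<ge> 2" using \<sigma> by (simp add: \<sigma>_def)
  define C where "C = 3 * 2 powr (\<sigma> / 2) * c powr (1 / \<beta>)"
  have C: "C > 0" using c by (simp add: C_def)
  show ?thesis
  proof (intro exI[of _ C] conjI C allI impI)
    fix e :: "real^'n \<Rightarrow> ennreal" and v :: "real^'n \<Rightarrow> real^'m" and Dv S and \<Lambda> NN V a :: real
    assume [measurable]: "e \<in> borel_measurable borel" "S \<in> sets borel" and \<Lambda>: "\<Lambda> > 0"
      and ball: "\<forall>y r. 0 < r \<longrightarrow> r \<le> 1/4 \<longrightarrow> (\<integral>x. (if dist x y < r then e x else 0)) \<le> ennreal (\<Lambda> * r ^ (CARD('n) - 1))"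
      and V: "(\<integral>x. e x) \<le> ennreal V" "V \<ge> 0"
      and S: "\<forall>x y. e x \<noteq> 0 \<longrightarrow> dist x y < 1/4 \<longrightarrow> y \<in> S"
      and v: "\<forall>x. (v has_derivative (\<lambda>h. Dv x *v h)) (at x)" and Dv: "continuous_on UNIV Dv"
      and NN: "(\<integral>x. ennreal ((norm (v x) + norm (Dv x)) powr p) * indicator S x) \<le> ennreal NN" "NN \<ge> 0" and a: "a > 0"
    have vc: "continuous_on UNIV v"
      by (intro continuous_at_imp_continuous_on ballI has_derivative_continuous[OF v[rule_format]])
    have [measurable]: "v \<in> borel_measurable borel" "Dv \<in> borel_measurable borel"
      using vc Dv by (auto intro: borel_measurable_continuous_onI)
    define q where "q k = (2::real) powr of_int k" for k :: int
    have q: "q k > 0" for k by (simp add: q_def)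
    define E where "E k x = (if q k \<le> (norm (v x))\<^sup>2 \<and> (norm (v x))\<^sup>2 < 2 * q k then e x else 0)" for k x
    define hh where "hh x = ennreal ((norm (v x) + norm (Dv x)) powr p) * indicator S x" for x
    define L where "L k x = (if q k / 2 < (norm (v x))\<^sup>2 \<and> (norm (v x))\<^sup>2 < 4 * q k then hh x else 0)" for k x
    have [measurable]: "E k \<in> borel_measurable borel" "hh \<in> borel_measurable borel" for k
      unfolding E_def hh_def by measurable
    have [measurable]: "L k \<in> borel_measurable borel" for k unfolding L_def by measurable
    define m where "m k = enn2real (\<integral>x. E k x)" for k
    define al where "al k = enn2real (\<integral>x. L k x)" for k
    have E_le: "(\<integral>x. E k x) \<le> ennreal V" for k
      by (rule order_trans[OF nn_integral_mono V(1)]) (simp add: E_def)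
    have L_le: "(\<integral>x. L k x) \<le> ennreal NN" for k
      by (rule order_trans[OF nn_integral_mono NN(1)]) (simp add: L_def hh_def)
    have mE: "(\<integral>x. E k x) = ennreal (m k)" for k
      unfolding m_def using le_less_trans[OF E_le[of k] ennreal_less_top] by simp
    have aL: "(\<integral>x. L k x) = ennreal (al k)" for k
      unfolding al_def using le_less_trans[OF L_le[of k] ennreal_less_top] by simp
    have m0: "m k \<ge> 0" and al0: "al k \<ge> 0" for k by (simp_all add: m_def al_def)
    have alNN: "al k \<le> NN" for k using L_le[of k] NN(2) unfolding aL by simp
    have mk: "m k \<le> c powr (1 / \<beta>) * q k powr (- \<sigma> / 2) * NN powr (1 / \<beta> - 1) * \<Lambda> * al k" for k
    proof -
      have "m k \<le> (c * q k powr (- p / 2) * al k) powr (1 / \<beta>) * \<Lambda>"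
        unfolding c_def
      proof (rule level_set_trace[where e=e and v=v and Dv=Dv and S=S])
        show "(\<integral>x. (if q k \<le> (norm (v x))\<^sup>2 \<and> (norm (v x))\<^sup>2 < 2 * q k then e x else 0)) = ennreal (m k)"
          using mE unfolding E_def .
        show "(\<integral>x. (if q k / 2 < (norm (v x))\<^sup>2 \<and> (norm (v x))\<^sup>2 < 4 * q k then ennreal ((norm (v x) + norm (Dv x)) powr p) * indicator S x else 0)) \<le> ennreal (al k)"
          using aL[of k] unfolding L_def hh_def by simp
        show "\<exists>A \<in> borel_measurable borel.
     (\<forall>r. 0 < r \<and> r \<le> 1/4 \<longrightarrow> A r > 0) \<and>
     (\<integral>r. (if 0 < r \<and> r \<le> 1/4 then ennreal (A r) else 0)) \<le> ennreal (1/4) \<and>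
     (\<integral>r. (if 0 < r \<and> r \<le> 1/4 then ennreal (A r powr (1 - p) * min (\<Lambda>' * r ^ (CARD('n) - 1)) m' / r ^ CARD('n)) else 0))
       \<le> ennreal (K * \<Lambda>' powr \<beta> * m' powr (1 - \<beta>))" if "\<Lambda>' > 0" "m' > 0" for \<Lambda>' m'
          by (rule HK[OF that])
      qed (use p \<beta> K \<Lambda> S v Dv q m0 al0 ball in auto)
      also have "(c * q k powr (- p / 2) * al k) powr (1 / \<beta>) = c powr (1 / \<beta>) * q k powr (- \<sigma> / 2) * al k powr (1 / \<beta>)"
        using c q[of k] al0[of k] by (simp add: powr_mult powr_powr \<sigma>_def mult.commute[of \<beta>])
      also have "al k powr (1 / \<beta>) \<le> al k * NN powr (1 / \<beta> - 1)"
      proof (cases "al k = 0")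
        case False
        then have "al k > 0" using al0[of k] by simp
        then have "al k powr (1 / \<beta>) = al k * al k powr (1 / \<beta> - 1)" by (simp add: powr_mult_base)
        also have "\<dots> \<le> al k * NN powr (1 / \<beta> - 1)"
          using al0[of k] alNN[of k] \<beta> by (intro mult_left_mono powr_mono2) auto
        finally show ?thesis .
      qed simp
      finally show ?thesis using \<Lambda> c by (simp add: mult_ac mult_left_mono mult_right_mono)
    qed
    have sumL: "(\<integral>\<^sup>+k. ennreal (al k) \<partial>count_space UNIV) \<le> ennreal (3 * NN)"
    proof -
      have "(\<integral>\<^sup>+k. ennreal (al k) \<partial>count_space UNIV) = (\<integral>\<^sup>+k. (\<integral>x. L k x) \<partial>count_space UNIV)" by (simp add: aL)
      also have "\<dots> = (\<integral>x. (\<integral>\<^sup>+k. L k x \<partial>count_space UNIV))"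
        by (rule nn_integral_count_space_nn_integral[symmetric]) auto
      also have "\<dots> = (\<integral>x. hh x * (\<integral>\<^sup>+k. (if 2 powr of_int k / 2 < (norm (v x))\<^sup>2 \<and> (norm (v x))\<^sup>2 < 4 * 2 powr of_int k then 1 else 0) \<partial>count_space (UNIV::int set)))"
        by (intro nn_integral_cong, subst nn_integral_cmult[symmetric]) (auto intro!: nn_integral_cong simp: L_def q_def)
      also have "\<dots> \<le> (\<integral>x. hh x * 3)"
        by (intro nn_integral_mono mult_left_mono dyadic_shell_count) auto
      also have "\<dots> = (\<integral>x. hh x) * 3" by (rule nn_integral_multc) measurable
      also have "\<dots> \<le> ennreal NN * 3" using NN(1) unfolding hh_def by (intro mult_right_mono) auto
      also have "\<dots> = ennreal (3 * NN)" using NN(2) by (simp add: ennreal_mult' mult.commute)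
      finally show ?thesis .
    qed
    have main: "(\<integral>x. e x * ennreal (norm (v x) powr \<sigma>)) \<le> ennreal (C * \<Lambda> * NN powr (1 / \<beta>))"
    proof -
      have "(\<integral>x. e x * ennreal (norm (v x) powr \<sigma>)) \<le> (\<integral>x. (\<integral>\<^sup>+k. ennreal ((2 * q k) powr (\<sigma> / 2)) * E k x \<partial>count_space UNIV))"
      proof (rule nn_integral_mono)
        fix x
        show "e x * ennreal (norm (v x) powr \<sigma>) \<le> (\<integral>\<^sup>+k. ennreal ((2 * q k) powr (\<sigma> / 2)) * E k x \<partial>count_space UNIV)"
        proof (cases "v x = 0")
          case False
          then obtain k where k: "q k \<le> (norm (v x))\<^sup>2" "(norm (v x))\<^sup>2 < 2 * q k"
            using dyadic_level_exists[of "(norm (v x))\<^sup>2"] by (auto simp: q_def)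
          have "norm (v x) powr \<sigma> = ((norm (v x))\<^sup>2) powr (\<sigma> / 2)"
            using False by (simp add: powr_realpow[symmetric] powr_powr del: powr_numeral)
          also have "\<dots> \<le> (2 * q k) powr (\<sigma> / 2)" using k \<sigma>2 by (intro powr_mono2) auto
          finally have "e x * ennreal (norm (v x) powr \<sigma>) \<le> e x * ennreal ((2 * q k) powr (\<sigma> / 2))"
            by (intro mult_left_mono ennreal_leI) auto
          also have "\<dots> = ennreal ((2 * q k) powr (\<sigma> / 2)) * E k x"
            using k by (simp add: E_def mult.commute)
          also have "\<dots> \<le> (\<integral>\<^sup>+k. ennreal ((2 * q k) powr (\<sigma> / 2)) * E k x \<partial>count_space UNIV)"
            by (rule nn_integral_ge_point) simp
          finally show ?thesis .
        qed simp
      qed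
      also have "\<dots> = (\<integral>\<^sup>+k. (\<integral>x. ennreal ((2 * q k) powr (\<sigma> / 2)) * E k x) \<partial>count_space UNIV)"
        by (rule nn_integral_count_space_nn_integral) auto
      also have "\<dots> = (\<integral>\<^sup>+k. ennreal ((2 * q k) powr (\<sigma> / 2) * m k) \<partial>count_space UNIV)"
        by (intro nn_integral_cong) (simp add: nn_integral_cmult mE ennreal_mult'' m0)
      also have "\<dots> \<le> (\<integral>\<^sup>+k. ennreal (2 powr (\<sigma> / 2) * c powr (1 / \<beta>) * NN powr (1 / \<beta> - 1) * \<Lambda>) * ennreal (al k) \<partial>count_space UNIV)"
      proof (rule nn_integral_mono)
        fix k
        have "(2 * q k) powr (\<sigma> / 2) * m k \<le> (2 * q k) powr (\<sigma> / 2) * (c powr (1 / \<beta>) * q k powr (- \<sigma> / 2) * NN powr (1 / \<beta> - 1) * \<Lambda> * al k)"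
          by (intro mult_left_mono mk) auto
        also have "\<dots> = (2 powr (\<sigma> / 2) * c powr (1 / \<beta>) * NN powr (1 / \<beta> - 1) * \<Lambda>) * al k * (q k powr (\<sigma> / 2) * q k powr (- \<sigma> / 2))"
          using q[of k] by (simp add: powr_mult mult_ac)
        also have "q k powr (\<sigma> / 2) * q k powr (- \<sigma> / 2) = 1" using q[of k] by (simp add: powr_add[symmetric])
        finally show "ennreal ((2 * q k) powr (\<sigma> / 2) * m k) \<le> ennreal (2 powr (\<sigma> / 2) * c powr (1 / \<beta>) * NN powr (1 / \<beta> - 1) * \<Lambda>) * ennreal (al k)"
          using al0[of k] by (simp add: ennreal_mult''[symmetric] ennreal_leI)
      qed
      also have "\<dots> = ennreal (2 powr (\<sigma> / 2) * c powr (1 / \<beta>) * NN powr (1 / \<beta> - 1) * \<Lambda>) * (\<integral>\<^sup>+k. ennreal (al k) \<partial>count_space UNIV)"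
        by (rule nn_integral_cmult) simp
      also have "\<dots> \<le> ennreal (2 powr (\<sigma> / 2) * c powr (1 / \<beta>) * NN powr (1 / \<beta> - 1) * \<Lambda>) * ennreal (3 * NN)"
        by (intro mult_left_mono sumL) auto
      also have "\<dots> = ennreal (C * \<Lambda> * (NN * NN powr (1 / \<beta> - 1)))"
        using NN(2) by (subst ennreal_mult''[symmetric]) (auto simp: C_def mult_ac)
      also have "NN * NN powr (1 / \<beta> - 1) = NN powr (1 / \<beta>)"
      proof (cases "NN = 0")
        case False
        then show ?thesis using NN(2) by (simp add: powr_mult_base)
      qed simp
      finally show ?thesis .
    qed
    have pt: "e x * ennreal ((norm (v x))\<^sup>2) \<le> ennreal (a\<^sup>2) * e x + ennreal (a powr (2 - \<sigma>)) * (e x * ennreal (norm (v x) powr \<sigma>))" for x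
    proof (cases "norm (v x) \<le> a")
      case True
      then have "(norm (v x))\<^sup>2 \<le> a\<^sup>2" by (intro power_mono) auto
      then have "e x * ennreal ((norm (v x))\<^sup>2) \<le> ennreal (a\<^sup>2) * e x"
        by (subst mult.commute) (intro mult_right_mono ennreal_leI, auto)
      then show ?thesis by (rule order_trans) simp
    next
      case False
      then have va: "norm (v x) > a" by simp
      have "(norm (v x))\<^sup>2 = norm (v x) powr (2 - \<sigma>) * norm (v x) powr \<sigma>"
        using va a by (simp add: powr_add[symmetric])
      also have "\<dots> \<le> a powr (2 - \<sigma>) * norm (v x) powr \<sigma>"
        using va a \<sigma>2 by (intro mult_right_mono powr_antimono_base) auto
      finally have "e x * ennreal ((norm (v x))\<^sup>2) \<le> e x * ennreal (a powr (2 - \<sigma>) * norm (v x) powr \<sigma>)"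
        by (intro mult_left_mono ennreal_leI) auto
      also have "\<dots> = ennreal (a powr (2 - \<sigma>)) * (e x * ennreal (norm (v x) powr \<sigma>))"
        by (simp add: ennreal_mult' mult_ac)
      finally show ?thesis by (rule order_trans) simp
    qed
    have "(\<integral>x. e x * ennreal ((norm (v x))\<^sup>2)) \<le> (\<integral>x. ennreal (a\<^sup>2) * e x + ennreal (a powr (2 - \<sigma>)) * (e x * ennreal (norm (v x) powr \<sigma>)))"
      by (intro nn_integral_mono pt)
    also have "\<dots> = ennreal (a\<^sup>2) * (\<integral>x. e x) + ennreal (a powr (2 - \<sigma>)) * (\<integral>x. e x * ennreal (norm (v x) powr \<sigma>))"
      by (subst nn_integral_add) (simp_all add: nn_integral_cmult)
    also have "\<dots> \<le> ennreal (a\<^sup>2) * ennreal V + ennreal (a powr (2 - \<sigma>)) * ennreal (C * \<Lambda> * NN powr (1 / \<beta>))"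
      by (intro add_mono mult_left_mono V main) auto
    also have "\<dots> = ennreal (a\<^sup>2 * V + a powr (2 - p / \<beta>) * (C * \<Lambda> * NN powr (1 / \<beta>)))"
      unfolding \<sigma>_def[symmetric] using V(2) C \<Lambda> by (intro ennreal_mult_add_mult) auto
    finally show "(\<integral>x. e x * ennreal ((norm (v x))\<^sup>2)) \<le> ennreal (a\<^sup>2 * V + a powr (2 - p / \<beta>) * (C * \<Lambda> * NN powr (1 / \<beta>)))" .
  qed
qed

lemma power_le_exp_square:
  fixes z :: real
  assumes z: "z \<ge> 0" and k: "k \<ge> 1"
  shows "z ^ k \<le> real k ^ k * exp (1/2) * exp (z\<^sup>2 / 2)"
proof -
  have "(z / real k) ^ k \<le> (1 + z / real k) ^ k" using z by (intro power_mono) auto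
  also have "\<dots> \<le> exp z" using z k by (intro exp_ge_one_plus_x_over_n_power_n) auto
  also have "\<dots> \<le> exp (1/2 + z\<^sup>2 / 2)"
    using zero_le_power2[of "z - 1"] by (simp add: power2_eq_square algebra_simps)
  finally have "z ^ k / real k ^ k \<le> exp (1/2) * exp (z\<^sup>2 / 2)" by (simp add: power_divide exp_add)
  then show ?thesis using k by (simp add: divide_le_eq mult_ac)
qed

section \<open>Constants of the double well and the discrepancy bound\<close>

text \<open>Layer-cake in the distance: exp(-l \<rho>^2) is the integral of 2 l r exp(-l r^2) over r
  \<ge> \<rho>, which brings in the ball bound A r^k. Half of the exponent absorbs r^k. Cutting e
  off at radius R extends the ball bound to all radii.\<close>

lemma gaussian_mass_le:
  fixes e :: "real^'n \<Rightarrow> ennreal" and l :: real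
  assumes [measurable]: "e \<in> borel_measurable borel" and l: "l > 0" and k: "k \<ge> 1" and A: "A \<ge> 0" and R: "R > 0"
    and ball: "\<And>r. 0 < r \<Longrightarrow> r \<le> R \<Longrightarrow> (\<integral>x. (if dist x y < r then e x else 0)) \<le> ennreal (A * r ^ k)"
  shows "(\<integral>x. (if dist x y < R then e x * ennreal (exp (- l * (norm (x - y))\<^sup>2)) else 0))
    \<le> ennreal (2 * real k ^ k * exp (1/2) * A * l powr (- real k / 2))"
proof -
  define f where "f x = (if dist x y < R then e x else 0)" for x
  have [measurable]: "f \<in> borel_measurable borel" unfolding f_def by measurable
  have fb: "(\<integral>x. (if dist x y < r then f x else 0)) \<le> ennreal (A * r ^ k)" if r: "r > 0" for r
  proof (cases "r \<le> R")
    case True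
    then show ?thesis by (intro order_trans[OF nn_integral_mono ball[OF r]]) (auto simp: f_def)
  next
    case False
    have "(\<integral>x. (if dist x y < r then f x else 0)) \<le> (\<integral>x. (if dist x y < R then e x else 0))"
      by (intro nn_integral_mono) (auto simp: f_def)
    also have "\<dots> \<le> ennreal (A * R ^ k)" using ball[of R] R by simp
    also have "\<dots> \<le> ennreal (A * r ^ k)" using False R A by (intro ennreal_leI mult_left_mono power_mono) auto
    finally show ?thesis .
  qed
  have layer: "ennreal (exp (- l' * \<rho>\<^sup>2)) = (\<integral>r. (if \<rho> \<le> r then ennreal (2 * l' * r * exp (- l' * r\<^sup>2)) else 0))"
    if \<rho>: "\<rho> \<ge> 0" and l': "l' > 0" for \<rho> l'
  proof -
    have "(\<integral>r. ennreal (2 * l' * r * exp (- l' * r\<^sup>2)) * indicator {\<rho>..} r) = ennreal (0 - (- exp (- l' * \<rho>\<^sup>2)))"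
    proof (rule nn_integral_FTC_atLeast)
      show "((\<lambda>r. - exp (- l' * r\<^sup>2)) has_real_derivative 2 * l' * r * exp (- l' * r\<^sup>2)) (at r)" for r
        by (auto intro!: derivative_eq_intros)
      show "((\<lambda>r. - exp (- l' * r\<^sup>2)) \<longlongrightarrow> 0) at_top" using l' by real_asymp
    qed (use \<rho> l' in auto)
    moreover have "(\<integral>r. ennreal (2 * l' * r * exp (- l' * r\<^sup>2)) * indicator {\<rho>..} r)
       = (\<integral>r. (if \<rho> \<le> r then ennreal (2 * l' * r * exp (- l' * r\<^sup>2)) else 0))"
      by (intro nn_integral_cong) (auto simp: indicator_def)
    ultimately show ?thesis by simp
  qed
  define D where "D = real k ^ k * exp (1/2) * l powr (- real k / 2)"
  have D: "D \<ge> 0" by (simp add: D_def)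
  have pt: "2 * l * r * exp (- l * r\<^sup>2) * (A * r ^ k) \<le> 2 * D * A * (2 * (l / 2) * r * exp (- (l / 2) * r\<^sup>2))" if r: "r \<ge> 0" for r
  proof -
    have "(sqrt l * r) ^ k \<le> real k ^ k * exp (1/2) * exp ((sqrt l * r)\<^sup>2 / 2)"
      using r l k by (intro power_le_exp_square) auto
    moreover have "sqrt l ^ k = l powr (real k / 2)"
      using l k by (simp add: powr_half_sqrt[symmetric] powr_power)
    ultimately have "l powr (real k / 2) * r ^ k \<le> real k ^ k * exp (1/2) * exp (l * r\<^sup>2 / 2)"
      using l by (simp add: power_mult_distrib del: real_sqrt_power)
    then have le: "l powr (- real k / 2) * (l powr (real k / 2) * r ^ k) \<le> l powr (- real k / 2) * (real k ^ k * exp (1/2) * exp (l * r\<^sup>2 / 2))"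
      by (intro mult_left_mono) auto
    have eq: "l powr (- real k / 2) * (l powr (real k / 2) * r ^ k) = r ^ k"
      using l unfolding mult.assoc[symmetric] powr_add[symmetric] by simp
    have "r ^ k \<le> D * exp (l * r\<^sup>2 / 2)" using le unfolding eq by (simp add: D_def mult_ac)
    then have "(2 * l * r * exp (- l * r\<^sup>2) * A) * r ^ k \<le> (2 * l * r * exp (- l * r\<^sup>2) * A) * (D * exp (l * r\<^sup>2 / 2))"
      using r l A by (intro mult_left_mono) auto
    also have "\<dots> = 2 * D * A * (l * r) * (exp (- l * r\<^sup>2) * exp (l * r\<^sup>2 / 2))" by (simp add: mult_ac)
    also have "exp (- l * r\<^sup>2) * exp (l * r\<^sup>2 / 2) = exp (- (l / 2) * r\<^sup>2)"
      by (simp add: exp_add[symmetric] field_simps)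
    finally show ?thesis by (simp add: mult_ac)
  qed
  have "(\<integral>x. (if dist x y < R then e x * ennreal (exp (- l * (norm (x - y))\<^sup>2)) else 0))
    = (\<integral>x. f x * (\<integral>r. (if dist x y \<le> r then ennreal (2 * l * r * exp (- l * r\<^sup>2)) else 0)))"
    using layer[OF _ l] by (intro nn_integral_cong) (auto simp: f_def dist_norm)
  also have "\<dots> = (\<integral>x. (\<integral>r. (if dist x y \<le> r then f x * ennreal (2 * l * r * exp (- l * r\<^sup>2)) else 0)))"
    by (subst nn_integral_cmult[symmetric]) (auto intro!: nn_integral_cong)
  also have "\<dots> = (\<integral>r. (\<integral>x. (if dist x y \<le> r then f x * ennreal (2 * l * r * exp (- l * r\<^sup>2)) else 0)))"
    by (rule lborel_pair.Fubini') measurable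
  also have "\<dots> \<le> (\<integral>r. ennreal (2 * D * A) * (if 0 \<le> r then ennreal (2 * (l / 2) * r * exp (- (l / 2) * r\<^sup>2)) else 0))"
  proof (rule nn_integral_mono)
    fix r :: real
    show "(\<integral>x. (if dist x y \<le> r then f x * ennreal (2 * l * r * exp (- l * r\<^sup>2)) else 0))
      \<le> ennreal (2 * D * A) * (if 0 \<le> r then ennreal (2 * (l / 2) * r * exp (- (l / 2) * r\<^sup>2)) else 0)"
    proof (cases "r > 0")
      case False
      have "(if dist x y \<le> r then f x * ennreal (2 * l * r * exp (- l * r\<^sup>2)) else 0) = 0" for x
      proof (cases "dist x y \<le> r")
        case True
        then have "r = 0" using False zero_le_dist[of x y] by linarith
        then show ?thesis by simp
      qed simp
      then show ?thesis by simp
    next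
      case True
      have fb': "(\<integral>x. (if dist x y \<le> r then f x else 0)) \<le> ennreal (A * r ^ k)"
      proof -
        have "((\<lambda>s. ennreal (A * (r + s) ^ k)) \<longlongrightarrow> ennreal (A * (r + 0) ^ k)) (at_right 0)"
          by (intro tendsto_intros)
        moreover have "\<forall>\<^sub>F s in at_right 0. (\<integral>x. (if dist x y \<le> r then f x else 0)) \<le> ennreal (A * (r + s) ^ k)"
          unfolding eventually_at_right_field
        proof (intro exI[of _ 1] conjI allI impI)
          fix s :: real assume s: "0 < s"
          have "(\<integral>x. (if dist x y \<le> r then f x else 0)) \<le> (\<integral>x. (if dist x y < r + s then f x else 0))"
            using s by (intro nn_integral_mono) auto
          also have "\<dots> \<le> ennreal (A * (r + s) ^ k)" using True s by (intro fb) auto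
          finally show "(\<integral>x. (if dist x y \<le> r then f x else 0)) \<le> ennreal (A * (r + s) ^ k)" .
        qed simp
        ultimately show ?thesis
          using tendsto_lowerbound[of "\<lambda>s. ennreal (A * (r + s) ^ k)" _ "at_right (0::real)"] by simp
      qed
      have "(\<integral>x. (if dist x y \<le> r then f x * ennreal (2 * l * r * exp (- l * r\<^sup>2)) else 0))
        = (\<integral>x. ennreal (2 * l * r * exp (- l * r\<^sup>2)) * (if dist x y \<le> r then f x else 0))"
        by (intro nn_integral_cong) (auto simp: mult.commute)
      also have "\<dots> = ennreal (2 * l * r * exp (- l * r\<^sup>2)) * (\<integral>x. (if dist x y \<le> r then f x else 0))"
        by (rule nn_integral_cmult) measurable
      also have "\<dots> \<le> ennreal (2 * l * r * exp (- l * r\<^sup>2)) * ennreal (A * r ^ k)"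
        by (intro mult_left_mono fb') auto
      also have "\<dots> = ennreal (2 * l * r * exp (- l * r\<^sup>2) * (A * r ^ k))"
        using True A by (subst ennreal_mult'') auto
      also have "\<dots> \<le> ennreal (2 * D * A * (2 * (l / 2) * r * exp (- (l / 2) * r\<^sup>2)))"
        using pt[of r] True by (intro ennreal_leI) auto
      also have "\<dots> = ennreal (2 * D * A) * ennreal (2 * (l / 2) * r * exp (- (l / 2) * r\<^sup>2))"
        using True l by (intro ennreal_mult'') auto
      finally show ?thesis using True by simp
    qed
  qed
  also have "\<dots> = ennreal (2 * D * A) * ennreal (exp (- (l / 2) * 0\<^sup>2))"
    using l by (subst layer) (auto simp: nn_integral_cmult)
  finally show ?thesis by (simp add: D_def mult_ac)
qed

lemma one_plus_times_exp_le:
  fixes x :: real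
  shows "x \<ge> 0 \<Longrightarrow> (1 + x) * exp (- x) \<le> 2 * exp (- (x / 2))"
proof -
  assume x: "x \<ge> 0"
  have "1 + x \<le> 2 * exp (x / 2)" using exp_ge_add_one_self[of "x / 2"] x by linarith
  then have "(1 + x) * exp (- x) \<le> 2 * exp (x / 2) * exp (- x)" by (intro mult_right_mono) auto
  also have "\<dots> = 2 * (exp (x / 2) * exp (- x))" by simp
  also have "exp (x / 2) * exp (- x) = exp (- (x / 2))" by (simp add: exp_add[symmetric])
  finally show ?thesis .
qed

section \<open>Quantitative properties of the double well\<close>

lemma convex_well_lower_bounds:
  fixes V V1 V2 :: "real \<Rightarrow> real"
  assumes V: "\<And>z. (V has_real_derivative V1 z) (at z)" and V1: "\<And>z. (V1 has_real_derivative V2 z) (at z)"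
    and 0: "V 0 = 0" "V1 0 = 0" and k: "\<And>z. 0 \<le> z \<Longrightarrow> z \<le> b \<Longrightarrow> V2 z \<ge> \<kappa>" and z: "0 \<le> z" "z \<le> b"
  shows "V1 z \<ge> \<kappa> * z" "V z \<ge> \<kappa> * z\<^sup>2 / 2"
proof -
  have a: "V1 z \<ge> \<kappa> * z" if z: "0 \<le> z" "z \<le> b" for z
  proof -
    have "V1 0 - \<kappa> * 0 \<le> V1 z - \<kappa> * z"
      by (rule DERIV_nonneg_imp_nondecreasing[OF z(1)])
        (use z k in \<open>auto intro!: exI[of _ "V2 _ - \<kappa>"] derivative_eq_intros V1\<close>)
    then show ?thesis using 0 by simp
  qed
  show "V1 z \<ge> \<kappa> * z" by (rule a[OF z])
  have "V 0 - \<kappa> * 0\<^sup>2 / 2 \<le> V z - \<kappa> * z\<^sup>2 / 2"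
  proof (rule DERIV_nonneg_imp_nondecreasing[OF z(1)])
    fix y assume y: "0 \<le> y" "y \<le> z"
    have "((\<lambda>z. V z - \<kappa> * z\<^sup>2 / 2) has_real_derivative V1 y - \<kappa> * y) (at y)"
      by (auto intro!: derivative_eq_intros V)
    then show "\<exists>D. ((\<lambda>z. V z - \<kappa> * z\<^sup>2 / 2) has_real_derivative D) (at y) \<and> 0 \<le> D"
      using a[of y] y z by auto
  qed
  then show "V z \<ge> \<kappa> * z\<^sup>2 / 2" using 0 by simp
qed

text \<open>Near the wells, convexity makes |W'| at least linear and W at least quadratic in the
  distance, while \<open>hump\<close> is at most linear; so (\<gamma> - x) W' dominates
  \<open>hump\<close>, and W dominates its square. Between -\<alpha> and \<alpha>, W is bounded
  below by its endpoint values, since it rises up to \<gamma> and falls afterwards. The last bound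
  measures W by x + 1, because \<phi> + 1 is what decays at infinity.\<close>

lemma double_well_constants:
  fixes W W1 W2 :: "real \<Rightarrow> real"
  assumes W: "\<And>x. (W has_real_derivative W1 x) (at x)" and W1: "\<And>x. (W1 has_real_derivative W2 x) (at x)"
    and nonneg: "\<And>x. W x \<ge> 0" and wells: "W 1 = 0" "W (-1) = 0" "W1 1 = 0" "W1 (-1) = 0"
    and \<gamma>: "-1 < \<gamma>" "\<gamma> < 1" and dec: "\<And>x. \<gamma> < x \<Longrightarrow> x < 1 \<Longrightarrow> W1 x < 0" and inc: "\<And>x. -1 < x \<Longrightarrow> x < \<gamma> \<Longrightarrow> W1 x > 0"
    and \<alpha>: "0 < \<alpha>" "\<alpha> < 1" and \<kappa>: "\<kappa> > 0" and conv: "\<And>x. \<alpha> \<le> \<bar>x\<bar> \<Longrightarrow> \<bar>x\<bar> \<le> 1 \<Longrightarrow> W2 x \<ge> \<kappa>"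
  shows "\<bar>x\<bar> \<le> 1 \<Longrightarrow> (\<gamma> - x) * W1 x \<ge> 0"
    and "\<exists>\<mu>>0. \<mu> \<le> 1/4 \<and> (\<forall>x. \<bar>x\<bar> \<le> 1 \<longrightarrow> \<mu> * hump \<gamma> x \<le> (\<gamma> - x) * W1 x / 2 + W x / 2)"
    and "\<exists>C>0. \<forall>x. \<bar>x\<bar> \<le> 1 \<longrightarrow> (hump \<gamma> x)\<^sup>2 \<le> C * W x"
    and "\<exists>C>0. \<forall>x. \<bar>x\<bar> \<le> 1 \<longrightarrow> W x \<le> C * (x + 1)"
proof -
  have W1c: "isCont W1 x" for x using W1 by (rule DERIV_isCont)
  have sgn: "(\<gamma> - x) * W1 x \<ge> 0" if "\<bar>x\<bar> \<le> 1" for x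
  proof -
    consider "x = -1" | "x = 1" | "x = \<gamma>" | "-1 < x" "x < \<gamma>" | "\<gamma> < x" "x < 1" using \<open>\<bar>x\<bar> \<le> 1\<close> by fastforce
    then show ?thesis
    proof cases
      case 4
      then show ?thesis using inc[of x] by (intro mult_nonneg_nonneg) auto
    next
      case 5
      then show ?thesis using dec[of x] by (intro mult_nonpos_nonpos) auto
    qed (use wells in auto)
  qed
  show "\<bar>x\<bar> \<le> 1 \<Longrightarrow> (\<gamma> - x) * W1 x \<ge> 0" by (rule sgn)
  have left: "W1 x \<ge> \<kappa> * (x + 1)" "W x \<ge> \<kappa> * (x + 1)\<^sup>2 / 2" if "-1 \<le> x" "x \<le> - \<alpha>" for x
  proof -
    have d: "((\<lambda>z. W (z - 1)) has_real_derivative W1 (z - 1)) (at z)" "((\<lambda>z. W1 (z - 1)) has_real_derivative W2 (z - 1)) (at z)" for z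
    proof -
      have "((\<lambda>z. z - 1) has_real_derivative 1) (at z)" by (auto intro!: derivative_eq_intros)
      from DERIV_chain2[where f=W, OF W this] DERIV_chain2[where f=W1, OF W1 this]
      show "((\<lambda>z. W (z - 1)) has_real_derivative W1 (z - 1)) (at z)" "((\<lambda>z. W1 (z - 1)) has_real_derivative W2 (z - 1)) (at z)"
        by simp_all
    qed
    have "W2 (z - 1) \<ge> \<kappa>" if "0 \<le> z" "z \<le> 1 - \<alpha>" for z using conv[of "z - 1"] that \<alpha> by auto
    from convex_well_lower_bounds[OF d _ _ this, where z="x + 1"] that wells
    show "W1 x \<ge> \<kappa> * (x + 1)" "W x \<ge> \<kappa> * (x + 1)\<^sup>2 / 2" by auto
  qed
  have right: "- W1 x \<ge> \<kappa> * (1 - x)" "W x \<ge> \<kappa> * (1 - x)\<^sup>2 / 2" if "x \<le> 1" "\<alpha> \<le> x" for x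
  proof -
    have d: "((\<lambda>z. W (1 - z)) has_real_derivative - W1 (1 - z)) (at z)" "((\<lambda>z. - W1 (1 - z)) has_real_derivative W2 (1 - z)) (at z)" for z
    proof -
      have "((\<lambda>z. 1 - z) has_real_derivative -1) (at z)" by (auto intro!: derivative_eq_intros)
      from DERIV_chain2[where f=W, OF W this] DERIV_minus[OF DERIV_chain2[where f=W1, OF W1 this]]
      show "((\<lambda>z. W (1 - z)) has_real_derivative - W1 (1 - z)) (at z)" "((\<lambda>z. - W1 (1 - z)) has_real_derivative W2 (1 - z)) (at z)"
        by simp_all
    qed
    have "W2 (1 - z) \<ge> \<kappa>" if "0 \<le> z" "z \<le> 1 - \<alpha>" for z using conv[of "1 - z"] that \<alpha> by auto
    from convex_well_lower_bounds[OF d _ _ this, where z="1 - x"] that wells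
    show "- W1 x \<ge> \<kappa> * (1 - x)" "W x \<ge> \<kappa> * (1 - x)\<^sup>2 / 2" by auto
  qed
  \<comment> \<open>Convexity forces W' > 0 at -\<alpha>, whereas \<gamma> \<le> -\<alpha> would
    make W' negative just to the right of it.\<close>
  have \<gamma>\<alpha>: "- \<alpha> < \<gamma>"
  proof (rule ccontr)
    assume "\<not> - \<alpha> < \<gamma>"
    then have le: "\<gamma> \<le> - \<alpha>" by simp
    have "W1 (- \<alpha>) \<ge> \<kappa> * (1 - \<alpha>)" using left(1)[of "- \<alpha>"] \<alpha> by simp
    moreover have "\<kappa> * (1 - \<alpha>) > 0" using \<alpha> \<kappa> by simp
    ultimately have "W1 (- \<alpha>) > 0" by linarith
    then have "\<forall>\<^sub>F x in at_right (- \<alpha>). W1 x > 0"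
      using W1c[of "- \<alpha>"] by (auto simp: isCont_def filterlim_at_split intro: order_tendstoD)
    moreover have "\<forall>\<^sub>F x in at_right (- \<alpha>). x \<in> {- \<alpha><..<1}" using \<alpha> by (intro eventually_at_right_real) auto
    ultimately have "\<forall>\<^sub>F x in at_right (- \<alpha>). False"
      by eventually_elim (use le dec in force)
    then show False by simp
  qed
  have \<gamma>\<alpha>': "\<gamma> < \<alpha>"
  proof (rule ccontr)
    assume "\<not> \<gamma> < \<alpha>"
    then have le: "\<alpha> \<le> \<gamma>" by simp
    have "- W1 \<alpha> \<ge> \<kappa> * (1 - \<alpha>)" using right(1)[of \<alpha>] \<alpha> by simp
    moreover have "\<kappa> * (1 - \<alpha>) > 0" using \<alpha> \<kappa> by simp
    ultimately have "W1 \<alpha> < 0" by linarith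
    then have "\<forall>\<^sub>F x in at_left \<alpha>. W1 x < 0"
      using W1c[of \<alpha>] by (auto simp: isCont_def filterlim_at_split intro: order_tendstoD)
    moreover have "\<forall>\<^sub>F x in at_left \<alpha>. x \<in> {-1<..<\<alpha>}" using \<alpha> by (intro eventually_at_left_real) auto
    ultimately have "\<forall>\<^sub>F x in at_left \<alpha>. False"
      by eventually_elim (use le inc in force)
    then show False by simp
  qed
  define w0 where "w0 = \<kappa> * (1 - \<alpha>)\<^sup>2 / 2"
  have w0: "w0 > 0" using \<kappa> \<alpha> by (simp add: w0_def)
  have mid: "W x \<ge> w0" if "- \<alpha> \<le> x" "x \<le> \<alpha>" for x
  proof (cases "x \<le> \<gamma>")
    case True
    have "W (- \<alpha>) \<le> W x"
    proof (rule DERIV_nonneg_imp_nondecreasing[OF that(1)])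
      fix z assume z: "- \<alpha> \<le> z" "z \<le> x"
      then have "(\<gamma> - z) * W1 z \<ge> 0" using that \<alpha> by (intro sgn) auto
      moreover have "W1 z \<ge> 0 \<or> z = \<gamma>" using z True inc[of z] \<alpha> by (cases "z < \<gamma>") auto
      moreover have "W1 \<gamma> \<ge> 0"
      proof (rule ccontr)
        assume "\<not> W1 \<gamma> \<ge> 0"
        then have "\<forall>\<^sub>F x in at_left \<gamma>. W1 x < 0"
          using W1c[of \<gamma>] by (auto simp: isCont_def filterlim_at_split intro: order_tendstoD)
        moreover have "\<forall>\<^sub>F x in at_left \<gamma>. x \<in> {-1<..<\<gamma>}" using \<gamma> by (intro eventually_at_left_real) auto
        ultimately have "\<forall>\<^sub>F x in at_left \<gamma>. False"
          by eventually_elim (use inc in force)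
        then show False by simp
      qed
      ultimately show "\<exists>y. (W has_real_derivative y) (at z) \<and> 0 \<le> y" using W by auto
    qed
    moreover have "W (- \<alpha>) \<ge> w0" using left(2)[of "- \<alpha>"] \<alpha> by (simp add: w0_def)
    ultimately show ?thesis by simp
  next
    case False
    have "W \<alpha> \<le> W x"
    proof (rule DERIV_nonpos_imp_nonincreasing[OF that(2)])
      fix z assume z: "x \<le> z" "z \<le> \<alpha>"
      then have "W1 z \<le> 0" using False dec[of z] \<alpha> by auto
      then show "\<exists>y. (W has_real_derivative y) (at z) \<and> y \<le> 0" using W by auto
    qed
    moreover have "W \<alpha> \<ge> w0" using right(2)[of \<alpha>] \<alpha> by (simp add: w0_def)
    ultimately show ?thesis by simp
  qed
  have hleft: "hump \<gamma> x \<le> 2 * (x + 1) / (1 + \<gamma>)" if "-1 \<le> x" "x \<le> - \<alpha>" for x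
  proof -
    define s where "s = (\<gamma> - x) / (1 + \<gamma>)"
    have s1: "1 - s = (x + 1) / (1 + \<gamma>)" using \<gamma> by (simp add: s_def field_simps)
    have s: "s \<le> 1" "0 \<le> s" using s1 that \<gamma> \<gamma>\<alpha> by (auto simp: s_def divide_simps)
    have "hump \<gamma> x = 1 - s\<^sup>2" using that \<gamma>\<alpha> by (simp add: hump_def s_def power_divide power2_commute)
    also have "\<dots> = (1 - s) * (1 + s)" by (simp add: power2_eq_square algebra_simps)
    also have "\<dots> \<le> (1 - s) * 2" using s by (intro mult_left_mono) auto
    also have "\<dots> = 2 * (1 - s)" by simp
    finally show ?thesis unfolding s1 times_divide_eq_right .
  qed
  have hright: "hump \<gamma> x \<le> 2 * (1 - x) / (1 - \<gamma>)" if "x \<le> 1" "\<alpha> \<le> x" for x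
  proof -
    define s where "s = (x - \<gamma>) / (1 - \<gamma>)"
    have s1: "1 - s = (1 - x) / (1 - \<gamma>)" using \<gamma> by (simp add: s_def field_simps)
    have s: "s \<le> 1" "0 \<le> s" using s1 that \<gamma> \<gamma>\<alpha>' by (auto simp: s_def divide_simps)
    have "hump \<gamma> x = 1 - s\<^sup>2" using that \<gamma>\<alpha>' by (simp add: hump_def s_def power_divide)
    also have "\<dots> = (1 - s) * (1 + s)" by (simp add: power2_eq_square algebra_simps)
    also have "\<dots> \<le> (1 - s) * 2" using s by (intro mult_left_mono) auto
    also have "\<dots> = 2 * (1 - s)" by simp
    finally show ?thesis unfolding s1 times_divide_eq_right .
  qed
  show "\<exists>\<mu>>0. \<mu> \<le> 1/4 \<and> (\<forall>x. \<bar>x\<bar> \<le> 1 \<longrightarrow> \<mu> * hump \<gamma> x \<le> (\<gamma> - x) * W1 x / 2 + W x / 2)"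
  proof -
    define m1 where "m1 = (\<gamma> + \<alpha>) * \<kappa> * (1 + \<gamma>) / 4"
    define m2 where "m2 = (\<alpha> - \<gamma>) * \<kappa> * (1 - \<gamma>) / 4"
    define \<mu> where "\<mu> = min (min (1/4) (w0 / 2)) (min m1 m2)"
    have pos: "m1 > 0" "m2 > 0" using \<gamma> \<gamma>\<alpha> \<gamma>\<alpha>' \<kappa> by (auto simp: m1_def m2_def)
    have \<mu>: "\<mu> > 0" "\<mu> \<le> 1/4" "\<mu> \<le> w0 / 2" "\<mu> \<le> m1" "\<mu> \<le> m2" using pos w0 by (auto simp: \<mu>_def)
    have "\<mu> * hump \<gamma> x \<le> (\<gamma> - x) * W1 x / 2 + W x / 2" if x: "\<bar>x\<bar> \<le> 1" for x
    proof -
      have h0: "hump \<gamma> x \<ge> 0" "hump \<gamma> x \<le> 1" using hump_bounds[OF \<gamma> x] by auto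
      consider "-1 \<le> x" "x \<le> - \<alpha>" | "- \<alpha> \<le> x" "x \<le> \<alpha>" | "\<alpha> \<le> x" "x \<le> 1" using x by linarith
      then show ?thesis
      proof cases
        case 1
        have "\<mu> * hump \<gamma> x \<le> m1 * (2 * (x + 1) / (1 + \<gamma>))" using \<mu> h0 hleft[OF 1] pos by (intro mult_mono) auto
        also have "\<dots> = (\<gamma> + \<alpha>) * (\<kappa> * (x + 1)) / 2" using \<gamma> by (simp add: m1_def field_simps)
        also have "\<dots> \<le> (\<gamma> - x) * W1 x / 2" using left(1)[OF 1] 1 \<gamma>\<alpha> \<kappa> by (intro divide_right_mono mult_mono) auto
        finally show ?thesis using nonneg[of x] by simp
      next
        case 2
        have "\<mu> * hump \<gamma> x \<le> w0 / 2 * 1" using \<mu> h0 w0 by (intro mult_mono) auto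
        then show ?thesis using mid[OF 2] sgn[OF x] by simp
      next
        case 3
        have "\<mu> * hump \<gamma> x \<le> m2 * (2 * (1 - x) / (1 - \<gamma>))" using \<mu> h0 hright[OF 3(2,1)] pos by (intro mult_mono) auto
        also have "\<dots> = (\<alpha> - \<gamma>) * (\<kappa> * (1 - x)) / 2" using \<gamma> by (simp add: m2_def field_simps)
        also have "\<dots> \<le> (x - \<gamma>) * (- W1 x) / 2" using right(1)[OF 3(2,1)] 3 \<gamma>\<alpha>' \<kappa> by (intro divide_right_mono mult_mono) auto
        also have "(x - \<gamma>) * (- W1 x) = (\<gamma> - x) * W1 x" by (simp add: algebra_simps)
        finally show ?thesis using nonneg[of x] by simp
      qed
    qed
    then show ?thesis using \<mu> by blast
  qed
  show "\<exists>C>0. \<forall>x. \<bar>x\<bar> \<le> 1 \<longrightarrow> (hump \<gamma> x)\<^sup>2 \<le> C * W x"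
  proof -
    define c1 where "c1 = 8 / (\<kappa> * (1 + \<gamma>)\<^sup>2)"
    define c2 where "c2 = 8 / (\<kappa> * (1 - \<gamma>)\<^sup>2)"
    have pos: "c1 > 0" "c2 > 0" "1 / w0 > 0" using \<gamma> \<kappa> w0 by (auto simp: c1_def c2_def)
    have "(hump \<gamma> x)\<^sup>2 \<le> (c1 + c2 + 1 / w0) * W x" if x: "\<bar>x\<bar> \<le> 1" for x
    proof -
      have h0: "hump \<gamma> x \<ge> 0" "hump \<gamma> x \<le> 1" using hump_bounds[OF \<gamma> x] by auto
      have p: "c1 * W x \<ge> 0" "c2 * W x \<ge> 0" "1 / w0 * W x \<ge> 0" using pos nonneg[of x] by simp_all
      consider "-1 \<le> x" "x \<le> - \<alpha>" | "- \<alpha> \<le> x" "x \<le> \<alpha>" | "\<alpha> \<le> x" "x \<le> 1" using x by linarith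
      then have "(hump \<gamma> x)\<^sup>2 \<le> c1 * W x + c2 * W x + 1 / w0 * W x"
      proof cases
        case 1
        have "(hump \<gamma> x)\<^sup>2 \<le> (2 * (x + 1) / (1 + \<gamma>))\<^sup>2" using h0 hleft[OF 1] by (intro power_mono) auto
        also have "\<dots> = c1 * (\<kappa> * (x + 1)\<^sup>2 / 2)" using \<gamma> \<kappa> by (simp add: c1_def power_divide power_mult_distrib del: distrib_left_numeral)
        also have "\<dots> \<le> c1 * W x" using left(2)[OF 1] pos by (intro mult_left_mono) auto
        finally show ?thesis using p by linarith
      next
        case 2
        have "(hump \<gamma> x)\<^sup>2 \<le> 1" using h0 by (simp add: power_le_one)
        also have "1 \<le> 1 / w0 * W x" using mid[OF 2] w0 by simp
        finally show ?thesis using p by linarith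
      next
        case 3
        have "(hump \<gamma> x)\<^sup>2 \<le> (2 * (1 - x) / (1 - \<gamma>))\<^sup>2" using h0 hright[OF 3(2,1)] by (intro power_mono) auto
        also have "\<dots> = c2 * (\<kappa> * (1 - x)\<^sup>2 / 2)" using \<gamma> \<kappa> by (simp add: c2_def power_divide power_mult_distrib del: right_diff_distrib_numeral)
        also have "\<dots> \<le> c2 * W x" using right(2)[OF 3(2,1)] pos by (intro mult_left_mono) auto
        finally show ?thesis using p by linarith
      qed
      then show ?thesis by (simp add: distrib_right)
    qed
    moreover have "c1 + c2 + 1 / w0 > 0" using pos by linarith
    ultimately show ?thesis by blast
  qed
  show "\<exists>C>0. \<forall>x. \<bar>x\<bar> \<le> 1 \<longrightarrow> W x \<le> C * (x + 1)"
  proof -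
    have "continuous_on {-1..1} W1" using W1c by (intro continuous_at_imp_continuous_on) auto
    then have "bounded (W1 ` {-1..1})" by (intro compact_imp_bounded compact_continuous_image) auto
    then obtain B where B: "B > 0" "\<And>x. x \<in> {-1..1} \<Longrightarrow> \<bar>W1 x\<bar> \<le> B"
      unfolding bounded_pos by auto
    have "W x \<le> B * (x + 1)" if x: "\<bar>x\<bar> \<le> 1" for x
    proof -
      have "B * (- 1 + 1) - W (-1) \<le> B * (x + 1) - W x"
      proof (rule DERIV_nonneg_imp_nondecreasing[where f="\<lambda>z. B * (z + 1) - W z"])
        fix z assume z: "-1 \<le> z" "z \<le> x"
        have "((\<lambda>z. B * (z + 1) - W z) has_real_derivative B - W1 z) (at z)"
          by (auto intro!: derivative_eq_intros W)
        moreover have "B - W1 z \<ge> 0" 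
        proof -
          have "z \<le> 1" using z x by linarith
          then show ?thesis using B(2)[of z] z by auto
        qed
        ultimately show "\<exists>y. ((\<lambda>z. B * (z + 1) - W z) has_real_derivative y) (at z) \<and> 0 \<le> y" by blast
      qed (use x in auto)
      then show ?thesis using wells by simp
    qed
    then show ?thesis using B by blast
  qed
qed

section \<open>From the barrier to a discrepancy bound in powers of \<epsilon>\<close>

context allen_cahn_transport
begin

text \<open>With \<omega> = \<epsilon>^(1-\<beta>), the barrier terms containing \<open>hump\<close>
  are split by the arithmetic-geometric mean with weight \<eta> = \<epsilon>^\<delta>, using the
  bound of its square by CB W: one part is a small multiple of W, the rest is \<omega>^2/\<eta>, and
  \<omega>/\<eta> times the layer. The value of \<delta> is the one that makes \<omega>^2/\<eta> =
  \<epsilon> \<eta>; it is positive because \<beta> < 1/2, and -\<beta> - \<delta> equals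
  -1/2.\<close>

lemma discrepancy_bound:
  fixes \<gamma> \<mu> \<beta> CB CL :: real
  assumes \<gamma>: "-1 < \<gamma>" "\<gamma> < 1" and \<mu>: "0 < \<mu>" "\<mu> \<le> 1/4" and \<beta>: "0 < \<beta>" "\<beta> < 1/2"
    and sgn: "\<And>x. \<bar>x\<bar> \<le> 1 \<Longrightarrow> (\<gamma> - x) * W1 x \<ge> 0"
    and bw: "\<And>x. \<bar>x\<bar> \<le> 1 \<Longrightarrow> \<mu> * hump \<gamma> x \<le> (\<gamma> - x) * W1 x / 2 + W x / 2"
    and CB: "CB > 0" "\<And>x. \<bar>x\<bar> \<le> 1 \<Longrightarrow> (hump \<gamma> x)\<^sup>2 \<le> CB * W x"
    and CL: "CL > 0" "\<And>x. \<bar>x\<bar> \<le> 1 \<Longrightarrow> W x \<le> CL * (x + 1)"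
    and init: "\<And>x. \<epsilon> * (norm (g x 0))\<^sup>2 / 2 - W (\<phi> x 0) / \<epsilon> \<le> \<epsilon> powr (- \<beta>)"
    and Du: "\<And>x t. t \<in> {0..T} \<Longrightarrow> norm (Du x t) \<le> \<epsilon> powr (- (\<beta> + 1))"
    and cpt: "\<And>\<delta>. \<delta> > 0 \<Longrightarrow> \<exists>K. compact K \<and> (\<forall>x. \<forall>t\<in>{0..T}.
        (\<exists>x'\<in>K. \<phi> x' t = \<phi> x t \<and> g x' t = g x t) \<or> \<epsilon>\<^sup>2 * (norm (g x t))\<^sup>2 / 2 < \<delta>)"
    and t: "t \<in> {0..T}"
  defines "\<delta> \<equiv> (1 - 2 * \<beta>) / 2"
  shows "\<epsilon> * (norm (g x t))\<^sup>2 - E x t \<le> 2 * \<epsilon> powr \<delta> * E x t + (4 * CB + 2) * \<epsilon> powr \<delta>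
      + (4 * CB + 2) * \<epsilon> powr (- \<beta> - \<delta>) * exp (- 2 * \<mu> * t / \<epsilon>\<^sup>2)"
    and "E x t \<le> (4 * CL + 8) / \<epsilon>"
proof -
  define \<omega> where "\<omega> = \<epsilon> powr (1 - \<beta>)"
  have \<omega>: "\<omega> > 0" using eps_pos by (simp add: \<omega>_def)
  have \<omega>1: "\<omega> \<le> 1" unfolding \<omega>_def using eps_pos eps_less_1 \<beta> by (intro powr_le1) auto
  have e2: "\<epsilon>\<^sup>2 = \<epsilon> powr 2" using eps_pos by simp
  have \<epsilon>\<omega>: "\<epsilon> * \<epsilon> powr (- \<beta>) = \<omega>" using eps_pos by (simp add: \<omega>_def powr_diff powr_minus divide_inverse)
  have init': "\<epsilon>\<^sup>2 * (norm (g x 0))\<^sup>2 / 2 - W (\<phi> x 0) \<le> \<omega>" for x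
  proof -
    have "\<epsilon> * (\<epsilon> * (norm (g x 0))\<^sup>2 / 2 - W (\<phi> x 0) / \<epsilon>) \<le> \<epsilon> * \<epsilon> powr (- \<beta>)"
      using init[of x] eps_pos by (intro mult_left_mono) auto
    then show ?thesis unfolding \<epsilon>\<omega> using eps_pos by (simp add: right_diff_distrib power2_eq_square mult.assoc)
  qed
  have Du': "\<epsilon>\<^sup>2 * norm (Du x t) \<le> \<omega>" if "t \<in> {0..T}" for x t
  proof -
    have "\<epsilon>\<^sup>2 * norm (Du x t) \<le> \<epsilon> powr 2 * \<epsilon> powr (- (\<beta> + 1))"
      unfolding e2 by (intro mult_left_mono Du that) auto
    also have "\<dots> = \<omega>" unfolding powr_add[symmetric] \<omega>_def by (simp add: algebra_simps)
    finally show ?thesis .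
  qed
  define X where "X = exp (- \<mu> * t / \<epsilon>\<^sup>2)"
  have X: "X > 0" "X \<le> 1" using \<mu> t by (auto simp: X_def)
  have XX: "exp (- 2 * \<mu> * t / \<epsilon>\<^sup>2) = X\<^sup>2" by (simp add: X_def exp_double[symmetric])
  define h where "h = hump \<gamma> (\<phi> x t)"
  have h: "0 \<le> h" "h \<le> 1" "h\<^sup>2 \<le> CB * W (\<phi> x t)"
    using hump_bounds[OF \<gamma> \<phi>_bound[OF t]] CB(2)[OF \<phi>_bound[OF t]] by (auto simp: h_def)
  have B: "\<epsilon>\<^sup>2 * (norm (g x t))\<^sup>2 / 2 - W (\<phi> x t) \<le> (4 * \<omega> + 2 * sqrt \<omega> * X) * h + 2 * \<omega> * X\<^sup>2"
    using discrepancy_barrier[OF \<gamma> \<mu> \<omega> sgn bw init' Du' cpt t, of x]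
    unfolding h_def[symmetric] XX X_def[symmetric] .
  have E_eq: "\<epsilon> * E x t = \<epsilon>\<^sup>2 * (norm (g x t))\<^sup>2 / 2 + W (\<phi> x t)"
    using eps_pos by (simp add: E_def power2_eq_square distrib_left)
  define \<eta> where "\<eta> = \<epsilon> powr \<delta>"
  have \<eta>: "\<eta> > 0" "\<eta> \<le> 1" unfolding \<eta>_def using eps_pos eps_less_1 \<beta> by (auto simp: \<delta>_def intro!: powr_le1)
  have hW: "h\<^sup>2 / CB \<le> W (\<phi> x t)" using h CB by (simp add: divide_le_eq mult.commute)
  have amgm: "2 * a * h \<le> \<eta> * W (\<phi> x t) + a\<^sup>2 * CB / \<eta>" for a
  proof -
    have "0 \<le> (\<eta> * h - a * CB)\<^sup>2 / (\<eta> * CB)" using \<eta> CB by simp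
    also have "\<dots> = \<eta> * (h\<^sup>2 / CB) + a\<^sup>2 * CB / \<eta> - 2 * a * h"
      using \<eta> CB by (simp add: field_simps power2_eq_square)
    also have "\<dots> \<le> \<eta> * W (\<phi> x t) + a\<^sup>2 * CB / \<eta> - 2 * a * h"
      using mult_left_mono[OF hW, of \<eta>] \<eta> by simp
    finally show ?thesis by simp
  qed
  have c1: "\<omega>\<^sup>2 / \<eta> = \<epsilon> * \<eta>"
  proof -
    have "\<omega>\<^sup>2 / \<eta> = \<epsilon> powr ((1 - \<beta>) + (1 - \<beta>) - \<delta>)"
      using eps_pos by (simp add: \<omega>_def \<eta>_def power2_eq_square powr_add[symmetric] powr_diff[symmetric])
    also have "(1 - \<beta>) + (1 - \<beta>) - \<delta> = 1 + \<delta>" by (simp add: \<delta>_def field_simps)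
    finally show ?thesis using eps_pos by (simp add: powr_add \<eta>_def)
  qed
  have c2: "\<omega> / \<eta> = \<epsilon> * \<epsilon> powr (- \<beta> - \<delta>)"
  proof -
    have "\<omega> / \<eta> = \<epsilon> powr (1 + (- \<beta> - \<delta>))"
      using eps_pos by (simp add: \<omega>_def \<eta>_def powr_diff[symmetric] algebra_simps)
    then show ?thesis using eps_pos by (simp add: powr_add)
  qed
  have "\<epsilon>\<^sup>2 * (norm (g x t))\<^sup>2 / 2 - W (\<phi> x t) \<le> 2 * (2 * \<omega>) * h + 2 * (sqrt \<omega> * X) * h + 2 * \<omega> * X\<^sup>2"
    using B by (simp add: algebra_simps)
  also have "\<dots> \<le> (\<eta> * W (\<phi> x t) + (2 * \<omega>)\<^sup>2 * CB / \<eta>) + (\<eta> * W (\<phi> x t) + (sqrt \<omega> * X)\<^sup>2 * CB / \<eta>) + 2 * (\<omega> / \<eta>) * X\<^sup>2"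
  proof -
    have "\<omega> \<le> \<omega> / \<eta>" using \<eta> \<omega> by (simp add: le_divide_eq)
    then have "2 * \<omega> * X\<^sup>2 \<le> 2 * (\<omega> / \<eta>) * X\<^sup>2" by (intro mult_right_mono) auto
    then show ?thesis using amgm[of "2 * \<omega>"] amgm[of "sqrt \<omega> * X"] by linarith
  qed
  also have "\<dots> = 2 * \<eta> * W (\<phi> x t) + 4 * CB * (\<omega>\<^sup>2 / \<eta>) + (CB + 2) * (\<omega> / \<eta>) * X\<^sup>2"
    using \<omega> by (simp add: power_mult_distrib algebra_simps add_divide_distrib)
  also have "\<dots> \<le> 2 * \<eta> * (\<epsilon> * E x t) + (4 * CB + 2) * (\<epsilon> * \<eta>) + (4 * CB + 2) * (\<epsilon> * \<epsilon> powr (- \<beta> - \<delta>)) * X\<^sup>2"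
    unfolding c1 c2
  proof (intro add_mono mult_left_mono mult_right_mono)
    show "W (\<phi> x t) \<le> \<epsilon> * E x t" unfolding E_eq by simp
  qed (use CB eps_pos \<eta> in auto)
  also have "\<dots> = \<epsilon> * (2 * \<eta> * E x t + (4 * CB + 2) * \<eta> + (4 * CB + 2) * \<epsilon> powr (- \<beta> - \<delta>) * X\<^sup>2)"
    by (simp add: algebra_simps)
  finally have "\<epsilon> * (\<epsilon> * (norm (g x t))\<^sup>2 - E x t) \<le> \<epsilon> * (2 * \<eta> * E x t + (4 * CB + 2) * \<eta> + (4 * CB + 2) * \<epsilon> powr (- \<beta> - \<delta>) * X\<^sup>2)"
    unfolding right_diff_distrib E_eq by (simp add: power2_eq_square)
  then show "\<epsilon> * (norm (g x t))\<^sup>2 - E x t \<le> 2 * \<epsilon> powr \<delta> * E x t + (4 * CB + 2) * \<epsilon> powr \<delta>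
      + (4 * CB + 2) * \<epsilon> powr (- \<beta> - \<delta>) * exp (- 2 * \<mu> * t / \<epsilon>\<^sup>2)"
    using eps_pos unfolding XX \<eta>_def by simp
  have sw: "sqrt \<omega> \<le> 1" using \<omega>1 by simp
  have q1: "(4 * \<omega> + 2 * sqrt \<omega> * X) * h \<le> (4 * 1 + 2 * 1 * 1) * 1"
    using \<omega> \<omega>1 sw X h by (intro mult_mono add_mono) auto
  have q2: "2 * \<omega> * X\<^sup>2 \<le> 2 * 1 * 1" using \<omega> \<omega>1 X by (intro mult_mono) (auto simp: power_le_one)
  have q3: "W (\<phi> x t) \<le> CL * 2"
    using CL(2)[OF \<phi>_bound[OF t, of x]] \<phi>_bound[OF t, of x] CL(1) mult_left_mono[of "\<phi> x t + 1" 2 CL] by linarith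
  have "\<epsilon>\<^sup>2 * (norm (g x t))\<^sup>2 / 2 - W (\<phi> x t) \<le> (4 * 1 + 2 * 1 * 1) * 1 + 2 * 1 * 1"
    by (rule order_trans[OF B add_mono[OF q1 q2]])
  then have q4: "\<epsilon>\<^sup>2 * (norm (g x t))\<^sup>2 / 2 - W (\<phi> x t) \<le> 8" by simp
  have "a + b \<le> 4 * c + 8" if "a - b \<le> 8" "b \<le> c * 2" for a b c :: real using that by linarith
  from this[OF q4 q3] have "\<epsilon> * E x t \<le> 4 * CL + 8" unfolding E_eq .
  then show "E x t \<le> (4 * CL + 8) / \<epsilon>" using eps_pos by (simp add: le_divide_eq mult.commute)
qed

end

section \<open>Unfolding the torus\<close>

lemma countable_lattice: "countable {k :: real^'n. lattice_vec k}"
proof -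
  have "countable (\<int> :: real set)" unfolding Ints_def by simp
  then have "countable (PiE (UNIV :: 'n set) (\<lambda>_. \<int> :: real set))" by (intro countable_PiE) auto
  then have "countable ((\<lambda>f. \<chi> i. f i) ` PiE (UNIV :: 'n set) (\<lambda>_. \<int> :: real set))" by (rule countable_image)
  moreover have "{k :: real^'n. lattice_vec k} \<subseteq> (\<lambda>f. \<chi> i. f i) ` PiE (UNIV :: 'n set) (\<lambda>_. \<int> :: real set)"
  proof
    fix k :: "real^'n" assume "k \<in> {k. lattice_vec k}"
    then have "(\<lambda>i. k $ i) \<in> PiE (UNIV :: 'n set) (\<lambda>_. \<int> :: real set)" by (auto simp: lattice_vec_def)
    then show "k \<in> (\<lambda>f. \<chi> i. f i) ` PiE (UNIV :: 'n set) (\<lambda>_. \<int> :: real set)"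
      by (intro image_eqI[of _ _ "\<lambda>i. k $ i"]) (simp_all add: vec_eq_iff)
  qed
  ultimately show ?thesis by (rule countable_subset[rotated])
qed

lemma lattice_vec_uminus: "lattice_vec k \<Longrightarrow> lattice_vec (- k)"
  by (simp add: lattice_vec_def)

lemma lattice_vec_close:
  fixes k k' :: "real^'n"
  assumes "lattice_vec k" "lattice_vec k'" "dist k k' < 1"
  shows "k = k'"
proof (rule ccontr)
  assume "k \<noteq> k'"
  then obtain i where i: "k $ i \<noteq> k' $ i" by (auto simp: vec_eq_iff)
  obtain a b where ab: "k $ i = of_int a" "k' $ i = of_int b"
    using assms unfolding lattice_vec_def by (metis Ints_cases)
  have "1 \<le> \<bar>k $ i - k' $ i\<bar>" using i unfolding ab by (simp flip: of_int_diff of_int_abs)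
  also have "\<dots> \<le> norm (k - k')" using component_le_norm_cart[of "k - k'" i] by simp
  finally show False using assms by (simp add: dist_norm)
qed

lemma unit_cell_measurable [measurable]: "Omega tor \<in> sets (borel :: (real^'n) measure)"
proof (cases tor)
  case True
  have "Omega tor = (\<Inter>i. {x :: real^'n. 0 \<le> x $ i} \<inter> {x. x $ i < 1})" using True by (auto simp: Omega_def)
  moreover have "{x :: real^'n. 0 \<le> x $ i} \<inter> {x. x $ i < 1} \<in> sets borel" for i
    by (intro sets.Int borel_closed borel_open closed_Collect_le open_Collect_less continuous_intros)
  ultimately show ?thesis by simp
qed (simp add: Omega_def)

lemma lattice_tiling:
  fixes x :: "real^'n"
  shows "(\<integral>\<^sup>+k. indicator (Omega True) (x - k) \<partial>count_space {k. lattice_vec k}) = (1 :: ennreal)"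
proof -
  define k0 :: "real^'n" where "k0 = (\<chi> i. of_int \<lfloor>x $ i\<rfloor>)"
  have k0: "lattice_vec k0" by (simp add: lattice_vec_def k0_def)
  have "indicator (Omega True) (x - k) = (indicator {k0} k :: ennreal)" if "lattice_vec k" for k
  proof -
    have "x - k \<in> Omega True \<longleftrightarrow> k = k0"
    proof
      assume a: "x - k \<in> Omega True"
      have "k $ i = k0 $ i" for i
      proof -
        have "k $ i \<in> \<int>" using that by (simp add: lattice_vec_def)
        then obtain b where "k $ i = of_int b" by (rule Ints_cases)
        moreover have "0 \<le> x $ i - k $ i" "x $ i - k $ i < 1" using a by (auto simp: Omega_def)
        ultimately show ?thesis by (simp add: k0_def) linarith
      qed
      then show "k = k0" by (simp add: vec_eq_iff)
    next
      assume "k = k0"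
      have "0 \<le> x $ i - of_int \<lfloor>x $ i\<rfloor> \<and> x $ i - of_int \<lfloor>x $ i\<rfloor> < 1" for i by linarith
      then show "x - k \<in> Omega True" using \<open>k = k0\<close> by (simp add: Omega_def k0_def)
    qed
    then show ?thesis by (simp add: indicator_def)
  qed
  then have "(\<integral>\<^sup>+k. indicator (Omega True) (x - k) \<partial>count_space {k. lattice_vec k}) = (\<integral>\<^sup>+k. indicator {k0} k \<partial>count_space {k. lattice_vec k})"
    by (intro nn_integral_cong) simp
  also have "\<dots> = 1" using k0 by (subst nn_integral_indicator) auto
  finally show ?thesis .
qed

text \<open>Each point of R^n is a lattice translate of a point of the cell in exactly one way;
  Tonelli over the countable lattice does the rest.\<close>

lemma nn_integral_unfold_cell:
  fixes f :: "real^'n \<Rightarrow> ennreal"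
  assumes [measurable]: "f \<in> borel_measurable borel"
  shows "(\<integral>x. f x) = (\<integral>x. (\<integral>\<^sup>+k. f (x + k) \<partial>count_space {k. lattice_vec k}) * indicator (Omega True) x)"
proof -
  have "(\<integral>x. f x) = (\<integral>x. (\<integral>\<^sup>+k. f x * indicator (Omega True) (x - k) \<partial>count_space {k. lattice_vec k}))"
    by (simp add: nn_integral_cmult lattice_tiling)
  also have "\<dots> = (\<integral>\<^sup>+k. (\<integral>x. f x * indicator (Omega True) (x - k)) \<partial>count_space {k. lattice_vec k})"
    by (rule nn_integral_count_space_nn_integral[OF countable_lattice]) measurable
  also have "\<dots> = (\<integral>\<^sup>+k. (\<integral>x. f (x + k) * indicator (Omega True) x) \<partial>count_space {k. lattice_vec k})"
  proof (rule nn_integral_cong)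
    fix k :: "real^'n"
    show "(\<integral>x. f x * indicator (Omega True) (x - k)) = (\<integral>x. f (x + k) * indicator (Omega True) x)"
      using nn_integral_translate[of "\<lambda>x. f x * indicator (Omega True) (x - k)" k] by (simp add: add.commute)
  qed
  also have "\<dots> = (\<integral>x. (\<integral>\<^sup>+k. f (x + k) * indicator (Omega True) x \<partial>count_space {k. lattice_vec k}))"
    by (rule nn_integral_count_space_nn_integral[OF countable_lattice, symmetric]) measurable
  finally show ?thesis by (simp add: nn_integral_multc)
qed

text \<open>Two lattice translates of one point inside a ball of radius r \<le> 1/2 are less than 1
  apart, hence equal. So at most one term of the unfolded sum survives and no point of the torus is
  counted twice.\<close>

lemma ball_integral_le_Oball:
  fixes h :: "real^'n \<Rightarrow> ennreal"
  assumes [measurable]: "h \<in> borel_measurable borel" and per: "\<And>x k. tor \<Longrightarrow> lattice_vec k \<Longrightarrow> h (x + k) = h x"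
    and r: "r \<le> 1/2"
  shows "(\<integral>x. (if dist x y < r then h x else 0)) \<le> (\<integral>x. h x * indicator (Oball tor y r \<inter> Omega tor) x)"
proof (cases tor)
  case False
  then show ?thesis by (intro nn_integral_mono) (auto simp: Oball_def Omega_def indicator_def dist_commute)
next
  case True
  have "(\<integral>x. (if dist x y < r then h x else 0))
    = (\<integral>x. (\<integral>\<^sup>+k. (if dist (x + k) y < r then h (x + k) else 0) \<partial>count_space {k. lattice_vec k}) * indicator (Omega True) x)"
    by (rule nn_integral_unfold_cell) measurable
  also have "\<dots> \<le> (\<integral>x. h x * indicator (Oball tor y r \<inter> Omega tor) x)"
  proof (rule nn_integral_mono)
    fix x
    show "(\<integral>\<^sup>+k. (if dist (x + k) y < r then h (x + k) else 0) \<partial>count_space {k. lattice_vec k}) * indicator (Omega True) x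
      \<le> h x * indicator (Oball tor y r \<inter> Omega tor) x"
    proof (cases "x \<in> Omega True \<and> (\<exists>k. lattice_vec k \<and> dist (x + k) y < r)")
      case T: True
      then obtain k0 where k0: "lattice_vec k0" "dist (x + k0) y < r" by blast
      have eq: "(if dist (x + k) y < r then h (x + k) else 0) \<le> h x * indicator {k0} k" if "lattice_vec k" for k
      proof (cases "dist (x + k) y < r")
        case True
        have "dist k k0 = dist (x + k) (x + k0)" by (simp add: dist_norm)
        also have "\<dots> \<le> dist (x + k) y + dist (x + k0) y" by (rule dist_triangle2)
        also have "\<dots> < 1" using True k0 r by linarith
        finally have "k = k0" by (rule lattice_vec_close[OF that k0(1)])
        then show ?thesis using per[OF \<open>tor\<close> that] by simp
      qed simp
      have "(\<integral>\<^sup>+k. (if dist (x + k) y < r then h (x + k) else 0) \<partial>count_space {k. lattice_vec k}) \<le> (\<integral>\<^sup>+k. h x * indicator {k0} k \<partial>count_space {k. lattice_vec k})"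
        using eq by (intro nn_integral_mono) auto
      also have "\<dots> = h x" using k0 by (subst nn_integral_cmult_indicator) auto
      finally have le: "(\<integral>\<^sup>+k. (if dist (x + k) y < r then h (x + k) else 0) \<partial>count_space {k. lattice_vec k}) \<le> h x" .
      have "x \<in> Oball tor y r"
        unfolding Oball_def using T k0 \<open>tor\<close> lattice_vec_uminus[OF k0(1)]
        by (auto intro!: exI[of _ "- k0"] simp: dist_norm algebra_simps)
      then show ?thesis using le T \<open>tor\<close> by (simp add: indicator_def)
    next
      case F: False
      show ?thesis
      proof (cases "x \<in> Omega True")
        case True
        then have "(\<integral>\<^sup>+k. (if dist (x + k) y < r then h (x + k) else 0) \<partial>count_space {k. lattice_vec k}) = (\<integral>\<^sup>+k. 0 \<partial>count_space {k :: real^'n. lattice_vec k})"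
          using F by (intro nn_integral_cong) auto
        then show ?thesis by simp
      qed simp
    qed
  qed
  finally show ?thesis .
qed

text \<open>The reverse inequality has no bound on the radius: a point of the torus ball has at
  least one translate in the Euclidean ball.\<close>

lemma Oball_integral_le_ball:
  fixes h :: "real^'n \<Rightarrow> ennreal"
  assumes [measurable]: "h \<in> borel_measurable borel" and per: "\<And>x k. tor \<Longrightarrow> lattice_vec k \<Longrightarrow> h (x + k) = h x"
  shows "(\<integral>x. h x * indicator (Oball tor y r \<inter> Omega tor) x) \<le> (\<integral>x. (if dist x y < r then h x else 0))"
proof (cases tor)
  case False
  then show ?thesis by (intro nn_integral_mono) (auto simp: Oball_def Omega_def indicator_def dist_commute)
next
  case True
  have "(\<integral>x. h x * indicator (Oball tor y r \<inter> Omega tor) x)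
    \<le> (\<integral>x. (\<integral>\<^sup>+k. (if dist (x + k) y < r then h (x + k) else 0) \<partial>count_space {k. lattice_vec k}) * indicator (Omega True) x)"
  proof (rule nn_integral_mono)
    fix x
    show "h x * indicator (Oball tor y r \<inter> Omega tor) x
      \<le> (\<integral>\<^sup>+k. (if dist (x + k) y < r then h (x + k) else 0) \<partial>count_space {k. lattice_vec k}) * indicator (Omega True) x"
    proof (cases "x \<in> Oball tor y r \<inter> Omega tor")
      case T: True
      then obtain k where k: "lattice_vec k" "dist x (y + k) < r" using True by (auto simp: Oball_def)
      have d: "dist (x + - k) y < r" using k(2) by (simp add: dist_norm algebra_simps)
      have "h x = (if dist (x + - k) y < r then h (x + - k) else 0)"
        using d per[OF True lattice_vec_uminus[OF k(1)]] by simp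
      also have "\<dots> \<le> (\<integral>\<^sup>+k. (if dist (x + k) y < r then h (x + k) else 0) \<partial>count_space {k. lattice_vec k})"
        by (rule nn_integral_ge_point[where p="\<lambda>k. if dist (x + k) y < r then h (x + k) else 0"]) (use lattice_vec_uminus[OF k(1)] in simp)
      finally show ?thesis using T True by (simp add: indicator_def)
    qed simp
  qed
  also have "\<dots> = (\<integral>x. (if dist x y < r then h x else 0))"
    by (rule nn_integral_unfold_cell[symmetric]) measurable
  finally show ?thesis .
qed

section \<open>Almost monotonicity of the localized heat kernel average\<close>

text \<open>Bridge from integrals of signed continuous functions to nonnegative majorants. Only the
  positive part has to be dominated, since \<open>ennreal\<close> sends negative numbers to
  0.\<close>

lemma integral_le_of_nn_integral_le:
  fixes f :: "'a::euclidean_space \<Rightarrow> real"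
  assumes f: "continuous_on (cbox l r) f" and P: "\<And>x. x \<in> cbox l r \<Longrightarrow> ennreal (f x) \<le> P x"
    and c: "(\<integral>x. P x) \<le> ennreal c" "c \<ge> 0"
  shows "integral (cbox l r) f \<le> c"
proof -
  have fc: "continuous_on (cbox l r) (\<lambda>x. max 0 (f x))" using f by (intro continuous_intros)
  have int: "(\<lambda>x. max 0 (f x)) integrable_on cbox l r" by (rule integrable_continuous[OF fc])
  have "integral (cbox l r) f \<le> integral (cbox l r) (\<lambda>x. max 0 (f x))"
    by (rule integral_le[OF integrable_continuous[OF f] int]) simp
  also have "\<dots> \<le> c"
  proof -
    let ?I = "integral (cbox l r) (\<lambda>x. max 0 (f x))"
    let ?h = "\<lambda>x. if x \<in> cbox l r then max 0 (f x) else 0"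
    have "(?h has_integral ?I) UNIV"
      using integrable_integral[OF int] by (subst has_integral_restrict_UNIV)
    moreover have "?h \<in> borel_measurable borel"
    proof -
      have "(\<lambda>x. indicator (cbox l r) x *\<^sub>R max 0 (f x)) \<in> borel_measurable borel"
        by (rule borel_measurable_continuous_on_indicator[OF _ fc]) simp
      moreover have "(\<lambda>x. indicator (cbox l r) x *\<^sub>R max 0 (f x)) = ?h" by (auto simp: indicator_def)
      ultimately show ?thesis by simp
    qed
    ultimately have A: "(\<integral>x. ennreal (?h x)) = ennreal ?I"
      by (intro nn_integral_has_integral_lborel) auto
    have B: "(\<integral>x. ennreal (?h x)) \<le> (\<integral>x. P x)"
      using P by (intro nn_integral_mono) (auto simp: max_def ennreal_neg)
    have "ennreal ?I \<le> ennreal c" unfolding A[symmetric] by (rule order_trans[OF B c(1)])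
    then show ?thesis using c by simp
  qed
  finally show ?thesis .
qed

lemma powr_diff_le:
  fixes x y a :: real
  assumes "0 \<le> y" "y \<le> x" "0 < a" "a \<le> 1"
  shows "x powr a - y powr a \<le> (x - y) powr a"
proof (cases "x = 0")
  case False
  then have x: "x > 0" using assms by simp
  have sub: "z * x powr a / x \<le> z powr a" if "0 \<le> z" "z \<le> x" for z
  proof (cases "z = 0")
    case False
    then have z: "z > 0" using that by simp
    have "z / x \<le> (z / x) powr a"
    proof -
      have "(z / x) powr 1 \<le> (z / x) powr a" using z x that assms by (intro powr_mono') auto
      then show ?thesis using z x by simp
    qed
    then have "z / x * x powr a \<le> (z / x) powr a * x powr a" by (intro mult_right_mono) auto
    also have "\<dots> = z powr a" using z x by (simp add: powr_divide)
    finally show ?thesis by simp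
  qed simp
  have "x powr a = y * x powr a / x + (x - y) * x powr a / x" using x by (simp add: field_simps)
  also have "\<dots> \<le> y powr a + (x - y) powr a" using assms by (intro add_mono sub) auto
  finally show ?thesis by simp
qed (use assms in auto)

text \<open>A comparison of A with \<theta> N^(q-2) decides which summand dominates. The exponents
  are those of Young's inequality for the pair q/2 and q/(q-2), with constants 1; \<theta> stays
  free so that the term integrated in time can be made small.\<close>

lemma Young_split:
  fixes N \<theta> q A :: real
  assumes N: "N > 0" and \<theta>: "\<theta> > 0" and q: "q > 2" and A: "A > 0"
  shows "N\<^sup>2 * A \<le> \<theta> * N powr q + \<theta> powr (- 2 / (q - 2)) * A powr (q / (q - 2))"
proof (cases "A \<le> \<theta> * N powr (q - 2)")
  case True
  have N2: "N\<^sup>2 = N powr 2" using N by simp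
  have "N\<^sup>2 * A \<le> N\<^sup>2 * (\<theta> * N powr (q - 2))" using True by (intro mult_left_mono) auto
  also have "\<dots> = \<theta> * (N powr 2 * N powr (q - 2))" unfolding N2 by simp
  also have "N powr 2 * N powr (q - 2) = N powr q" unfolding powr_add[symmetric] by simp
  finally show ?thesis by (rule order_trans) simp
next
  case False
  then have "N powr (q - 2) \<le> A / \<theta>" using \<theta> by (simp add: field_simps)
  then have "(N powr (q - 2)) powr (2 / (q - 2)) \<le> (A / \<theta>) powr (2 / (q - 2))" using q by (intro powr_mono2) auto
  moreover have "(q - 2) * (2 / (q - 2)) = 2" using q by (simp del: left_diff_distrib_numeral)
  ultimately have "N\<^sup>2 \<le> (A / \<theta>) powr (2 / (q - 2))" using N unfolding powr_powr by simp
  then have "N\<^sup>2 * A \<le> (A / \<theta>) powr (2 / (q - 2)) * A" using A by (intro mult_right_mono) auto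
  also have "\<dots> = \<theta> powr (- (2 / (q - 2))) * (A powr (2 / (q - 2)) * A powr 1)"
    using A \<theta> by (simp add: powr_divide powr_minus field_simps)
  also have "A powr (2 / (q - 2)) * A powr 1 = A powr (q / (q - 2))"
  proof -
    have "2 / (q - 2) + 1 = q / (q - 2)" using q by (simp add: field_simps)
    then show ?thesis unfolding powr_add[symmetric] by simp
  qed
  finally have "N\<^sup>2 * A \<le> \<theta> powr (- 2 / (q - 2)) * A powr (q / (q - 2))" by simp
  then show ?thesis by (rule order_trans) (use \<theta> in simp)
qed

text \<open>The constant of \<open>gaussian_mass_le\<close> for the weight exp(-|x - y|^2/(c
  \<tau>)) with c at most 8: c = 4 is the heat kernel, c = 8 the wider Gaussian that absorbs a
  factor linear in |x - y|^2/\<tau>.\<close>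

definition gauss_const :: "nat \<Rightarrow> real" where
  "gauss_const k = 2 * real k ^ k * exp (1/2) * 8 powr (real k / 2)"

text \<open>The singularity left in time: the trace inequality costs (s - t)^(-(n-1) b/p), and
  Young's inequality raises it to q/(q-2), the exponent conjugate to q/2. The condition
  \<open>kq\<close> < 1 is integrability at the pole.\<close>

abbreviation (input) kq :: "'n::finite itself \<Rightarrow> real \<Rightarrow> real \<Rightarrow> real \<Rightarrow> real" where
  "kq T b p q \<equiv> (real CARD('n) - 1) * b / p * (q / (q - 2))"

abbreviation (input) gvol :: "'n::finite itself \<Rightarrow> real" where
  "gvol T \<equiv> gauss_const CARD('n) * unit_ball_vol (real CARD('n))"

text \<open>Below the radius \<open>rmin * \<epsilon>\<close> the density bound is trivial, because the energy density is at most \<open>CE / \<epsilon>\<close>.\<close>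

abbreviation (input) rmin :: "'n::finite itself \<Rightarrow> real \<Rightarrow> real" where
  "rmin T CE \<equiv> 1 / (unit_ball_vol (real CARD('n)) * CE)"

lemma gauss_const_ge_1: "k \<ge> 1 \<Longrightarrow> gauss_const k \<ge> 1"
proof -
  assume k: "k \<ge> 1"
  have "1 * 1 * 1 * 1 \<le> 2 * real k ^ k * exp (1/2) * 8 powr (real k / 2)"
    using k by (intro mult_mono ge_one_powr_ge_zero one_le_power) auto
  then show ?thesis by (simp add: gauss_const_def)
qed

lemma scaled_gaussian_mass_le:
  fixes e :: "real^'n \<Rightarrow> ennreal" and \<tau> c :: real
  assumes e [measurable]: "e \<in> borel_measurable borel" and \<tau>: "\<tau> > 0" and c: "0 < c" "c \<le> 8" and k: "k \<ge> 1" and A: "A \<ge> 0" and R: "R > 0"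
    and ball: "\<And>r. 0 < r \<Longrightarrow> r \<le> R \<Longrightarrow> (\<integral>x. (if dist x y < r then e x else 0)) \<le> ennreal (A * r ^ k)"
  shows "(\<integral>x. (if dist x y < R then e x * ennreal (\<tau> powr s * exp (- (1 / (c * \<tau>)) * (norm (x - y))\<^sup>2)) else 0))
    \<le> ennreal (gauss_const k * A * \<tau> powr (s + real k / 2))"
proof -
  have "(\<integral>x. (if dist x y < R then e x * ennreal (\<tau> powr s * exp (- (1 / (c * \<tau>)) * (norm (x - y))\<^sup>2)) else 0))
    = (\<integral>x. ennreal (\<tau> powr s) * (if dist x y < R then e x * ennreal (exp (- (1 / (c * \<tau>)) * (norm (x - y))\<^sup>2)) else 0))"
    by (intro nn_integral_cong) (auto simp: ennreal_mult' mult_ac)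
  also have "\<dots> = ennreal (\<tau> powr s) * (\<integral>x. (if dist x y < R then e x * ennreal (exp (- (1 / (c * \<tau>)) * (norm (x - y))\<^sup>2)) else 0))"
    by (rule nn_integral_cmult) measurable
  also have "\<dots> \<le> ennreal (\<tau> powr s) * ennreal (2 * real k ^ k * exp (1/2) * A * (1 / (c * \<tau>)) powr (- real k / 2))"
    by (intro mult_left_mono gaussian_mass_le) (use \<tau> c k A R ball e in auto)
  also have "\<dots> = ennreal (2 * real k ^ k * exp (1/2) * A * (\<tau> powr s * (1 / (c * \<tau>)) powr (- real k / 2)))"
    using A by (subst ennreal_mult''[symmetric]) (auto simp: mult_ac)
  also have "\<dots> \<le> ennreal (gauss_const k * A * \<tau> powr (s + real k / 2))"
  proof (rule ennreal_leI)
    have "(1 / (c * \<tau>)) powr (- real k / 2) = (c * \<tau>) powr (real k / 2)"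
      using c \<tau> by (simp add: powr_divide powr_minus)
    also have "\<dots> = c powr (real k / 2) * \<tau> powr (real k / 2)" using c \<tau> by (simp add: powr_mult)
    also have "\<dots> \<le> 8 powr (real k / 2) * \<tau> powr (real k / 2)" using c by (intro mult_right_mono powr_mono2) auto
    finally have "\<tau> powr s * (1 / (c * \<tau>)) powr (- real k / 2) \<le> \<tau> powr s * (8 powr (real k / 2) * \<tau> powr (real k / 2))"
      by (intro mult_left_mono) auto
    also have "\<dots> = 8 powr (real k / 2) * \<tau> powr (s + real k / 2)" using \<tau> by (simp add: powr_add)
    finally have "(2 * real k ^ k * exp (1/2) * A) * (\<tau> powr s * (1 / (c * \<tau>)) powr (- real k / 2))
       \<le> (2 * real k ^ k * exp (1/2) * A) * (8 powr (real k / 2) * \<tau> powr (s + real k / 2))"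
      using A by (intro mult_left_mono) auto
    then show "2 * real k ^ k * exp (1/2) * A * (\<tau> powr s * (1 / (c * \<tau>)) powr (- real k / 2)) \<le> gauss_const k * A * \<tau> powr (s + real k / 2)"
      by (simp add: gauss_const_def mult_ac)
  qed
  finally show ?thesis .
qed

text \<open>The conclusion of \<open>trace_inequality\<close> with its constant named, so that it
  can serve as a locale assumption; the type argument carries the dimension.\<close>

definition trace_property :: "('n::finite) itself \<Rightarrow> real \<Rightarrow> real \<Rightarrow> real \<Rightarrow> bool" where
  "trace_property _ p b C \<longleftrightarrow> (\<forall>(e :: real^'n \<Rightarrow> ennreal) (v :: real^'n \<Rightarrow> real^'n) Dv S \<Lambda> NN V a.
     e \<in> borel_measurable borel \<longrightarrow> S \<in> sets borel \<longrightarrow> \<Lambda> > 0 \<longrightarrow>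
     (\<forall>y r. 0 < r \<longrightarrow> r \<le> 1/4 \<longrightarrow> (\<integral>x. (if dist x y < r then e x else 0)) \<le> ennreal (\<Lambda> * r ^ (CARD('n) - 1))) \<longrightarrow>
     (\<integral>x. e x) \<le> ennreal V \<longrightarrow> V \<ge> 0 \<longrightarrow>
     (\<forall>x y. e x \<noteq> 0 \<longrightarrow> dist x y < 1/4 \<longrightarrow> y \<in> S) \<longrightarrow>
     (\<forall>x. (v has_derivative (\<lambda>h. Dv x *v h)) (at x)) \<longrightarrow> continuous_on UNIV Dv \<longrightarrow>
     (\<integral>x. ennreal ((norm (v x) + norm (Dv x)) powr p) * indicator S x) \<le> ennreal NN \<longrightarrow> NN \<ge> 0 \<longrightarrow> a > 0 \<longrightarrow>
     (\<integral>x. e x * ennreal ((norm (v x))\<^sup>2)) \<le> ennreal (a\<^sup>2 * V + a powr (2 - p / b) * (C * \<Lambda> * NN powr (1 / b))))"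

text \<open>Energy weighted by the kernel has density ratio up to \<tau>^(-(n-1)/2) M but mass at
  most c M. The splitting height a = N \<tau>^(-(n-1) b/(2 p)), with N = NN^(1/p), makes the two
  terms of the trace inequality equal up to constants, and only the power \<tau>^(-(n-1) b/p)
  remains.\<close>

lemma scaled_trace:
  fixes e :: "real^'n \<Rightarrow> ennreal" and v :: "real^'n \<Rightarrow> real^'n"
  assumes tr: "trace_property TYPE('n) p b C" and C: "C > 0" and p: "p > 1" and b: "0 < b" "b \<le> 1"
    and e: "e \<in> borel_measurable borel" "S \<in> sets borel" and M: "M > 0" and c: "c > 0" and \<tau>: "\<tau> > 0"
    and ball: "\<And>y r. 0 < r \<Longrightarrow> r \<le> 1/4 \<Longrightarrow> (\<integral>x. (if dist x y < r then e x else 0)) \<le> ennreal (\<tau> powr (- (real CARD('n) - 1) / 2) * M * r ^ (CARD('n) - 1))"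
    and V: "(\<integral>x. e x) \<le> ennreal (c * M)"
    and S: "\<And>x y. e x \<noteq> 0 \<Longrightarrow> dist x y < 1/4 \<Longrightarrow> y \<in> S"
    and v: "\<And>x. (v has_derivative (\<lambda>h. Dv x *v h)) (at x)" "continuous_on UNIV Dv"
    and NN: "(\<integral>x. ennreal ((norm (v x) + norm (Dv x)) powr p) * indicator S x) \<le> ennreal NN" "NN > 0"
  shows "(\<integral>x. e x * ennreal ((norm (v x))\<^sup>2))
    \<le> ennreal ((c + C) * M * ((NN powr (1 / p))\<^sup>2 * \<tau> powr (- ((real CARD('n) - 1) * b / p))))"
proof -
  define N where "N = NN powr (1 / p)"
  have N: "N > 0" using NN by (simp add: N_def)
  define n1 where "n1 = real CARD('n) - 1"
  define a where "a = N * \<tau> powr (- (n1 * b / (2 * p)))"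
  have a: "a > 0" using N \<tau> by (simp add: a_def)
  define \<Lambda> where "\<Lambda> = \<tau> powr (- n1 / 2) * M"
  have \<Lambda>: "\<Lambda> > 0" using \<tau> M by (simp add: \<Lambda>_def)
  have "(\<integral>x. e x * ennreal ((norm (v x))\<^sup>2)) \<le> ennreal (a\<^sup>2 * (c * M) + a powr (2 - p / b) * (C * \<Lambda> * NN powr (1 / b)))"
    using tr[unfolded trace_property_def, rule_format, of e S \<Lambda> "c * M" v Dv NN a]
      e \<Lambda> ball V S v NN a M c unfolding \<Lambda>_def n1_def by simp
  also have "a\<^sup>2 * (c * M) + a powr (2 - p / b) * (C * \<Lambda> * NN powr (1 / b)) = (c + C) * M * (N\<^sup>2 * \<tau> powr (- (n1 * b / p)))"
  proof -
    have a2: "a\<^sup>2 = N\<^sup>2 * \<tau> powr (- (n1 * b / p))"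
    proof -
      have "a\<^sup>2 = N\<^sup>2 * (\<tau> powr (- (n1 * b / (2 * p))) * \<tau> powr (- (n1 * b / (2 * p))))"
        by (simp add: a_def power2_eq_square)
      also have "\<tau> powr (- (n1 * b / (2 * p))) * \<tau> powr (- (n1 * b / (2 * p))) = \<tau> powr (- (n1 * b / p))"
        unfolding powr_add[symmetric] by (simp add: field_simps)
      finally show ?thesis .
    qed
    have "NN powr (1 / b) = N powr (p / b)" using NN p by (simp add: N_def powr_powr)
    moreover have "a powr (2 - p / b) = a\<^sup>2 * a powr (- (p / b))"
      using a unfolding powr_diff powr_minus by (simp add: divide_inverse)
    moreover have "a powr (- (p / b)) = N powr (- (p / b)) * \<tau> powr (n1 / 2)"
    proof -
      have "a powr (- (p / b)) = N powr (- (p / b)) * \<tau> powr (- (n1 * b / (2 * p)) * (- (p / b)))"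
        using N \<tau> by (simp add: a_def powr_mult powr_powr)
      also have "- (n1 * b / (2 * p)) * (- (p / b)) = n1 / 2" using p b by (simp add: field_simps)
      finally show ?thesis .
    qed
    ultimately have "a powr (2 - p / b) * (C * \<Lambda> * NN powr (1 / b))
      = a\<^sup>2 * C * M * (N powr (- (p / b)) * N powr (p / b)) * (\<tau> powr (n1 / 2) * \<tau> powr (- n1 / 2))"
      by (simp add: \<Lambda>_def mult_ac)
    also have "N powr (- (p / b)) * N powr (p / b) = 1" using N unfolding powr_add[symmetric] by simp
    also have "\<tau> powr (n1 / 2) * \<tau> powr (- n1 / 2) = 1" using \<tau> unfolding powr_add[symmetric] by simp
    finally have X: "a powr (2 - p / b) * (C * \<Lambda> * NN powr (1 / b)) = C * M * a\<^sup>2" by (simp add: mult_ac)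
    have "a\<^sup>2 * (c * M) + C * M * a\<^sup>2 = (c + C) * M * a\<^sup>2" by (simp add: algebra_simps)
    then show ?thesis unfolding X by (simp only: a2)
  qed
  finally show ?thesis unfolding N_def n1_def .
qed

section \<open>Density ratios and the growth rate of the localized average\<close>

context allen_cahn_transport
begin

text \<open>Radii stop at 1/2, up to which balls of the torus lift faithfully. Total mass is
  recorded on R^n only; on the torus it is recovered by covering the unit cell.\<close>

definition dens :: "bool \<Rightarrow> real \<Rightarrow> real \<Rightarrow> bool" where
  "dens tor t M \<longleftrightarrow> (\<forall>y r. 0 < r \<longrightarrow> r \<le> 1/2 \<longrightarrow>
      (\<integral>x. (if dist x y < r then ennreal (E x t) else 0)) \<le> ennreal (M * r ^ (CARD('n) - 1)))
    \<and> (\<not> tor \<longrightarrow> (\<integral>x. ennreal (E x t)) \<le> ennreal M)"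

lemma densD:
  assumes "dens tor t M" "0 < r" "r \<le> 1/2"
  shows "(\<integral>x. (if dist x y < r then ennreal (E x t) else 0)) \<le> ennreal (M * r ^ (CARD('n) - 1))"
  using assms by (simp add: dens_def)

lemma measurable_slices:
  assumes "t \<in> {0..T}"
  shows "(\<lambda>x. E x t) \<in> borel_measurable borel" "(\<lambda>x. u x t) \<in> borel_measurable borel"
  using cont_slices[OF assms, of UNIV] by (auto intro: borel_measurable_continuous_onI)

text \<open>Three Gaussians carry the errors: F1 the energy part of the discrepancy and the drift;
  F2, of doubled variance, the cutoff terms with their factor linear in |x - y|^2/\<tau>; F3,
  without energy, the constant c2, where an n-dimensional volume against an (n-1)-dimensional
  normalization gains sqrt \<tau>. The constant 1920 is 16 * 60 * 2.\<close>

lemma heat_kernel_rate: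
  fixes y :: "real^'n"
  assumes n2: "CARD('n) \<ge> 2" and t: "t \<in> {0..T}" and s: "t < s" and M: "M > 0" and d: "dens tor t M"
    and tr: "trace_property TYPE('n) p b C" "C > 0" "p > 1" "0 < b" "b \<le> 1"
    and Du: "continuous_on UNIV (\<lambda>x. Du x t)"
    and NN: "(\<integral>x. ennreal ((norm (u x t) + norm (Du x t)) powr p) * indicator (ball y (1/2)) x) \<le> ennreal NN" "NN > 0"
    and disc: "\<And>x. \<epsilon> * (norm (g x t))\<^sup>2 - E x t \<le> c1 * E x t + c2" and c: "c1 \<ge> 0" "c2 \<ge> 0"
  shows "integral (cbox l r) (\<lambda>x. (s - t) powr (- (real CARD('n) - 1) / 2) * exp (- (1 / (4 * (s - t))) * (norm (x - y))\<^sup>2) *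
       (2 * (1 / (4 * (s - t))) * cut 16 ((norm (x - y))\<^sup>2) ^ 3 * (\<epsilon> * (norm (g x t))\<^sup>2 - E x t)
       + cut 16 ((norm (x - y))\<^sup>2) * E x t * (60 + 24 * (1 / (4 * (s - t))) * (norm (x - y))\<^sup>2) * 16
       + cut 16 ((norm (x - y))\<^sup>2) ^ 3 * (norm (u x t))\<^sup>2 * E x t / 2))
    \<le> c1 * gauss_const (CARD('n) - 1) * M / (2 * (s - t))
      + c2 * (gvol TYPE('n)) / (2 * sqrt (s - t))
      + 1920 * gauss_const (CARD('n) - 1) * M
      + (gauss_const (CARD('n) - 1) + C) * M * ((NN powr (1 / p))\<^sup>2 * (s - t) powr (- ((real CARD('n) - 1) * b / p))) / 2"
    (is "integral _ ?f \<le> _")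
proof -
  define \<tau> where "\<tau> = s - t"
  have \<tau>: "\<tau> > 0" using s by (simp add: \<tau>_def)
  define n1 where "n1 = CARD('n) - 1"
  have n1: "n1 \<ge> 1" "real n1 = real CARD('n) - 1" using n2 by (auto simp: n1_def of_nat_diff)
  define q where "q x = (norm (x - y))\<^sup>2" for x
  define a where "a = \<tau> powr (- real n1 / 2)"
  have a: "a > 0" using \<tau> by (simp add: a_def)
  have [measurable]: "(\<lambda>x. E x t) \<in> borel_measurable borel" "(\<lambda>x. u x t) \<in> borel_measurable borel"
    by (rule measurable_slices[OF t])+
  let ?B = "\<lambda>x. dist x y < 1/4"
  have ballE: "(\<integral>x. (if dist x y' < r then ennreal (E x t) else 0)) \<le> ennreal (M * r ^ n1)" if "0 < r" "r \<le> 1/4" for r y'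
    using densD[OF d, of r y'] that by (simp add: n1_def)
  define F1 where "F1 x = (if ?B x then ennreal (E x t) * ennreal (\<tau> powr (- real n1 / 2) * exp (- (1 / (4 * \<tau>)) * (norm (x - y))\<^sup>2)) else 0)" for x
  define F2 where "F2 x = (if ?B x then ennreal (E x t) * ennreal (\<tau> powr (- real n1 / 2) * exp (- (1 / (8 * \<tau>)) * (norm (x - y))\<^sup>2)) else 0)" for x
  define F3 where "F3 x = (if ?B x then 1 * ennreal (\<tau> powr (- real n1 / 2) * exp (- (1 / (4 * \<tau>)) * (norm (x - y))\<^sup>2)) else 0)" for x
  have [measurable]: "F1 \<in> borel_measurable borel" "F2 \<in> borel_measurable borel" "F3 \<in> borel_measurable borel"
    unfolding F1_def F2_def F3_def by measurable
  have I1: "(\<integral>x. F1 x) \<le> ennreal (gauss_const n1 * M)"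
  proof -
    have "(\<integral>x. F1 x) \<le> ennreal (gauss_const n1 * M * \<tau> powr (- real n1 / 2 + real n1 / 2))"
      unfolding F1_def by (rule scaled_gaussian_mass_le) (use \<tau> n1(1) M ballE in auto)
    then show ?thesis using \<tau> by simp
  qed
  have I2: "(\<integral>x. F2 x) \<le> ennreal (gauss_const n1 * M)"
  proof -
    have "(\<integral>x. F2 x) \<le> ennreal (gauss_const n1 * M * \<tau> powr (- real n1 / 2 + real n1 / 2))"
      unfolding F2_def by (rule scaled_gaussian_mass_le) (use \<tau> n1(1) M ballE in auto)
    then show ?thesis using \<tau> by simp
  qed
  have I3: "(\<integral>x. F3 x) \<le> ennreal (gauss_const CARD('n) * unit_ball_vol (real CARD('n)) * sqrt \<tau>)"
  proof -
    have "(\<integral>x. (if dist x y < r then 1 else 0)) \<le> ennreal (unit_ball_vol (real CARD('n)) * r ^ CARD('n))" if "r > 0" for r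
    proof -
      have "(\<integral>x. (if dist x y < r then 1 else 0)) = (\<integral>x. indicator (ball y r) x)"
        by (intro nn_integral_cong) (simp add: indicator_def dist_commute)
      then show ?thesis using that by (simp add: emeasure_ball)
    qed
    moreover have "- real n1 / 2 + real CARD('n) / 2 = 1/2" using n1 by (simp add: field_simps)
    moreover have "(\<integral>x. F3 x) \<le> ennreal (gauss_const CARD('n) * unit_ball_vol (real CARD('n)) * \<tau> powr (- real n1 / 2 + real CARD('n) / 2))"
      unfolding F3_def by (rule scaled_gaussian_mass_le) (use \<tau> n2 calculation(1) in auto)
    ultimately show ?thesis using \<tau> by (simp only: powr_half_sqrt less_imp_le)
  qed
  have F1a: "F1 x \<le> ennreal a * ennreal (E x t)" for x
  proof -
    have "exp (- (1 / (4 * \<tau>)) * (norm (x - y))\<^sup>2) \<le> 1" using \<tau> by simp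
    then have "\<tau> powr (- real n1 / 2) * exp (- (1 / (4 * \<tau>)) * (norm (x - y))\<^sup>2) \<le> a"
      unfolding a_def by (intro mult_left_le) auto
    then have "ennreal (E x t) * ennreal (\<tau> powr (- real n1 / 2) * exp (- (1 / (4 * \<tau>)) * (norm (x - y))\<^sup>2)) \<le> ennreal (E x t) * ennreal a"
      by (intro mult_left_mono ennreal_leI) auto
    then show ?thesis unfolding F1_def by (simp only: mult.commute split: if_split) simp
  qed
  have I4: "(\<integral>x. F1 x * ennreal ((norm (u x t))\<^sup>2))
    \<le> ennreal ((gauss_const n1 + C) * M * ((NN powr (1 / p))\<^sup>2 * \<tau> powr (- ((real CARD('n) - 1) * b / p))))"
  proof (rule scaled_trace[OF tr, where S="ball y (1/2)" and Dv="\<lambda>x. Du x t"])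
    show "(\<integral>x. (if dist x y' < r then F1 x else 0)) \<le> ennreal (\<tau> powr (- (real CARD('n) - 1) / 2) * M * r ^ (CARD('n) - 1))"
      if r: "0 < r" "r \<le> 1/4" for y' r
    proof -
      have "(\<integral>x. (if dist x y' < r then F1 x else 0)) \<le> (\<integral>x. ennreal a * (if dist x y' < r then ennreal (E x t) else 0))"
        using F1a by (intro nn_integral_mono) auto
      also have "\<dots> = ennreal a * (\<integral>x. (if dist x y' < r then ennreal (E x t) else 0))"
        by (rule nn_integral_cmult) measurable
      also have "\<dots> \<le> ennreal a * ennreal (M * r ^ n1)" by (intro mult_left_mono ballE r) auto
      also have "\<dots> = ennreal (a * M * r ^ n1)" using a by (simp add: ennreal_mult'[symmetric] mult.assoc)
      finally show ?thesis unfolding a_def n1(2)[symmetric] n1_def[symmetric] .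
    qed
    show "y' \<in> ball y (1/2)" if "F1 x \<noteq> 0" "dist x y' < 1/4" for x y'
    proof -
      have "dist x y < 1/4" using that by (auto simp: F1_def split: if_splits)
      then show ?thesis using that dist_triangle3[of y y' x] by (simp add: dist_commute)
    qed
    show "gauss_const n1 > 0" using gauss_const_ge_1[OF n1(1)] by simp
  qed (use M \<tau> I1 u_deriv[OF t] Du NN in auto)
  define P where "P x = ennreal (c1 / (2 * \<tau>)) * F1 x + ennreal (c2 / (2 * \<tau>)) * F3 x + ennreal 1920 * F2 x + ennreal (1/2) * (F1 x * ennreal ((norm (u x t))\<^sup>2))" for x
  define Kc where "Kc = c1 / (2 * \<tau>) * (gauss_const n1 * M) + c2 / (2 * \<tau>) * (gauss_const CARD('n) * unit_ball_vol (real CARD('n)) * sqrt \<tau>)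
     + 1920 * (gauss_const n1 * M) + 1/2 * ((gauss_const n1 + C) * M * ((NN powr (1 / p))\<^sup>2 * \<tau> powr (- ((real CARD('n) - 1) * b / p))))"
  have gp: "gauss_const n1 \<ge> 1" "gauss_const CARD('n) \<ge> 1" using gauss_const_ge_1 n1 n2 by auto
  have IP: "(\<integral>x. P x) \<le> ennreal Kc"
  proof -
    have "(\<integral>x. P x) = ennreal (c1 / (2 * \<tau>)) * (\<integral>x. F1 x) + ennreal (c2 / (2 * \<tau>)) * (\<integral>x. F3 x)
      + ennreal 1920 * (\<integral>x. F2 x) + ennreal (1/2) * (\<integral>x. F1 x * ennreal ((norm (u x t))\<^sup>2))"
      unfolding P_def by (simp add: nn_integral_add nn_integral_cmult)
    also have "\<dots> \<le> ennreal (c1 / (2 * \<tau>)) * ennreal (gauss_const n1 * M)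
      + ennreal (c2 / (2 * \<tau>)) * ennreal (gauss_const CARD('n) * unit_ball_vol (real CARD('n)) * sqrt \<tau>)
      + ennreal 1920 * ennreal (gauss_const n1 * M)
      + ennreal (1/2) * ennreal ((gauss_const n1 + C) * M * ((NN powr (1 / p))\<^sup>2 * \<tau> powr (- ((real CARD('n) - 1) * b / p))))"
      by (intro add_mono mult_left_mono I1 I2 I3 I4) auto
    also have "\<dots> = ennreal Kc"
      unfolding Kc_def using gp c \<tau> M tr(2)
      by (simp only: ennreal_mult[symmetric] ennreal_plus[symmetric] mult_nonneg_nonneg add_nonneg_nonneg divide_nonneg_nonneg
          order_trans[OF zero_le_one] less_imp_le zero_le_power2 powr_ge_zero real_sqrt_ge_zero unit_ball_vol_nonneg of_nat_0_le_iff
          zero_le_numeral zero_le_one)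
    finally show ?thesis .
  qed
  have pt: "ennreal (?f x) \<le> P x" for x
  proof (cases "?B x")
    case False
    then have "q x \<ge> (1/4)\<^sup>2" unfolding q_def by (intro power_mono) (auto simp: dist_norm)
    then have "cut 16 (q x) = 0" by (intro cut_bounds) (simp add: power2_eq_square)
    then show ?thesis by (simp add: q_def[symmetric])
  next
    case True
    define k where "k = a * exp (- (1 / (4 * \<tau>)) * q x)"
    define k2 where "k2 = a * exp (- (1 / (8 * \<tau>)) * q x)"
    define w where "w = cut 16 (q x)"
    have k: "k \<ge> 0" "k2 \<ge> 0" using a by (auto simp: k_def k2_def)
    have w01: "0 \<le> w" "w \<le> 1" using cut_bounds(1)[of 16 "q x"] cut_bounds(2)[of "q x" 16] by (auto simp: w_def q_def)
    then have w: "0 \<le> w" "w \<le> 1" "w ^ 3 \<le> 1" by (auto simp: power_le_one)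
    have E0: "E x t \<ge> 0" by (rule E_nonneg)
    have F: "F1 x = ennreal (E x t) * ennreal k" "F2 x = ennreal (E x t) * ennreal k2" "F3 x = ennreal k"
      using True by (simp_all add: F1_def F2_def F3_def k_def k2_def a_def q_def)
    have A1: "k * (2 * (1 / (4 * \<tau>)) * w ^ 3 * (\<epsilon> * (norm (g x t))\<^sup>2 - E x t)) \<le> c1 / (2 * \<tau>) * (E x t * k) + c2 / (2 * \<tau>) * k"
    proof -
      have "w ^ 3 * (\<epsilon> * (norm (g x t))\<^sup>2 - E x t) \<le> w ^ 3 * (c1 * E x t + c2)"
        using w by (intro mult_left_mono disc) auto
      also have "\<dots> \<le> 1 * (c1 * E x t + c2)" using w c E0 by (intro mult_right_mono) auto
      finally have "k / (2 * \<tau>) * (w ^ 3 * (\<epsilon> * (norm (g x t))\<^sup>2 - E x t)) \<le> k / (2 * \<tau>) * (c1 * E x t + c2)"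
        using k \<tau> by (intro mult_left_mono) auto
      moreover have "k * (2 * (1 / (4 * \<tau>)) * w ^ 3 * Y) = k / (2 * \<tau>) * (w ^ 3 * Y)" for Y
        using \<tau> by (simp add: field_simps)
      moreover have "c1 / (2 * \<tau>) * (E x t * k) + c2 / (2 * \<tau>) * k = k / (2 * \<tau>) * (c1 * E x t + c2)"
        by (simp add: distrib_left add_divide_distrib mult_ac)
      ultimately show ?thesis by (simp only:)
    qed
    have A2: "k * (w * E x t * (60 + 24 * (1 / (4 * \<tau>)) * q x) * 16) \<le> 1920 * (E x t * k2)"
    proof -
      define z where "z = 1 / (4 * \<tau>) * q x"
      have z: "z \<ge> 0" using \<tau> by (simp add: z_def q_def)
      have kz: "k = a * exp (- z)" "k2 = a * exp (- (z / 2))" by (simp_all add: k_def k2_def z_def)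
      have "k * (w * E x t * (60 + 24 * (1 / (4 * \<tau>)) * q x) * 16) = (16 * w) * (E x t * (k * (60 + 24 * z)))"
        by (simp add: z_def)
      also have "\<dots> \<le> (16 * 1) * (E x t * (k * (60 * (1 + z))))"
        using w E0 k z by (intro mult_mono mult_left_mono) auto
      also have "\<dots> = 960 * E x t * a * ((1 + z) * exp (- z))" by (simp add: kz)
      also have "\<dots> \<le> 960 * E x t * a * (2 * exp (- (z / 2)))"
        using E0 a z by (intro mult_left_mono one_plus_times_exp_le) auto
      also have "\<dots> = 1920 * (E x t * k2)" by (simp add: kz)
      finally show ?thesis .
    qed
    have A3: "k * (w ^ 3 * (norm (u x t))\<^sup>2 * E x t / 2) \<le> 1/2 * (E x t * k * (norm (u x t))\<^sup>2)"
    proof -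
      have "(w ^ 3) * (k * (norm (u x t))\<^sup>2 * E x t / 2) \<le> 1 * (k * (norm (u x t))\<^sup>2 * E x t / 2)"
        using w k E0 by (intro mult_right_mono) auto
      then show ?thesis by (simp add: mult_ac)
    qed
    have "?f x = k * (2 * (1 / (4 * \<tau>)) * w ^ 3 * (\<epsilon> * (norm (g x t))\<^sup>2 - E x t))
       + k * (w * E x t * (60 + 24 * (1 / (4 * \<tau>)) * q x) * 16) + k * (w ^ 3 * (norm (u x t))\<^sup>2 * E x t / 2)"
      unfolding k_def w_def q_def a_def \<tau>_def n1(2) by (simp only: distrib_left)
    also have "\<dots> \<le> (c1 / (2 * \<tau>) * (E x t * k) + c2 / (2 * \<tau>) * k) + 1920 * (E x t * k2) + 1/2 * (E x t * k * (norm (u x t))\<^sup>2)"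
      by (intro add_mono A1 A2 A3)
    finally have "ennreal (?f x) \<le> ennreal ((c1 / (2 * \<tau>) * (E x t * k) + c2 / (2 * \<tau>) * k) + 1920 * (E x t * k2) + 1/2 * (E x t * k * (norm (u x t))\<^sup>2))"
      by (rule ennreal_leI)
    also have "\<dots> = P x"
    proof -
      have nn: "0 \<le> c1 / (2 * \<tau>)" "0 \<le> c2 / (2 * \<tau>)" "0 \<le> E x t * k" "0 \<le> E x t * k2" "(0::real) \<le> 1920" "(0::real) \<le> 1/2" "0 \<le> (norm (u x t))\<^sup>2"
        using c \<tau> E0 k by auto
      show ?thesis unfolding P_def F
        using nn E0 k by (simp only: ennreal_mult[symmetric] ennreal_plus[symmetric] mult_nonneg_nonneg add_nonneg_nonneg)
    qed
    finally show ?thesis .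
  qed
  have "integral (cbox l r) ?f \<le> Kc"
  proof (rule integral_le_of_nn_integral_le[OF _ pt IP])
    show "continuous_on (cbox l r) ?f"
      using t by (intro continuous_intros cont_slices) auto
    show "Kc \<ge> 0" unfolding Kc_def using gp c \<tau> M tr(2) by (intro add_nonneg_nonneg mult_nonneg_nonneg divide_nonneg_nonneg) auto
  qed
  also have "Kc = c1 * gauss_const n1 * M / (2 * \<tau>) + c2 * (gvol TYPE('n)) / (2 * sqrt \<tau>)
      + 1920 * gauss_const n1 * M
      + (gauss_const n1 + C) * M * ((NN powr (1 / p))\<^sup>2 * \<tau> powr (- ((real CARD('n) - 1) * b / p))) / 2"
  proof -
    have "sqrt \<tau> / \<tau> = 1 / sqrt \<tau>" using \<tau> by (simp add: field_simps)
    then have "c2 / (2 * \<tau>) * (gauss_const CARD('n) * unit_ball_vol (real CARD('n)) * sqrt \<tau>) = c2 * (gvol TYPE('n)) / (2 * sqrt \<tau>)"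
      using \<tau> by (simp add: field_simps)
    then show ?thesis unfolding Kc_def by simp
  qed
  finally show ?thesis unfolding \<tau>_def n1_def .
qed

end

text \<open>The bound on Y' is split because Q is merely integrable, with a known integral, while
  the remaining rate has the explicit primitive F.\<close>

lemma derivative_comparison:
  fixes Y F Q :: "real \<Rightarrow> real"
  assumes le: "t0 \<le> t1"
    and Y: "\<And>t. t \<in> {t0..t1} \<Longrightarrow> (Y has_real_derivative Y' t) (at t within {t0..t1})"
    and F: "\<And>t. t \<in> {t0..t1} \<Longrightarrow> (F has_real_derivative F' t) (at t within {t0..t1})"
    and Q: "Q integrable_on {t0..t1}"
    and ineq: "\<And>t. t \<in> {t0..t1} \<Longrightarrow> Y' t \<le> F' t + c * Q t"
  shows "Y t1 - Y t0 \<le> F t1 - F t0 + c * integral {t0..t1} Q"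
proof -
  have 1: "(Y' has_integral (Y t1 - Y t0)) {t0..t1}" and 2: "(F' has_integral (F t1 - F t0)) {t0..t1}"
    using le Y F by (auto intro!: fundamental_theorem_of_calculus simp flip: has_real_derivative_iff_has_vector_derivative)
  have "((\<lambda>t. F' t + c * Q t) has_integral (F t1 - F t0) + c * integral {t0..t1} Q) {t0..t1}"
    using has_integral_mult_right[OF integrable_integral[OF Q], of c] by (intro has_integral_add 2) auto
  from has_integral_le[OF 1 this ineq] show ?thesis .
qed

lemma nn_integral_eq_integral_cbox:
  fixes f :: "'a::euclidean_space \<Rightarrow> real"
  assumes f: "continuous_on UNIV f" and f0: "\<And>x. f x \<ge> 0" and out: "\<And>x. x \<notin> cbox l r \<Longrightarrow> f x = 0"
  shows "(\<integral>x. ennreal (f x)) = ennreal (integral (cbox l r) f)"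
proof (rule nn_integral_has_integral_lborel)
  show "f \<in> borel_measurable borel" using f by (rule borel_measurable_continuous_onI)
  have "(f has_integral integral (cbox l r) f) (cbox l r)"
    by (intro integrable_integral integrable_continuous continuous_on_subset[OF f]) auto
  then show "(f has_integral integral (cbox l r) f) UNIV"
    by (rule has_integral_on_superset) (use out in auto)
qed (rule f0)

text \<open>Interface between the estimates and the iteration. NN t dominates the p-th power of the
  velocity norm on every ball of radius 1/2, and globally on R^n; Bq bounds the time integral of its
  power q/p. CW and CE are the constants of the discrepancy bound and of the pointwise energy
  bound.\<close>

locale controlled_flow = allen_cahn_transport T \<epsilon> W W1 W2 u Du \<phi> g H T3 \<phi>t gt
  for T \<epsilon> :: real and W W1 W2 :: "real \<Rightarrow> real"
    and u :: "real^'n \<Rightarrow> real \<Rightarrow> real^'n" and Du :: "real^'n \<Rightarrow> real \<Rightarrow> real^'n^'n"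
    and \<phi> :: "real^'n \<Rightarrow> real \<Rightarrow> real" and g :: "real^'n \<Rightarrow> real \<Rightarrow> real^'n"
    and H :: "real^'n \<Rightarrow> real \<Rightarrow> real^'n^'n" and T3 :: "real^'n \<Rightarrow> real \<Rightarrow> real^'n^'n^'n"
    and \<phi>t :: "real^'n \<Rightarrow> real \<Rightarrow> real" and gt :: "real^'n \<Rightarrow> real \<Rightarrow> real^'n" +
  fixes tor :: bool and p b Ct q Bq \<mu> \<delta> CW CE :: real and NN :: "real \<Rightarrow> real"
  assumes n2: "CARD('n) \<ge> 2"
    and tr: "trace_property TYPE('n) p b Ct" "Ct > 0" "p > 1" "0 < b" "b \<le> 1"
    and q: "q > 2" and kap: "kq TYPE('n) b p q < 1"
    and Du_cont: "\<And>t. t \<in> {0..T} \<Longrightarrow> continuous_on UNIV (\<lambda>x. Du x t)"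
    and NN1: "\<And>t. t \<in> {0..T} \<Longrightarrow> NN t \<ge> 1"
    and NN_loc: "\<And>t y. t \<in> {0..T} \<Longrightarrow>
       (\<integral>x. ennreal ((norm (u x t) + norm (Du x t)) powr p) * indicator (ball y (1/2)) x) \<le> ennreal (NN t)"
    and NN_glob: "\<And>t. \<not> tor \<Longrightarrow> t \<in> {0..T} \<Longrightarrow>
       (\<integral>x. ennreal ((norm (u x t) + norm (Du x t)) powr p) * indicator UNIV x) \<le> ennreal (NN t)"
    and NN_int: "\<And>t0 t1. 0 \<le> t0 \<Longrightarrow> t0 \<le> t1 \<Longrightarrow> t1 \<le> T \<Longrightarrow> (\<lambda>t. NN t powr (q / p)) integrable_on {t0..t1}"
      "\<And>t0 t1. 0 \<le> t0 \<Longrightarrow> t0 \<le> t1 \<Longrightarrow> t1 \<le> T \<Longrightarrow> integral {t0..t1} (\<lambda>t. NN t powr (q / p)) \<le> Bq"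
    and disc: "\<And>x t. t \<in> {0..T} \<Longrightarrow> \<epsilon> * (norm (g x t))\<^sup>2 - E x t \<le> 2 * \<epsilon> powr \<delta> * E x t + CW * \<epsilon> powr \<delta>
      + CW * \<epsilon> powr (- 1/2) * exp (- 2 * \<mu> * t / \<epsilon>\<^sup>2)"
    and E_le: "\<And>x t. t \<in> {0..T} \<Longrightarrow> E x t \<le> CE / \<epsilon>"
    and cst: "\<mu> > 0" "\<delta> > 0" "CW > 0" "CE > 0"
begin

lemma G_pos: "gauss_const (CARD('n) - 1) \<ge> 1" "(gvol TYPE('n)) > 0" "((real CARD('n) - 1) * b / p) > 0" "(kq TYPE('n) b p q) > 0" "(rmin TYPE('n) CE) > 0" "gauss_const CARD('n) > 0"
proof -
  show "gauss_const (CARD('n) - 1) \<ge> 1" using n2 by (intro gauss_const_ge_1) auto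
  have "gauss_const CARD('n) \<ge> 1" using n2 by (intro gauss_const_ge_1) auto
  then show "gauss_const CARD('n) > 0" by simp
  then show "(gvol TYPE('n)) > 0" by (intro mult_pos_pos) auto
  show k: "((real CARD('n) - 1) * b / p) > 0" using n2 tr by (intro divide_pos_pos mult_pos_pos) auto
  show "(kq TYPE('n) b p q) > 0" using k q by (intro mult_pos_pos[OF k] divide_pos_pos) auto
  show "(rmin TYPE('n) CE) > 0" using cst by (intro divide_pos_pos mult_pos_pos) auto
qed

text \<open>Integrated in time, the first summand costs at most \<theta> Bq and the second is an
  integrable power at the pole. It is used with \<tau> = s - t for the kernel and with \<tau> = 1
  for the total mass.\<close>

lemma NN_powr_split:
  assumes t: "t \<in> {0..T}" and \<theta>: "\<theta> > 0" and \<tau>: "\<tau> > 0"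
  shows "(NN t powr (1 / p))\<^sup>2 * \<tau> powr (- ((real CARD('n) - 1) * b / p)) \<le> \<theta> * NN t powr (q / p) + \<theta> powr (- 2 / (q - 2)) * \<tau> powr (- (kq TYPE('n) b p q))"
proof -
  have N: "NN t > 0" using NN1[OF t] by simp
  have "(NN t powr (1 / p))\<^sup>2 * \<tau> powr (- ((real CARD('n) - 1) * b / p)) \<le> \<theta> * (NN t powr (1 / p)) powr q + \<theta> powr (- 2 / (q - 2)) * (\<tau> powr (- ((real CARD('n) - 1) * b / p))) powr (q / (q - 2))"
    using N \<theta> q \<tau> by (intro Young_split) auto
  then show ?thesis by (simp add: powr_powr)
qed

lemma mass_rate:
  assumes tor: "\<not> tor" and t: "t \<in> {0..T}" and M: "M > 0" and d: "dens tor t M" and i: "\<iota> \<ge> 0"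
  shows "integral (cbox l r) (\<lambda>x. 1 * exp (- 0 * (norm (x - y))\<^sup>2) *
       (2 * 0 * cut \<iota> ((norm (x - y))\<^sup>2) ^ 3 * (\<epsilon> * (norm (g x t))\<^sup>2 - E x t)
       + cut \<iota> ((norm (x - y))\<^sup>2) * E x t * (60 + 24 * 0 * (norm (x - y))\<^sup>2) * \<iota>
       + cut \<iota> ((norm (x - y))\<^sup>2) ^ 3 * (norm (u x t))\<^sup>2 * E x t / 2))
    \<le> 60 * \<iota> * M + (1 + Ct) / 2 * M * (NN t powr (1 / p))\<^sup>2" (is "integral _ ?f \<le> _")
proof -
  have [measurable]: "(\<lambda>x. E x t) \<in> borel_measurable borel" "(\<lambda>x. u x t) \<in> borel_measurable borel"
    by (rule measurable_slices[OF t])+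
  have mass: "(\<integral>x. ennreal (E x t)) \<le> ennreal M" using d tor by (simp add: dens_def)
  have I: "(\<integral>x. ennreal (E x t) * ennreal ((norm (u x t))\<^sup>2)) \<le> ennreal ((1 + Ct) * M * ((NN t powr (1 / p))\<^sup>2 * 1 powr (- ((real CARD('n) - 1) * b / p))))"
  proof (rule scaled_trace[OF tr, where S=UNIV and Dv="\<lambda>x. Du x t"])
    show "(\<integral>x. (if dist x y < r then ennreal (E x t) else 0)) \<le> ennreal (1 powr (- (real CARD('n) - 1) / 2) * M * r ^ (CARD('n) - 1))"
      if "0 < r" "r \<le> 1/4" for y r using densD[OF d, of r y] that by simp
  qed (use M mass u_deriv[OF t] Du_cont[OF t] NN_glob[OF tor t] NN1[OF t] in auto)
  define P where "P x = ennreal (60 * \<iota>) * ennreal (E x t) + ennreal (1/2) * (ennreal (E x t) * ennreal ((norm (u x t))\<^sup>2))" for x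
  have "integral (cbox l r) ?f \<le> 60 * \<iota> * M + 1/2 * ((1 + Ct) * M * (NN t powr (1 / p))\<^sup>2)"
  proof (rule integral_le_of_nn_integral_le[where P=P])
    show "continuous_on (cbox l r) ?f" using t by (intro continuous_intros cont_slices) auto
    show "60 * \<iota> * M + 1/2 * ((1 + Ct) * M * (NN t powr (1 / p))\<^sup>2) \<ge> 0"
      using i M tr(2) by (intro add_nonneg_nonneg mult_nonneg_nonneg) auto
    have "(\<integral>x. P x) = ennreal (60 * \<iota>) * (\<integral>x. ennreal (E x t)) + ennreal (1/2) * (\<integral>x. ennreal (E x t) * ennreal ((norm (u x t))\<^sup>2))"
      unfolding P_def by (simp add: nn_integral_add nn_integral_cmult)
    also have "\<dots> \<le> ennreal (60 * \<iota>) * ennreal M + ennreal (1/2) * ennreal ((1 + Ct) * M * (NN t powr (1 / p))\<^sup>2)"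
      using I by (intro add_mono mult_left_mono mass) auto
    also have "\<dots> = ennreal (60 * \<iota> * M + 1/2 * ((1 + Ct) * M * (NN t powr (1 / p))\<^sup>2))"
      using i M tr(2) by (intro ennreal_mult_add_mult) auto
    finally show "(\<integral>x. P x) \<le> ennreal (60 * \<iota> * M + 1/2 * ((1 + Ct) * M * (NN t powr (1 / p))\<^sup>2))" .
    fix x
    define w where "w = cut \<iota> ((norm (x - y))\<^sup>2)"
    have w01: "0 \<le> w" "w \<le> 1" using cut_bounds(1)[of \<iota> "(norm (x - y))\<^sup>2"] cut_bounds(2)[of "(norm (x - y))\<^sup>2" \<iota>] i by (auto simp: w_def)
    then have w: "0 \<le> w" "w \<le> 1" "w ^ 3 \<le> 1" by (auto simp: power_le_one)
    have E0: "E x t \<ge> 0" by (rule E_nonneg)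
    have "?f x = w * (60 * \<iota> * E x t) + w ^ 3 * ((norm (u x t))\<^sup>2 * E x t / 2)" by (simp add: w_def)
    also have "\<dots> \<le> 1 * (60 * \<iota> * E x t) + 1 * ((norm (u x t))\<^sup>2 * E x t / 2)"
      using w i E0 by (intro add_mono mult_right_mono) auto
    finally have "ennreal (?f x) \<le> ennreal (60 * \<iota> * E x t + 1/2 * (E x t * (norm (u x t))\<^sup>2))"
      by (intro ennreal_leI) (simp add: mult_ac)
    also have "\<dots> = P x"
    proof -
      have nn: "0 \<le> 60 * \<iota>" "(0::real) \<le> 1/2" "0 \<le> (norm (u x t))\<^sup>2" using i by auto
      show ?thesis unfolding P_def
        using nn E0 by (simp only: ennreal_mult[symmetric] ennreal_plus[symmetric] mult_nonneg_nonneg add_nonneg_nonneg)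
    qed
    finally show "ennreal (?f x) \<le> P x" .
  qed
  then show ?thesis by simp
qed

text \<open>The weighted inequality with a = 1 and m = 0: the weight is the bare cutoff, the
  discrepancy drops out, and the errors are 60 \<iota> and the drift. Letting \<iota> = 1/(j+1) tend
  to 0, monotone convergence recovers the total mass on R^n.\<close>

lemma mass_step:
  assumes tor: "\<not> tor" and t: "0 \<le> t0" "t0 \<le> t1" "t1 \<le> T" and M: "M > 0" and d: "\<And>t. t \<in> {t0..t1} \<Longrightarrow> dens tor t M"
    and d0: "dens tor t0 M0" and M0: "M0 \<ge> 0" and \<theta>: "\<theta> > 0"
  shows "(\<integral>x. ennreal (E x t1)) \<le> ennreal (M0 + M * (60 * (t1 - t0) + (1 + Ct) / 2 * (\<theta> * Bq + \<theta> powr (- 2 / (q - 2)) * (t1 - t0))))"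
proof -
  have tT: "t1 \<in> {0..T}" "t0 \<in> {0..T}" using t by auto
  have [measurable]: "(\<lambda>x. E x t1) \<in> borel_measurable borel" by (rule measurable_slices[OF tT(1)])
  define R where "R = M0 + M * (60 * (t1 - t0) + (1 + Ct) / 2 * (\<theta> * Bq + \<theta> powr (- 2 / (q - 2)) * (t1 - t0)))"
  have trunc: "(\<integral>x. ennreal (kern0 1 0 \<iota> ((norm (x - 0))\<^sup>2) * E x t1)) \<le> ennreal R" if i: "0 < \<iota>" "\<iota> \<le> 1" for \<iota>
  proof -
    define K where "K = 1 / \<iota>"
    have K: "K \<ge> 1" using i by (simp add: K_def)
    have out: "(norm (x - 0))\<^sup>2 * \<iota> \<ge> 1" if "norm x \<ge> K" for x :: "real^'n"
    proof -
      have "norm x * 1 \<le> norm x * norm x" using that K by (intro mult_left_mono) auto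
      then have "K \<le> (norm x)\<^sup>2" using that by (simp add: power2_eq_square)
      then have "K * \<iota> \<le> (norm x)\<^sup>2 * \<iota>" using i by (intro mult_right_mono) auto
      then show ?thesis using i by (simp add: K_def)
    qed
    obtain a where box: "ball (0::real^'n) (K + 1) \<subseteq> cbox (- a) a"
      using bounded_subset_cbox_symmetric[OF bounded_ball] by blast
    let ?Y = "\<lambda>t. integral (cbox (- a) a) (\<lambda>x. kern0 1 0 \<iota> ((norm (x - 0))\<^sup>2) * E x t)"
    have Yeq: "(\<integral>x. ennreal (kern0 1 0 \<iota> ((norm (x - 0))\<^sup>2) * E x t)) = ennreal (?Y t)" if "t \<in> {0..T}" for t
    proof (rule nn_integral_eq_integral_cbox)
      show "continuous_on UNIV (\<lambda>x. kern0 1 0 \<iota> ((norm (x - 0))\<^sup>2) * E x t)"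
        using that by (intro continuous_intros cont_slices) auto
      show "kern0 1 0 \<iota> ((norm (x - 0))\<^sup>2) * E x t \<ge> 0" for x
        using cut_bounds(1) by (simp add: kern0_def E_nonneg)
      show "kern0 1 0 \<iota> ((norm (x - 0))\<^sup>2) * E x t = 0" if "x \<notin> cbox (- a) a" for x
      proof -
        have "norm x \<ge> K"
        proof (rule ccontr)
          assume "\<not> norm x \<ge> K"
          then have "x \<in> ball 0 (K + 1)" by simp
          then show False using box that by blast
        qed
        from kern_vanish(1)[OF out[OF this]] show ?thesis by simp
      qed
    qed
    obtain Y' where Y': "\<And>t. t \<in> {t0..t1} \<Longrightarrow> (?Y has_real_derivative Y' t) (at t within {t0..t1})"
      "\<And>t. t \<in> {t0..t1} \<Longrightarrow> Y' t \<le> integral (cbox (- a) a) (\<lambda>x. 1 * exp (- 0 * (norm (x - 0))\<^sup>2) *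
       (2 * 0 * cut \<iota> ((norm (x - 0))\<^sup>2) ^ 3 * (\<epsilon> * (norm (g x t))\<^sup>2 - E x t)
       + cut \<iota> ((norm (x - 0))\<^sup>2) * E x t * (60 + 24 * 0 * (norm (x - 0))\<^sup>2) * \<iota>
       + cut \<iota> ((norm (x - 0))\<^sup>2) ^ 3 * (norm (u x t))\<^sup>2 * E x t / 2))"
      using weighted_energy_inequality[of t0 t1 "\<lambda>_. 1" "\<lambda>_. 0" \<iota> K 0 "- a" a] t i K out box by auto
    have cmp: "?Y t1 - ?Y t0 \<le> M * (60 + (1 + Ct) / 2 * \<theta> powr (- 2 / (q - 2))) * t1 - M * (60 + (1 + Ct) / 2 * \<theta> powr (- 2 / (q - 2))) * t0
      + ((1 + Ct) / 2 * M * \<theta>) * integral {t0..t1} (\<lambda>t. NN t powr (q / p))"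
    proof (rule derivative_comparison[OF t(2) Y'(1) _ NN_int(1)[OF t]])
      show "((\<lambda>t. M * (60 + (1 + Ct) / 2 * \<theta> powr (- 2 / (q - 2))) * t) has_real_derivative M * (60 + (1 + Ct) / 2 * \<theta> powr (- 2 / (q - 2)))) (at t within {t0..t1})" for t
        by (rule DERIV_cmult_Id)
      fix t assume tt: "t \<in> {t0..t1}"
      then have t': "t \<in> {0..T}" using t by auto
      have "Y' t \<le> 60 * \<iota> * M + (1 + Ct) / 2 * M * (NN t powr (1 / p))\<^sup>2"
        using Y'(2)[OF tt] mass_rate[OF tor t' M d[OF tt], of \<iota> "- a" a 0] i by linarith
      also have "\<dots> \<le> 60 * 1 * M + (1 + Ct) / 2 * M * (\<theta> * NN t powr (q / p) + \<theta> powr (- 2 / (q - 2)))"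
      proof (intro add_mono mult_left_mono mult_right_mono)
        show "(NN t powr (1 / p))\<^sup>2 \<le> \<theta> * NN t powr (q / p) + \<theta> powr (- 2 / (q - 2))"
          using NN_powr_split[OF t' \<theta>, of 1] by simp
      qed (use i M tr(2) in auto)
      finally show "Y' t \<le> M * (60 + (1 + Ct) / 2 * \<theta> powr (- 2 / (q - 2))) + (1 + Ct) / 2 * M * \<theta> * NN t powr (q / p)"
        by (simp add: algebra_simps)
    qed
    have Y0: "?Y t0 \<le> M0"
    proof -
      have "ennreal (?Y t0) \<le> (\<integral>x. ennreal (E x t0))"
        unfolding Yeq[OF tT(2), symmetric]
      proof (intro nn_integral_mono ennreal_leI)
        fix x :: "real^'n"
        have "kern0 1 0 \<iota> ((norm (x - 0))\<^sup>2) \<le> 1"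
          using cut_bounds(1)[of \<iota> "(norm x)\<^sup>2"] cut_bounds(2)[of "(norm x)\<^sup>2" \<iota>] i by (simp add: kern0_def power_le_one)
        then show "kern0 1 0 \<iota> ((norm (x - 0))\<^sup>2) * E x t0 \<le> E x t0"
          using E_nonneg[of x t0] by (intro mult_left_le_one_le) (auto simp: kern0_def cut_bounds(1))
      qed
      also have "\<dots> \<le> ennreal M0" using d0 tor by (simp add: dens_def)
      finally show ?thesis using M0 by simp
    qed
    have "(1 + Ct) / 2 * M * \<theta> * integral {t0..t1} (\<lambda>t. NN t powr (q / p)) \<le> (1 + Ct) / 2 * M * \<theta> * Bq"
      using M tr(2) \<theta> by (intro mult_left_mono NN_int(2) t) auto
    moreover have "R = M0 + (M * (60 + (1 + Ct) / 2 * \<theta> powr (- 2 / (q - 2))) * t1 - M * (60 + (1 + Ct) / 2 * \<theta> powr (- 2 / (q - 2))) * t0) + (1 + Ct) / 2 * M * \<theta> * Bq"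
      unfolding R_def by algebra
    ultimately have "?Y t1 \<le> R" using cmp Y0 by linarith
    then show ?thesis unfolding Yeq[OF tT(1)] by (rule ennreal_leI)
  qed
  have "(\<integral>x. ennreal (E x t1)) \<le> ennreal R"
  proof -
    define f where "f j x = ennreal (kern0 1 0 (1 / real (Suc j)) ((norm (x - 0))\<^sup>2) * E x t1)" for j and x :: "real^'n"
    have [measurable]: "f j \<in> borel_measurable borel" for j unfolding f_def kern0_def cut_def by measurable
    have inc: "incseq f"
    proof (intro incseq_SucI le_funI)
      fix j and x :: "real^'n"
      have "(norm x)\<^sup>2 * (1 / real (Suc (Suc j))) \<le> (norm x)\<^sup>2 * (1 / real (Suc j))"
        by (intro mult_left_mono divide_left_mono) auto
      then have "cut (1 / real (Suc j)) ((norm x)\<^sup>2) ^ 3 \<le> cut (1 / real (Suc (Suc j))) ((norm x)\<^sup>2) ^ 3"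
        unfolding cut_def by (intro power_mono) auto
      then show "f j x \<le> f (Suc j) x"
        unfolding f_def kern0_def using E_nonneg[of x t1] by (intro ennreal_leI mult_right_mono) auto
    qed
    have lim: "(SUP j. f j x) = ennreal (E x t1)" for x
    proof (rule LIMSEQ_unique)
      show "(\<lambda>j. f j x) \<longlonglongrightarrow> (SUP j. f j x)"
        using inc by (intro LIMSEQ_SUP) (auto simp: incseq_def le_fun_def)
      have "(\<lambda>j. max 0 (1 - (norm x)\<^sup>2 * (1 / real (Suc j))) ^ 3 * E x t1) \<longlonglongrightarrow> max 0 (1 - (norm x)\<^sup>2 * 0) ^ 3 * E x t1"
        using LIMSEQ_inverse_real_of_nat by (intro tendsto_intros) (simp add: inverse_eq_divide)
      then have "(\<lambda>j. ennreal (max 0 (1 - (norm x)\<^sup>2 * (1 / real (Suc j))) ^ 3 * E x t1)) \<longlonglongrightarrow> ennreal (E x t1)"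
        by (intro tendsto_ennrealI) simp
      then show "(\<lambda>j. f j x) \<longlonglongrightarrow> ennreal (E x t1)" by (simp add: f_def kern0_def cut_def)
    qed
    have "(\<integral>x. ennreal (E x t1)) = (\<integral>x. (SUP j. f j x))" by (simp add: lim)
    also have "\<dots> = (SUP j. \<integral>\<^sup>+x. f j x \<partial>lborel)" by (rule nn_integral_monotone_convergence_SUP[OF inc]) simp
    also have "\<dots> \<le> ennreal R" unfolding f_def by (intro SUP_least trunc) auto
    finally show ?thesis .
  qed
  then show ?thesis unfolding R_def .
qed

lemma small_ball:
  assumes t: "t \<in> {0..T}" and r: "0 < r" "r \<le> (rmin TYPE('n) CE) * \<epsilon>"
  shows "(\<integral>x. (if dist x y < r then ennreal (E x t) else 0)) \<le> ennreal (r ^ (CARD('n) - 1))"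
proof -
  have "(\<integral>x. (if dist x y < r then ennreal (E x t) else 0)) \<le> (\<integral>x. ennreal (CE / \<epsilon>) * indicator (ball y r) x)"
    using E_le[OF t] by (intro nn_integral_mono) (auto simp: indicator_def dist_commute intro!: ennreal_leI)
  also have "\<dots> = ennreal (CE / \<epsilon>) * ennreal (unit_ball_vol (real CARD('n)) * r ^ CARD('n))"
    using r by (simp add: nn_integral_cmult_indicator emeasure_ball)
  also have "\<dots> = ennreal (CE / \<epsilon> * (unit_ball_vol (real CARD('n)) * r ^ CARD('n)))"
    using r by (subst ennreal_mult''[symmetric]) auto
  also have "\<dots> \<le> ennreal (r ^ (CARD('n) - 1))"
  proof (rule ennreal_leI)
    have rr: "r ^ CARD('n) = r * r ^ (CARD('n) - 1)" using n2 by (cases "CARD('n)") auto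
    have "CE / \<epsilon> * (unit_ball_vol (real CARD('n)) * r) \<le> CE / \<epsilon> * (unit_ball_vol (real CARD('n)) * ((rmin TYPE('n) CE) * \<epsilon>))"
      using r cst eps_pos by (intro mult_left_mono) auto
    also have "\<dots> = 1" using cst eps_pos unit_ball_vol_pos[of "real CARD('n)"] by (simp add: less_imp_neq[symmetric])
    finally have "CE / \<epsilon> * (unit_ball_vol (real CARD('n)) * r) * r ^ (CARD('n) - 1) \<le> 1 * r ^ (CARD('n) - 1)"
      using r by (intro mult_right_mono) auto
    then show "CE / \<epsilon> * (unit_ball_vol (real CARD('n)) * r ^ CARD('n)) \<le> r ^ (CARD('n) - 1)"
      unfolding rr by (simp add: mult_ac)
  qed
  finally show ?thesis .
qed

text \<open>Error of a step relative to the assumed bound. The first two terms vanish with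
  \<epsilon>: the logarithm is the integral of 1/(s - t) for s - t at least the square of
  \<open>rmin\<close> * \<epsilon>, and sqrt \<epsilon> is the contribution of the initial layer.
  The others are made small by \<theta> and then by h.\<close>

definition err :: "real \<Rightarrow> real \<Rightarrow> real" where
  "err \<theta> h = \<epsilon> powr \<delta> * (gauss_const (CARD('n) - 1) + CW * (gvol TYPE('n)) * sqrt (T + 1)) * (ln (T + 1) - 2 * ln ((rmin TYPE('n) CE) * \<epsilon>))
    + CW * (gvol TYPE('n)) * sqrt \<epsilon> / (4 * \<mu> * (rmin TYPE('n) CE))
    + 1920 * gauss_const (CARD('n) - 1) * h + (gauss_const (CARD('n) - 1) + Ct) / 2 * (\<theta> * Bq + \<theta> powr (- 2 / (q - 2)) * (h powr (1 - (kq TYPE('n) b p q)) / (1 - (kq TYPE('n) b p q))))"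

text \<open>The pole is placed at s = t1 + r^2, so at time t1 the kernel is at least r^(1-n)/4 on
  the ball: the exponential gives 3/4 and the cutoff (3/4)^3, since 16 r^2 \<le> 1/4. At time t0 the
  kernel average is at most a constant times M0, uniformly in s.\<close>

lemma heat_ball_step:
  assumes t: "0 \<le> t0" "t0 \<le> t1" "t1 \<le> T" and M: "M \<ge> 1" and d: "\<And>t. t \<in> {t0..t1} \<Longrightarrow> dens tor t M"
    and d0: "dens tor t0 M0" and M0: "M0 \<ge> 0" and \<theta>: "\<theta> > 0" and r: "(rmin TYPE('n) CE) * \<epsilon> < r" "r \<le> 1/8"
  shows "(\<integral>x. (if dist x y < r then ennreal (E x t1) else 0))
    \<le> ennreal (4 * r ^ (CARD('n) - 1) * (gauss_const (CARD('n) - 1) * M0 + M * err \<theta> (t1 - t0)))"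
proof -
  have c0e: "(rmin TYPE('n) CE) * \<epsilon> > 0" using G_pos eps_pos by (intro mult_pos_pos) auto
  have r0: "r > 0" using r c0e by linarith
  have tT: "t1 \<in> {0..T}" "t0 \<in> {0..T}" using t by auto
  define s where "s = t1 + r\<^sup>2"
  have r2: "r\<^sup>2 > 0" "r\<^sup>2 \<le> 1" using r r0 by (auto simp: power_le_one)
  have st: "t < s" if "t \<in> {t0..t1}" for t using that r2(1) unfolding s_def atLeastAtMost_iff by linarith
  define n1 where "n1 = CARD('n) - 1"
  have n1: "n1 \<ge> 1" "real n1 = real CARD('n) - 1" using n2 by (auto simp: n1_def of_nat_diff)
  define K where "K = norm y + 1/4"
  have K: "K > 0" by (simp add: K_def add_nonneg_pos)
  have out: "(norm (x - y))\<^sup>2 * 16 \<ge> 1" if "norm x \<ge> K" for x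
  proof -
    have "1/4 \<le> norm (x - y)" using that norm_triangle_ineq2[of x y] by (simp add: K_def)
    then have "(1/4)\<^sup>2 \<le> (norm (x - y))\<^sup>2" by (intro power_mono) auto
    then show ?thesis by (simp add: power2_eq_square)
  qed
  obtain a where box: "ball (0::real^'n) (K + 1) \<subseteq> cbox (- a) a"
    using bounded_subset_cbox_symmetric[OF bounded_ball] by blast
  let ?a = "\<lambda>t. (s - t) powr (- (real CARD('n) - 1) / 2)" and ?m = "\<lambda>t. 1 / (4 * (s - t))"
  let ?Y = "\<lambda>t. integral (cbox (- a) a) (\<lambda>x. kern0 (?a t) (?m t) 16 ((norm (x - y))\<^sup>2) * E x t)"
  have Yeq: "(\<integral>x. ennreal (kern0 (?a t) (?m t) 16 ((norm (x - y))\<^sup>2) * E x t)) = ennreal (?Y t)" if "t \<in> {0..T}" for t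
  proof (rule nn_integral_eq_integral_cbox)
    show "continuous_on UNIV (\<lambda>x. kern0 (?a t) (?m t) 16 ((norm (x - y))\<^sup>2) * E x t)"
      using that by (intro continuous_intros cont_slices) auto
    show "kern0 (?a t) (?m t) 16 ((norm (x - y))\<^sup>2) * E x t \<ge> 0" for x
      using cut_bounds(1) by (simp add: kern0_def E_nonneg)
    show "kern0 (?a t) (?m t) 16 ((norm (x - y))\<^sup>2) * E x t = 0" if "x \<notin> cbox (- a) a" for x
    proof -
      have "norm x \<ge> K"
        proof (rule ccontr)
          assume "\<not> norm x \<ge> K"
          then have "x \<in> ball 0 (K + 1)" by simp
          then show False using box that by blast
        qed
      from kern_vanish(1)[OF out[OF this]] show ?thesis by simp
    qed
  qed
  have ad: "(?a has_real_derivative 2 * (real CARD('n) - 1) * ?m t * ?a t) (at t within {t0..t1})" if tt: "t \<in> {t0..t1}" for t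
  proof -
    have "((\<lambda>t. s - t) has_real_derivative -1) (at t within {t0..t1})" by (auto intro!: derivative_eq_intros)
    from DERIV_chain2[OF has_real_derivative_powr[of "s - t" "- (real CARD('n) - 1) / 2"] this] st[OF tt]
    have "(?a has_real_derivative (- (real CARD('n) - 1) / 2 * (s - t) powr (- (real CARD('n) - 1) / 2 - 1)) * -1) (at t within {t0..t1})" by simp
    moreover have e: "(s - t) powr (- (real CARD('n) - 1) / 2 - 1) = ?a t / (s - t)" unfolding powr_diff using st[OF tt] by simp
    have alg: "- m / 2 * (A / d) * - 1 = 2 * m * (1 / (4 * d)) * A" for m A d :: real by simp
    show ?thesis using calculation unfolding e alg .
  qed
  have md: "(?m has_real_derivative 4 * (?m t)\<^sup>2) (at t within {t0..t1})" if tt: "t \<in> {t0..t1}" for t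
    using st[OF tt] by (auto intro!: derivative_eq_intros simp: power2_eq_square field_simps)
  obtain Y' where Y': "\<And>t. t \<in> {t0..t1} \<Longrightarrow> (?Y has_real_derivative Y' t) (at t within {t0..t1})"
    "\<And>t. t \<in> {t0..t1} \<Longrightarrow> Y' t \<le> integral (cbox (- a) a) (\<lambda>x. ?a t * exp (- ?m t * (norm (x - y))\<^sup>2) *
       (2 * ?m t * cut 16 ((norm (x - y))\<^sup>2) ^ 3 * (\<epsilon> * (norm (g x t))\<^sup>2 - E x t)
       + cut 16 ((norm (x - y))\<^sup>2) * E x t * (60 + 24 * ?m t * (norm (x - y))\<^sup>2) * 16
       + cut 16 ((norm (x - y))\<^sup>2) ^ 3 * (norm (u x t))\<^sup>2 * E x t / 2))"
  proof (rule weighted_energy_inequality[of t0 t1 ?a ?m 16 K y "- a" a])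
    show "0 \<le> ?m t" if "t \<in> {t0..t1}" for t using st[OF that] by simp
  qed (use t ad md K out box in auto)
  define \<alpha> where "\<alpha> = \<epsilon> powr \<delta> * (gauss_const (CARD('n) - 1) + CW * (gvol TYPE('n)) * sqrt (T + 1))"
  define \<beta>2 where "\<beta>2 = CW * (gvol TYPE('n)) * \<epsilon> powr (- 1/2) / (2 * ((rmin TYPE('n) CE) * \<epsilon>))"
  define C3 where "C3 = (gauss_const (CARD('n) - 1) + Ct) / 2"
  have pos: "\<alpha> \<ge> 0" "\<beta>2 \<ge> 0" "C3 \<ge> 0"
    using G_pos cst T_pos tr(2) c0e eps_pos unfolding \<alpha>_def \<beta>2_def C3_def
    by (auto intro!: mult_nonneg_nonneg add_nonneg_nonneg divide_nonneg_nonneg)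
  \<comment> \<open>Explicit primitive of all error rates except the one proportional to NN t powr
    (q / p), whose time integral is at most Bq.\<close>
  define F where "F t = - (M * \<alpha>) * ln (s - t) - \<beta>2 * \<epsilon>\<^sup>2 / (2 * \<mu>) * exp (- 2 * \<mu> * t / \<epsilon>\<^sup>2) + 1920 * gauss_const (CARD('n) - 1) * M * t
     - C3 * M * \<theta> powr (- 2 / (q - 2)) * ((s - t) powr (1 - (kq TYPE('n) b p q)) / (1 - (kq TYPE('n) b p q)))" for t
  define F' where "F' t = M * \<alpha> / (s - t) + \<beta>2 * exp (- 2 * \<mu> * t / \<epsilon>\<^sup>2) + 1920 * gauss_const (CARD('n) - 1) * M
     + C3 * M * \<theta> powr (- 2 / (q - 2)) * (s - t) powr (- (kq TYPE('n) b p q))" for t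
  have k1: "1 - (kq TYPE('n) b p q) > 0" "1 - (kq TYPE('n) b p q) \<le> 1" using kap G_pos(4) by linarith+
  have Fd: "(F has_real_derivative F' t) (at t within {t0..t1})" if tt: "t \<in> {t0..t1}" for t
  proof -
    have sp: "s - t > 0" using st[OF tt] by simp
    have d1: "((\<lambda>t. s - t) has_real_derivative -1) (at t within {t0..t1})" by (auto intro!: derivative_eq_intros)
    have L: "((\<lambda>t. ln (s - t)) has_real_derivative (1 / (s - t)) * -1) (at t within {t0..t1})"
      using DERIV_chain2[OF DERIV_ln_divide[OF sp] d1] .
    have X: "((\<lambda>t. exp (- 2 * \<mu> * t / \<epsilon>\<^sup>2)) has_real_derivative exp (- 2 * \<mu> * t / \<epsilon>\<^sup>2) * (- 2 * \<mu> / \<epsilon>\<^sup>2)) (at t within {t0..t1})"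
      by (intro DERIV_chain2[OF DERIV_exp] DERIV_cdivide DERIV_cmult_Id)
    have Pw: "((\<lambda>t. (s - t) powr (1 - (kq TYPE('n) b p q))) has_real_derivative ((1 - (kq TYPE('n) b p q)) * (s - t) powr (1 - (kq TYPE('n) b p q) - 1)) * -1) (at t within {t0..t1})"
      using DERIV_chain2[OF has_real_derivative_powr[OF sp] d1] .
    have "(F has_real_derivative - (M * \<alpha>) * ((1 / (s - t)) * -1) - \<beta>2 * \<epsilon>\<^sup>2 / (2 * \<mu>) * (exp (- 2 * \<mu> * t / \<epsilon>\<^sup>2) * (- 2 * \<mu> / \<epsilon>\<^sup>2)) + 1920 * gauss_const (CARD('n) - 1) * M
     - C3 * M * \<theta> powr (- 2 / (q - 2)) * (((1 - (kq TYPE('n) b p q)) * (s - t) powr (1 - (kq TYPE('n) b p q) - 1)) * -1 / (1 - (kq TYPE('n) b p q)))) (at t within {t0..t1})"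
      unfolding F_def by (intro DERIV_add DERIV_diff DERIV_cmult DERIV_cdivide L X Pw DERIV_cmult_Id)
    moreover have "\<beta>2 * \<epsilon>\<^sup>2 / (2 * \<mu>) * (exp (- 2 * \<mu> * t / \<epsilon>\<^sup>2) * (- 2 * \<mu> / \<epsilon>\<^sup>2)) = - (\<beta>2 * exp (- 2 * \<mu> * t / \<epsilon>\<^sup>2))"
      using cst(1) eps_pos by simp
    moreover have "((1 - (kq TYPE('n) b p q)) * (s - t) powr (1 - (kq TYPE('n) b p q) - 1)) * -1 / (1 - (kq TYPE('n) b p q)) = - ((s - t) powr (- (kq TYPE('n) b p q)))"
    proof -
      have e: "1 - k - 1 = - k" for k :: real by simp
      have alg: "c * A * -1 / c = - A" if "c > 0" for c A :: real using that by simp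
      show ?thesis unfolding e by (rule alg[OF k1(1)])
    qed
    ultimately show ?thesis unfolding F'_def by (elim DERIV_cong) (simp only: mult_minus_right minus_mult_minus mult_1_right minus_mult_left[symmetric] diff_minus_eq_add minus_minus times_divide_eq_right)
  qed
  have rate: "Y' t \<le> F' t + (C3 * M * \<theta>) * NN t powr (q / p)" if tt: "t \<in> {t0..t1}" for t
  proof -
    have t': "t \<in> {0..T}" using tt t by auto
    define \<tau> where "\<tau> = s - t"
    have \<tau>: "\<tau> > 0" "r\<^sup>2 \<le> \<tau>" "\<tau> \<le> T + 1" using st[OF tt] tt t r2 by (auto simp: \<tau>_def s_def)
    define X where "X = exp (- 2 * \<mu> * t / \<epsilon>\<^sup>2)"
    have X: "X > 0" by (simp add: X_def)
    \<comment> \<open>The lower bound on r turns the factor 1/sqrt(s - t) in front of the initial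
      layer into 1/\<epsilon>, up to a constant, so that the layer can be integrated
      exactly.\<close>
    have sr: "(rmin TYPE('n) CE) * \<epsilon> \<le> sqrt \<tau>"
    proof -
      have "r = sqrt (r\<^sup>2)" using r0 by simp
      also have "\<dots> \<le> sqrt \<tau>" using \<tau> by (intro real_sqrt_le_mono) auto
      finally show ?thesis using r by linarith
    qed
    have sT: "sqrt \<tau> \<le> sqrt (T + 1)" using \<tau> by (intro real_sqrt_le_mono)
    have "Y' t \<le> (2 * \<epsilon> powr \<delta>) * gauss_const (CARD('n) - 1) * M / (2 * \<tau>) + (CW * \<epsilon> powr \<delta> + CW * \<epsilon> powr (- 1/2) * X) * (gvol TYPE('n)) / (2 * sqrt \<tau>)
      + 1920 * gauss_const (CARD('n) - 1) * M + (gauss_const (CARD('n) - 1) + Ct) * M * ((NN t powr (1 / p))\<^sup>2 * \<tau> powr (- ((real CARD('n) - 1) * b / p))) / 2"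
      unfolding \<tau>_def
    proof (rule order_trans[OF Y'(2)[OF tt] heat_kernel_rate[OF n2 t' st[OF tt] _ d[OF tt] tr Du_cont[OF t'] NN_loc[OF t']]])
      show "\<epsilon> * (norm (g x t))\<^sup>2 - E x t \<le> 2 * \<epsilon> powr \<delta> * E x t + (CW * \<epsilon> powr \<delta> + CW * \<epsilon> powr (- 1/2) * X)" for x
        using disc[OF t', of x] unfolding X_def by linarith
    qed (use M NN1[OF t'] cst X in auto)
    also have "\<dots> \<le> M * \<alpha> / \<tau> + \<beta>2 * X + 1920 * gauss_const (CARD('n) - 1) * M + C3 * M * (\<theta> * NN t powr (q / p) + \<theta> powr (- 2 / (q - 2)) * \<tau> powr (- (kq TYPE('n) b p q)))"
    proof -
      have a1: "CW * \<epsilon> powr \<delta> * (gvol TYPE('n)) / (2 * sqrt \<tau>) \<le> M * (\<epsilon> powr \<delta> * (CW * (gvol TYPE('n)) * sqrt (T + 1))) / \<tau>"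
      proof -
        have "1 / sqrt \<tau> = sqrt \<tau> / \<tau>" using \<tau> by (simp add: field_simps)
        also have "\<dots> \<le> sqrt (T + 1) / \<tau>" using sT \<tau> by (intro divide_right_mono) auto
        finally have "(CW * \<epsilon> powr \<delta> * (gvol TYPE('n)) / 2) * (1 / sqrt \<tau>) \<le> (CW * \<epsilon> powr \<delta> * (gvol TYPE('n)) / 2) * (sqrt (T + 1) / \<tau>)"
          using cst G_pos by (intro mult_left_mono) auto
        also have "\<dots> = 1/2 * (\<epsilon> powr \<delta> * (CW * (gvol TYPE('n)) * sqrt (T + 1)) / \<tau>)" by simp
        also have "\<dots> \<le> M * (\<epsilon> powr \<delta> * (CW * (gvol TYPE('n)) * sqrt (T + 1)) / \<tau>)"
          using M cst G_pos \<tau> T_pos by (intro mult_right_mono divide_nonneg_nonneg mult_nonneg_nonneg) auto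
        finally show ?thesis by simp
      qed
      have a2: "CW * \<epsilon> powr (- 1/2) * X * (gvol TYPE('n)) / (2 * sqrt \<tau>) \<le> \<beta>2 * X"
      proof -
        have "CW * \<epsilon> powr (- 1/2) * X * (gvol TYPE('n)) / (2 * sqrt \<tau>) \<le> CW * \<epsilon> powr (- 1/2) * X * (gvol TYPE('n)) / (2 * ((rmin TYPE('n) CE) * \<epsilon>))"
        proof -
          have mono: "N / (2 * x) \<le> N / (2 * z)" if "0 < z" "z \<le> x" "N \<ge> 0" for N x z :: real
            using that by (intro divide_left_mono) auto
          show ?thesis using cst X G_pos by (intro mono[OF c0e sr] mult_nonneg_nonneg) auto
        qed
        then show ?thesis by (simp add: \<beta>2_def mult_ac)
      qed
      have a3: "C3 * M * ((NN t powr (1 / p))\<^sup>2 * \<tau> powr (- ((real CARD('n) - 1) * b / p))) \<le> C3 * M * (\<theta> * NN t powr (q / p) + \<theta> powr (- 2 / (q - 2)) * \<tau> powr (- (kq TYPE('n) b p q)))"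
        using pos M by (intro mult_left_mono NN_powr_split[OF t' \<theta> \<tau>(1)]) auto
      have e1: "(2 * \<epsilon> powr \<delta>) * gauss_const (CARD('n) - 1) * M / (2 * \<tau>) = M * (\<epsilon> powr \<delta> * gauss_const (CARD('n) - 1)) / \<tau>" by simp
      have e2: "(CW * \<epsilon> powr \<delta> + CW * \<epsilon> powr (- 1/2) * X) * (gvol TYPE('n)) / (2 * sqrt \<tau>)
         = CW * \<epsilon> powr \<delta> * (gvol TYPE('n)) / (2 * sqrt \<tau>) + CW * \<epsilon> powr (- 1/2) * X * (gvol TYPE('n)) / (2 * sqrt \<tau>)"
        by (simp only: distrib_right add_divide_distrib)
      have e3: "(gauss_const (CARD('n) - 1) + Ct) * M * ((NN t powr (1 / p))\<^sup>2 * \<tau> powr (- ((real CARD('n) - 1) * b / p))) / 2 = C3 * M * ((NN t powr (1 / p))\<^sup>2 * \<tau> powr (- ((real CARD('n) - 1) * b / p)))"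
        by (simp add: C3_def)
      have e4: "M * \<alpha> / \<tau> = M * (\<epsilon> powr \<delta> * gauss_const (CARD('n) - 1)) / \<tau> + M * (\<epsilon> powr \<delta> * (CW * (gvol TYPE('n)) * sqrt (T + 1))) / \<tau>"
        by (simp only: \<alpha>_def distrib_left add_divide_distrib)
      show ?thesis unfolding e1 e2 e3 e4 using a1 a2 a3 by linarith
    qed
    also have "\<dots> = F' t + (C3 * M * \<theta>) * NN t powr (q / p)"
    proof -
      have alg: "A + B + C + c * (z * N + P * S) = A + B + C + c * P * S + c * z * N" for A B C c z N P S :: real by algebra
      show ?thesis unfolding F'_def \<tau>_def X_def by (rule alg)
    qed
    finally show ?thesis .
  qed
  have cmp: "?Y t1 - ?Y t0 \<le> F t1 - F t0 + (C3 * M * \<theta>) * integral {t0..t1} (\<lambda>t. NN t powr (q / p))"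
    by (rule derivative_comparison[OF t(2) Y'(1) Fd NN_int(1)[OF t] rate])
  have Fle: "F t1 - F t0 \<le> M * (\<alpha> * (ln (T + 1) - 2 * ln ((rmin TYPE('n) CE) * \<epsilon>)) + CW * (gvol TYPE('n)) * sqrt \<epsilon> / (4 * \<mu> * (rmin TYPE('n) CE)) + 1920 * gauss_const (CARD('n) - 1) * (t1 - t0)
     + C3 * (\<theta> powr (- 2 / (q - 2)) * ((t1 - t0) powr (1 - (kq TYPE('n) b p q)) / (1 - (kq TYPE('n) b p q)))))"
  proof -
    have l1: "ln (s - t0) - ln (s - t1) \<le> ln (T + 1) - 2 * ln ((rmin TYPE('n) CE) * \<epsilon>)"
    proof -
      have "s - t0 \<le> T + 1" "s - t0 > 0" using t r2 st[of t0] by (auto simp: s_def)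
      then have "ln (s - t0) \<le> ln (T + 1)" by simp
      moreover have "ln (s - t1) = 2 * ln r" using r0 by (simp add: s_def ln_realpow)
      moreover have "ln ((rmin TYPE('n) CE) * \<epsilon>) \<le> ln r" using c0e r by simp
      ultimately show ?thesis by linarith
    qed
    have A: "M * \<alpha> * (ln (s - t0) - ln (s - t1)) \<le> M * (\<alpha> * (ln (T + 1) - 2 * ln ((rmin TYPE('n) CE) * \<epsilon>)))"
      using l1 pos M by (simp add: mult.assoc mult_left_mono)
    have B: "\<beta>2 * \<epsilon>\<^sup>2 / (2 * \<mu>) * (exp (- 2 * \<mu> * t0 / \<epsilon>\<^sup>2) - exp (- 2 * \<mu> * t1 / \<epsilon>\<^sup>2)) \<le> M * (CW * (gvol TYPE('n)) * sqrt \<epsilon> / (4 * \<mu> * (rmin TYPE('n) CE)))"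
    proof -
      have "exp (- 2 * \<mu> * t0 / \<epsilon>\<^sup>2) \<le> 1" using cst t by simp
      then have "exp (- 2 * \<mu> * t0 / \<epsilon>\<^sup>2) - exp (- 2 * \<mu> * t1 / \<epsilon>\<^sup>2) \<le> 1" using exp_gt_zero[of "- 2 * \<mu> * t1 / \<epsilon>\<^sup>2"] by linarith
      then have "\<beta>2 * \<epsilon>\<^sup>2 / (2 * \<mu>) * (exp (- 2 * \<mu> * t0 / \<epsilon>\<^sup>2) - exp (- 2 * \<mu> * t1 / \<epsilon>\<^sup>2)) \<le> \<beta>2 * \<epsilon>\<^sup>2 / (2 * \<mu>) * 1"
        using pos cst by (intro mult_left_mono) auto
      also have "\<dots> = CW * (gvol TYPE('n)) * sqrt \<epsilon> / (4 * \<mu> * (rmin TYPE('n) CE))"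
      proof -
        have "\<epsilon> powr (- 1/2) * \<epsilon> = sqrt \<epsilon>"
        proof -
          have "\<epsilon> powr (- 1/2) * \<epsilon> = \<epsilon> powr (- 1/2) * \<epsilon> powr 1" using eps_pos by simp
          also have "\<dots> = \<epsilon> powr (1/2)" unfolding powr_add[symmetric] by simp
          finally show ?thesis using eps_pos by (simp add: powr_half_sqrt)
        qed
        then have "\<epsilon>\<^sup>2 * \<epsilon> powr (- 1/2) = \<epsilon> * sqrt \<epsilon>" by (simp add: power2_eq_square mult_ac)
        moreover have "\<beta>2 * \<epsilon>\<^sup>2 / (2 * \<mu>) * 1 = CW * (gvol TYPE('n)) * (\<epsilon>\<^sup>2 * \<epsilon> powr (- 1/2)) / (4 * \<mu> * ((rmin TYPE('n) CE) * \<epsilon>))"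
          by (simp add: \<beta>2_def mult_ac)
        ultimately show ?thesis using eps_pos by simp
      qed
      also have "\<dots> \<le> M * (CW * (gvol TYPE('n)) * sqrt \<epsilon> / (4 * \<mu> * (rmin TYPE('n) CE)))"
      proof -
        have "CW * (gvol TYPE('n)) * sqrt \<epsilon> / (4 * \<mu> * (rmin TYPE('n) CE)) \<ge> 0" using cst G_pos eps_pos by (intro divide_nonneg_nonneg mult_nonneg_nonneg) auto
        from mult_right_mono[OF M this] show ?thesis by simp
      qed
      finally show ?thesis .
    qed
    \<comment> \<open>Subadditivity of the concave power makes this bound depend on t1 - t0 alone,
      whatever the pole s.\<close>
    have D: "C3 * M * \<theta> powr (- 2 / (q - 2)) * ((s - t0) powr (1 - (kq TYPE('n) b p q)) / (1 - (kq TYPE('n) b p q)) - (s - t1) powr (1 - (kq TYPE('n) b p q)) / (1 - (kq TYPE('n) b p q)))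
      \<le> M * (C3 * (\<theta> powr (- 2 / (q - 2)) * ((t1 - t0) powr (1 - (kq TYPE('n) b p q)) / (1 - (kq TYPE('n) b p q)))))"
    proof -
      have "(s - t0) powr (1 - (kq TYPE('n) b p q)) - (s - t1) powr (1 - (kq TYPE('n) b p q)) \<le> ((s - t0) - (s - t1)) powr (1 - (kq TYPE('n) b p q))"
        using t r2 k1 by (intro powr_diff_le) (auto simp: s_def)
      then have "(s - t0) powr (1 - (kq TYPE('n) b p q)) / (1 - (kq TYPE('n) b p q)) - (s - t1) powr (1 - (kq TYPE('n) b p q)) / (1 - (kq TYPE('n) b p q)) \<le> (t1 - t0) powr (1 - (kq TYPE('n) b p q)) / (1 - (kq TYPE('n) b p q))"
        using k1 by (simp add: diff_divide_distrib[symmetric] divide_right_mono)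
      then have "C3 * M * \<theta> powr (- 2 / (q - 2)) * ((s - t0) powr (1 - (kq TYPE('n) b p q)) / (1 - (kq TYPE('n) b p q)) - (s - t1) powr (1 - (kq TYPE('n) b p q)) / (1 - (kq TYPE('n) b p q)))
        \<le> C3 * M * \<theta> powr (- 2 / (q - 2)) * ((t1 - t0) powr (1 - (kq TYPE('n) b p q)) / (1 - (kq TYPE('n) b p q)))"
        using pos M by (intro mult_left_mono) auto
      then show ?thesis by (simp only: mult_ac)
    qed
    have "F t1 - F t0 = M * \<alpha> * (ln (s - t0) - ln (s - t1)) + \<beta>2 * \<epsilon>\<^sup>2 / (2 * \<mu>) * (exp (- 2 * \<mu> * t0 / \<epsilon>\<^sup>2) - exp (- 2 * \<mu> * t1 / \<epsilon>\<^sup>2))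
       + M * (1920 * gauss_const (CARD('n) - 1) * (t1 - t0)) + C3 * M * \<theta> powr (- 2 / (q - 2)) * ((s - t0) powr (1 - (kq TYPE('n) b p q)) / (1 - (kq TYPE('n) b p q)) - (s - t1) powr (1 - (kq TYPE('n) b p q)) / (1 - (kq TYPE('n) b p q)))"
      unfolding F_def right_diff_distrib by simp
    then show ?thesis using A B D by (simp only: distrib_left)
  qed
  have Y0: "?Y t0 \<le> gauss_const (CARD('n) - 1) * M0"
  proof -
    have s0: "s - t0 > 0" using st[of t0] t by simp
    have "ennreal (?Y t0) \<le> (\<integral>x. (if dist x y < 1/4 then ennreal (E x t0) * ennreal ((s - t0) powr (- real n1 / 2) * exp (- (1 / (4 * (s - t0))) * (norm (x - y))\<^sup>2)) else 0))"
      unfolding Yeq[OF tT(2), symmetric]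
    proof (rule nn_integral_mono)
      fix x
      show "ennreal (kern0 (?a t0) (?m t0) 16 ((norm (x - y))\<^sup>2) * E x t0)
        \<le> (if dist x y < 1/4 then ennreal (E x t0) * ennreal ((s - t0) powr (- real n1 / 2) * exp (- (1 / (4 * (s - t0))) * (norm (x - y))\<^sup>2)) else 0)"
      proof (cases "dist x y < 1/4")
        case True
        have "cut 16 ((norm (x - y))\<^sup>2) ^ 3 \<le> 1" using cut_bounds(1)[of 16 "(norm (x - y))\<^sup>2"] cut_bounds(2)[of "(norm (x - y))\<^sup>2" 16] by (simp add: power_le_one)
        then have "kern0 (?a t0) (?m t0) 16 ((norm (x - y))\<^sup>2) \<le> ?a t0 * exp (- ?m t0 * (norm (x - y))\<^sup>2)"
          unfolding kern0_def by (intro mult_left_le) auto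
        then have "ennreal (kern0 (?a t0) (?m t0) 16 ((norm (x - y))\<^sup>2) * E x t0) \<le> ennreal (E x t0 * (?a t0 * exp (- ?m t0 * (norm (x - y))\<^sup>2)))"
          using E_nonneg[of x t0] by (intro ennreal_leI) (simp add: mult.commute mult_left_mono)
        also have "\<dots> = ennreal (E x t0) * ennreal (?a t0 * exp (- ?m t0 * (norm (x - y))\<^sup>2))"
          using E_nonneg[of x t0] by (rule ennreal_mult')
        finally show ?thesis using True n1(2) by simp
      next
        case False
        then have "(1/4)\<^sup>2 \<le> (norm (x - y))\<^sup>2" by (intro power_mono) (auto simp: dist_norm)
        then have "kern0 (?a t0) (?m t0) 16 ((norm (x - y))\<^sup>2) = 0" by (intro kern_vanish) (simp add: power2_eq_square)
        then show ?thesis by simp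
      qed
    qed
    also have "\<dots> \<le> ennreal (gauss_const (CARD('n) - 1) * M0 * (s - t0) powr (- real n1 / 2 + real n1 / 2))"
      unfolding n1_def[symmetric]
    proof (rule scaled_gaussian_mass_le)
      show "(\<lambda>x. ennreal (E x t0)) \<in> borel_measurable borel" using measurable_slices(1)[OF tT(2)] by simp
      show "(\<integral>x. (if dist x y < r then ennreal (E x t0) else 0)) \<le> ennreal (M0 * r ^ n1)" if "0 < r" "r \<le> 1/4" for r
        using densD[OF d0, of r y] that by (simp add: n1_def)
    qed (use s0 n1 M0 in auto)
    also have "\<dots> = ennreal (gauss_const (CARD('n) - 1) * M0)" using s0 by simp
    finally show ?thesis using G_pos M0 by simp
  qed
  have Y1: "?Y t1 \<le> gauss_const (CARD('n) - 1) * M0 + M * err \<theta> (t1 - t0)"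
  proof -
    have "(C3 * M * \<theta>) * integral {t0..t1} (\<lambda>t. NN t powr (q / p)) \<le> (C3 * M * \<theta>) * Bq"
      using pos M \<theta> by (intro mult_left_mono NN_int(2) t) auto
    moreover have "M * err \<theta> (t1 - t0) = M * (\<alpha> * (ln (T + 1) - 2 * ln ((rmin TYPE('n) CE) * \<epsilon>)) + CW * (gvol TYPE('n)) * sqrt \<epsilon> / (4 * \<mu> * (rmin TYPE('n) CE)) + 1920 * gauss_const (CARD('n) - 1) * (t1 - t0)
     + C3 * (\<theta> powr (- 2 / (q - 2)) * ((t1 - t0) powr (1 - (kq TYPE('n) b p q)) / (1 - (kq TYPE('n) b p q))))) + (C3 * M * \<theta>) * Bq"
      unfolding err_def \<alpha>_def[symmetric] C3_def[symmetric] by (simp only: distrib_left mult_ac add_ac)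
    ultimately show ?thesis using cmp Fle Y0 by linarith
  qed
  have rp: "r ^ n1 > 0" using r0 by simp
  have lower: "ennreal (E x t1) \<le> ennreal (4 * r ^ n1) * ennreal (kern0 (?a t1) (?m t1) 16 ((norm (x - y))\<^sup>2) * E x t1)" if x: "dist x y < r" for x
  proof -
    define Q where "Q = (norm (x - y))\<^sup>2"
    have Q: "0 \<le> Q" "Q \<le> r\<^sup>2" using x unfolding Q_def by (auto simp: dist_norm intro!: power_mono)
    have "r\<^sup>2 \<le> (1/8)\<^sup>2" using r r0 by (intro power_mono) auto
    then have "Q * 16 \<le> 1/4" using Q by (simp add: power2_eq_square)
    then have "3/4 \<le> cut 16 Q" by (simp add: cut_def)
    then have c3: "(3/4) ^ 3 \<le> cut 16 Q ^ 3" by (intro power_mono) auto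
    have "1 / (4 * r\<^sup>2) * Q \<le> 1/4" using Q r0 by (simp add: divide_le_eq)
    then have "3/4 \<le> exp (- (1 / (4 * r\<^sup>2)) * Q)" using exp_ge_add_one_self[of "- (1 / (4 * r\<^sup>2)) * Q"] by linarith
    then have "3/4 * (3/4) ^ 3 \<le> exp (- (1 / (4 * r\<^sup>2)) * Q) * cut 16 Q ^ 3" using c3 by (intro mult_mono) auto
    then have ex: "1/4 \<le> exp (- (1 / (4 * r\<^sup>2)) * Q) * cut 16 Q ^ 3" by (simp add: power3_eq_cube)
    have at1: "?a t1 = 1 / r ^ n1"
    proof -
      have "?a t1 = (r powr 2) powr (- real n1 / 2)" using r0 n1(2) by (simp add: s_def)
      also have "\<dots> = r powr (- real n1)" by (simp add: powr_powr)
      finally show ?thesis using r0 by (simp add: powr_minus_divide powr_realpow)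
    qed
    have "4 * r ^ n1 * kern0 (?a t1) (?m t1) 16 Q = 4 * (exp (- (1 / (4 * r\<^sup>2)) * Q) * cut 16 Q ^ 3)"
      unfolding kern0_def at1 using r0 by (simp add: s_def)
    then have "1 \<le> 4 * r ^ n1 * kern0 (?a t1) (?m t1) 16 Q" using ex by linarith
    then have "1 * E x t1 \<le> 4 * r ^ n1 * kern0 (?a t1) (?m t1) 16 Q * E x t1" by (intro mult_right_mono E_nonneg)
    then have "ennreal (E x t1) \<le> ennreal (4 * r ^ n1 * (kern0 (?a t1) (?m t1) 16 Q * E x t1))" by (intro ennreal_leI) (simp add: mult.assoc)
    also have "\<dots> = ennreal (4 * r ^ n1) * ennreal (kern0 (?a t1) (?m t1) 16 Q * E x t1)" using rp by (intro ennreal_mult') auto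
    finally show ?thesis unfolding Q_def .
  qed
  have "(\<integral>x. (if dist x y < r then ennreal (E x t1) else 0))
    \<le> (\<integral>x. ennreal (4 * r ^ n1) * ennreal (kern0 (?a t1) (?m t1) 16 ((norm (x - y))\<^sup>2) * E x t1))"
    using lower by (intro nn_integral_mono) auto
  also have "\<dots> = ennreal (4 * r ^ n1) * ennreal (?Y t1)"
    unfolding Yeq[OF tT(1), symmetric]
  proof (rule nn_integral_cmult)
    have "continuous_on UNIV (\<lambda>x. kern0 (?a t1) (?m t1) 16 ((norm (x - y))\<^sup>2) * E x t1)"
      using tT by (intro continuous_intros cont_slices) auto
    then show "(\<lambda>x. ennreal (kern0 (?a t1) (?m t1) 16 ((norm (x - y))\<^sup>2) * E x t1)) \<in> borel_measurable lborel"
      using measurable_compose[OF borel_measurable_continuous_onI measurable_ennreal] by simp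
  qed
  also have "\<dots> \<le> ennreal (4 * r ^ n1) * ennreal (gauss_const (CARD('n) - 1) * M0 + M * err \<theta> (t1 - t0))"
    by (intro mult_left_mono ennreal_leI Y1) auto
  also have "\<dots> = ennreal (4 * r ^ n1 * (gauss_const (CARD('n) - 1) * M0 + M * err \<theta> (t1 - t0)))"
    using rp by (intro ennreal_mult'[symmetric]) auto
  finally show ?thesis unfolding n1_def .
qed

end

section \<open>Growth of the density on short time steps\<close>

text \<open>The finite cover of K moves along with y, so a single N, fixed by K and e, serves every
  centre, function and bound.\<close>

lemma finite_cover_integral:
  fixes K :: "(real^'n) set"
  assumes K: "compact K" and e: "e > 0"
  shows "\<exists>N\<ge>1::real. \<forall>h \<in> borel_measurable borel. \<forall>B y. (\<forall>z. (\<integral>x. (if dist x z < e then h x else 0)) \<le> (B::ennreal))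
    \<longrightarrow> (\<integral>x. (if x - y \<in> K then h x else 0)) \<le> ennreal N * B"
proof -
  obtain F where F: "finite F" "K \<subseteq> (\<Union>c\<in>F. ball c e)"
    using K e unfolding compact_eq_totally_bounded by blast
  have "(\<integral>x. (if x - y \<in> K then h x else 0)) \<le> ennreal (max 1 (real (card F))) * B"
    if h [measurable]: "h \<in> borel_measurable borel" and B: "\<And>z. (\<integral>x. (if dist x z < e then h x else 0)) \<le> B"
    for h :: "real^'n \<Rightarrow> ennreal" and B y
  proof -
    have "(\<integral>x. (if x - y \<in> K then h x else 0)) \<le> (\<integral>x. (\<Sum>c\<in>F. (if dist x (y + c) < e then h x else 0)))"
    proof (rule nn_integral_mono)
      fix x
      show "(if x - y \<in> K then h x else 0) \<le> (\<Sum>c\<in>F. (if dist x (y + c) < e then h x else 0))"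
      proof (cases "x - y \<in> K")
        case True
        then obtain c where c: "c \<in> F" "dist c (x - y) < e" using F by auto
        then have "dist x (y + c) < e" by (simp add: dist_norm norm_minus_commute algebra_simps)
        then show ?thesis using member_le_sum[OF c(1), of "\<lambda>c. if dist x (y + c) < e then h x else 0"] F True by simp
      qed simp
    qed
    also have "\<dots> = (\<Sum>c\<in>F. (\<integral>x. (if dist x (y + c) < e then h x else 0)))"
      by (rule nn_integral_sum) measurable
    also have "\<dots> \<le> (\<Sum>c\<in>F. B)" by (intro sum_mono B)
    also have "\<dots> = ennreal (real (card F)) * B" by (simp add: ennreal_of_nat_eq_real_of_nat)
    also have "\<dots> \<le> ennreal (max 1 (real (card F))) * B" by (intro mult_right_mono ennreal_leI) auto
    finally show ?thesis .
  qed
  then show ?thesis by (intro exI[of _ "max 1 (real (card F))"]) auto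
qed

context allen_cahn_transport
begin

lemma dens_mono:
  assumes d: "dens tor t M" and M: "M \<le> M'"
  shows "dens tor t M'"
  unfolding dens_def
proof (intro conjI allI impI)
  fix y :: "real^'n" and r :: real assume r: "0 < r" "r \<le> 1/2"
  have "ennreal (M * r ^ (CARD('n) - 1)) \<le> ennreal (M' * r ^ (CARD('n) - 1))"
    using r M by (intro ennreal_leI mult_right_mono) auto
  with densD[OF d r, of y] show "(\<integral>x. (if dist x y < r then ennreal (E x t) else 0)) \<le> ennreal (M' * r ^ (CARD('n) - 1))"
    by (rule order_trans)
next
  assume "\<not> tor"
  then have "(\<integral>x. ennreal (E x t)) \<le> ennreal M" using d by (simp add: dens_def)
  also have "\<dots> \<le> ennreal M'" by (rule ennreal_leI[OF M])
  finally show "(\<integral>x. ennreal (E x t)) \<le> ennreal M'" .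
qed

lemma dens_limit:
  assumes d: "\<And>k. dens tor t (a + c / 2 ^ k)"
  shows "dens tor t a"
proof -
  have lim: "(\<lambda>k. a + c / 2 ^ k) \<longlonglongrightarrow> a"
    using tendsto_add[OF tendsto_const[of a] LIMSEQ_divide_realpow_zero[of 2 c]] by simp
  show ?thesis
    unfolding dens_def
  proof (intro conjI allI impI)
    fix y :: "real^'n" and r :: real assume r: "0 < r" "r \<le> 1/2"
    have "(\<lambda>k. ennreal ((a + c / 2 ^ k) * r ^ (CARD('n) - 1))) \<longlonglongrightarrow> ennreal (a * r ^ (CARD('n) - 1))"
      by (intro tendsto_ennrealI tendsto_mult lim tendsto_const)
    then show "(\<integral>x. (if dist x y < r then ennreal (E x t) else 0)) \<le> ennreal (a * r ^ (CARD('n) - 1))"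
      by (rule LIMSEQ_le_const) (use densD[OF d r] in blast)
  next
    assume "\<not> tor"
    have "(\<lambda>k. ennreal (a + c / 2 ^ k)) \<longlonglongrightarrow> ennreal a" by (intro tendsto_ennrealI lim)
    then show "(\<integral>x. ennreal (E x t)) \<le> ennreal a"
      by (rule LIMSEQ_le_const) (use d \<open>\<not> tor\<close> in \<open>auto simp: dens_def\<close>)
  qed
qed

end

context controlled_flow
begin

lemma err_mono:
  assumes h: "0 \<le> h'" "h' \<le> h" and \<theta>: "\<theta> > 0"
  shows "err \<theta> h' \<le> err \<theta> h"
proof -
  have k1: "1 - (kq TYPE('n) b p q) > 0" using kap by simp
  have "h' powr (1 - (kq TYPE('n) b p q)) \<le> h powr (1 - (kq TYPE('n) b p q))"
    using h k1 by (intro powr_mono2) auto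
  then show ?thesis
    unfolding err_def using h k1 G_pos(1) tr(2)
    by (intro add_mono order_refl mult_left_mono divide_right_mono) auto
qed

text \<open>Three ranges of radii: up to \<open>rmin\<close> * \<epsilon> by the pointwise energy
  bound, up to 1/8 by the kernel, up to 1/2 by covering with balls of radius 1/8 at the price of the
  factor N. The bound M assumed on the step returns with a factor of at most 1/2.\<close>

lemma density_step:
  fixes N M M0 \<theta> h :: real
  assumes N: "N \<ge> 1" and cov: "\<And>(f :: real^'n \<Rightarrow> ennreal) B y. f \<in> borel_measurable borel \<Longrightarrow>
       (\<And>z. (\<integral>x. (if dist x z < 1/8 then f x else 0)) \<le> B) \<Longrightarrow>
       (\<integral>x. (if x - y \<in> cball 0 (1/2) then f x else 0)) \<le> ennreal N * B"
    and t: "0 \<le> t0" "t0 \<le> t1" "t1 \<le> T" "t1 - t0 \<le> h" and M: "M \<ge> 1" and d: "\<And>t. t \<in> {t0..t1} \<Longrightarrow> dens tor t M"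
    and d0: "dens tor t0 M0" and M0: "M0 \<ge> 1" and \<theta>: "\<theta> > 0"
    and small: "4 * N * err \<theta> h \<le> 1/2" "60 * h + (1 + Ct) / 2 * (\<theta> * Bq + \<theta> powr (- 2 / (q - 2)) * h) \<le> 1/2"
    and eps: "(rmin TYPE('n) CE) * \<epsilon> < 1/8"
  shows "dens tor t1 (4 * N * gauss_const (CARD('n) - 1) * M0 + M / 2)"
proof -
  define Gc where "Gc = gauss_const (CARD('n) - 1)"
  define c0 where "c0 = (rmin TYPE('n) CE) * \<epsilon>"
  define R where "R = 4 * N * Gc * M0 + M / 2"
  have G1: "Gc \<ge> 1" using G_pos(1) by (simp add: Gc_def)
  have tT: "t1 \<in> {0..T}" using t by auto
  have [measurable]: "(\<lambda>x. E x t1) \<in> borel_measurable borel" by (rule measurable_slices[OF tT])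
  have prod1: "Gc * M0 \<ge> 1" "N * (Gc * M0) \<ge> Gc * M0"
  proof -
    show "Gc * M0 \<ge> 1" using mult_mono[OF G1 M0] G1 by simp
    then show "N * (Gc * M0) \<ge> Gc * M0" using N mult_right_mono[OF N, of "Gc * M0"] by simp
  qed
  have R1: "R \<ge> 1" unfolding R_def using prod1 M by (simp add: mult.assoc)
  have er: "4 * N * (Gc * M0 + M * err \<theta> (t1 - t0)) \<le> R"
  proof -
    have "err \<theta> (t1 - t0) \<le> err \<theta> h" using t \<theta> by (intro err_mono) auto
    then have "(4 * N) * err \<theta> (t1 - t0) \<le> (4 * N) * err \<theta> h" using N by (intro mult_left_mono) auto
    then have "M * ((4 * N) * err \<theta> (t1 - t0)) \<le> M * (1/2)" using small M by (intro mult_left_mono) auto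
    then show ?thesis unfolding R_def by (simp add: algebra_simps)
  qed
  have er1: "4 * (Gc * M0 + M * err \<theta> (t1 - t0)) \<le> R"
  proof (cases "Gc * M0 + M * err \<theta> (t1 - t0) \<ge> 0")
    case True
    have "1 * (4 * (Gc * M0 + M * err \<theta> (t1 - t0))) \<le> N * (4 * (Gc * M0 + M * err \<theta> (t1 - t0)))"
      using True by (intro mult_right_mono N) auto
    then show ?thesis using er by (simp add: mult_ac)
  next
    case False
    have "4 * X \<le> R" if "\<not> X \<ge> 0" for X using that R1 by linarith
    from this[OF False] show ?thesis .
  qed
  have small_r: "(\<integral>x. (if dist x y < r then ennreal (E x t1) else 0)) \<le> ennreal (R * r ^ (CARD('n) - 1))"
    if r: "0 < r" "r \<le> 1/8" for y r
  proof (cases "r \<le> c0")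
    case True
    have "1 * r ^ (CARD('n) - 1) \<le> R * r ^ (CARD('n) - 1)" using r by (intro mult_right_mono R1) auto
    then have "ennreal (r ^ (CARD('n) - 1)) \<le> ennreal (R * r ^ (CARD('n) - 1))" by (intro ennreal_leI) simp
    with small_ball[OF tT r(1) True[unfolded c0_def], of y] show ?thesis by (rule order_trans)
  next
    case False
    have "4 * (Gc * M0 + M * err \<theta> (t1 - t0)) * r ^ (CARD('n) - 1) \<le> R * r ^ (CARD('n) - 1)"
      using r by (intro mult_right_mono er1) auto
    then have "ennreal (4 * r ^ (CARD('n) - 1) * (Gc * M0 + M * err \<theta> (t1 - t0))) \<le> ennreal (R * r ^ (CARD('n) - 1))"
      by (intro ennreal_leI) (simp only: mult_ac)
    moreover have "(\<integral>x. (if dist x y < r then ennreal (E x t1) else 0))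
      \<le> ennreal (4 * r ^ (CARD('n) - 1) * (Gc * M0 + M * err \<theta> (t1 - t0)))"
      unfolding Gc_def using False r M0 by (intro heat_ball_step[OF t(1-3) M d d0 _ \<theta>]) (auto simp: c0_def)
    ultimately show ?thesis by (rule order_trans[rotated])
  qed
  show ?thesis
    unfolding R_def[unfolded Gc_def, symmetric] dens_def
  proof (intro conjI allI impI)
    fix y :: "real^'n" and r :: real assume r: "0 < r" "r \<le> 1/2"
    show "(\<integral>x. (if dist x y < r then ennreal (E x t1) else 0)) \<le> ennreal (R * r ^ (CARD('n) - 1))"
    proof (cases "r \<le> 1/8")
      case True
      then show ?thesis by (rule small_r[OF r(1)])
    next
      case False
      have "(\<integral>x. (if dist x y < r then ennreal (E x t1) else 0))
        \<le> (\<integral>x. (if x - y \<in> cball 0 (1/2) then ennreal (E x t1) else 0))"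
        using r by (intro nn_integral_mono) (auto simp: dist_norm norm_minus_commute)
      also have "\<dots> \<le> ennreal N * ennreal (4 * (1/8) ^ (CARD('n) - 1) * (Gc * M0 + M * err \<theta> (t1 - t0)))"
        unfolding Gc_def using eps M0 by (intro cov heat_ball_step[OF t(1-3) M d d0 _ \<theta>]) auto
      also have "\<dots> = ennreal (N * (4 * (1/8) ^ (CARD('n) - 1) * (Gc * M0 + M * err \<theta> (t1 - t0))))"
        using N by (intro ennreal_mult'[symmetric]) auto
      also have "\<dots> \<le> ennreal (R * r ^ (CARD('n) - 1))"
      proof (rule ennreal_leI)
        have "4 * N * (Gc * M0 + M * err \<theta> (t1 - t0)) * (1/8) ^ (CARD('n) - 1) \<le> R * (1/8) ^ (CARD('n) - 1)"
          by (intro mult_right_mono er) auto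
        also have "\<dots> \<le> R * r ^ (CARD('n) - 1)" using R1 False by (intro mult_left_mono power_mono) auto
        finally show "N * (4 * (1/8) ^ (CARD('n) - 1) * (Gc * M0 + M * err \<theta> (t1 - t0))) \<le> R * r ^ (CARD('n) - 1)"
          by (simp only: mult_ac)
      qed
      finally show ?thesis .
    qed
  next
    assume tor: "\<not> tor"
    have "(\<integral>x. ennreal (E x t1)) \<le> ennreal (M0 + M * (60 * (t1 - t0) + (1 + Ct) / 2 * (\<theta> * Bq + \<theta> powr (- 2 / (q - 2)) * (t1 - t0))))"
      by (rule mass_step[OF tor t(1-3) _ d d0 _ \<theta>]) (use M M0 in auto)
    also have "\<dots> \<le> ennreal R"
    proof (rule ennreal_leI)
      have "60 * (t1 - t0) + (1 + Ct) / 2 * (\<theta> * Bq + \<theta> powr (- 2 / (q - 2)) * (t1 - t0))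
        \<le> 60 * h + (1 + Ct) / 2 * (\<theta> * Bq + \<theta> powr (- 2 / (q - 2)) * h)"
        using t tr(2) by (intro add_mono mult_left_mono order_refl) auto
      then have "M * (60 * (t1 - t0) + (1 + Ct) / 2 * (\<theta> * Bq + \<theta> powr (- 2 / (q - 2)) * (t1 - t0))) \<le> M * (1/2)"
        using small(2) M by (intro mult_left_mono) auto
      moreover have "M0 \<le> 4 * N * Gc * M0"
      proof -
        have "M0 \<le> Gc * M0" using mult_right_mono[OF G1, of M0] M0 by simp
        then show ?thesis using prod1 by (simp add: mult.assoc)
      qed
      ultimately show "M0 + M * (60 * (t1 - t0) + (1 + Ct) / 2 * (\<theta> * Bq + \<theta> powr (- 2 / (q - 2)) * (t1 - t0))) \<le> R"
        unfolding R_def by linarith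
    qed
    finally show "(\<integral>x. ennreal (E x t1)) \<le> ennreal R" .
  qed
qed

lemma density_growth:
  fixes N Mx M0 \<theta> h :: real
  assumes N: "N \<ge> 1" and cov: "\<And>(f :: real^'n \<Rightarrow> ennreal) B y. f \<in> borel_measurable borel \<Longrightarrow>
       (\<And>z. (\<integral>x. (if dist x z < 1/8 then f x else 0)) \<le> B) \<Longrightarrow>
       (\<integral>x. (if x - y \<in> cball 0 (1/2) then f x else 0)) \<le> ennreal N * B"
    and h: "h > 0" and ap: "\<And>t. t \<in> {0..T} \<Longrightarrow> dens tor t Mx" "Mx \<ge> 0"
    and d0: "dens tor 0 M0" and M0: "M0 \<ge> 1" and \<theta>: "\<theta> > 0"
    and small: "4 * N * err \<theta> h \<le> 1/2" "60 * h + (1 + Ct) / 2 * (\<theta> * Bq + \<theta> powr (- 2 / (q - 2)) * h) \<le> 1/2"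
    and eps: "(rmin TYPE('n) CE) * \<epsilon> < 1/8"
    and t: "t \<in> {0..T}" "t \<le> real j * h"
  shows "dens tor t ((2 * (4 * N * gauss_const (CARD('n) - 1))) ^ j * M0)"
  using t
proof (induction j arbitrary: t)
  case 0
  then show ?case using d0 by simp
next
  case (Suc j)
  define C where "C = 4 * N * gauss_const (CARD('n) - 1)"
  have C: "C \<ge> 1"
  proof -
    have "1 * 1 \<le> N * gauss_const (CARD('n) - 1)" using N G_pos(1) by (intro mult_mono) auto
    then show ?thesis by (simp add: C_def)
  qed
  define A where "A = (2 * C) ^ j * M0"
  have A: "A \<ge> 1"
  proof -
    have "1 * 1 \<le> (2 * C) ^ j * M0" using C M0 by (intro mult_mono one_le_power) auto
    then show ?thesis by (simp add: A_def)
  qed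
  have AS: "(2 * C) ^ Suc j * M0 = 2 * C * A" by (simp add: A_def)
  have CA: "C * A \<ge> 1 * A" using C A by (intro mult_right_mono) auto
  show ?case
    unfolding C_def[symmetric] AS
  proof (cases "t \<le> real j * h")
    case True
    have "dens tor t A" using Suc.IH[OF Suc.prems(1) True] unfolding A_def C_def .
    then show "dens tor t (2 * C * A)" by (rule dens_mono) (use CA A in linarith)
  next
    case False
    define t0 where "t0 = real j * h"
    have t0: "0 \<le> t0" "t0 \<le> t" "t0 \<in> {0..T}" using False h Suc.prems by (auto simp: t0_def)
    have d0': "dens tor t0 A" using Suc.IH[OF t0(3)] unfolding A_def C_def t0_def by simp
    \<comment> \<open>The improvement of M to C A + M/2 is repeated on the same time interval,
      starting from the crude bound Mx. After k rounds the excess over the fixed point 2 C A is Mx /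
      2^k, so Mx disappears in the limit, however large it is.\<close>
    have all: "\<forall>s \<in> {t0..t}. dens tor s (2 * C * A + Mx / 2 ^ k)" for k
    proof (induction k)
      case 0
      show ?case
      proof
        fix s assume "s \<in> {t0..t}"
        then have "s \<in> {0..T}" using t0 Suc.prems by auto
        from ap(1)[OF this] show "dens tor s (2 * C * A + Mx / 2 ^ 0)" by (rule dens_mono) (use CA A in simp)
      qed
    next
      case (Suc k)
      show ?case
      proof
        fix s assume s: "s \<in> {t0..t}"
        have "dens tor s (4 * N * gauss_const (CARD('n) - 1) * A + (2 * C * A + Mx / 2 ^ k) / 2)"
        proof (rule density_step[OF N cov t0(1) _ _ _ _ _ d0' A \<theta> small eps])
          show "t0 \<le> s" "s \<le> T" "s - t0 \<le> h" using s \<open>t \<in> {0..T}\<close> \<open>t \<le> real (Suc j) * h\<close> by (auto simp: t0_def algebra_simps)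
          have "Mx / 2 ^ k \<ge> 0" using ap(2) by simp
          then show "1 \<le> 2 * C * A + Mx / 2 ^ k" using CA A by linarith
          show "dens tor s' (2 * C * A + Mx / 2 ^ k)" if "s' \<in> {t0..s}" for s'
            using Suc that s by auto
        qed
        moreover have "4 * N * gauss_const (CARD('n) - 1) * A + (2 * C * A + Mx / 2 ^ k) / 2 = 2 * C * A + Mx / 2 ^ Suc k"
          unfolding C_def[symmetric] by simp
        ultimately show "dens tor s (2 * C * A + Mx / 2 ^ Suc k)" by simp
      qed
    qed
    show "dens tor t (2 * C * A)"
    proof (rule dens_limit)
      show "dens tor t (2 * C * A + Mx / 2 ^ k)" for k using bspec[OF all, of t k] t0(2) by simp
    qed
  qed
qed

text \<open>This bound degenerates as \<epsilon> tends to 0; the iteration asks for its finiteness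
  only.\<close>

lemma apriori_density:
  assumes mass: "\<And>t. \<not> tor \<Longrightarrow> t \<in> {0..T} \<Longrightarrow> (\<integral>x. ennreal (E x t)) \<le> ennreal A"
  shows "\<exists>M\<ge>0. \<forall>t\<in>{0..T}. dens tor t M"
proof -
  define M where "M = max A (CE / \<epsilon> * unit_ball_vol (real CARD('n)))"
  have "0 \<le> CE / \<epsilon> * unit_ball_vol (real CARD('n))" using cst eps_pos by simp
  then have M0: "M \<ge> 0" by (simp add: M_def le_max_iff_disj)
  have "dens tor t M" if t: "t \<in> {0..T}" for t
    unfolding dens_def
  proof (intro conjI allI impI)
    fix y :: "real^'n" and r :: real assume r: "0 < r" "r \<le> 1/2"
    have "(\<integral>x. (if dist x y < r then ennreal (E x t) else 0)) \<le> (\<integral>x. ennreal (CE / \<epsilon>) * indicator (ball y r) x)"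
      using E_le[OF t] by (intro nn_integral_mono) (auto simp: indicator_def dist_commute intro!: ennreal_leI)
    also have "\<dots> = ennreal (CE / \<epsilon>) * ennreal (unit_ball_vol (real CARD('n)) * r ^ CARD('n))"
      using r by (simp add: nn_integral_cmult_indicator emeasure_ball)
    also have "\<dots> = ennreal (CE / \<epsilon> * (unit_ball_vol (real CARD('n)) * r ^ CARD('n)))"
      using r by (subst ennreal_mult''[symmetric]) auto
    also have "\<dots> \<le> ennreal (M * r ^ (CARD('n) - 1))"
    proof (rule ennreal_leI)
      have "r ^ CARD('n) \<le> r ^ (CARD('n) - 1)" using r by (intro power_decreasing) auto
      then have "CE / \<epsilon> * unit_ball_vol (real CARD('n)) * r ^ CARD('n) \<le> CE / \<epsilon> * unit_ball_vol (real CARD('n)) * r ^ (CARD('n) - 1)"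
        using cst eps_pos by (intro mult_left_mono) auto
      also have "\<dots> \<le> M * r ^ (CARD('n) - 1)" using r by (intro mult_right_mono) (auto simp: M_def)
      finally show "CE / \<epsilon> * (unit_ball_vol (real CARD('n)) * r ^ CARD('n)) \<le> M * r ^ (CARD('n) - 1)" by (simp add: mult.assoc)
    qed
    finally show "(\<integral>x. (if dist x y < r then ennreal (E x t) else 0)) \<le> ennreal (M * r ^ (CARD('n) - 1))" .
  next
    assume "\<not> tor"
    from mass[OF this t] show "(\<integral>x. ennreal (E x t)) \<le> ennreal M"
      by (rule order_trans) (auto intro!: ennreal_leI simp: M_def)
  qed
  then show ?thesis using M0 by blast
qed

end

section \<open>Translating the hypotheses\<close>

lemma Ck_Suc_deriv:
  fixes f :: "real \<Rightarrow> real"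
  assumes "Ck (Suc k) UNIV f"
  shows "(f has_real_derivative deriv f x) (at x)" "Ck k UNIV (deriv f)"
proof -
  obtain G where G: "\<And>x. (f has_derivative (\<lambda>h. \<Sum>b\<in>Basis. (h \<bullet> b) *\<^sub>R G b x)) (at x)" "\<And>b. b \<in> Basis \<Longrightarrow> Ck k UNIV (G b)"
    using assms by auto
  have D: "(f has_real_derivative G 1 x) (at x)" for x
  proof -
    have "(*) (G 1 x) = (\<lambda>h. \<Sum>b\<in>Basis. (h \<bullet> b) *\<^sub>R G b x)" by (auto simp: mult.commute)
    then show ?thesis unfolding has_field_derivative_def using G(1)[of x] by simp
  qed
  have e: "deriv f = G 1" using D by (auto intro!: ext DERIV_imp_deriv)
  show "(f has_real_derivative deriv f x) (at x)" using D e by simp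
  show "Ck k UNIV (deriv f)" unfolding e by (rule G(2)) simp
qed

text \<open>The joint derivative in (x,t) provided by \<open>Ck\<close>, restricted to a time slice,
  must be \<open>Du\<close>. This transfers its joint continuity to \<open>Du\<close>, which was
  specified slice by slice.\<close>

lemma spatial_jacobian_continuous:
  fixes u :: "real^'n \<Rightarrow> real \<Rightarrow> real^'m"
  assumes C: "Ck (Suc 0) (UNIV \<times> {0..T}) (\<lambda>(x,t). u x t)"
    and D: "\<And>x t. t \<in> {0..T} \<Longrightarrow> ((\<lambda>y. u y t) has_derivative (\<lambda>h. Du x t *v h)) (at x)"
  shows "continuous_on (UNIV \<times> {0..T}) (\<lambda>(x,t). Du x t)"
proof -
  obtain G where G: "\<And>z. z \<in> UNIV \<times> {0..T} \<Longrightarrow> ((\<lambda>(x,t). u x t) has_derivative (\<lambda>h. \<Sum>b\<in>Basis. (h \<bullet> b) *\<^sub>R G b z)) (at z within UNIV \<times> {0..T})"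
    "\<And>b. b \<in> Basis \<Longrightarrow> continuous_on (UNIV \<times> {0..T}) (G b)"
    using C by auto
  have eq: "Du x t *v h = (\<Sum>b\<in>Basis. ((h, 0) \<bullet> b) *\<^sub>R G b (x, t))" if t: "t \<in> {0..T}" for x t h
  proof -
    have 1: "((\<lambda>y. (y, t)) has_derivative (\<lambda>h. (h, 0))) (at x within UNIV)" by (auto intro!: derivative_eq_intros)
    have "((\<lambda>(x,t). u x t) has_derivative (\<lambda>h. \<Sum>b\<in>Basis. (h \<bullet> b) *\<^sub>R G b (x, t))) (at (x, t) within (\<lambda>y. (y, t)) ` UNIV)"
      using G(1)[of "(x, t)"] t by (rule_tac has_derivative_subset) auto
    from diff_chain_within[OF 1 this]
    have "((\<lambda>y. u y t) has_derivative (\<lambda>h. \<Sum>b\<in>Basis. ((h, 0) \<bullet> b) *\<^sub>R G b (x, t))) (at x)" by (simp add: o_def)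
    from has_derivative_unique[OF D[OF t] this] show ?thesis by meson
  qed
  have "Du x t = (\<chi> i j. (\<Sum>b\<in>Basis. ((axis j 1, 0) \<bullet> b) *\<^sub>R G b (x, t)) $ i)" if t: "t \<in> {0..T}" for x t
    unfolding eq[OF t, symmetric] by (simp add: vec_eq_iff matrix_vector_mult_basis column_def)
  then have "continuous_on (UNIV \<times> {0..T}) (\<lambda>(x,t). Du x t)
     = continuous_on (UNIV \<times> {0..T}) (\<lambda>z. \<chi> i j. (\<Sum>b\<in>Basis. ((axis j 1, 0) \<bullet> b) *\<^sub>R G b z) $ i)"
    by (intro continuous_on_cong) auto
  then show ?thesis using G(2) by (auto intro!: continuous_intros)
qed

text \<open>\<open>Lp_norm\<close> rests on the Bochner integral, which returns 0 for a
  non-integrable function; integrability of each slice must be proved before a bound on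
  \<open>Lp_norm\<close> says anything. The cell, or the compact support, reduces everything to one
  box, where continuity in time is a parameter integral.\<close>

lemma Lp_norm_slices:
  fixes v :: "real^'n \<Rightarrow> real \<Rightarrow> 'b::real_normed_vector"
  assumes v: "continuous_on (UNIV \<times> {0..T}) (\<lambda>(x,t). v x t)" and p: "p > 0"
    and supp: "\<not> tor \<Longrightarrow> \<exists>R. \<forall>x. \<forall>t\<in>{0..T}. norm x \<ge> R \<longrightarrow> v x t = 0"
  shows "t \<in> {0..T} \<Longrightarrow> (\<integral>x. ennreal (norm (v x t) powr p) * indicator (Omega tor) x) = ennreal (Lp_norm tor p (\<lambda>x. v x t) powr p)"
    and "continuous_on {0..T} (\<lambda>t. Lp_norm tor p (\<lambda>x. v x t))"
proof -
  define f where "f x t = norm (v x t) powr p" for x t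
  have fc: "continuous_on S (\<lambda>x. f x t)" if "t \<in> {0..T}" for S t
    unfolding f_def using continuous_on_slice[OF v that] p by (intro continuous_on_powr' continuous_intros) (auto intro: continuous_on_subset)
  have "\<exists>l r. \<forall>t\<in>{0..T}. integrable lborel (\<lambda>x. indicator (Omega tor) x *\<^sub>R f x t) \<and> (LINT x:Omega tor|lborel. f x t) = integral (cbox l r) (\<lambda>x. f x t)"
  proof (cases tor)
    case True
    have sub: "Omega tor \<subseteq> cbox 0 (\<chi> i. (1 :: real))" 
    proof
      fix x assume "x \<in> Omega tor"
      then have "\<forall>i. 0 \<le> x $ i \<and> x $ i < 1" using True by (simp add: Omega_def)
      then show "x \<in> cbox 0 (\<chi> i. 1)" by (simp add: mem_box_cart less_imp_le)
    qed
    have "integrable lborel (\<lambda>x. indicator (Omega tor) x *\<^sub>R f x t) \<and> (LINT x:Omega tor|lborel. f x t) = integral (cbox 0 (\<chi> i. 1)) (\<lambda>x. f x t)"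
      if t: "t \<in> {0..T}" for t
    proof
      have fm: "(\<lambda>x. f x t) \<in> borel_measurable borel" by (rule borel_measurable_continuous_onI[OF fc[OF t]])
      show i: "integrable lborel (\<lambda>x. indicator (Omega tor) x *\<^sub>R f x t)"
      proof (rule Bochner_Integration.integrable_bound[OF borel_integrable_compact[OF compact_cbox fc[OF t]]])
        show "(\<lambda>x. indicator (Omega tor) x *\<^sub>R f x t) \<in> borel_measurable lborel" using fm unit_cell_measurable by measurable
        show "AE x in lborel. norm (indicator (Omega tor) x *\<^sub>R f x t) \<le> norm (indicator (cbox 0 (\<chi> i. 1)) x *\<^sub>R f x t)"
          using sub by (auto simp: indicator_def)
      qed
      have "(LINT x:Omega tor|lborel. f x t) = integral (Omega tor) (\<lambda>x. f x t)"
        using i by (intro set_borel_integral_eq_integral) (simp add: set_integrable_def)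
      also have "\<dots> = integral (cbox 0 (\<chi> i. 1)) (\<lambda>x. f x t)"
      proof (rule integral_spike_set)
        have "{x \<in> Omega tor - cbox 0 (\<chi> i. 1). f x t \<noteq> 0} = {}" using sub by blast
        then show "negligible {x \<in> Omega tor - cbox 0 (\<chi> i. 1). f x t \<noteq> 0}" by (simp only: negligible_empty)
        have "negligible (\<Union>i. {x :: real^'n. x $ i = 1})" 
        proof (intro negligible_Union)
          have "negligible {x :: real^'n. x $ i = 1}" for i
            using negligible_standard_hyperplane[of "axis i 1 :: real^'n" 1] by (simp add: inner_axis axis_in_Basis_iff)
          then show "negligible t" if "t \<in> range (\<lambda>i. {x :: real^'n. x $ i = 1})" for t using that by auto
        qed simp
        then show "negligible {x \<in> cbox 0 (\<chi> i. 1) - Omega tor. f x t \<noteq> 0}"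
        proof (rule negligible_subset)
          show "{x \<in> cbox 0 (\<chi> i. 1) - Omega tor. f x t \<noteq> 0} \<subseteq> (\<Union>i. {x. x $ i = 1})"
            using True by (auto simp: Omega_def mem_box_cart) (metis order_antisym linorder_not_le)
        qed
      qed
      finally show "(LINT x:Omega tor|lborel. f x t) = integral (cbox 0 (\<chi> i. 1)) (\<lambda>x. f x t)" .
    qed
    then show ?thesis by blast
  next
    case False
    obtain R where R: "\<And>x t. t \<in> {0..T} \<Longrightarrow> norm x \<ge> R \<Longrightarrow> v x t = 0" using supp[OF False] by blast
    obtain a where a: "ball (0::real^'n) R \<subseteq> cbox (- a) a" using bounded_subset_cbox_symmetric[OF bounded_ball] by blast
    have out: "f x t = 0" if "x \<notin> cbox (- a) a" "t \<in> {0..T}" for x t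
    proof -
      have "norm x \<ge> R" using that a by (meson in_mono linorder_not_le mem_ball_0)
      then show ?thesis using R that by (simp add: f_def)
    qed
    have Om: "Omega tor = (UNIV :: (real^'n) set)" using False by (simp add: Omega_def)
    have "integrable lborel (\<lambda>x. indicator (Omega tor) x *\<^sub>R f x t) \<and> (LINT x:Omega tor|lborel. f x t) = integral (cbox (- a) a) (\<lambda>x. f x t)"
      if t: "t \<in> {0..T}" for t
    proof
      have "(\<lambda>x. indicator (Omega tor) x *\<^sub>R f x t) = (\<lambda>x. indicator (cbox (- a) a) x *\<^sub>R f x t)"
        by (rule ext) (use out[OF _ t] in \<open>auto simp: Om indicator_def\<close>)
      then show i: "integrable lborel (\<lambda>x. indicator (Omega tor) x *\<^sub>R f x t)"
        using borel_integrable_compact[OF compact_cbox fc[OF t]] by simp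
      have "(LINT x:Omega tor|lborel. f x t) = integral (Omega tor) (\<lambda>x. f x t)"
        using i by (intro set_borel_integral_eq_integral) (simp add: set_integrable_def)
      also have "\<dots> = integral (cbox (- a) a) (\<lambda>x. f x t)"
      proof (rule integral_spike_set)
        have "{x \<in> Omega tor - cbox (- a) a. f x t \<noteq> 0} = {}" using out[OF _ t] by auto
        then show "negligible {x \<in> Omega tor - cbox (- a) a. f x t \<noteq> 0}" by (simp only: negligible_empty)
      qed (simp add: Om)
      finally show "(LINT x:Omega tor|lborel. f x t) = integral (cbox (- a) a) (\<lambda>x. f x t)" .
    qed
    then show ?thesis by blast
  qed
  then obtain l r where lr: "\<And>t. t \<in> {0..T} \<Longrightarrow> integrable lborel (\<lambda>x. indicator (Omega tor) x *\<^sub>R f x t)"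
    "\<And>t. t \<in> {0..T} \<Longrightarrow> (LINT x:Omega tor|lborel. f x t) = integral (cbox l r) (\<lambda>x. f x t)" by blast
  have nonneg: "(LINT x:Omega tor|lborel. f x t) \<ge> 0" for t
    unfolding set_lebesgue_integral_def by (intro Bochner_Integration.integral_nonneg) (auto simp: f_def)
  show "(\<integral>x. ennreal (norm (v x t) powr p) * indicator (Omega tor) x) = ennreal (Lp_norm tor p (\<lambda>x. v x t) powr p)" if t: "t \<in> {0..T}"
  proof -
    have "(\<integral>x. ennreal (f x t) * indicator (Omega tor) x) = (\<integral>x. ennreal (indicator (Omega tor) x *\<^sub>R f x t))"
      by (intro nn_integral_cong) (auto simp: indicator_def)
    also have "\<dots> = ennreal (LINT x:Omega tor|lborel. f x t)"
      unfolding set_lebesgue_integral_def by (rule nn_integral_eq_integral[OF lr(1)[OF t]]) (auto simp: f_def)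
    also have "(LINT x:Omega tor|lborel. f x t) = Lp_norm tor p (\<lambda>x. v x t) powr p"
      using nonneg[of t] p by (simp add: Lp_norm_def f_def[symmetric] powr_powr)
    finally show ?thesis by (simp add: f_def)
  qed
  have swap: "continuous_on ({0..T} \<times> cbox l r) (\<lambda>z. (snd z, fst z))" by (intro continuous_intros)
  have "continuous_on ({0..T} \<times> cbox l r) (\<lambda>z. v (snd z) (fst z))"
  proof -
    have "(\<lambda>z. (snd z, fst z)) ` ({0..T} \<times> cbox l r) \<subseteq> UNIV \<times> {0..T}" by auto
    from continuous_on_compose2[OF v swap this] show ?thesis by simp
  qed
  then have "continuous_on ({0..T} \<times> cbox l r) (\<lambda>(t, x). f x t)"
    unfolding f_def case_prod_beta using p by (intro continuous_on_powr' continuous_intros) auto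
  then have "continuous_on {0..T} (\<lambda>t. integral (cbox l r) (\<lambda>x. f x t))"
    by (rule integral_continuous_on_param)
  then have "continuous_on {0..T} (\<lambda>t. (integral (cbox l r) (\<lambda>x. f x t)) powr (1 / p))"
  proof (intro continuous_on_powr' continuous_on_const ballI conjI impI)
    show "integral (cbox l r) (\<lambda>x. f x t) \<ge> 0" if "t \<in> {0..T}" for t using nonneg[of t] lr(2)[OF that] by simp
  qed (use p in auto)
  moreover have "(integral (cbox l r) (\<lambda>x. f x t)) powr (1 / p) = Lp_norm tor p (\<lambda>x. v x t)" if "t \<in> {0..T}" for t
    using lr(2)[OF that] by (simp add: Lp_norm_def f_def[symmetric])
  ultimately show "continuous_on {0..T} (\<lambda>t. Lp_norm tor p (\<lambda>x. v x t))"
    by (rule continuous_on_eq)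
qed

lemma ennreal_le_mult_of_divide_le:
  assumes c: "c > 0" and le: "m / ennreal c \<le> ennreal d"
  shows "m \<le> ennreal (d * c)"
proof -
  have "m = m * (ennreal c / ennreal c)" using c divide_ennreal[of c c] by simp
  also have "\<dots> = m / ennreal c * ennreal c" by (rule ennreal_divide_times[symmetric])
  also have "\<dots> \<le> ennreal d * ennreal c" using le by (rule mult_right_mono) simp
  also have "\<dots> = ennreal (d * c)" using c by (intro ennreal_mult''[symmetric]) simp
  finally show ?thesis .
qed

lemma add_powr_le:
  fixes a b p :: real
  assumes "a \<ge> 0" "b \<ge> 0" "p > 0"
  shows "(a + b) powr p \<le> 2 powr p * (a powr p + b powr p)"
proof -
  have "(a + b) powr p \<le> (2 * max a b) powr p" using assms by (intro powr_mono2) auto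
  also have "\<dots> = 2 powr p * max a b powr p" using assms by (simp add: powr_mult)
  also have "\<dots> \<le> 2 powr p * (a powr p + b powr p)" by (intro mult_left_mono) (auto simp: max_def)
  finally show ?thesis .
qed

text \<open>The summand 1 in NN keeps it at least 1, so that its powers may be split by
  \<open>Young_split\<close>; the factors 2 come from \<open>add_powr_le\<close>. On the torus a
  ball of radius 1/2 embeds, so the norm over the cell controls every local one.\<close>

lemma velocity_control:
  fixes u :: "real^'n \<Rightarrow> real \<Rightarrow> real^'n" and Du :: "real^'n \<Rightarrow> real \<Rightarrow> real^'n^'n"
  assumes u: "continuous_on (UNIV \<times> {0..T}) (\<lambda>(x,t). u x t)" and Du: "continuous_on (UNIV \<times> {0..T}) (\<lambda>(x,t). Du x t)"
    and p: "p > 1" and q: "q > 2" and T: "T > 0" and c1: "c1 > 0"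
    and peru: "\<And>x t k. tor \<Longrightarrow> t \<in> {0..T} \<Longrightarrow> lattice_vec k \<Longrightarrow> u (x + k) t = u x t"
    and perD: "\<And>x t k. tor \<Longrightarrow> t \<in> {0..T} \<Longrightarrow> lattice_vec k \<Longrightarrow> Du (x + k) t = Du x t"
    and suppu: "\<not> tor \<Longrightarrow> \<exists>R. \<forall>x. \<forall>t\<in>{0..T}. norm x \<ge> R \<longrightarrow> u x t = 0"
    and suppD: "\<not> tor \<Longrightarrow> \<exists>R. \<forall>x. \<forall>t\<in>{0..T}. norm x \<ge> R \<longrightarrow> Du x t = 0"
    and int: "(LINT t : {0..T} | lborel. (Lp_norm tor p (\<lambda>x. u x t) + Lp_norm tor p (\<lambda>x. Du x t)) powr q) powr (1 / q) \<le> c1"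
  defines "NN \<equiv> \<lambda>t. 2 * (2 * (Lp_norm tor p (\<lambda>x. u x t) + Lp_norm tor p (\<lambda>x. Du x t) + 1)) powr p"
  shows "NN t \<ge> 1"
    and "t \<in> {0..T} \<Longrightarrow> (\<integral>x. ennreal ((norm (u x t) + norm (Du x t)) powr p) * indicator (ball y (1/2)) x) \<le> ennreal (NN t)"
    and "\<not> tor \<Longrightarrow> t \<in> {0..T} \<Longrightarrow> (\<integral>x. ennreal ((norm (u x t) + norm (Du x t)) powr p) * indicator UNIV x) \<le> ennreal (NN t)"
    and "0 \<le> t0 \<Longrightarrow> t0 \<le> t1 \<Longrightarrow> t1 \<le> T \<Longrightarrow> (\<lambda>t. NN t powr (q / p)) integrable_on {t0..t1}"
    and "0 \<le> t0 \<Longrightarrow> t0 \<le> t1 \<Longrightarrow> t1 \<le> T \<Longrightarrow> integral {t0..t1} (\<lambda>t. NN t powr (q / p)) \<le> 2 powr (q / p) * 4 powr q * (c1 powr q + T)"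
proof -
  define A where "A t = Lp_norm tor p (\<lambda>x. u x t)" for t
  define B where "B t = Lp_norm tor p (\<lambda>x. Du x t)" for t
  have AB0: "A t \<ge> 0" "B t \<ge> 0" for t by (auto simp: A_def B_def Lp_norm_def)
  have NN: "NN t = 2 * (2 * (A t + B t + 1)) powr p" for t by (simp add: NN_def A_def B_def)
  have p0: "p > 0" using p by simp
  show "NN t \<ge> 1" for t
  proof -
    have "1 \<le> (2 * (A t + B t + 1)) powr p" using AB0[of t] p by (intro ge_one_powr_ge_zero) auto
    then show ?thesis unfolding NN by simp
  qed
  have om: "(\<integral>x. ennreal ((norm (u x t) + norm (Du x t)) powr p) * indicator (Omega tor) x) \<le> ennreal (NN t)" if t: "t \<in> {0..T}" for t
  proof -
    have [measurable]: "(\<lambda>x. u x t) \<in> borel_measurable borel" "(\<lambda>x. Du x t) \<in> borel_measurable borel"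
      using continuous_on_slice[OF u t] continuous_on_slice[OF Du t] by (auto intro: borel_measurable_continuous_onI)
    have "(\<integral>x. ennreal ((norm (u x t) + norm (Du x t)) powr p) * indicator (Omega tor) x)
      \<le> (\<integral>x. ennreal (2 powr p) * (ennreal (norm (u x t) powr p) * indicator (Omega tor) x + ennreal (norm (Du x t) powr p) * indicator (Omega tor) x))"
    proof (rule nn_integral_mono)
      fix x
      have "ennreal ((norm (u x t) + norm (Du x t)) powr p) \<le> ennreal (2 powr p * (norm (u x t) powr p + norm (Du x t) powr p))"
        using p0 by (intro ennreal_leI add_powr_le) auto
      also have "\<dots> = ennreal (2 powr p) * (ennreal (norm (u x t) powr p) + ennreal (norm (Du x t) powr p))"
        by (simp add: ennreal_mult)
      finally show "ennreal ((norm (u x t) + norm (Du x t)) powr p) * indicator (Omega tor) x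
        \<le> ennreal (2 powr p) * (ennreal (norm (u x t) powr p) * indicator (Omega tor) x + ennreal (norm (Du x t) powr p) * indicator (Omega tor) x)"
        by (auto simp: indicator_def)
    qed
    also have "\<dots> = ennreal (2 powr p) * ((\<integral>x. ennreal (norm (u x t) powr p) * indicator (Omega tor) x) + (\<integral>x. ennreal (norm (Du x t) powr p) * indicator (Omega tor) x))"
      by (simp add: nn_integral_cmult nn_integral_add)
    also have "\<dots> = ennreal (2 powr p) * (ennreal (A t powr p) + ennreal (B t powr p))"
      using Lp_norm_slices(1)[OF u p0 suppu t] Lp_norm_slices(1)[OF Du p0 suppD t] by (simp add: A_def B_def)
    also have "\<dots> = ennreal (2 powr p * (A t powr p + B t powr p))" by (simp add: ennreal_mult)
    also have "\<dots> \<le> ennreal (NN t)"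
    proof (rule ennreal_leI)
      have "A t powr p \<le> (A t + B t + 1) powr p" "B t powr p \<le> (A t + B t + 1) powr p"
        using AB0[of t] p0 by (auto intro!: powr_mono2)
      then have "2 powr p * (A t powr p + B t powr p) \<le> 2 powr p * (2 * (A t + B t + 1) powr p)" by (intro mult_left_mono) auto
      also have "\<dots> = NN t" unfolding NN using AB0[of t] by (subst powr_mult) auto
      finally show "2 powr p * (A t powr p + B t powr p) \<le> NN t" .
    qed
    finally show ?thesis .
  qed
  show "(\<integral>x. ennreal ((norm (u x t) + norm (Du x t)) powr p) * indicator UNIV x) \<le> ennreal (NN t)" if "\<not> tor" "t \<in> {0..T}" for t
    using om[OF that(2)] that(1) by (simp add: Omega_def)
  show "(\<integral>x. ennreal ((norm (u x t) + norm (Du x t)) powr p) * indicator (ball y (1/2)) x) \<le> ennreal (NN t)" if t: "t \<in> {0..T}" for t y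
  proof -
    let ?h = "\<lambda>x. ennreal ((norm (u x t) + norm (Du x t)) powr p)"
    have [measurable]: "(\<lambda>x. u x t) \<in> borel_measurable borel" "(\<lambda>x. Du x t) \<in> borel_measurable borel"
      using continuous_on_slice[OF u t] continuous_on_slice[OF Du t] by (auto intro: borel_measurable_continuous_onI)
    have "(\<integral>x. ?h x * indicator (ball y (1/2)) x) = (\<integral>x. (if dist x y < 1/2 then ?h x else 0))"
      by (intro nn_integral_cong) (auto simp: indicator_def dist_commute)
    also have "\<dots> \<le> (\<integral>x. ?h x * indicator (Oball tor y (1/2) \<inter> Omega tor) x)"
    proof (rule ball_integral_le_Oball)
      show "?h (x + k) = ?h x" if "tor" "lattice_vec k" for x k using peru[OF that(1) t that(2)] perD[OF that(1) t that(2)] by simp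
    qed auto
    also have "\<dots> \<le> (\<integral>x. ?h x * indicator (Omega tor) x)"
      by (intro nn_integral_mono) (auto simp: indicator_def)
    also have "\<dots> \<le> ennreal (NN t)" by (rule om[OF t])
    finally show ?thesis .
  qed
  have cA: "continuous_on {0..T} A" and cB: "continuous_on {0..T} B"
    unfolding A_def B_def using Lp_norm_slices(2)[OF u p0 suppu] Lp_norm_slices(2)[OF Du p0 suppD] by auto
  have NNq: "NN t powr (q / p) = 2 powr (q / p) * (2 * (A t + B t + 1)) powr q" for t
    unfolding NN using AB0[of t] p0 by (simp add: powr_mult powr_powr)
  have cN: "continuous_on {0..T} (\<lambda>t. NN t powr (q / p))"
    unfolding NNq using cA cB AB0 q
    by (intro continuous_intros continuous_on_powr') (auto simp: add_nonneg_nonneg add_nonneg_eq_0_iff)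
  show "(\<lambda>t. NN t powr (q / p)) integrable_on {t0..t1}" if "0 \<le> t0" "t0 \<le> t1" "t1 \<le> T" for t0 t1
    using that by (intro integrable_continuous_interval continuous_on_subset[OF cN]) auto
  show "integral {t0..t1} (\<lambda>t. NN t powr (q / p)) \<le> 2 powr (q / p) * 4 powr q * (c1 powr q + T)" if "0 \<le> t0" "t0 \<le> t1" "t1 \<le> T" for t0 t1
  proof -
    have cq: "continuous_on {0..T} (\<lambda>t. (A t + B t) powr q)"
      using cA cB AB0 q by (intro continuous_intros continuous_on_powr') auto
    have iq: "(\<lambda>t. (A t + B t) powr q) integrable_on {0..T}" by (rule integrable_continuous_interval[OF cq])
    \<comment> \<open>Continuity makes the time integrand integrable, so the bound
      \<open>int\<close> concerns a genuine integral and not the default value 0.\<close>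
    have "set_integrable lborel {0..T} (\<lambda>t. (A t + B t) powr q)" by (rule borel_integrable_atLeastAtMost') (rule cq)
    then have L: "(LINT t:{0..T}|lborel. (A t + B t) powr q) = integral {0..T} (\<lambda>t. (A t + B t) powr q)"
      by (rule set_borel_integral_eq_integral)
    have I0: "integral {0..T} (\<lambda>t. (A t + B t) powr q) \<ge> 0" by (rule integral_nonneg[OF iq]) simp
    have "(integral {0..T} (\<lambda>t. (A t + B t) powr q)) powr (1 / q) \<le> c1" using int L by (simp add: A_def B_def)
    then have "((integral {0..T} (\<lambda>t. (A t + B t) powr q)) powr (1 / q)) powr q \<le> c1 powr q" using q by (intro powr_mono2) auto
    then have Iq: "integral {0..T} (\<lambda>t. (A t + B t) powr q) \<le> c1 powr q" using I0 q by (simp add: powr_powr)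
    have "integral {t0..t1} (\<lambda>t. NN t powr (q / p)) \<le> integral {0..T} (\<lambda>t. NN t powr (q / p))"
      using that by (intro integral_subset_le integrable_continuous_interval continuous_on_subset[OF cN]) auto
    also have "\<dots> \<le> integral {0..T} (\<lambda>t. 2 powr (q / p) * 4 powr q * ((A t + B t) powr q + 1))"
    proof (rule integral_le)
      show "(\<lambda>t. NN t powr (q / p)) integrable_on {0..T}" by (rule integrable_continuous_interval[OF cN])
      show "(\<lambda>t. 2 powr (q / p) * 4 powr q * ((A t + B t) powr q + 1)) integrable_on {0..T}"
        by (intro integrable_continuous_interval continuous_intros cq)
      fix t
      have "(2 * (A t + B t + 1)) powr q = 2 powr q * ((A t + B t) + 1) powr q" using AB0[of t] by (subst powr_mult) auto
      also have "\<dots> \<le> 2 powr q * (2 powr q * ((A t + B t) powr q + 1 powr q))"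
        using AB0[of t] q by (intro mult_left_mono add_powr_le) auto
      also have "\<dots> = 4 powr q * ((A t + B t) powr q + 1)" using powr_mult[of 2 2 q] by simp
      finally show "NN t powr (q / p) \<le> 2 powr (q / p) * 4 powr q * ((A t + B t) powr q + 1)"
        unfolding NNq by (simp add: mult.assoc)
    qed
    also have "\<dots> = 2 powr (q / p) * 4 powr q * (integral {0..T} (\<lambda>t. (A t + B t) powr q) + T)"
    proof -
      have "integral {0..T} (\<lambda>t. (A t + B t) powr q + 1) = integral {0..T} (\<lambda>t. (A t + B t) powr q) + integral {0..T} (\<lambda>t. 1)"
        by (rule integral_add[OF iq integrable_const_ivl])
      then show ?thesis using T by simp
    qed
    also have "\<dots> \<le> 2 powr (q / p) * 4 powr q * (c1 powr q + T)" using Iq by (intro mult_left_mono) auto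
    finally show ?thesis .
  qed
qed

text \<open>Compared with a sum over integer radii: volumes of order m^n against m^(-n-2) leave a
  convergent series of inverse squares.\<close>

lemma nn_integral_inverse_power_finite:
  "\<exists>A. (\<integral>x. (if norm (x::real^'n) \<ge> 1 then ennreal (1 / norm x ^ (CARD('n) + 2)) else 0)) \<le> ennreal A"
proof -
  let ?n = "CARD('n)"
  let ?c = "\<lambda>m::nat. ennreal (1 / real (Suc m) ^ (?n + 2))"
  have "(\<integral>x. (if norm (x::real^'n) \<ge> 1 then ennreal (1 / norm x ^ (?n + 2)) else 0))
    \<le> (\<integral>x. (\<Sum>m. ?c m * indicator (ball (0::real^'n) (real (m + 2))) x))"
  proof (rule nn_integral_mono)
    fix x :: "real^'n"
    show "(if norm x \<ge> 1 then ennreal (1 / norm x ^ (?n + 2)) else 0) \<le> (\<Sum>m. ?c m * indicator (ball 0 (real (m + 2))) x)"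
    proof (cases "norm x \<ge> 1")
      case True
      define m where "m = nat \<lfloor>norm x\<rfloor> - 1"
      have "nat \<lfloor>norm x\<rfloor> \<ge> 1" using True by (simp add: le_nat_floor)
      then have m: "real (Suc m) \<le> norm x" "norm x < real (m + 2)" using True unfolding m_def by linarith+
      have "1 / norm x ^ (?n + 2) \<le> 1 / real (Suc m) ^ (?n + 2)"
        using m by (intro divide_left_mono power_mono mult_pos_pos zero_less_power) auto
      then have "ennreal (1 / norm x ^ (?n + 2)) \<le> ?c m * indicator (ball 0 (real (m + 2))) x"
        using m by (auto simp: indicator_def intro!: ennreal_leI)
      also have "\<dots> \<le> (\<Sum>m. ?c m * indicator (ball 0 (real (m + 2))) x)"
      proof -
        have single: "f m \<le> suminf f" for f :: "nat \<Rightarrow> ennreal" using sum_le_suminf[OF summableI, of "{m}" f] by simp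
        show ?thesis by (rule single)
      qed
      finally show ?thesis using True by simp
    qed simp
  qed
  also have "\<dots> = (\<Sum>m. ?c m * emeasure lborel (ball (0::real^'n) (real (m + 2))))"
  proof -
    have "(\<integral>x. (\<Sum>m. ?c m * indicator (ball (0::real^'n) (real (m + 2))) x)) = (\<Sum>m. \<integral>\<^sup>+x. ?c m * indicator (ball (0::real^'n) (real (m + 2))) x \<partial>lborel)"
      by (intro nn_integral_suminf borel_measurable_times_ennreal borel_measurable_const borel_measurable_indicator) auto
    also have "\<dots> = (\<Sum>m. ?c m * emeasure lborel (ball (0::real^'n) (real (m + 2))))"
      by (intro suminf_cong nn_integral_cmult_indicator) simp
    finally show ?thesis .
  qed
  also have "\<dots> \<le> (\<Sum>m. ennreal (unit_ball_vol (real ?n) * 2 ^ ?n * (1 / real (Suc m) ^ 2)))"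
  proof (rule suminf_le)
    fix m
    have "?c m * emeasure lborel (ball (0::real^'n) (real (m + 2))) = ennreal (1 / real (Suc m) ^ (?n + 2) * (unit_ball_vol (real ?n) * real (m + 2) ^ ?n))"
      by (subst ennreal_mult) (auto simp: emeasure_ball)
    also have "\<dots> \<le> ennreal (unit_ball_vol (real ?n) * 2 ^ ?n * (1 / real (Suc m) ^ 2))"
    proof (rule ennreal_leI)
      have "real (m + 2) ^ ?n \<le> (2 * real (Suc m)) ^ ?n" by (intro power_mono) auto
      also have "\<dots> = 2 ^ ?n * real (Suc m) ^ ?n" by (rule power_mult_distrib)
      finally have "1 / real (Suc m) ^ (?n + 2) * (unit_ball_vol (real ?n) * real (m + 2) ^ ?n)
        \<le> 1 / real (Suc m) ^ (?n + 2) * (unit_ball_vol (real ?n) * (2 ^ ?n * real (Suc m) ^ ?n))"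
        by (intro mult_left_mono) auto
      also have "\<dots> = unit_ball_vol (real ?n) * 2 ^ ?n * (1 / real (Suc m) ^ 2)"
      proof -
        have z: "1 / z ^ (?n + 2) * (w * (2 ^ ?n * z ^ ?n)) = w * 2 ^ ?n * (1 / z ^ 2)" if "z > 0" for z w :: real
          using that by (simp add: power_add power2_eq_square)
        show ?thesis by (rule z) simp
      qed
      finally show "1 / real (Suc m) ^ (?n + 2) * (unit_ball_vol (real ?n) * real (m + 2) ^ ?n) \<le> unit_ball_vol (real ?n) * 2 ^ ?n * (1 / real (Suc m) ^ 2)" .
    qed
    finally show "?c m * emeasure lborel (ball (0::real^'n) (real (m + 2))) \<le> ennreal (unit_ball_vol (real ?n) * 2 ^ ?n * (1 / real (Suc m) ^ 2))" .
  qed auto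
  also have "\<dots> = ennreal (\<Sum>m. unit_ball_vol (real ?n) * 2 ^ ?n * (1 / real (Suc m) ^ 2))"
  proof (rule suminf_ennreal2)
    have "summable (\<lambda>m. 1 / real (Suc m) ^ 2)"
      using inverse_power_summable[of 2, where 'a=real] by (subst summable_Suc_iff) (simp add: inverse_eq_divide)
    then show "summable (\<lambda>m. unit_ball_vol (real ?n) * 2 ^ ?n * (1 / real (Suc m) ^ 2))" by (rule summable_mult)
  qed auto
  finally show ?thesis by blast
qed

section \<open>Compactness, finite mass, and passage between \<open>dens\<close> and
  \<open>Dfun\<close>\<close>

context allen_cahn_transport
begin

lemma gradient_periodic:
  assumes per: "\<And>x k. lattice_vec k \<Longrightarrow> \<phi> (x + k) t = \<phi> x t" and t: "t \<in> {0..T}" and k: "lattice_vec k"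
  shows "g (x + k) t = g x t"
proof -
  have "((\<lambda>y. \<phi> (y + k) t) has_derivative (\<lambda>h. g (x + k) t \<bullet> h)) (at x)"
  proof -
    have sh: "((\<lambda>y. y + k) has_derivative (\<lambda>h. h)) (at x)" by (auto intro!: derivative_eq_intros)
    show ?thesis by (rule has_derivative_compose[OF sh \<phi>_deriv[OF t]])
  qed
  then have "((\<lambda>y. \<phi> y t) has_derivative (\<lambda>h. g (x + k) t \<bullet> h)) (at x)" by (simp add: per[OF k])
  from has_derivative_unique[OF this \<phi>_deriv[OF t]] have "g (x + k) t \<bullet> h = g x t \<bullet> h" for h by meson
  then have "(g (x + k) t - g x t) \<bullet> (g (x + k) t - g x t) = 0" by (simp add: inner_diff_left)
  then show ?thesis by simp
qed

text \<open>This supplies the hypothesis \<open>cpt\<close> of the barrier argument: on the torus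
  every point has a translate in the closed unit cube, and on R^n the decay at infinity with k = 0
  makes the gradient small outside a ball.\<close>

lemma profile_compact:
  fixes tor :: bool
  assumes per: "\<And>x t k. tor \<Longrightarrow> lattice_vec k \<Longrightarrow> \<phi> (x + k) t = \<phi> x t"
    and decay: "\<And>k e. \<not> tor \<Longrightarrow> e > 0 \<Longrightarrow> \<exists>R0. \<forall>R\<ge>R0. \<forall>x. \<forall>t\<in>{0..T}. norm x \<ge> R \<longrightarrow>
            R ^ k * (\<bar>\<phi> x t + 1\<bar> + norm (g x t) + norm (H x t)) \<le> e"
    and d: "\<delta> > 0"
  shows "\<exists>K. compact K \<and> (\<forall>x. \<forall>t\<in>{0..T}. (\<exists>x'\<in>K. \<phi> x' t = \<phi> x t \<and> g x' t = g x t) \<or> \<epsilon>\<^sup>2 * (norm (g x t))\<^sup>2 / 2 < \<delta>)"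
proof (cases tor)
  case True
  have "\<exists>x'\<in>cbox 0 (\<chi> i. 1). \<phi> x' t = \<phi> x t \<and> g x' t = g x t" if t: "t \<in> {0..T}" for x t
  proof -
    define k where "k = (\<chi> i. - (of_int \<lfloor>x $ i\<rfloor> :: real))"
    have k: "lattice_vec k" by (simp add: lattice_vec_def k_def)
    have "x + k \<in> cbox 0 (\<chi> i. 1)"
      by (auto simp: mem_box_cart k_def intro: order_trans[OF less_imp_le[OF floor_correct[THEN conjunct2]]])
    then show ?thesis using per[OF True k] gradient_periodic[OF per[OF True] t k] by blast
  qed
  then show ?thesis using compact_cbox by blast
next
  case False
  obtain R where R0: "\<forall>S\<ge>R. \<forall>x. \<forall>t\<in>{0..T}. norm x \<ge> S \<longrightarrow> S ^ 0 * (\<bar>\<phi> x t + 1\<bar> + norm (g x t) + norm (H x t)) \<le> sqrt \<delta>"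
    using decay[OF False, of "sqrt \<delta>" 0] d by auto
  have R: "\<bar>\<phi> x t + 1\<bar> + norm (g x t) + norm (H x t) \<le> sqrt \<delta>" if "t \<in> {0..T}" "norm x \<ge> R" for x t
    using R0[rule_format, OF order_refl that] by simp
  have far: "\<epsilon>\<^sup>2 * (norm (g x t))\<^sup>2 / 2 < \<delta>" if "t \<in> {0..T}" "x \<notin> cball 0 R" for x t
  proof -
    have "norm (g x t) \<le> sqrt \<delta>" using R[OF that(1), of x] that(2) norm_ge_zero[of "H x t"] abs_ge_zero[of "\<phi> x t + 1"] unfolding mem_cball dist_0_norm by linarith
    then have "(norm (g x t))\<^sup>2 \<le> (sqrt \<delta>)\<^sup>2" by (intro power_mono) auto
    then have "\<epsilon>\<^sup>2 * (norm (g x t))\<^sup>2 \<le> 1 * \<delta>" using eps_pos eps_less_1 d by (intro mult_mono) (auto simp: power_le_one)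
    then show ?thesis using d by simp
  qed
  show ?thesis
  proof (intro exI conjI allI ballI)
    show "compact (cball (0::real^'n) R)" by simp
    fix x t assume t: "t \<in> {0..T}"
    show "(\<exists>x'\<in>cball 0 R. \<phi> x' t = \<phi> x t \<and> g x' t = g x t) \<or> \<epsilon>\<^sup>2 * (norm (g x t))\<^sup>2 / 2 < \<delta>"
      using far[OF t, of x] by (cases "x \<in> cball 0 R") blast+
  qed
qed

text \<open>Decay of order n + 2 gives an integrable tail. The linear bound W \<le> CL (x + 1)
  carries the decay of \<phi> + 1 over to the potential term.\<close>

lemma mass_finite:
  assumes decay: "\<And>k e. e > 0 \<Longrightarrow> \<exists>R0. \<forall>R\<ge>R0. \<forall>x. \<forall>t\<in>{0..T}. norm x \<ge> R \<longrightarrow>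
            R ^ k * (\<bar>\<phi> x t + 1\<bar> + norm (g x t) + norm (H x t)) \<le> e"
    and CL: "CL > 0" "\<And>x. \<bar>x\<bar> \<le> 1 \<Longrightarrow> W x \<le> CL * (x + 1)"
    and E_le: "\<And>x t. t \<in> {0..T} \<Longrightarrow> E x t \<le> CE / \<epsilon>" and CE: "CE > 0"
  shows "\<exists>A. \<forall>t\<in>{0..T}. (\<integral>x. ennreal (E x t)) \<le> ennreal A"
proof -
  obtain A where A: "(\<integral>x. (if norm (x::real^'n) \<ge> 1 then ennreal (1 / norm x ^ (CARD('n) + 2)) else 0)) \<le> ennreal A"
    using nn_integral_inverse_power_finite by blast
  obtain R0 where R0: "\<forall>R\<ge>R0. \<forall>x. \<forall>t\<in>{0..T}. norm x \<ge> R \<longrightarrow> R ^ (CARD('n) + 2) * (\<bar>\<phi> x t + 1\<bar> + norm (g x t) + norm (H x t)) \<le> 1"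
    using decay[of 1 "CARD('n) + 2"] by auto
  define R where "R = max R0 1"
  define c where "c = \<epsilon> + CL / \<epsilon>"
  have c: "c > 0" using CL eps_pos by (simp add: c_def add_pos_pos)
  have far: "E x t \<le> c * (1 / norm x ^ (CARD('n) + 2))" if t: "t \<in> {0..T}" and x: "norm x \<ge> R" for x t
  proof -
    define z where "z = 1 / norm x ^ (CARD('n) + 2)"
    have n1: "norm x \<ge> 1" "norm x \<ge> R0" using x by (auto simp: R_def)
    have np: "norm x ^ (CARD('n) + 2) \<ge> 1" by (rule one_le_power[OF n1(1)])
    have "norm x ^ (CARD('n) + 2) * (\<bar>\<phi> x t + 1\<bar> + norm (g x t) + norm (H x t)) \<le> 1" using R0 n1 t by blast
    then have "\<bar>\<phi> x t + 1\<bar> + norm (g x t) + norm (H x t) \<le> z" using np unfolding z_def by (simp add: field_simps)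
    then have b: "\<phi> x t + 1 \<le> z" "norm (g x t) \<le> z" using norm_ge_zero[of "g x t"] norm_ge_zero[of "H x t"] by linarith+
    have z: "0 < z" "z \<le> 1" using np by (auto simp: z_def)
    have "(norm (g x t))\<^sup>2 \<le> z * 1" unfolding power2_eq_square using b z by (intro mult_mono) auto
    then have "\<epsilon> * (norm (g x t))\<^sup>2 \<le> \<epsilon> * z" using eps_pos by (intro mult_left_mono) auto
    moreover have "\<epsilon> * (norm (g x t))\<^sup>2 \<ge> 0" using eps_pos by simp
    moreover have "W (\<phi> x t) / \<epsilon> \<le> CL * z / \<epsilon>"
    proof (rule divide_right_mono)
      have "W (\<phi> x t) \<le> CL * (\<phi> x t + 1)" by (rule CL(2)[OF \<phi>_bound[OF t]])
      also have "\<dots> \<le> CL * z" using b CL by (intro mult_left_mono) auto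
      finally show "W (\<phi> x t) \<le> CL * z" .
    qed (use eps_pos in simp)
    ultimately have "E x t \<le> \<epsilon> * z + CL * z / \<epsilon>" unfolding E_def by linarith
    also have "\<dots> = c * z" by (simp add: c_def distrib_right)
    finally show ?thesis unfolding z_def .
  qed
  define V where "V = CE / \<epsilon> * (unit_ball_vol (real CARD('n)) * R ^ CARD('n))"
  have R1: "R \<ge> 1" by (simp add: R_def)
  have "(\<integral>x. ennreal (E x t)) \<le> ennreal (V + c * max A 0)" if t: "t \<in> {0..T}" for t
  proof -
    have "(\<integral>x. ennreal (E x t)) \<le> (\<integral>x. ennreal (CE / \<epsilon>) * indicator (ball (0::real^'n) R) x + ennreal c * (if norm x \<ge> 1 then ennreal (1 / norm x ^ (CARD('n) + 2)) else 0))"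
    proof (rule nn_integral_mono)
      fix x :: "real^'n"
      show "ennreal (E x t) \<le> ennreal (CE / \<epsilon>) * indicator (ball 0 R) x + ennreal c * (if norm x \<ge> 1 then ennreal (1 / norm x ^ (CARD('n) + 2)) else 0)"
      proof (cases "norm x \<ge> R")
        case True
        have "ennreal (E x t) \<le> ennreal (c * (1 / norm x ^ (CARD('n) + 2)))" by (rule ennreal_leI[OF far[OF t True]])
        also have "\<dots> = ennreal c * ennreal (1 / norm x ^ (CARD('n) + 2))" using c by (intro ennreal_mult') auto
        finally show ?thesis using True R1 by simp
      next
        case False
        have "ennreal (E x t) \<le> ennreal (CE / \<epsilon>)" by (rule ennreal_leI[OF E_le[OF t]])
        also have "ennreal (CE / \<epsilon>) = ennreal (CE / \<epsilon>) * indicator (ball 0 R) x" using False by simp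
        also have "\<dots> \<le> ennreal (CE / \<epsilon>) * indicator (ball 0 R) x + ennreal c * (if norm x \<ge> 1 then ennreal (1 / norm x ^ (CARD('n) + 2)) else 0)"
          by (rule add_increasing2) simp_all
        finally show ?thesis .
      qed
    qed
    also have "\<dots> = ennreal (CE / \<epsilon>) * emeasure lborel (ball (0::real^'n) R) + ennreal c * (\<integral>x. (if norm (x::real^'n) \<ge> 1 then ennreal (1 / norm x ^ (CARD('n) + 2)) else 0))"
    proof -
      have [measurable]: "(\<lambda>x::real^'n. if norm x \<ge> 1 then ennreal (1 / norm x ^ (CARD('n) + 2)) else 0) \<in> borel_measurable borel"
        by measurable
      have [measurable]: "(indicator (ball (0::real^'n) R) :: _ \<Rightarrow> ennreal) \<in> borel_measurable borel" by (rule borel_measurable_indicator) simp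
      show ?thesis by (subst nn_integral_add) (simp_all add: nn_integral_cmult nn_integral_cmult_indicator)
    qed
    also have "\<dots> \<le> ennreal (CE / \<epsilon>) * ennreal (unit_ball_vol (real CARD('n)) * R ^ CARD('n)) + ennreal c * ennreal (max A 0)"
      using R1 order_trans[OF A, of "ennreal (max A 0)"] by (intro add_mono mult_left_mono) (auto simp: emeasure_ball ennreal_leI)
    also have "\<dots> = ennreal (V + c * max A 0)"
      unfolding V_def using CE eps_pos R1 c by (intro ennreal_mult_add_mult) auto
    finally show ?thesis .
  qed
  then show ?thesis by blast
qed

abbreviation (input) "mu tor t \<equiv> mu_eps tor \<epsilon> W (\<lambda>x. \<phi> x t) (\<lambda>x. g x t)"

lemma mu_eps_eq: "mu tor t S = (\<integral>x. ennreal (E x t) * indicator (S \<inter> Omega tor) x)"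
  unfolding mu_eps_def E_def by simp

lemma dens_of_Dfun:
  assumes per: "\<And>x k. tor \<Longrightarrow> lattice_vec k \<Longrightarrow> \<phi> (x + k) t = \<phi> x t" and t: "t \<in> {0..T}"
    and D: "Dfun tor \<epsilon> W (\<lambda>x. \<phi> x t) (\<lambda>x. g x t) \<le> ennreal D0" and D0: "D0 \<ge> 0"
  shows "dens tor t (max 1 ((1 + unit_ball_vol (real (CARD('n) - 1))) * D0))" (is "dens tor t ?M")
proof -
  let ?w = "unit_ball_vol (real (CARD('n) - 1))"
  have [measurable]: "(\<lambda>x. E x t) \<in> borel_measurable borel" by (rule measurable_slices[OF t])
  have Eper: "ennreal (E (x + k) t) = ennreal (E x t)" if "tor" "lattice_vec k" for x k
    using per[OF that] gradient_periodic[OF per[OF that(1)] t that(2)] by (simp add: E_def)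
  have mass: "mu tor t (Omega tor) \<le> ennreal D0" using D by (simp add: Dfun_def)
  show ?thesis
    unfolding dens_def
  proof (intro conjI allI impI)
    fix y :: "real^'n" and r :: real assume r: "0 < r" "r \<le> 1/2"
    let ?c = "?w * r ^ (CARD('n) - 1)"
    have c: "?c > 0" using r by (intro mult_pos_pos) auto
    have S: "(SUP xr \<in> (UNIV :: (real^'n) set) \<times> {0<..}. mu tor t (Oball tor (fst xr) (snd xr)) /
          ennreal (?w * (snd xr) ^ (CARD('n) - 1))) \<le> ennreal D0" using D by (simp add: Dfun_def)
    have "mu tor t (Oball tor y r) / ennreal ?c \<le> ennreal D0"
      using bspec[OF S[unfolded SUP_le_iff], of "(y, r)"] r by simp
    then have mu: "mu tor t (Oball tor y r) \<le> ennreal (D0 * ?c)"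
      by (rule ennreal_le_mult_of_divide_le[OF c])
    have "(\<integral>x. (if dist x y < r then ennreal (E x t) else 0)) \<le> (\<integral>x. ennreal (E x t) * indicator (Oball tor y r \<inter> Omega tor) x)"
      by (rule ball_integral_le_Oball[OF _ Eper r(2)]) measurable
    also have "\<dots> \<le> ennreal (D0 * ?c)" using mu unfolding mu_eps_eq .
    also have "\<dots> \<le> ennreal (?M * r ^ (CARD('n) - 1))"
    proof (rule ennreal_leI)
      have "D0 * ?w \<le> (1 + ?w) * D0" using D0 by (simp add: distrib_right)
      then have "D0 * ?w \<le> ?M" by (rule max.coboundedI2)
      then have "D0 * ?w * r ^ (CARD('n) - 1) \<le> ?M * r ^ (CARD('n) - 1)" using r by (intro mult_right_mono) auto
      then show "D0 * ?c \<le> ?M * r ^ (CARD('n) - 1)" by (simp only: mult.assoc)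
    qed
    finally show "(\<integral>x. (if dist x y < r then ennreal (E x t) else 0)) \<le> ennreal (?M * r ^ (CARD('n) - 1))" .
  next
    assume "\<not> tor"
    then have "(\<integral>x. ennreal (E x t)) \<le> ennreal D0" using mass unfolding mu_eps_eq by (simp add: Omega_def)
    also have "\<dots> \<le> ennreal ?M"
    proof (rule ennreal_leI)
      have "0 \<le> ?w * D0" using D0 by simp
      then have "D0 \<le> (1 + ?w) * D0" by (simp add: distrib_right)
      then show "D0 \<le> ?M" by (rule max.coboundedI2)
    qed
    finally show "(\<integral>x. ennreal (E x t)) \<le> ennreal ?M" .
  qed
qed

text \<open>Radii up to 1/2 lift to R^n. Beyond, the total mass suffices, because (2 r)^(n-1) \<ge>
  1; this is the factor 2^(n-1). On the torus the total mass comes from covering the unit cube by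
  balls of radius 1/4.\<close>

lemma Dfun_of_dens:
  assumes per: "\<And>x k. tor \<Longrightarrow> lattice_vec k \<Longrightarrow> \<phi> (x + k) t = \<phi> x t" and t: "t \<in> {0..T}"
    and d: "dens tor t M" and M: "M \<ge> 1"
    and N: "N \<ge> 1" and cov: "\<And>(f :: real^'n \<Rightarrow> ennreal) B y. f \<in> borel_measurable borel \<Longrightarrow>
       (\<And>z. (\<integral>x. (if dist x z < 1/4 then f x else 0)) \<le> B) \<Longrightarrow>
       (\<integral>x. (if x - y \<in> cbox 0 (\<chi> i. 1) then f x else 0)) \<le> ennreal N * B"
  shows "Dfun tor \<epsilon> W (\<lambda>x. \<phi> x t) (\<lambda>x. g x t) \<le> ennreal (M * (N * 2 ^ (CARD('n) - 1) * (1 + 1 / unit_ball_vol (real (CARD('n) - 1)))))"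
    (is "_ \<le> ennreal ?D")
proof -
  let ?w = "unit_ball_vol (real (CARD('n) - 1))" and ?n1 = "CARD('n) - 1"
  have w: "?w > 0" by simp
  have [measurable]: "(\<lambda>x. E x t) \<in> borel_measurable borel" by (rule measurable_slices[OF t])
  have Eper: "ennreal (E (x + k) t) = ennreal (E x t)" if "tor" "lattice_vec k" for x k
    using per[OF that] gradient_periodic[OF per[OF that(1)] t that(2)] by (simp add: E_def)
  have p2: "(2::real) ^ ?n1 \<ge> 1" by simp
  have NM: "M \<le> N * M" "N * M \<le> N * M * 2 ^ ?n1" "N * M \<ge> 1"
  proof -
    show 1: "M \<le> N * M" using mult_right_mono[OF N, of M] M by simp
    then show 2: "N * M \<ge> 1" using M by linarith
    then show "N * M \<le> N * M * 2 ^ ?n1" using mult_left_mono[OF p2, of "N * M"] by simp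
  qed
  have D: "?D = N * M * 2 ^ ?n1 + N * M * 2 ^ ?n1 / ?w" by (simp add: distrib_left mult_ac)
  have Dw: "N * M * 2 ^ ?n1 / ?w \<ge> 0" using NM w by (intro divide_nonneg_nonneg) auto
  have tot: "mu tor t (Omega tor) \<le> ennreal (N * M)"
  proof (cases tor)
    case True
    have "mu tor t (Omega tor) \<le> (\<integral>x. (if x - 0 \<in> cbox 0 (\<chi> i. 1) then ennreal (E x t) else 0))"
      unfolding mu_eps_eq using True by (intro nn_integral_mono) (auto simp: indicator_def Omega_def mem_box_cart less_imp_le)
    also have "\<dots> \<le> ennreal N * ennreal (M * (1/4) ^ ?n1)"
    proof (rule cov)
      show "(\<lambda>x. ennreal (E x t)) \<in> borel_measurable borel" by measurable
      show "(\<integral>x. (if dist x z < 1/4 then ennreal (E x t) else 0)) \<le> ennreal (M * (1/4) ^ ?n1)" for z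
        by (rule densD[OF d]) auto
    qed
    also have "\<dots> = ennreal (N * (M * (1/4) ^ ?n1))" using N by (intro ennreal_mult'[symmetric]) auto
    also have "\<dots> \<le> ennreal (N * M)"
      using N M by (intro ennreal_leI mult_left_mono mult_left_le) (auto simp: power_le_one)
    finally show ?thesis .
  next
    case False
    have "mu tor t (Omega tor) \<le> ennreal M"
      unfolding mu_eps_eq using d False by (simp add: Omega_def dens_def)
    also have "\<dots> \<le> ennreal (N * M)" by (rule ennreal_leI[OF NM(1)])
    finally show ?thesis .
  qed
  have ball: "mu tor t (Oball tor y r) / ennreal (?w * r ^ ?n1) \<le> ennreal ?D" if r: "r > 0" for y r
  proof -
    have rp: "?w * r ^ ?n1 > 0" using w r by simp
    have "mu tor t (Oball tor y r) \<le> ennreal (N * M * 2 ^ ?n1 * r ^ ?n1)"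
    proof (cases "r \<le> 1/2")
      case True
      have "mu tor t (Oball tor y r) \<le> (\<integral>x. (if dist x y < r then ennreal (E x t) else 0))"
        unfolding mu_eps_eq by (rule Oball_integral_le_ball[OF _ Eper]) measurable
      also have "\<dots> \<le> ennreal (M * r ^ ?n1)" by (rule densD[OF d r True])
      also have "\<dots> \<le> ennreal (N * M * 2 ^ ?n1 * r ^ ?n1)" using NM r by (intro ennreal_leI mult_right_mono) auto
      finally show ?thesis .
    next
      case False
      have "mu tor t (Oball tor y r) \<le> mu tor t (Omega tor)"
        unfolding mu_eps_eq by (intro nn_integral_mono) (auto simp: indicator_def)
      also note tot
      also have "ennreal (N * M) \<le> ennreal (N * M * 2 ^ ?n1 * r ^ ?n1)"
      proof (rule ennreal_leI)
        have "1 \<le> (2 * r) ^ ?n1" using False by (intro one_le_power) auto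
        then have "N * M * 1 \<le> N * M * (2 * r) ^ ?n1" using NM by (intro mult_left_mono) auto
        then show "N * M \<le> N * M * 2 ^ ?n1 * r ^ ?n1" by (simp add: power_mult_distrib mult.assoc)
      qed
      finally show ?thesis .
    qed
    then have "mu tor t (Oball tor y r) / ennreal (?w * r ^ ?n1) \<le> ennreal (N * M * 2 ^ ?n1 * r ^ ?n1) / ennreal (?w * r ^ ?n1)"
      by (rule divide_right_mono_ennreal)
    also have "\<dots> = ennreal (N * M * 2 ^ ?n1 * r ^ ?n1 / (?w * r ^ ?n1))" using NM rp r by (intro divide_ennreal) auto
    also have "\<dots> = ennreal (N * M * 2 ^ ?n1 / ?w)" using r by simp
    also have "\<dots> \<le> ennreal ?D" unfolding D using NM by (intro ennreal_leI) simp
    finally show ?thesis .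
  qed
  have "1 \<le> ?D" unfolding D using NM Dw by linarith
  then have "1 \<le> ennreal ?D" using ennreal_leI[of 1 ?D] by simp
  moreover have "ennreal (N * M) \<le> ennreal ?D" unfolding D using NM Dw by (intro ennreal_leI) linarith
  then have "mu tor t (Omega tor) \<le> ennreal ?D" by (rule order_trans[OF tot])
  ultimately show ?thesis
    unfolding Dfun_def using ball by (intro max.boundedI SUP_least) auto
qed

end

text \<open>The condition p > n q/(2 (q - 1)) is what makes the trace inequality compatible with
  integrability in time. For n \<ge> 3 it already gives p > 2 n/(n + 1), which an exponent p/b \<ge>
  2 with room to spare requires. In the plane that threshold is 4/3, and equality is left to the
  critical case with b = 2/3.\<close>

lemma exponent_choice:
  fixes p q :: real
  assumes n: "n \<ge> 2" and q: "q > 2" and p: "real n * q / (2 * (q - 1)) < p" and p2: "n = 2 \<Longrightarrow> p \<ge> 4/3"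
  shows "p > 1" and "\<exists>b. 0 < b \<and> b \<le> 1 \<and> p / b \<ge> 2 \<and> admissible_exponents n p b \<and> (real n - 1) * b / p * (q / (q - 2)) < 1"
proof -
  have "real n / 2 < real n * q / (2 * (q - 1))" using q n by (simp add: field_simps)
  then have pn: "p > real n / 2" using p by (rule less_trans)
  then show p1: "p > 1" using n by simp
  have n1: "real n - 1 > 0" using n by simp
  show "\<exists>b. 0 < b \<and> b \<le> 1 \<and> p / b \<ge> 2 \<and> admissible_exponents n p b \<and> (real n - 1) * b / p * (q / (q - 2)) < 1"
  proof (cases "n = 2 \<and> p = 4/3")
    case True
    then have "2 * q / (2 * (q - 1)) < 4/3" using p by simp
    then have "q > 4" using q by (simp add: field_simps)
    then have "(real 2 - 1) * (2/3) / (4/3) * (q / (q - 2)) < 1" by (simp add: field_simps)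
    then show ?thesis
      unfolding conjunct1[OF True] conjunct2[OF True]
      by (intro exI[of _ "2/3"] conjI admissible_exponents_critical_plane) simp_all
  next
    case False
    have pbig: "p > 2 * real n / (real n + 1)"
    proof (cases "n = 2")
      case True
      then show ?thesis using p2 False by auto
    next
      case False
      then have "real n + 1 \<ge> 4" using n by auto
      then have "real n * 4 \<le> real n * (real n + 1)" by (intro mult_left_mono) auto
      then have "2 * real n / (real n + 1) \<le> real n / 2" by (simp add: field_simps)
      then show ?thesis using pn by simp
    qed
    \<comment> \<open>With b = p x the conditions are: L < x for admissibility, x < U for
      \<open>kq\<close> < 1, x < 1/2 for p/b \<ge> 2, and x < 1/p for b \<le> 1. L < U restates the
      lower bound on p in terms of n and q.\<close>
    define L U where "L = (real n / p - 1) / (real n - 1)" and "U = (1 - 2 / q) / (real n - 1)"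
    have "L < 1/2"
    proof -
      have "2 * real n < p * (real n + 1)" using pbig by (simp add: field_simps)
      then have "real n / p - 1 < (real n - 1) / 2" using p1 by (simp add: field_simps)
      then show ?thesis using n1 by (simp add: L_def divide_less_eq)
    qed
    moreover have "L < 1 / p"
    proof -
      have "real n / p - 1 < (real n - 1) / p" using p1 by (simp add: field_simps)
      then show ?thesis using n1 by (simp add: L_def divide_less_eq mult.commute)
    qed
    moreover have "L < U"
    proof -
      have "real n * q < p * (2 * (q - 1))" using p q by (simp add: divide_less_eq)
      then have "real n / p - 1 < 1 - 2 / q" using p1 q by (simp add: field_simps)
      then show ?thesis using n1 by (simp add: L_def U_def divide_strict_right_mono)
    qed
    moreover have "U > 0" using q n1 by (simp add: U_def)
    moreover have "1 / p > 0" using p1 by simp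
    ultimately have "max 0 L < min (1/2) (min (1/p) U)" by auto
    then obtain x where x: "max 0 L < x" "x < min (1/2) (min (1/p) U)" using dense by blast
    then have x0: "x > 0" "L < x" "x < 1/2" "x < 1/p" "x < U" by auto
    have "admissible_exponents n p (p * x)"
    proof (rule admissible_exponents_subcritical)
      have "real n / p - 1 < x * (real n - 1)" using x0(2) n1 by (simp add: L_def divide_less_eq)
      then have "p * (real n / p - 1) < p * (x * (real n - 1))" using p1 by (intro mult_strict_left_mono) auto
      then show "real n - p < p * x * (real n - 1)" using p1 by (simp add: right_diff_distrib mult.assoc)
      show "p * x \<le> 1" using x0 p1 by (simp add: field_simps)
    qed (use n p1 x0 in auto)
    moreover have "(real n - 1) * (p * x) / p * (q / (q - 2)) < 1"
    proof -
      have "(real n - 1) * x < 1 - 2 / q" using x0(5) n1 by (simp add: U_def less_divide_eq mult.commute)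
      then have "(real n - 1) * x * (q / (q - 2)) < (1 - 2 / q) * (q / (q - 2))" using q by (intro mult_strict_right_mono) auto
      also have "\<dots> = 1" using q by (simp add: field_simps)
      finally show ?thesis using p1 by simp
    qed
    moreover have "p / (p * x) \<ge> 2" using x0 p1 by (simp add: field_simps)
    moreover have "p * x \<le> 1" "p * x > 0" using x0 p1 by (simp_all add: field_simps)
    ultimately show ?thesis by blast
  qed
qed

text \<open>The order matters: \<theta> is taken first, to make the terms with Bq small, and then h,
  whose size depends on \<theta> through the factor \<theta> powr e. That h^(1-k) tends to 0 is
  where k < 1 enters.\<close>

lemma step_length_choice:
  fixes a C C' Bq e k \<eta> :: real
  assumes k: "k < 1" and \<eta>: "\<eta> > 0"
  shows "\<exists>\<theta>>0. \<exists>h>0. a * h + C * (\<theta> * Bq + \<theta> powr e * (h powr (1 - k) / (1 - k))) \<le> \<eta>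
    \<and> 60 * h + C' * (\<theta> * Bq + \<theta> powr e * h) \<le> 1/2"
proof -
  have "((\<lambda>\<theta>. C * (\<theta> * Bq)) \<longlongrightarrow> C * (0 * Bq)) (at_right 0)" by (intro tendsto_intros)
  then have "\<forall>\<^sub>F \<theta> in at_right 0. C * (\<theta> * Bq) < \<eta>" using \<eta> by (intro order_tendstoD(2)) auto
  moreover have "((\<lambda>\<theta>. C' * (\<theta> * Bq)) \<longlongrightarrow> C' * (0 * Bq)) (at_right 0)" by (intro tendsto_intros)
  then have "\<forall>\<^sub>F \<theta> in at_right 0. C' * (\<theta> * Bq) < 1/2" by (intro order_tendstoD(2)) auto
  ultimately have "\<forall>\<^sub>F \<theta> in at_right 0. C * (\<theta> * Bq) < \<eta> \<and> C' * (\<theta> * Bq) < 1/2 \<and> \<theta> > 0"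
    using eventually_at_right_less[of "0::real"] by eventually_elim simp
  from eventually_happens'[OF _ this] obtain \<theta> where \<theta>: "C * (\<theta> * Bq) < \<eta>" "C' * (\<theta> * Bq) < 1/2" "\<theta> > 0" by auto
  have pw: "((\<lambda>h::real. h powr (1 - k)) \<longlongrightarrow> 0) (at_right 0)"
    using k by real_asymp
  have "((\<lambda>h. a * h + C * (\<theta> * Bq + \<theta> powr e * (h powr (1 - k) / (1 - k)))) \<longlongrightarrow> a * 0 + C * (\<theta> * Bq + \<theta> powr e * (0 / (1 - k)))) (at_right 0)"
    using k by (intro tendsto_intros pw) auto
  then have "\<forall>\<^sub>F h in at_right 0. a * h + C * (\<theta> * Bq + \<theta> powr e * (h powr (1 - k) / (1 - k))) < \<eta>"
    using \<theta> by (intro order_tendstoD(2)) auto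
  moreover have "((\<lambda>h. 60 * h + C' * (\<theta> * Bq + \<theta> powr e * h)) \<longlongrightarrow> 60 * 0 + C' * (\<theta> * Bq + \<theta> powr e * 0)) (at_right 0)"
    by (intro tendsto_intros)
  then have "\<forall>\<^sub>F h in at_right 0. 60 * h + C' * (\<theta> * Bq + \<theta> powr e * h) < 1/2"
    using \<theta> by (intro order_tendstoD(2)) auto
  ultimately have "\<forall>\<^sub>F h in at_right 0. a * h + C * (\<theta> * Bq + \<theta> powr e * (h powr (1 - k) / (1 - k))) < \<eta>
      \<and> 60 * h + C' * (\<theta> * Bq + \<theta> powr e * h) < 1/2 \<and> h > 0"
    using eventually_at_right_less[of "0::real"] by eventually_elim simp
  from eventually_happens'[OF _ this] obtain h where h: "a * h + C * (\<theta> * Bq + \<theta> powr e * (h powr (1 - k) / (1 - k))) < \<eta>"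
      "60 * h + C' * (\<theta> * Bq + \<theta> powr e * h) < 1/2" "h > 0" by auto
  then show ?thesis using \<theta>(3) by (intro exI[of _ \<theta>] conjI exI[of _ h] h(3) less_imp_le[OF h(1)] less_imp_le[OF h(2)])
qed

lemma scale_choice:
  fixes \<delta> c A L B \<eta> :: real
  assumes \<delta>: "\<delta> > 0" and c: "c > 0" and \<eta>: "\<eta> > 0"
  shows "\<exists>\<epsilon>1>0. \<forall>\<epsilon>. 0 < \<epsilon> \<longrightarrow> \<epsilon> < \<epsilon>1 \<longrightarrow> c * \<epsilon> < 1/8 \<and> \<epsilon> powr \<delta> * A * (L - 2 * ln (c * \<epsilon>)) + B * sqrt \<epsilon> \<le> \<eta>"
proof -
  have l1: "((\<lambda>\<epsilon>::real. \<epsilon> powr \<delta>) \<longlongrightarrow> 0) (at_right 0)" using \<delta> by real_asymp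
  have l2: "((\<lambda>\<epsilon>::real. \<epsilon> powr \<delta> * ln \<epsilon>) \<longlongrightarrow> 0) (at_right 0)" using \<delta> by real_asymp
  have l3: "((\<lambda>\<epsilon>::real. sqrt \<epsilon>) \<longlongrightarrow> 0) (at_right 0)" by real_asymp
  have "((\<lambda>\<epsilon>. A * ((L - 2 * ln c) * \<epsilon> powr \<delta> - 2 * (\<epsilon> powr \<delta> * ln \<epsilon>)) + B * sqrt \<epsilon>) \<longlongrightarrow> A * ((L - 2 * ln c) * 0 - 2 * 0) + B * 0) (at_right 0)"
    by (intro tendsto_intros l1 l2 l3)
  then have "\<forall>\<^sub>F \<epsilon> in at_right 0. A * ((L - 2 * ln c) * \<epsilon> powr \<delta> - 2 * (\<epsilon> powr \<delta> * ln \<epsilon>)) + B * sqrt \<epsilon> < \<eta>"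
    using \<eta> by (intro order_tendstoD(2)) auto
  then obtain b where b: "b > 0" "\<And>\<epsilon>. 0 < \<epsilon> \<Longrightarrow> \<epsilon> < b \<Longrightarrow> A * ((L - 2 * ln c) * \<epsilon> powr \<delta> - 2 * (\<epsilon> powr \<delta> * ln \<epsilon>)) + B * sqrt \<epsilon> < \<eta>"
    unfolding eventually_at_right_field by auto
  show ?thesis
  proof (intro exI[of _ "min b (1 / (8 * c))"] conjI allI impI)
    show "0 < min b (1 / (8 * c))" using b c by simp
    fix \<epsilon> :: real assume e: "0 < \<epsilon>" "\<epsilon> < min b (1 / (8 * c))"
    then show "c * \<epsilon> < 1/8" using c by (simp add: field_simps)
    have "\<epsilon> powr \<delta> * A * (L - 2 * ln (c * \<epsilon>)) = A * ((L - 2 * ln c) * \<epsilon> powr \<delta> - 2 * (\<epsilon> powr \<delta> * ln \<epsilon>))"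
      using e c by (simp add: ln_mult algebra_simps)
    then show "\<epsilon> powr \<delta> * A * (L - 2 * ln (c * \<epsilon>)) + B * sqrt \<epsilon> \<le> \<eta>" using b(2)[OF e(1)] e(2) by linarith
  qed
qed

definition well_constants :: "(real \<Rightarrow> real) \<Rightarrow> real \<Rightarrow> real \<Rightarrow> real \<Rightarrow> real \<Rightarrow> bool" where
  "well_constants W \<gamma> \<mu> CB CL \<longleftrightarrow> -1 < \<gamma> \<and> \<gamma> < 1 \<and> 0 < \<mu> \<and> \<mu> \<le> 1/4 \<and> CB > 0 \<and> CL > 0 \<and>
     (\<forall>x. \<bar>x\<bar> \<le> 1 \<longrightarrow> (\<gamma> - x) * deriv W x \<ge> 0 \<and> \<mu> * hump \<gamma> x \<le> (\<gamma> - x) * deriv W x / 2 + W x / 2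
        \<and> (hump \<gamma> x)\<^sup>2 \<le> CB * W x \<and> W x \<le> CL * (x + 1))"

text \<open>The part of \<open>err\<close> depending on \<epsilon>, together with the condition on
  \<open>rmin\<close>, written out for CW = 4 CB + 2 and CE = 4 CL + 8.\<close>

definition scale_small :: "real \<Rightarrow> real \<Rightarrow> real \<Rightarrow> real \<Rightarrow> real \<Rightarrow> real \<Rightarrow> real \<Rightarrow> real \<Rightarrow> real \<Rightarrow> real \<Rightarrow> bool" where
  "scale_small G GL V T \<eta> \<beta> \<mu> CB CL \<epsilon> \<longleftrightarrow> (1 / (V * (4 * CL + 8))) * \<epsilon> < 1/8 \<and>
     \<epsilon> powr ((1 - 2 * \<beta>) / 2) * (G + (4 * CB + 2) * GL * sqrt (T + 1)) * (ln (T + 1) - 2 * ln ((1 / (V * (4 * CL + 8))) * \<epsilon>))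
      + (4 * CB + 2) * GL * sqrt \<epsilon> / (4 * \<mu> * (1 / (V * (4 * CL + 8)))) \<le> \<eta>"

text \<open>The theorem asks for \<epsilon>1 for every W and \<beta>, before their properties are
  known, so these stand as implications under the existential; if they fail, any positive value
  does. The target \<eta> is fixed beforehand, which keeps the density constant independent of W and
  \<beta>.\<close>

lemma well_scale:
  fixes W :: "real \<Rightarrow> real" and G GL V T \<eta> \<beta> :: real
  assumes V: "V > 0" and \<eta>: "\<eta> > 0"
  shows "\<exists>\<epsilon>1>0. Ck 3 UNIV W \<longrightarrow> (\<forall>x. W x \<ge> 0) \<longrightarrow> W 1 = 0 \<longrightarrow> W (-1) = 0 \<longrightarrow>
       deriv W 1 = 0 \<longrightarrow> deriv W (-1) = 0 \<longrightarrow>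
       (\<exists>\<gamma>. -1 < \<gamma> \<and> \<gamma> < 1 \<and> (\<forall>x. \<gamma> < x \<and> x < 1 \<longrightarrow> deriv W x < 0)
              \<and> (\<forall>x. -1 < x \<and> x < \<gamma> \<longrightarrow> deriv W x > 0)) \<longrightarrow>
       (\<exists>\<alpha> \<kappa>. 0 < \<alpha> \<and> \<alpha> < 1 \<and> \<kappa> > 0 \<and>
              (\<forall>x. \<alpha> \<le> \<bar>x\<bar> \<and> \<bar>x\<bar> \<le> 1 \<longrightarrow> deriv (deriv W) x \<ge> \<kappa>)) \<longrightarrow> \<beta> < 1/2 \<longrightarrow>
       (\<forall>\<epsilon>. 0 < \<epsilon> \<longrightarrow> \<epsilon> < \<epsilon>1 \<longrightarrow> (\<exists>\<gamma> \<mu> CB CL. well_constants W \<gamma> \<mu> CB CL \<and> scale_small G GL V T \<eta> \<beta> \<mu> CB CL \<epsilon>))"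
    (is "\<exists>\<epsilon>1>0. ?C \<longrightarrow> ?nn \<longrightarrow> ?w1 \<longrightarrow> ?w2 \<longrightarrow> ?w3 \<longrightarrow> ?w4 \<longrightarrow> ?g \<longrightarrow> ?ak \<longrightarrow> ?b \<longrightarrow> _")
proof (cases "?C \<and> ?nn \<and> ?w1 \<and> ?w2 \<and> ?w3 \<and> ?w4 \<and> ?g \<and> ?ak \<and> ?b")
  case False
  then show ?thesis by (intro exI[of _ 1] conjI impI) (simp, blast)
next
  case True
  then obtain \<gamma> \<alpha> \<kappa> where \<gamma>: "-1 < \<gamma>" "\<gamma> < 1" and dec: "\<And>x. \<gamma> < x \<Longrightarrow> x < 1 \<Longrightarrow> deriv W x < 0"
    and inc: "\<And>x. -1 < x \<Longrightarrow> x < \<gamma> \<Longrightarrow> deriv W x > 0" and \<alpha>: "0 < \<alpha>" "\<alpha> < 1" and \<kappa>: "\<kappa> > 0"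
    and conv: "\<And>x. \<alpha> \<le> \<bar>x\<bar> \<Longrightarrow> \<bar>x\<bar> \<le> 1 \<Longrightarrow> deriv (deriv W) x \<ge> \<kappa>" by blast
  have C: "Ck (Suc (Suc (Suc 0))) UNIV W" using True by (simp only: numeral_3_eq_3)
  note dW = Ck_Suc_deriv(1)[OF C] Ck_Suc_deriv(1)[OF Ck_Suc_deriv(2)[OF C]]
  have nn: "W x \<ge> 0" for x using True by blast
  have wells: "W 1 = 0" "W (-1) = 0" "deriv W 1 = 0" "deriv W (-1) = 0" using True by blast+
  note dwc = double_well_constants[OF dW nn wells \<gamma> dec inc \<alpha> \<kappa> conv]
  obtain \<mu> where \<mu>: "\<mu> > 0" "\<mu> \<le> 1/4" "\<And>x. \<bar>x\<bar> \<le> 1 \<Longrightarrow> \<mu> * hump \<gamma> x \<le> (\<gamma> - x) * deriv W x / 2 + W x / 2"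
    using dwc(2) by blast
  obtain CB where CB: "CB > 0" "\<And>x. \<bar>x\<bar> \<le> 1 \<Longrightarrow> (hump \<gamma> x)\<^sup>2 \<le> CB * W x" using dwc(3) by blast
  obtain CL where CL: "CL > 0" "\<And>x. \<bar>x\<bar> \<le> 1 \<Longrightarrow> W x \<le> CL * (x + 1)" using dwc(4) by blast
  have wc: "well_constants W \<gamma> \<mu> CB CL" unfolding well_constants_def using \<gamma> \<mu> CB CL dwc(1) by blast
  have "(1 - 2 * \<beta>) / 2 > 0" using True by simp
  moreover have "1 / (V * (4 * CL + 8)) > 0" using V CL by simp
  ultimately obtain \<epsilon>1 where \<epsilon>1: "\<epsilon>1 > 0" and small: "\<And>\<epsilon>. 0 < \<epsilon> \<Longrightarrow> \<epsilon> < \<epsilon>1 \<Longrightarrow> (1 / (V * (4 * CL + 8))) * \<epsilon> < 1/8 \<and>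
     \<epsilon> powr ((1 - 2 * \<beta>) / 2) * (G + (4 * CB + 2) * GL * sqrt (T + 1)) * (ln (T + 1) - 2 * ln ((1 / (V * (4 * CL + 8))) * \<epsilon>))
      + (4 * CB + 2) * GL / (4 * \<mu> * (1 / (V * (4 * CL + 8)))) * sqrt \<epsilon> \<le> \<eta>"
    using scale_choice[of "(1 - 2 * \<beta>) / 2" "1 / (V * (4 * CL + 8))" \<eta> "G + (4 * CB + 2) * GL * sqrt (T + 1)" "ln (T + 1)"
        "(4 * CB + 2) * GL / (4 * \<mu> * (1 / (V * (4 * CL + 8))))"] \<eta> by blast
  have "scale_small G GL V T \<eta> \<beta> \<mu> CB CL \<epsilon>" if "0 < \<epsilon>" "\<epsilon> < \<epsilon>1" for \<epsilon>
    using small[OF that] unfolding scale_small_def times_divide_eq_left[symmetric] .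
  then have all: "\<exists>\<gamma> \<mu> CB CL. well_constants W \<gamma> \<mu> CB CL \<and> scale_small G GL V T \<eta> \<beta> \<mu> CB CL \<epsilon>" if "0 < \<epsilon>" "\<epsilon> < \<epsilon>1" for \<epsilon>
    using wc that by blast
  show ?thesis by (rule exI[of _ \<epsilon>1], rule conjI[OF \<epsilon>1], intro impI allI) (rule all)
qed

lemma jacobian_periodic:
  fixes v :: "real^'n \<Rightarrow> real^'m"
  assumes D: "\<And>x. (v has_derivative (\<lambda>h. Dv x *v h)) (at x)" and per: "\<And>x. v (x + k) = v x"
  shows "Dv (x + k) = Dv x"
proof -
  have sh: "((\<lambda>y. y + k) has_derivative (\<lambda>h. h)) (at x)" by (auto intro!: derivative_eq_intros)
  have "((\<lambda>y. v (y + k)) has_derivative (\<lambda>h. Dv (x + k) *v h)) (at x)" by (rule has_derivative_compose[OF sh D])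
  then have "(v has_derivative (\<lambda>h. Dv (x + k) *v h)) (at x)" by (simp add: per)
  from has_derivative_unique[OF this D] have "Dv (x + k) *v h = Dv x *v h" for h by meson
  then show ?thesis by (simp add: matrix_eq)
qed

text \<open>The margin 1 places x in an open set on which v vanishes identically.\<close>

lemma jacobian_support:
  fixes v :: "real^'n \<Rightarrow> real^'m"
  assumes D: "\<And>x. (v has_derivative (\<lambda>h. Dv x *v h)) (at x)" and out: "\<And>x. norm x \<ge> R \<Longrightarrow> v x = 0" and x: "norm x \<ge> R + 1"
  shows "Dv x = 0"
proof -
  have op: "open (- cball (0::real^'n) R)" by (simp add: open_Compl)
  have "((\<lambda>_. 0) has_derivative (\<lambda>h. Dv x *v h)) (at x)"
    by (rule has_derivative_transform_within_open[OF D op]) (use x out in auto)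
  from has_derivative_unique[OF this has_derivative_const] have "Dv x *v h = 0" for h by meson
  then show ?thesis by (simp add: matrix_eq)
qed

section \<open>The estimate on [0,T] with all constants fixed in advance\<close>

lemma density_bound:
  fixes u :: "real^'n \<Rightarrow> real \<Rightarrow> real^'n" and Du :: "real^'n \<Rightarrow> real \<Rightarrow> real^'n^'n"
    and \<phi> :: "real^'n \<Rightarrow> real \<Rightarrow> real" and g :: "real^'n \<Rightarrow> real \<Rightarrow> real^'n"
    and H :: "real^'n \<Rightarrow> real \<Rightarrow> real^'n^'n" and T3 :: "real^'n \<Rightarrow> real \<Rightarrow> real^'n^'n^'n"
    and \<phi>t :: "real^'n \<Rightarrow> real \<Rightarrow> real" and gt :: "real^'n \<Rightarrow> real \<Rightarrow> real^'n"
    and N8 N4 \<theta> h Bq p q b Ct c1 D0 \<beta> T \<epsilon> \<eta> :: real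
  assumes n2: "CARD('n) \<ge> 2" and p: "p > 1" and b: "0 < b" "b \<le> 1" and Ct: "Ct > 0"
    and tr: "trace_property TYPE('n) p b Ct"
    and kap: "kq TYPE('n) b p q < 1"
    and Bq: "Bq = 2 powr (q / p) * 4 powr q * (c1 powr q + T)"
    and covN8: "N8 \<ge> 1" "\<forall>f \<in> borel_measurable borel. \<forall>B (y::real^'n). (\<forall>z. (\<integral>x. (if dist x z < 1/8 then f x else 0)) \<le> B)
        \<longrightarrow> (\<integral>x. (if x - y \<in> cball 0 (1/2) then f x else 0)) \<le> ennreal N8 * B"
    and covN4: "N4 \<ge> 1" "\<forall>f \<in> borel_measurable borel. \<forall>B (y::real^'n). (\<forall>z. (\<integral>x. (if dist x z < 1/4 then f x else 0)) \<le> B)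
        \<longrightarrow> (\<integral>x. (if x - y \<in> cbox 0 (\<chi> i. 1) then f x else 0)) \<le> ennreal N4 * B"
    and \<theta>: "\<theta> > 0" and h: "h > 0" "T \<le> real j * h" and \<eta>: "\<eta> = 1 / (16 * N8)"
    and step: "1920 * gauss_const (CARD('n) - 1) * h + (gauss_const (CARD('n) - 1) + Ct) / 2 *
       (\<theta> * Bq + \<theta> powr (- 2 / (q - 2)) * (h powr (1 - kq TYPE('n) b p q) / (1 - kq TYPE('n) b p q))) \<le> \<eta>"
      "60 * h + (1 + Ct) / 2 * (\<theta> * Bq + \<theta> powr (- 2 / (q - 2)) * h) \<le> 1/2"
    and well_cs: "\<exists>\<gamma> \<mu> CB CL. well_constants W \<gamma> \<mu> CB CL \<and> scale_small (gauss_const (CARD('n) - 1))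
       (gvol TYPE('n)) (unit_ball_vol (real CARD('n))) T \<eta> \<beta> \<mu> CB CL \<epsilon>"
    and W: "Ck 3 UNIV W" "\<forall>x. W x \<ge> 0"
    and q: "2 < q" and \<beta>: "0 < \<beta>" "\<beta> < 1/2" and eps: "0 < \<epsilon>" "\<epsilon> < 1" and T: "T > 0" and c1: "c1 > 0" and D0: "D0 > 0"
    and u: "smooth_on (UNIV \<times> {0..T}) (\<lambda>(x,t). u x t)"
      "\<forall>t\<in>{0..T}. \<forall>x. ((\<lambda>y. u y t) has_derivative (\<lambda>h. Du x t *v h)) (at x)"
      "tor \<longrightarrow> (\<forall>x t k. lattice_vec k \<longrightarrow> u (x + k) t = u x t)"
      "\<not> tor \<longrightarrow> (\<exists>R. \<forall>x. \<forall>t\<in>{0..T}. norm x \<ge> R \<longrightarrow> u x t = 0)"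
    and per: "tor \<longrightarrow> (\<forall>x t k. lattice_vec k \<longrightarrow> \<phi> (x + k) t = \<phi> x t)"
    and reg: "\<forall>t\<in>{0..T}. \<forall>x. ((\<lambda>y. \<phi> y t) has_derivative (\<lambda>h. g x t \<bullet> h)) (at x)"
      "\<forall>t\<in>{0..T}. \<forall>x. ((\<lambda>y. g y t) has_derivative (\<lambda>h. H x t *v h)) (at x)"
      "\<forall>t\<in>{0..T}. \<forall>x. ((\<lambda>y. H y t) has_derivative (\<lambda>h. \<chi> i j. \<Sum>k\<in>UNIV. T3 x t $ i $ j $ k * h $ k)) (at x)"
      "\<forall>x. \<forall>t\<in>{0..T}. ((\<lambda>s. \<phi> x s) has_real_derivative \<phi>t x t) (at t within {0..T})"
      "\<forall>x. \<forall>t\<in>{0..T}. ((\<lambda>s. g x s) has_vector_derivative gt x t) (at t within {0..T})"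
      "continuous_on (UNIV \<times> {0..T}) (\<lambda>(x,t). \<phi> x t)"
      "continuous_on (UNIV \<times> {0..T}) (\<lambda>(x,t). g x t)"
      "continuous_on (UNIV \<times> {0..T}) (\<lambda>(x,t). H x t)"
      "continuous_on (UNIV \<times> {0..T}) (\<lambda>(x,t). T3 x t)"
      "continuous_on (UNIV \<times> {0..T}) (\<lambda>(x,t). \<phi>t x t)"
      "continuous_on (UNIV \<times> {0..T}) (\<lambda>(x,t). gt x t)"
    and pde: "\<forall>x. \<forall>t\<in>{0..T}. \<phi>t x t + u x t \<bullet> g x t = (\<Sum>i\<in>UNIV. H x t $ i $ i) - deriv W (\<phi> x t) / \<epsilon>\<^sup>2"
    and bound: "\<forall>x. \<forall>t\<in>{0..T}. \<bar>\<phi> x t\<bar> \<le> 1"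
    and decay: "\<not> tor \<longrightarrow> (\<forall>k::nat. \<forall>e>0. \<exists>R0. \<forall>R\<ge>R0. \<forall>x. \<forall>t\<in>{0..T}. norm x \<ge> R \<longrightarrow>
            R ^ k * (\<bar>\<phi> x t + 1\<bar> + norm (g x t) + norm (H x t)) \<le> e)"
    and init: "\<forall>x. \<epsilon> * (norm (g x 0))\<^sup>2 / 2 - W (\<phi> x 0) / \<epsilon> \<le> \<epsilon> powr (-\<beta>)"
    and ub: "\<forall>x. \<forall>t\<in>{0..T}. norm (u x t) \<le> \<epsilon> powr (-\<beta>) \<and> norm (Du x t) \<le> \<epsilon> powr (-(\<beta> + 1))"
    and Lq: "(LINT t : {0..T} | lborel.
           (Lp_norm tor p (\<lambda>x. u x t) + Lp_norm tor p (\<lambda>x. Du x t)) powr q) powr (1 / q) \<le> c1"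
    and D: "Dfun tor \<epsilon> W (\<lambda>x. \<phi> x 0) (\<lambda>x. g x 0) \<le> ennreal D0"
  shows "\<forall>t\<in>{0..T}. Dfun tor \<epsilon> W (\<lambda>x. \<phi> x t) (\<lambda>x. g x t) \<le> ennreal
    ((2 * (4 * N8 * gauss_const (CARD('n) - 1))) ^ j * max 1 ((1 + unit_ball_vol (real (CARD('n) - 1))) * D0)
      * (N4 * 2 ^ (CARD('n) - 1) * (1 + 1 / unit_ball_vol (real (CARD('n) - 1)))))"
proof -
  have N8: "N8 \<ge> 1" "\<And>(f :: real^'n \<Rightarrow> ennreal) B y. f \<in> borel_measurable borel \<Longrightarrow>
       (\<And>z. (\<integral>x. (if dist x z < 1/8 then f x else 0)) \<le> B) \<Longrightarrow>
       (\<integral>x. (if x - y \<in> cball 0 (1/2) then f x else 0)) \<le> ennreal N8 * B"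
    using covN8 by blast+
  have N4: "N4 \<ge> 1" "\<And>(f :: real^'n \<Rightarrow> ennreal) B y. f \<in> borel_measurable borel \<Longrightarrow>
       (\<And>z. (\<integral>x. (if dist x z < 1/4 then f x else 0)) \<le> B) \<Longrightarrow>
       (\<integral>x. (if x - y \<in> cbox 0 (\<chi> i. 1) then f x else 0)) \<le> ennreal N4 * B"
    using covN4 by blast+
  obtain \<gamma> \<mu> CB CL where wc: "well_constants W \<gamma> \<mu> CB CL" and sc: "scale_small (gauss_const (CARD('n) - 1))
       (gvol TYPE('n)) (unit_ball_vol (real CARD('n))) T \<eta> \<beta> \<mu> CB CL \<epsilon>" using well_cs by blast
  have W3: "Ck (Suc (Suc (Suc 0))) UNIV W" using W by (simp only: numeral_3_eq_3)
  have u1: "Ck (Suc 0) (UNIV \<times> {0..T}) (\<lambda>(x,t). u x t)" "Ck 0 (UNIV \<times> {0..T}) (\<lambda>(x,t). u x t)"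
    using u(1) unfolding smooth_on_def by blast+
  have uc: "continuous_on (UNIV \<times> {0..T}) (\<lambda>(x,t). u x t)" using u1(2) by simp
  have Duc: "continuous_on (UNIV \<times> {0..T}) (\<lambda>(x,t). Du x t)" by (rule spatial_jacobian_continuous[OF u1(1)]) (use u(2) in blast)
  interpret A: allen_cahn_transport T \<epsilon> W "deriv W" "deriv (deriv W)" u Du \<phi> g H T3 \<phi>t gt
  proof
    show "(W has_real_derivative deriv W x) (at x)" for x by (rule Ck_Suc_deriv(1)[OF W3])
    show "(deriv W has_real_derivative deriv (deriv W) x) (at x)" for x by (rule Ck_Suc_deriv(1)[OF Ck_Suc_deriv(2)[OF W3]])
  qed (use T eps W uc u(2) reg pde bound in blast)+
  have peru: "u (x + k) t = u x t" if "tor" "t \<in> {0..T}" "lattice_vec k" for x t k using u(3) that by blast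
  have perD: "Du (x + k) t = Du x t" if "tor" "t \<in> {0..T}" "lattice_vec k" for x t k
    by (rule jacobian_periodic[of "\<lambda>y. u y t" "\<lambda>y. Du y t"]) (use u(2) peru that in blast)+
  have suppu: "\<exists>R. \<forall>x. \<forall>t\<in>{0..T}. norm x \<ge> R \<longrightarrow> u x t = 0" if "\<not> tor" using u(4) that by blast
  have suppD: "\<exists>R. \<forall>x. \<forall>t\<in>{0..T}. norm x \<ge> R \<longrightarrow> Du x t = 0" if nt: "\<not> tor"
  proof -
    obtain R where R: "\<And>x t. t \<in> {0..T} \<Longrightarrow> norm x \<ge> R \<Longrightarrow> u x t = 0" using suppu[OF nt] by blast
    have "Du x t = 0" if "t \<in> {0..T}" "norm x \<ge> R + 1" for x t
      by (rule jacobian_support[of "\<lambda>y. u y t" "\<lambda>y. Du y t" R]) (use u(2) R that in blast)+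
    then show ?thesis by blast
  qed
  note vc = velocity_control[OF uc Duc p q T c1 peru perD suppu suppD Lq]
  have per': "\<phi> (x + k) t = \<phi> x t" if "tor" "lattice_vec k" for x k t using per that by blast
  have decay': "\<exists>R0. \<forall>R\<ge>R0. \<forall>x. \<forall>t\<in>{0..T}. norm x \<ge> R \<longrightarrow> R ^ k * (\<bar>\<phi> x t + 1\<bar> + norm (g x t) + norm (H x t)) \<le> e"
    if "\<not> tor" "e > 0" for k e using decay that by blast
  have w: "-1 < \<gamma>" "\<gamma> < 1" "0 < \<mu>" "\<mu> \<le> 1/4" "CB > 0" "CL > 0" "\<And>x. \<bar>x\<bar> \<le> 1 \<Longrightarrow> (\<gamma> - x) * deriv W x \<ge> 0"
    "\<And>x. \<bar>x\<bar> \<le> 1 \<Longrightarrow> \<mu> * hump \<gamma> x \<le> (\<gamma> - x) * deriv W x / 2 + W x / 2"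
    "\<And>x. \<bar>x\<bar> \<le> 1 \<Longrightarrow> (hump \<gamma> x)\<^sup>2 \<le> CB * W x" "\<And>x. \<bar>x\<bar> \<le> 1 \<Longrightarrow> W x \<le> CL * (x + 1)"
    using wc unfolding well_constants_def by blast+
  have init': "\<epsilon> * (norm (g x 0))\<^sup>2 / 2 - W (\<phi> x 0) / \<epsilon> \<le> \<epsilon> powr (- \<beta>)" for x using init by blast
  have ub': "norm (Du x t) \<le> \<epsilon> powr (- (\<beta> + 1))" if "t \<in> {0..T}" for x t using ub that by blast
  note db = A.discrepancy_bound[OF w(1-4) \<beta> w(7,8) w(5,9) w(6,10) init' ub' A.profile_compact[OF per' decay']]
  have E_le: "A.E x t \<le> (4 * CL + 8) / \<epsilon>" if "t \<in> {0..T}" for x t by (rule db(2)) (use that in auto)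
  have ex: "- \<beta> - (1 - 2 * \<beta>) / 2 = - 1/2" by (simp add: field_simps)
  interpret C: controlled_flow T \<epsilon> W "deriv W" "deriv (deriv W)" u Du \<phi> g H T3 \<phi>t gt tor p b Ct q Bq \<mu> "(1 - 2 * \<beta>) / 2" "4 * CB + 2" "4 * CL + 8"
    "\<lambda>t. 2 * (2 * (Lp_norm tor p (\<lambda>x. u x t) + Lp_norm tor p (\<lambda>x. Du x t) + 1)) powr p"
  proof
    show "continuous_on UNIV (\<lambda>x. Du x t)" if "t \<in> {0..T}" for t by (rule continuous_on_slice[OF Duc that])
    show "\<epsilon> * (norm (g x t))\<^sup>2 - A.E x t \<le> 2 * \<epsilon> powr ((1 - 2 * \<beta>) / 2) * A.E x t + (4 * CB + 2) * \<epsilon> powr ((1 - 2 * \<beta>) / 2)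
      + (4 * CB + 2) * \<epsilon> powr (- 1/2) * exp (- 2 * \<mu> * t / \<epsilon>\<^sup>2)" if "t \<in> {0..T}" for x t
      unfolding ex[symmetric] by (rule db(1)) (use that in auto)
    let ?NN = "\<lambda>t. 2 * (2 * (Lp_norm tor p (\<lambda>x. u x t) + Lp_norm tor p (\<lambda>x. Du x t) + 1)) powr p"
    show "?NN t \<ge> 1" if "t \<in> {0..T}" for t by (rule vc(1)) (use that in auto)
    show "(\<integral>x. ennreal ((norm (u x t) + norm (Du x t)) powr p) * indicator (ball y (1/2)) x) \<le> ennreal (?NN t)"
      if "t \<in> {0..T}" for t y by (rule vc(2)) (use that in auto)
    show "(\<integral>x. ennreal ((norm (u x t) + norm (Du x t)) powr p) * indicator UNIV x) \<le> ennreal (?NN t)"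
      if "\<not> tor" "t \<in> {0..T}" for t by (rule vc(3)) (use that in auto)
    show "(\<lambda>t. ?NN t powr (q / p)) integrable_on {t0..t1}" if "0 \<le> t0" "t0 \<le> t1" "t1 \<le> T" for t0 t1 by (rule vc(4)) (use that in auto)
    show "integral {t0..t1} (\<lambda>t. ?NN t powr (q / p)) \<le> Bq" if "0 \<le> t0" "t0 \<le> t1" "t1 \<le> T" for t0 t1
      unfolding Bq by (rule vc(5)) (use that in auto)
    show "A.E x t \<le> (4 * CL + 8) / \<epsilon>" if "t \<in> {0..T}" for x t by (rule E_le[OF that])
    show "(1 - 2 * \<beta>) / 2 > 0" "4 * CB + 2 > 0" "4 * CL + 8 > 0" using \<beta> w(5,6) by simp_all
  qed (rule n2 tr Ct p b q kap w(3))+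
  have mass: "\<exists>A. \<forall>t\<in>{0..T}. \<not> tor \<longrightarrow> (\<integral>x. ennreal (A.E x t)) \<le> ennreal A"
  proof (cases tor)
    case False
    have "\<exists>A. \<forall>t\<in>{0..T}. (\<integral>x. ennreal (A.E x t)) \<le> ennreal A"
      by (rule A.mass_finite[OF decay'[OF False] w(6,10) E_le]) (use w(6) in auto)
    then show ?thesis by blast
  qed simp
  then obtain Am where Am: "\<And>t. \<not> tor \<Longrightarrow> t \<in> {0..T} \<Longrightarrow> (\<integral>x. ennreal (A.E x t)) \<le> ennreal Am" by blast
  obtain Mx where Mx: "Mx \<ge> 0" "\<And>t. t \<in> {0..T} \<Longrightarrow> A.dens tor t Mx" using C.apriori_density[OF Am] by blast
  have t0: "0 \<in> {0..T}" using T by simp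
  have D0': "D0 \<ge> 0" using D0 by simp
  have d0: "A.dens tor 0 (max 1 ((1 + unit_ball_vol (real (CARD('n) - 1))) * D0))"
    by (rule A.dens_of_Dfun[OF per' t0 D D0'])
  have err: "4 * N8 * C.err \<theta> h \<le> 1/2"
  proof -
    \<comment> \<open>One \<eta> pays for the terms that vanish with \<epsilon>, the other for those
      governed by \<theta> and h.\<close>
    have "C.err \<theta> h \<le> \<eta> + \<eta>"
      using step(1) sc unfolding C.err_def scale_small_def by linarith
    then have "4 * N8 * C.err \<theta> h \<le> 4 * N8 * (\<eta> + \<eta>)" using N8(1) by (intro mult_left_mono) auto
    also have "\<dots> = 1/2" using N8(1) by (simp add: \<eta>)
    finally show ?thesis .
  qed
  have c0: "1 / (unit_ball_vol (real CARD('n)) * (4 * CL + 8)) * \<epsilon> < 1/8" using sc unfolding scale_small_def by blast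
  have G1: "gauss_const (CARD('n) - 1) \<ge> 1" using n2 by (intro gauss_const_ge_1) auto
  have C1: "2 * (4 * N8 * gauss_const (CARD('n) - 1)) \<ge> 1"
  proof -
    have "1 * 1 \<le> N8 * gauss_const (CARD('n) - 1)" using N8(1) G1 by (intro mult_mono) auto
    then show ?thesis by simp
  qed
  have M1: "(2 * (4 * N8 * gauss_const (CARD('n) - 1))) ^ j * max 1 ((1 + unit_ball_vol (real (CARD('n) - 1))) * D0) \<ge> 1"
  proof -
    have "1 * 1 \<le> (2 * (4 * N8 * gauss_const (CARD('n) - 1))) ^ j * max 1 ((1 + unit_ball_vol (real (CARD('n) - 1))) * D0)"
      by (intro mult_mono one_le_power C1 zero_le_power order_trans[OF zero_le_one C1]) auto
    then show ?thesis by (simp only: mult_1_left)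
  qed
  show ?thesis
  proof
    fix t assume t: "t \<in> {0..T}"
    have tj: "t \<le> real j * h" using t h by simp
    have d: "A.dens tor t ((2 * (4 * N8 * gauss_const (CARD('n) - 1))) ^ j * max 1 ((1 + unit_ball_vol (real (CARD('n) - 1))) * D0))"
      by (rule C.density_growth[OF N8 h(1) Mx(2) Mx(1) d0 _ \<theta> err step(2) c0 t tj]) auto
    show "Dfun tor \<epsilon> W (\<lambda>x. \<phi> x t) (\<lambda>x. g x t) \<le> ennreal
      ((2 * (4 * N8 * gauss_const (CARD('n) - 1))) ^ j * max 1 ((1 + unit_ball_vol (real (CARD('n) - 1))) * D0)
      * (N4 * 2 ^ (CARD('n) - 1) * (1 + 1 / unit_ball_vol (real (CARD('n) - 1)))))"
      by (rule A.Dfun_of_dens[OF per' t d M1 N4]) auto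
  qed
qed

theorem theorem4p1:
  assumes n2: "CARD('n::finite) \<ge> 2"
  shows
  "\<forall>(p::real) (q::real) (c1::real) (D0::real) (T::real).
     \<exists>D1>0. \<forall>(c0::real) (\<beta>::real) (W::real \<Rightarrow> real).
     \<exists>\<epsilon>1>0.
     \<forall>(\<epsilon>::real) (tor::bool)
      (u::real^'n \<Rightarrow> real \<Rightarrow> real^'n) (Du::real^'n \<Rightarrow> real \<Rightarrow> real^'n^'n)
      (\<phi>::real^'n \<Rightarrow> real \<Rightarrow> real) (g::real^'n \<Rightarrow> real \<Rightarrow> real^'n)
      (H::real^'n \<Rightarrow> real \<Rightarrow> real^'n^'n) (T3::real^'n \<Rightarrow> real \<Rightarrow> real^'n^'n^'n)
      (\<phi>t::real^'n \<Rightarrow> real \<Rightarrow> real) (gt::real^'n \<Rightarrow> real \<Rightarrow> real^'n).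
     ( \<comment> \<open>hypotheses on W\<close>
       Ck 3 UNIV W \<and> (\<forall>x. W x \<ge> 0) \<and> W 1 = 0 \<and> W (-1) = 0 \<and>
       deriv W 1 = 0 \<and> deriv W (-1) = 0 \<and>
       (\<exists>\<gamma>. -1 < \<gamma> \<and> \<gamma> < 1 \<and> (\<forall>x. \<gamma> < x \<and> x < 1 \<longrightarrow> deriv W x < 0)
              \<and> (\<forall>x. -1 < x \<and> x < \<gamma> \<longrightarrow> deriv W x > 0)) \<and>
       (\<exists>\<alpha> \<kappa>. 0 < \<alpha> \<and> \<alpha> < 1 \<and> \<kappa> > 0 \<and>
              (\<forall>x. \<alpha> \<le> \<bar>x\<bar> \<and> \<bar>x\<bar> \<le> 1 \<longrightarrow> deriv (deriv W) x \<ge> \<kappa>)) \<and>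
       \<comment> \<open>parameters\<close>
       2 < q \<and> real CARD('n) * q / (2 * (q - 1)) < p \<and>
       (CARD('n) = 2 \<longrightarrow> p \<ge> 4/3) \<and>
       0 < \<beta> \<and> \<beta> < 1/2 \<and> 0 < \<epsilon> \<and> \<epsilon> < 1 \<and> T > 0 \<and> c0 > 0 \<and> c1 > 0 \<and> D0 > 0 \<and>
       \<comment> \<open>u in C_c^infinity(Omega x [0,T]; R^n), with spatial Jacobian Du\<close>
       smooth_on (UNIV \<times> {0..T}) (\<lambda>(x,t). u x t) \<and>
       (\<forall>t\<in>{0..T}. \<forall>x. ((\<lambda>y. u y t) has_derivative (\<lambda>h. Du x t *v h)) (at x)) \<and>
       (tor \<longrightarrow> (\<forall>x t k. lattice_vec k \<longrightarrow> u (x + k) t = u x t)) \<and>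
       (\<not> tor \<longrightarrow> (\<exists>R. \<forall>x. \<forall>t\<in>{0..T}. norm x \<ge> R \<longrightarrow> u x t = 0)) \<and>
       \<comment> \<open>regularity of phi: grad^j phi (j \<le> 3), d/dt grad^k phi (k \<le> 1) continuous\<close>
       (tor \<longrightarrow> (\<forall>x t k. lattice_vec k \<longrightarrow> \<phi> (x + k) t = \<phi> x t)) \<and>
       (\<forall>t\<in>{0..T}. \<forall>x. ((\<lambda>y. \<phi> y t) has_derivative (\<lambda>h. g x t \<bullet> h)) (at x)) \<and>
       (\<forall>t\<in>{0..T}. \<forall>x. ((\<lambda>y. g y t) has_derivative (\<lambda>h. H x t *v h)) (at x)) \<and>
       (\<forall>t\<in>{0..T}. \<forall>x. ((\<lambda>y. H y t) has_derivative
            (\<lambda>h. \<chi> i j. \<Sum>k\<in>UNIV. T3 x t $ i $ j $ k * h $ k)) (at x)) \<and>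
       (\<forall>x. \<forall>t\<in>{0..T}. ((\<lambda>s. \<phi> x s) has_real_derivative \<phi>t x t) (at t within {0..T})) \<and>
       (\<forall>x. \<forall>t\<in>{0..T}. ((\<lambda>s. g x s) has_vector_derivative gt x t) (at t within {0..T})) \<and>
       continuous_on (UNIV \<times> {0..T}) (\<lambda>(x,t). \<phi> x t) \<and>
       continuous_on (UNIV \<times> {0..T}) (\<lambda>(x,t). g x t) \<and>
       continuous_on (UNIV \<times> {0..T}) (\<lambda>(x,t). H x t) \<and>
       continuous_on (UNIV \<times> {0..T}) (\<lambda>(x,t). T3 x t) \<and>
       continuous_on (UNIV \<times> {0..T}) (\<lambda>(x,t). \<phi>t x t) \<and>
       continuous_on (UNIV \<times> {0..T}) (\<lambda>(x,t). gt x t) \<and>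
       \<comment> \<open>the equation\<close>
       (\<forall>x. \<forall>t\<in>{0..T}. \<phi>t x t + u x t \<bullet> g x t =
            (\<Sum>i\<in>UNIV. H x t $ i $ i) - deriv W (\<phi> x t) / \<epsilon>\<^sup>2) \<and>
       (\<forall>x. \<forall>t\<in>{0..T}. \<bar>\<phi> x t\<bar> \<le> 1) \<and>
       (\<forall>x. \<epsilon> * norm (g x 0) \<le> c0 \<and> \<epsilon>\<^sup>2 * norm (H x 0) \<le> c0 \<and> \<epsilon> ^ 3 * norm (T3 x 0) \<le> c0) \<and>
       (\<not> tor \<longrightarrow> (\<forall>k::nat. \<forall>e>0. \<exists>R0. \<forall>R\<ge>R0. \<forall>x. \<forall>t\<in>{0..T}. norm x \<ge> R \<longrightarrow>
            R ^ k * (\<bar>\<phi> x t + 1\<bar> + norm (g x t) + norm (H x t)) \<le> e)) \<and>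
       (\<forall>x. \<epsilon> * (norm (g x 0))\<^sup>2 / 2 - W (\<phi> x 0) / \<epsilon> \<le> \<epsilon> powr (-\<beta>)) \<and>
       (\<forall>x. \<forall>t\<in>{0..T}. norm (u x t) \<le> \<epsilon> powr (-\<beta>) \<and> norm (Du x t) \<le> \<epsilon> powr (-(\<beta> + 1))) \<and>
       (LINT t : {0..T} | lborel.
           (Lp_norm tor p (\<lambda>x. u x t) + Lp_norm tor p (\<lambda>x. Du x t)) powr q) powr (1 / q) \<le> c1 \<and>
       Dfun tor \<epsilon> W (\<lambda>x. \<phi> x 0) (\<lambda>x. g x 0) \<le> ennreal D0 \<and>
       \<epsilon> < \<epsilon>1
     ) \<longrightarrow> (\<forall>t\<in>{0..T}. Dfun tor \<epsilon> W (\<lambda>x. \<phi> x t) (\<lambda>x. g x t) \<le> ennreal D1)"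
proof (intro allI, goal_cases)
  case (1 p q c1 D0 T)
  let ?G = "gauss_const (CARD('n) - 1)" and ?V = "unit_ball_vol (real CARD('n))" and ?w = "unit_ball_vol (real (CARD('n) - 1))"
  let ?GL = "gauss_const CARD('n) * ?V"
  show ?case
  \<comment> \<open>For inadmissible parameters the hypotheses are contradictory and D1 = 1 serves;
    otherwise the exponent b and the trace constant exist, and D1 can be computed from them.\<close>
  proof (cases "2 < q \<and> real CARD('n) * q / (2 * (q - 1)) < p \<and> (CARD('n) = 2 \<longrightarrow> p \<ge> 4/3) \<and> T > 0")
    case False
    show ?thesis
    proof (intro exI[of _ "1::real"] conjI allI impI, goal_cases)
      case 3
      then show ?case using False by (elim conjE) blast
    qed simp_all
  next
    case True
    then have q: "2 < q" and pq: "real CARD('n) * q / (2 * (q - 1)) < p" and p2: "CARD('n) = 2 \<Longrightarrow> p \<ge> 4/3" and T: "T > 0" by auto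
    note p1 = exponent_choice(1)[OF n2 q pq p2]
    obtain b where b: "0 < b" "b \<le> 1" "p / b \<ge> 2" "admissible_exponents CARD('n) p b" and kap: "kq TYPE('n) b p q < 1"
      using exponent_choice(2)[OF n2 q pq p2] by blast
    obtain Ct where Ct: "Ct > 0" and tr: "trace_property TYPE('n) p b Ct"
      using trace_inequality[OF b(4) p1 b(1-3), where 'm='n] unfolding trace_property_def by blast
    obtain N8 where N8: "N8 \<ge> 1" "\<forall>f \<in> borel_measurable borel. \<forall>B (y::real^'n). (\<forall>z. (\<integral>x. (if dist x z < 1/8 then f x else 0)) \<le> B)
        \<longrightarrow> (\<integral>x. (if x - y \<in> cball 0 (1/2) then f x else 0)) \<le> ennreal N8 * B"
      using finite_cover_integral[OF compact_cball[of "0::real^'n" "1/2"], of "1/8"] by auto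
    obtain N4 where N4: "N4 \<ge> 1" "\<forall>f \<in> borel_measurable borel. \<forall>B (y::real^'n). (\<forall>z. (\<integral>x. (if dist x z < 1/4 then f x else 0)) \<le> B)
        \<longrightarrow> (\<integral>x. (if x - y \<in> cbox 0 (\<chi> i. 1) then f x else 0)) \<le> ennreal N4 * B"
      using finite_cover_integral[OF compact_cbox[of "0::real^'n" "\<chi> i. 1"], of "1/4"] by auto
    define Bq where "Bq = 2 powr (q / p) * 4 powr q * (c1 powr q + T)"
    \<comment> \<open>Chosen so that 4 * N8 * (\<eta> + \<eta>) = 1/2, the absorption condition of
      \<open>density_step\<close>.\<close>
    define \<eta> where "\<eta> = 1 / (16 * N8)"
    have \<eta>: "\<eta> > 0" using N8(1) by (simp add: \<eta>_def)
    obtain \<theta> h where \<theta>: "\<theta> > 0" and h: "h > 0"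
      and step: "1920 * ?G * h + (?G + Ct) / 2 * (\<theta> * Bq + \<theta> powr (- 2 / (q - 2)) * (h powr (1 - kq TYPE('n) b p q) / (1 - kq TYPE('n) b p q))) \<le> \<eta>"
        "60 * h + (1 + Ct) / 2 * (\<theta> * Bq + \<theta> powr (- 2 / (q - 2)) * h) \<le> 1/2"
      using step_length_choice[OF kap \<eta>, of "1920 * ?G" "(?G + Ct) / 2" Bq "- 2 / (q - 2)" "(1 + Ct) / 2"] by blast
    \<comment> \<open>The step length h was fixed without reference to \<epsilon>, W or \<beta>;
      hence so are the number j of steps and D1.\<close>
    obtain j :: nat where "T / h \<le> real j" using real_arch_simple by blast
    then have j: "T \<le> real j * h" using h by (simp add: field_simps)
    define D1 where "D1 = (2 * (4 * N8 * ?G)) ^ j * max 1 ((1 + ?w) * D0) * (N4 * 2 ^ (CARD('n) - 1) * (1 + 1 / ?w))"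
    have "?G \<ge> 1" using n2 by (intro gauss_const_ge_1) auto
    then have D1: "D1 > 0"
      unfolding D1_def using N8(1) N4(1) by (intro mult_pos_pos zero_less_power add_pos_nonneg less_max_iff_disj[THEN iffD2]) auto
    show ?thesis
    proof (rule exI[of _ D1], rule conjI[OF D1], intro allI, goal_cases)
      case (1 c0 \<beta> W)
      have V: "?V > 0" by simp
      from well_scale[OF V \<eta>, where W=W and G="?G" and GL="?GL" and T=T and \<beta>=\<beta>] show ?case
      proof (elim exE conjE, goal_cases)
        case ws: (1 \<epsilon>1)
        note well_cs = ws(2)[THEN mp, THEN mp, THEN mp, THEN mp, THEN mp, THEN mp, THEN mp, THEN mp, THEN mp, THEN spec, THEN mp, THEN mp]
        show ?case
        proof (rule exI[of _ \<epsilon>1], rule conjI[OF ws(1)], intro allI impI, goal_cases)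
        case (1 \<epsilon> tor u Du \<phi> g H T3 \<phi>t gt)
        from 1 show ?case
          unfolding D1_def
          by (elim conjE) (rule density_bound[OF n2 p1 b(1,2) Ct tr kap Bq_def N8 N4 \<theta> h j \<eta>_def step well_cs], assumption+)
        qed
      qed
    qed
  qed
qed

end
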